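(* Let $K$ be a number field containing $\mathbb{Q}[i]$, and let $F:=(f_1,\ldots,f_n)$ be a sequence of polynomials in $\mathbb{Z}[X_1,\ldots,X_n]$ such that $\max\{\deg(f_i): 1\le i\le n\}=2$ and $ht(f_i)\le h$ for $1\le i\le n$. Let $\zeta\in K^n$ be a smooth $K$-rational zero of $F$ (i.e. $F(\zeta)=0$ and $DF(\zeta)\in GL(n,K)$). Let $|\cdot|_\nu:K\to\mathbb{R}_+$, $\nu\in M_K$, be an absolute value on $K$ and let $L\subseteq K$ be a number field such that $\zeta\in L_\nu^n$. Then for every $z\in L^n$ with $z\ne\zeta$ and $$\|z-\zeta\|_\nu\,\gamma_\nu(F,\zeta)\le\frac{3-\sqrt7}{2},$$ the following inequalities hold: $$ht(z)\ge \frac{1}{3[L:\mathbb{Q}]}\Big(\log\gamma_\nu(F,\zeta)-[L:\mathbb{Q}](5\log n+2h)-3\Big),$$ $$ht(z)\ge \frac{1}{3[L:\mathbb{Q}]}\Big(\log d_\nu^{(F)}(DF(\zeta)^{-1},\Sigma_\nu)-[L:\mathbb{Q}](7\log n+3h)-5\Big).$$ Moreover, in the case $L=\mathbb{Q}[i]$ these bounds read $$ht(z)\ge\frac16\Big(\log\gamma_\nu(F,\zeta)-(10\log n+4h+3)\Big),\qquad ht(z)\ge\frac16\Big(\log d_\nu^{(F)}(DF(\zeta)^{-1},\Sigma_\nu)-(14\log n+6h+5)\Big).$$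
   Context: $M_K$ is the standard proper set of absolute values on $K$ (one for each place, extending the usual or a $p$-adic absolute value of $\mathbb{Q}$), with multiplicities $n_\nu=[K_\nu:\mathbb{Q}_\nu]$ for which the product formula holds. $K_\nu$ and $L_\nu$ are the completions of $K$ and $L$ with respect to $|\cdot|_\nu$. $\|\cdot\|_\nu$ is the norm on $K_\nu^n$ associated with $|\cdot|_\nu$: the Hermitian norm if $\nu$ is archimedean, the maximum norm otherwise; norms of multilinear operators are operator norms. For $f\in\mathbb{Z}[X_1,\ldots,X_n]$, $ht(f)$ is the logarithm of the maximum of the absolute values of its coefficients. For a point $z=(z_1,\ldots,z_n)$ with coordinates in a number field $L$, $ht(z)$ is the absolute logarithmic (Weil) height $ht(z)=\frac{1}{[L:\mathbb{Q}]}\sum_{\nu\in M_L}n_\nu\log\max\{1,|z_1|_\nu,\ldots,|z_n|_\nu\}$. $$\gamma_{\nu}(F,\zeta):=\sup_{k\ge 2}\left\|\frac{DF(\zeta)^{-1}D^{(k)}F(\zeta)}{k!}\right\|_{\nu}^{\frac{1}{k-1}},$$ where $DF(\zeta)^{-1}D^{(k)}F(\zeta):(K_\nu^n)^k\to K_\nu^n$ is a $k$-multilinear operator. $\Sigma_\nu$ is the set of singular matrices in $\mathcal{M}_n(K_\nu)$. $d_\nu^{(F)}$ is the Frobenius metric on $\mathcal{M}_n(K_\nu)$: the Euclidean (Hermitian) distance of the matrices of entries if $\nu$ is archimedean, the maximum of $|a_{ij}-b_{ij}|_\nu$ if $\nu$ is non-archimedean; the distance to a set is the infimum of the distances to its elements.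 *)

theory Defs
  imports
    "HOL-Analysis.Analysis"
    "HOL-Library.Poly_Mapping"
    "HOL-Algebra.Algebraic_Closure_Type"
begin

section \<open>Number fields and their absolute values\<close>

text \<open>
  Number fields are subsets of an arbitrary ambient field of characteristic zero.  The ambient
  field is also viewed as a ring record, in order to use subfields and dimensions from HOL-Algebra.
\<close>

definition number_field :: "'a::field_char_0 set \<Rightarrow> bool" where
  "number_field K \<longleftrightarrow>
     subfield K (ring_of_type_algebra :: 'a ring) \<and>
     ring.finite_dimension (ring_of_type_algebra :: 'a ring) \<rat> K"

definition field_degree :: "'a::field_char_0 set \<Rightarrow> nat" where
  "field_degree K = ring.dim (ring_of_type_algebra :: 'a ring) \<rat> K"

definition absolute_value :: "'a::field_char_0 set \<Rightarrow> ('a \<Rightarrow> real) \<Rightarrow> bool" where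
  "absolute_value K v \<longleftrightarrow>
     (\<forall>x\<in>K. 0 \<le> v x \<and> (v x = 0 \<longleftrightarrow> x = 0)) \<and>
     (\<forall>x\<in>K. \<forall>y\<in>K. v (x * y) = v x * v y \<and> v (x + y) \<le> v x + v y)"

definition padic_abs :: "nat \<Rightarrow> rat \<Rightarrow> real" where
  "padic_abs p q =
     (if q = 0 then 0
      else real p powi (int (multiplicity (int p) (snd (quotient_of q)))
                      - int (multiplicity (int p) (fst (quotient_of q)))))"

text \<open>
  Equivalent absolute values on \<open>K\<close> with the same nontrivial restriction to the rationals are equal,
  so the following set contains exactly one absolute value for each place.  Extensionality
  makes an absolute value on \<open>K\<close> determined, as a function, by its values on \<open>K\<close>.
\<close>

definition places :: "'a::field_char_0 set \<Rightarrow> ('a \<Rightarrow> real) set" where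
  "places K = {v \<in> extensional K. absolute_value K v \<and>
     ((\<forall>q. v (of_rat q) = real_of_rat \<bar>q\<bar>) \<or>
      (\<exists>p. Factorial_Ring.prime p \<and> (\<forall>q. v (of_rat q) = padic_abs p q)))}"

definition nonarchimedean :: "'a::field_char_0 set \<Rightarrow> ('a \<Rightarrow> real) \<Rightarrow> bool" where
  "nonarchimedean K v \<longleftrightarrow> (\<forall>x\<in>K. \<forall>y\<in>K. v (x + y) \<le> max (v x) (v y))"


section \<open>Completions\<close>

definition cauchy_ring :: "'a::field_char_0 set \<Rightarrow> ('a \<Rightarrow> real) \<Rightarrow> (nat \<Rightarrow> 'a) ring" where
  "cauchy_ring K v =
     \<lparr>carrier = {s. (\<forall>n. s n \<in> K) \<and> (\<forall>e>0. \<exists>N. \<forall>m\<ge>N. \<forall>n\<ge>N. v (s m - s n) < e)},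
      mult = (\<lambda>s t n. s n * t n),
      one = (\<lambda>_. 1),
      zero = (\<lambda>_. 0),
      add = (\<lambda>s t n. s n + t n)\<rparr>"

definition null_seqs :: "'a::field_char_0 set \<Rightarrow> ('a \<Rightarrow> real) \<Rightarrow> (nat \<Rightarrow> 'a) set" where
  "null_seqs K v = {s \<in> carrier (cauchy_ring K v). (\<lambda>n. v (s n)) \<longlonglongrightarrow> 0}"

type_synonym 'a cpl = "(nat \<Rightarrow> 'a) set"

definition completion :: "'a::field_char_0 set \<Rightarrow> ('a \<Rightarrow> real) \<Rightarrow> 'a cpl ring" where
  "completion K v = cauchy_ring K v Quot null_seqs K v"

definition cpl_emb :: "'a::field_char_0 set \<Rightarrow> ('a \<Rightarrow> real) \<Rightarrow> 'a \<Rightarrow> 'a cpl" where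
  "cpl_emb K v x = null_seqs K v +>\<^bsub>cauchy_ring K v\<^esub> (\<lambda>_. x)"

text \<open>For a subfield \<open>L\<close> of \<open>K\<close>, the completion of \<open>L\<close> as a subfield of that of \<open>K\<close>.\<close>

definition cpl_sub ::
  "'a::field_char_0 set \<Rightarrow> ('a \<Rightarrow> real) \<Rightarrow> 'a set \<Rightarrow> 'a cpl set" where
  "cpl_sub K v L =
     (\<lambda>s. null_seqs K v +>\<^bsub>cauchy_ring K v\<^esub> s) ` carrier (cauchy_ring L v)"

definition cpl_abs :: "('a::field_char_0 \<Rightarrow> real) \<Rightarrow> 'a cpl \<Rightarrow> real" where
  "cpl_abs v c = (THE r. \<forall>s\<in>c. (\<lambda>n. v (s n)) \<longlonglongrightarrow> r)"

definition local_degree :: "'a::field_char_0 set \<Rightarrow> ('a \<Rightarrow> real) \<Rightarrow> nat" where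
  "local_degree K v =
     ring.dim (completion K v) (cpl_sub K v \<rat>) (carrier (completion K v))"


section \<open>Heights\<close>

definition weil_height :: "'a::field_char_0 set \<Rightarrow> 'a ^ 'n \<Rightarrow> real" where
  "weil_height L z =
     (\<Sum>\<^sub>\<infinity>v\<in>places L. real (local_degree L v) * ln (Max (insert 1 (range (\<lambda>i. v (z $ i))))))
       / real (field_degree L)"

text \<open>Polynomials over the integers in variables indexed by \<open>'n\<close>: finitely supported maps from
  exponent vectors to coefficients.\<close>

type_synonym 'n int_mpoly = "('n \<Rightarrow>\<^sub>0 nat) \<Rightarrow>\<^sub>0 int"

definition mpoly_degree :: "'n::finite int_mpoly \<Rightarrow> nat" where
  "mpoly_degree f =
     Max (insert 0 ((\<lambda>m. \<Sum>i\<in>UNIV. Poly_Mapping.lookup m i) ` Poly_Mapping.keys f))"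

text \<open>The height is only meaningful for nonzero polynomials (\<open>ln 0 = 0\<close> by convention).\<close>

definition mpoly_height :: "'n::finite int_mpoly \<Rightarrow> real" where
  "mpoly_height f = ln (real_of_int (Max (range (\<lambda>m. \<bar>Poly_Mapping.lookup f m\<bar>))))"

definition mpoly_eval :: "'n::finite int_mpoly \<Rightarrow> 'a::field_char_0 ^ 'n \<Rightarrow> 'a" where
  "mpoly_eval f x =
     (\<Sum>m\<in>Poly_Mapping.keys f. of_int (Poly_Mapping.lookup f m) *
        (\<Prod>i\<in>UNIV. (x $ i) ^ Poly_Mapping.lookup m i))"

text \<open>Partial derivative; the truncated exponent in \<open>m - single i 1\<close> only occurs with
  coefficient zero.\<close>

definition mpoly_pderiv :: "'n \<Rightarrow> 'n::finite int_mpoly \<Rightarrow> 'n int_mpoly" where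
  "mpoly_pderiv i f =
     (\<Sum>m\<in>Poly_Mapping.keys f.
        Poly_Mapping.single (m - Poly_Mapping.single i 1)
          (Poly_Mapping.lookup f m * int (Poly_Mapping.lookup m i)))"

definition poly_jacobian :: "'n int_mpoly ^ 'n \<Rightarrow> 'a::field_char_0 ^ 'n \<Rightarrow> 'a ^ 'n ^ 'n::finite" where
  "poly_jacobian F x = (\<chi> i j. mpoly_eval (mpoly_pderiv j (F $ i)) x)"


section \<open>Norms and the gamma invariant\<close>

definition vec_norm :: "'a::field_char_0 set \<Rightarrow> ('a \<Rightarrow> real) \<Rightarrow> 'a cpl ^ 'n::finite \<Rightarrow> real" where
  "vec_norm K v x =
     (if nonarchimedean K v then Max (range (\<lambda>i. cpl_abs v (x $ i)))
      else sqrt (\<Sum>i\<in>UNIV. (cpl_abs v (x $ i))\<^sup>2))"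

definition cpl_space :: "'a::field_char_0 set \<Rightarrow> ('a \<Rightarrow> real) \<Rightarrow> ('a cpl ^ 'n) set" where
  "cpl_space K v = {x. \<forall>i. x $ i \<in> carrier (completion K v)}"

definition vec_emb ::
  "'a::field_char_0 set \<Rightarrow> ('a \<Rightarrow> real) \<Rightarrow> 'a ^ 'n \<Rightarrow> 'a cpl ^ 'n" where
  "vec_emb K v x = (\<chi> i. cpl_emb K v (x $ i))"

text \<open>Operator norm of a \<open>k\<close>-multilinear operator, whose arguments are numbered \<open>0,\<dots>,k-1\<close>.
  As for \<^const>\<open>onorm\<close>, arguments containing a zero vector contribute the harmless value 0.\<close>

definition multi_onorm ::
  "'a::field_char_0 set \<Rightarrow> ('a \<Rightarrow> real) \<Rightarrow> nat \<Rightarrow>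
     ((nat \<Rightarrow> 'a cpl ^ 'n::finite) \<Rightarrow> 'a cpl ^ 'n) \<Rightarrow> real" where
  "multi_onorm K v k B =
     (SUP V \<in> {..<k} \<rightarrow>\<^sub>E cpl_space K v. vec_norm K v (B V) / (\<Prod>m<k. vec_norm K v (V m)))"

text \<open>The \<open>k\<close>-th derivative of \<open>F\<close> at \<open>x\<close> applied to \<open>V 0,\<dots>,V (k-1)\<close>.\<close>

definition deriv_form ::
  "'a::field_char_0 set \<Rightarrow> ('a \<Rightarrow> real) \<Rightarrow> 'n int_mpoly ^ 'n \<Rightarrow> 'a ^ 'n \<Rightarrow> nat \<Rightarrow>
     (nat \<Rightarrow> 'a cpl ^ 'n::finite) \<Rightarrow> 'a cpl ^ 'n" where
  "deriv_form K v F x k V =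
     (\<chi> l. \<Oplus>\<^bsub>completion K v\<^esub>is\<in>{is. length is = k}.
        cpl_emb K v (mpoly_eval (fold mpoly_pderiv is (F $ l)) x)
          \<otimes>\<^bsub>completion K v\<^esub> (\<Otimes>\<^bsub>completion K v\<^esub>m\<in>{..<k}. V m $ (is ! m)))"

definition cpl_mat_vec ::
  "'a::field_char_0 set \<Rightarrow> ('a \<Rightarrow> real) \<Rightarrow> 'a cpl ^ 'n ^ 'n \<Rightarrow> 'a cpl ^ 'n \<Rightarrow> 'a cpl ^ 'n::finite" where
  "cpl_mat_vec K v A x =
     (\<chi> i. \<Oplus>\<^bsub>completion K v\<^esub>j\<in>UNIV. A $ i $ j \<otimes>\<^bsub>completion K v\<^esub> x $ j)"

definition cpl_mat_emb ::
  "'a::field_char_0 set \<Rightarrow> ('a \<Rightarrow> real) \<Rightarrow> 'a ^ 'n ^ 'n \<Rightarrow> 'a cpl ^ 'n ^ 'n" where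
  "cpl_mat_emb K v A = (\<chi> i j. cpl_emb K v (A $ i $ j))"

definition gamma_form ::
  "'a::field_char_0 set \<Rightarrow> ('a \<Rightarrow> real) \<Rightarrow> 'n int_mpoly ^ 'n \<Rightarrow> 'a ^ 'n \<Rightarrow> nat \<Rightarrow>
     (nat \<Rightarrow> 'a cpl ^ 'n::finite) \<Rightarrow> 'a cpl ^ 'n" where
  "gamma_form K v F x k V =
     (\<chi> i. cpl_emb K v (1 / fact k) \<otimes>\<^bsub>completion K v\<^esub>
        cpl_mat_vec K v (cpl_mat_emb K v (matrix_inv (poly_jacobian F x))) (deriv_form K v F x k V) $ i)"

definition gamma_inv ::
  "'a::field_char_0 set \<Rightarrow> ('a \<Rightarrow> real) \<Rightarrow> 'n int_mpoly ^ 'n \<Rightarrow> 'a ^ 'n::finite \<Rightarrow> real" where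
  "gamma_inv K v F x =
     (SUP k\<in>{2..}. multi_onorm K v k (gamma_form K v F x k) powr (1 / (real k - 1)))"


section \<open>Singular matrices and the Frobenius distance\<close>

definition cpl_det ::
  "'a::field_char_0 set \<Rightarrow> ('a \<Rightarrow> real) \<Rightarrow> 'a cpl ^ 'n ^ 'n::finite \<Rightarrow> 'a cpl" where
  "cpl_det K v A =
     (\<Oplus>\<^bsub>completion K v\<^esub>p\<in>{p. p permutes UNIV}.
        (if evenperm p then \<Otimes>\<^bsub>completion K v\<^esub>i\<in>UNIV. A $ i $ p i
         else \<ominus>\<^bsub>completion K v\<^esub> (\<Otimes>\<^bsub>completion K v\<^esub>i\<in>UNIV. A $ i $ p i)))"

definition singular_mats ::
  "'a::field_char_0 set \<Rightarrow> ('a \<Rightarrow> real) \<Rightarrow> ('a cpl ^ 'n ^ 'n::finite) set" where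
  "singular_mats K v =
     {A. (\<forall>i j. A $ i $ j \<in> carrier (completion K v)) \<and> cpl_det K v A = \<zero>\<^bsub>completion K v\<^esub>}"

definition frob_dist ::
  "'a::field_char_0 set \<Rightarrow> ('a \<Rightarrow> real) \<Rightarrow> 'a cpl ^ 'n ^ 'n \<Rightarrow> 'a cpl ^ 'n ^ 'n::finite \<Rightarrow> real" where
  "frob_dist K v A B =
     (let d = (\<lambda>(i, j). cpl_abs v (A $ i $ j \<ominus>\<^bsub>completion K v\<^esub> B $ i $ j))
      in if nonarchimedean K v then Max (range d) else sqrt (\<Sum>ij\<in>UNIV. (d ij)\<^sup>2))"

definition frob_setdist ::
  "'a::field_char_0 set \<Rightarrow> ('a \<Rightarrow> real) \<Rightarrow> 'a cpl ^ 'n ^ 'n \<Rightarrow> ('a cpl ^ 'n ^ 'n::finite) set \<Rightarrow> real"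
  where "frob_setdist K v A S = (INF B\<in>S. frob_dist K v A B)"

end

theory Submission imports Defs "Jordan_Normal_Form.Char_Poly" begin

no_notation fps_nth (infixl "$" 75)
no_notation vec_index (infixl "$" 100)
hide_const (open) up_ring.coeff up_ring.monom Polynomials.degree module.smult

text \<open>
  The bound is a Liouville inequality. Write \<open>g = DF(\<zeta>)\<inverse> D\<^sup>2F(\<zeta>) / 2\<close>, whose norm is \<open>\<gamma>\<close> because
  \<open>F\<close> is quadratic. If \<open>F(z) = 0\<close>, then Taylor expansion gives \<open>z - \<zeta> = - g(z - \<zeta>, z - \<zeta>)\<close>, which
  the hypothesis on \<open>\<gamma> * norm (z - \<zeta>)\<close> excludes. Hence some \<open>\<alpha> = f\<^sub>i(z)\<close> is a nonzero element of
  \<open>L\<close>. At \<open>\<nu>\<close> it is close to \<open>f\<^sub>i(\<zeta>) = 0\<close>, so it is smaller by a factor \<open>\<gamma>\<close> than the trivial bound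
  by the coefficients of \<open>f\<^sub>i\<close> and \<open>max(1, norm z)\<^sup>2\<close>, and summing over all places gives the first
  estimate if \<open>n \<ge> 2\<close>. For \<open>n = 1\<close> the square of \<open>f'(\<zeta>)\<close> is the discriminant, a nonzero integer,
  and \<open>\<gamma>\<close> itself is bounded. For the second estimate, the distance to the singular matrices is at
  most \<open>1 / max \<bar>J\<^sub>i\<^sub>j\<bar>\<close> with \<open>J = DF(\<zeta>)\<close>, while \<open>J g\<close> contains a coefficient of \<open>F\<close>, so that
  \<open>max \<bar>J\<^sub>i\<^sub>j\<bar>\<close> is at least \<open>exp (- h) / (2 n \<gamma>)\<close>.

  Of the product formula only the inequality \<open>\<Sum> n\<^sub>v log \<bar>\<alpha>\<bar>\<^sub>v \<ge> 0\<close> is needed. It follows from the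
  product formula of the rationals for the norm of \<open>\<alpha>\<close> once that norm is bounded by
  \<open>\<Prod> \<bar>\<alpha>\<bar>\<^sub>v ^ n\<^sub>v\<close> over the places above a given absolute value of the rationals. These places are
  the minimal power-multiplicative seminorms below the spectral seminorm of \<open>L\<close>, and the local
  degree \<open>n\<^sub>v\<close> is the maximal number of elements of a basis of \<open>L\<close> that stay independent at \<open>v\<close>.
\<close>

section \<open>Seminorms of a number field\<close>

text \<open>Neither the completion of the rationals at \<open>u\<close> nor its tensor product with
  \<open>L\<close> is formed in the theory of places: archimedean and \<open>p\<close>-adic absolute
  values are treated together, by inequalities with rational coefficients, and completions enter
  there only to identify the local degree. Without completeness, norms on \<open>L\<close> need not
  be equivalent. That the spectral seminorm nevertheless dominates the coordinate norm comes from
  the trace form, which is nondegenerate in characteristic zero. Constants in estimates of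
  multiplicative quantities disappear when an element is replaced by its powers; this turns a bound
  on the norm valid up to a factor into the exact one that can be summed over all places. In the
  final estimate, the count \<open>1 + n + n^2\<close> of monomials is absorbed by
  \<open>5 log n\<close> only for \<open>n \<ge> 2\<close>, which is why \<open>n = 1\<close> stands
  apart. The radius \<open>(3 - sqrt 7) / 2\<close> acts through the bound 1/5: it makes the
  fixed-point relation impossible, and it cancels the 5 in
  \<open>2 * Z + \<omega> \<le> 5 * Z\<close>, where \<open>Z\<close> is the size of
  \<open>z\<close> and \<open>\<omega>\<close> its distance to \<open>\<zeta>\<close>.\<close>

lemma le_of_pow_le:
  fixes a b C :: real
  assumes "0 < a" "\<And>k. b ^ k \<le> C * a ^ k"
  shows "b \<le> a"
proof (rule ccontr)
  assume "\<not> b \<le> a"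
  then have "1 < b / a" using assms(1) by simp
  then obtain k where "C < (b / a) ^ k" using real_arch_pow by blast
  then have "C * a ^ k < b ^ k" using assms(1) by (simp add: power_divide field_simps)
  with assms(2)[of k] show False by simp
qed

text \<open>Infima are accessible only through strictly larger numbers; letting both excesses shrink
  to 0 from the right gives the product bound by continuity.\<close>

lemma le_mult_of_le_eps:
  fixes t p q :: real
  assumes "\<And>a b. p < a \<Longrightarrow> q < b \<Longrightarrow> t \<le> a * b"
  shows "t \<le> p * q"
proof -
  have "((\<lambda>d. (p + d) * (q + d)) \<longlongrightarrow> (p + 0) * (q + 0)) (at_right 0)"
    by (intro tendsto_intros)
  moreover have "\<forall>\<^sub>F d in at_right 0. t \<le> (p + d) * (q + d)"
    using eventually_at_right_less[of "0::real"] by eventually_elim (rule assms, auto)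
  ultimately show ?thesis
    using tendsto_lowerbound[of _ "(p + 0) * (q + 0)" "at_right (0::real)" t] by simp
qed

text \<open>A number field as a rational vector space with a chosen basis \<open>e\<close> and
  coordinate functions \<open>co\<close>, so that linear algebra becomes finite sums over
  \<open>{..<D}\<close> and matrices, detached from the spans and dimensions of HOL-Algebra.\<close>

locale number_field_basis =
  fixes L :: "'a::field_char_0 set" and D :: nat and e :: "nat \<Rightarrow> 'a" and co :: "'a \<Rightarrow> nat \<Rightarrow> rat"
  assumes one_mem [simp]: "1 \<in> L"
    and add_mem [simp]: "x \<in> L \<Longrightarrow> y \<in> L \<Longrightarrow> x + y \<in> L"
    and mult_mem [simp]: "x \<in> L \<Longrightarrow> y \<in> L \<Longrightarrow> x * y \<in> L"
    and uminus_mem [simp]: "x \<in> L \<Longrightarrow> - x \<in> L"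
    and inverse_mem [simp]: "x \<in> L \<Longrightarrow> inverse x \<in> L"
    and e_mem [simp]: "i < D \<Longrightarrow> e i \<in> L"
    and co_expand: "x \<in> L \<Longrightarrow> x = (\<Sum>i<D. of_rat (co x i) * e i)"
    and co_unique: "x = (\<Sum>i<D. of_rat (q i) * e i) \<Longrightarrow> i < D \<Longrightarrow> co x i = q i"
begin

lemma zero_mem [simp]: "0 \<in> L"
  using add_mem[OF one_mem uminus_mem[OF one_mem]] by simp

lemma diff_mem [simp]: "x \<in> L \<Longrightarrow> y \<in> L \<Longrightarrow> x - y \<in> L"
  using add_mem[OF _ uminus_mem] by fastforce

lemma divide_mem [simp]: "x \<in> L \<Longrightarrow> y \<in> L \<Longrightarrow> x / y \<in> L"
  by (simp add: divide_inverse)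

lemma power_mem [simp]: "x \<in> L \<Longrightarrow> x ^ k \<in> L"
  by (induction k) auto

lemma sum_mem: "(\<And>i. i \<in> A \<Longrightarrow> f i \<in> L) \<Longrightarrow> sum f A \<in> L"
  by (induction A rule: infinite_finite_induct) auto

lemma of_nat_mem [simp]: "of_nat n \<in> L"
  by (induction n) auto

lemma of_int_mem [simp]: "of_int n \<in> L"
  by (cases n rule: int_cases2) auto

lemma of_rat_mem [simp]: "of_rat q \<in> L"
  by (cases q) (simp add: of_rat_rat)

lemma lincomb_mem [simp]: "(\<Sum>i<D. of_rat (q i) * e i) \<in> L"
  by (intro sum_mem mult_mem) auto

lemma co_lincomb [simp]: "i < D \<Longrightarrow> co (\<Sum>i<D. of_rat (q i) * e i) i = q i"
  by (rule co_unique) auto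

lemma co_add: "x \<in> L \<Longrightarrow> y \<in> L \<Longrightarrow> i < D \<Longrightarrow> co (x + y) i = co x i + co y i"
  by (rule co_unique[where q = "\<lambda>i. co x i + co y i"], subst co_expand[of x], simp, subst co_expand[of y])
     (auto simp: of_rat_add algebra_simps sum.distrib)

lemma co_scale: "x \<in> L \<Longrightarrow> i < D \<Longrightarrow> co (of_rat q * x) i = q * co x i"
  by (rule co_unique[where q = "\<lambda>i. q * co x i"], subst co_expand[of x])
     (auto simp: of_rat_mult algebra_simps sum_distrib_left)

lemma co_0 [simp]: "i < D \<Longrightarrow> co 0 i = 0"
  by (rule co_unique[where q = "\<lambda>_. 0"]) auto

lemma co_sum: "(\<And>j. j \<in> A \<Longrightarrow> f j \<in> L) \<Longrightarrow> i < D \<Longrightarrow> co (sum f A) i = (\<Sum>j\<in>A. co (f j) i)"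
proof (induction A rule: infinite_finite_induct)
  case (insert a A)
  then show ?case by (simp add: co_add sum_mem)
qed auto

lemma eq_iff_co: "x \<in> L \<Longrightarrow> y \<in> L \<Longrightarrow> x = y \<longleftrightarrow> (\<forall>i<D. co x i = co y i)"
  using co_expand[of x] co_expand[of y] by (metis (no_types, lifting) lessThan_iff sum.cong)

lemma D_pos: "0 < D"
proof (rule ccontr)
  assume "\<not> 0 < D"
  then have "(1::'a) = 0" using co_expand[of 1] by simp
  then show False by simp
qed

end

text \<open>\<open>u\<close> stands for the usual absolute value of the rationals or a
  \<open>p\<close>-adic one. Nontriviality supplies rational scalars of every order of magnitude,
  which take the place of real scaling factors.\<close>

locale number_field_abs = number_field_basis L D e co
  for L :: "'a::field_char_0 set" and D e co +
  fixes u :: "rat \<Rightarrow> real"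
  assumes u_abs: "absolute_value UNIV u"
    and u_nontrivial: "\<exists>c. c \<noteq> 0 \<and> u c < 1"
begin

lemma u_nonneg [simp]: "0 \<le> u q" and u_eq_0_iff [simp]: "u q = 0 \<longleftrightarrow> q = 0"
  and u_mult: "u (q * r) = u q * u r" and u_add: "u (q + r) \<le> u q + u r"
  using u_abs by (auto simp: absolute_value_def)

lemma u_0 [simp]: "u 0 = 0"
  by simp

lemma u_pos [simp]: "0 < u q \<longleftrightarrow> q \<noteq> 0"
  using u_nonneg[of q] u_eq_0_iff[of q] by linarith

lemma u_1 [simp]: "u 1 = 1"
  using u_mult[of 1 1] u_eq_0_iff[of 1] by simp

lemma u_power: "u (q ^ k) = u q ^ k"
  by (induction k) (auto simp: u_mult)

lemma u_minus [simp]: "u (- q) = u q"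
proof -
  have "(u (- 1))\<^sup>2 = 1" using u_mult[of "-1" "-1"] by (simp add: power2_eq_square)
  then have "u (- 1) = 1" using u_nonneg[of "-1"] by (simp add: power2_eq_1_iff)
  then show ?thesis using u_mult[of "-1" q] by simp
qed

lemma u_inverse: "u (inverse q) = inverse (u q)"
  by (cases "q = 0") (auto simp: field_simps simp flip: u_mult)

lemma u_prod: "u (prod f A) = (\<Prod>i\<in>A. u (f i))"
  by (induction A rule: infinite_finite_induct) (auto simp: u_mult)

lemma u_sum: "u (sum f A) \<le> (\<Sum>i\<in>A. u (f i))"
  by (induction A rule: infinite_finite_induct) (auto intro: order_trans[OF u_add])

lemma u_of_nat: "u (of_nat n) \<le> real n"
  by (induction n) (auto intro: order_trans[OF u_add])

section \<open>Coordinate norm and spectral seminorm\<close>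

definition nm :: "'a \<Rightarrow> real" where "nm x = (\<Sum>i<D. u (co x i))"

lemma nm_nonneg [simp]: "0 \<le> nm x"
  by (simp add: nm_def sum_nonneg)

lemma nm_0 [simp]: "nm 0 = 0"
  by (simp add: nm_def)

lemma nm_eq_0_iff: "x \<in> L \<Longrightarrow> nm x = 0 \<longleftrightarrow> x = 0"
  by (auto simp: nm_def sum_nonneg_eq_0_iff eq_iff_co[of x 0])

lemma nm_pos: "x \<in> L \<Longrightarrow> x \<noteq> 0 \<Longrightarrow> 0 < nm x"
  using nm_eq_0_iff nm_nonneg[of x] by (metis less_eq_real_def)

lemma nm_add: "x \<in> L \<Longrightarrow> y \<in> L \<Longrightarrow> nm (x + y) \<le> nm x + nm y"
  unfolding nm_def sum.distrib[symmetric] by (intro sum_mono) (auto simp: co_add u_add)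

lemma nm_scale: "x \<in> L \<Longrightarrow> nm (of_rat q * x) = u q * nm x"
  by (auto simp: nm_def co_scale u_mult sum_distrib_left)

lemma nm_sum: "(\<And>j. j \<in> A \<Longrightarrow> f j \<in> L) \<Longrightarrow> nm (sum f A) \<le> (\<Sum>j\<in>A. nm (f j))"
proof (induction A rule: infinite_finite_induct)
  case (insert a A)
  then show ?case using nm_add[of "f a" "sum f A"] by (force simp: sum_mem)
qed auto

lemma u_co_le_nm: "i < D \<Longrightarrow> u (co x i) \<le> nm x"
  unfolding nm_def by (rule member_le_sum) auto

text \<open>By bilinearity only the finitely many products \<open>e i * e j\<close> matter.
  Submultiplicativity up to a constant is enough for the growth rates of powers, on which a constant
  factor has no influence.\<close>

lemma nm_mult_bound: "\<exists>C>0. \<forall>x\<in>L. \<forall>y\<in>L. nm (x * y) \<le> C * nm x * nm y"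
proof -
  define C where "C = 1 + (\<Sum>i<D. \<Sum>j<D. nm (e i * e j))"
  have "0 < C" unfolding C_def by (intro add_pos_nonneg sum_nonneg) auto
  moreover have "nm (x * y) \<le> C * nm x * nm y" if "x \<in> L" "y \<in> L" for x y
  proof -
    have "x * y = (\<Sum>i<D. \<Sum>j<D. of_rat (co x i * co y j) * (e i * e j))"
      by (subst co_expand[OF that(1)], subst co_expand[OF that(2)])
         (simp add: sum_product of_rat_mult algebra_simps)
    also have "nm \<dots> \<le> (\<Sum>i<D. \<Sum>j<D. nm (of_rat (co x i * co y j) * (e i * e j)))"
      by (intro order_trans[OF nm_sum] sum_mono nm_sum sum_mem) auto
    also have "\<dots> = (\<Sum>i<D. \<Sum>j<D. u (co x i) * u (co y j) * nm (e i * e j))"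
      by (intro sum.cong refl) (subst nm_scale, auto simp: u_mult)
    also have "\<dots> \<le> (\<Sum>i<D. \<Sum>j<D. nm x * nm y * nm (e i * e j))"
      by (intro sum_mono mult_mono u_co_le_nm) auto
    also have "\<dots> = (C - 1) * nm x * nm y"
      by (simp add: C_def sum_distrib_left sum_distrib_right mult_ac)
    also have "\<dots> \<le> C * nm x * nm y" by (intro mult_right_mono) auto
    finally show ?thesis .
  qed
  ultimately show ?thesis by blast
qed

text \<open>The infimum of these rates is the spectral radius, usually written as the limit of the
  \<open>k\<close>-th roots of \<open>nm (x ^ k)\<close>. An infimum of admissible exponential rates
  avoids a proof that the limit exists.\<close>

definition growth_rates :: "'a \<Rightarrow> real set" where
  "growth_rates x = {a. 0 < a \<and> (\<exists>C. \<forall>k. nm (x ^ k) \<le> C * a ^ k)}"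

definition rho :: "'a \<Rightarrow> real" where "rho x = Inf (growth_rates x)"

lemma growth_ratesE:
  assumes "a \<in> growth_rates x"
  obtains C where "0 < C" "\<And>k. nm (x ^ k) \<le> C * a ^ k"
proof -
  from assms obtain C where "0 < a" "\<And>k. nm (x ^ k) \<le> C * a ^ k" by (auto simp: growth_rates_def)
  then have "nm (x ^ k) \<le> (1 + \<bar>C\<bar>) * a ^ k" for k
    by (smt (verit, ccfv_SIG) mult_right_mono zero_le_power)
  then show ?thesis by (intro that[of "1 + \<bar>C\<bar>"]) auto
qed

lemma growth_rates_mono: "a \<in> growth_rates x \<Longrightarrow> a \<le> b \<Longrightarrow> b \<in> growth_rates x"
proof -
  assume *: "a \<in> growth_rates x" "a \<le> b"
  then obtain C where C: "0 < C" "\<And>k. nm (x ^ k) \<le> C * a ^ k" by (auto elim: growth_ratesE)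
  have "0 < a" using * by (auto simp: growth_rates_def)
  then have "nm (x ^ k) \<le> C * b ^ k" for k
    using C(2)[of k] power_mono[of a b k] * C(1) by (smt (verit) mult_left_mono)
  then show ?thesis using \<open>0 < a\<close> * by (auto simp: growth_rates_def)
qed

lemma growth_rates_nonempty: "x \<in> L \<Longrightarrow> growth_rates x \<noteq> {}"
proof -
  assume x: "x \<in> L"
  obtain C where C: "0 < C" "\<And>x y. x \<in> L \<Longrightarrow> y \<in> L \<Longrightarrow> nm (x * y) \<le> C * nm x * nm y"
    using nm_mult_bound by auto
  define a where "a = 1 + C * nm x"
  have a: "0 < a" "C * nm x \<le> a" using C(1) by (auto simp: a_def add_pos_nonneg)
  have "nm (x ^ k) \<le> nm 1 * a ^ k" for k
  proof (induction k)
    case (Suc k)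
    have "nm (x ^ Suc k) \<le> (C * nm x) * nm (x ^ k)" using C(2)[of x "x ^ k"] x by simp
    also have "\<dots> \<le> a * (nm 1 * a ^ k)" using Suc a C(1) by (intro mult_mono) auto
    finally show ?case by (simp add: algebra_simps)
  qed auto
  with a show ?thesis by (auto simp: growth_rates_def)
qed

lemma rho_le: "a \<in> growth_rates x \<Longrightarrow> rho x \<le> a"
  unfolding rho_def by (rule cInf_lower) (auto simp: growth_rates_def intro!: bdd_belowI[of _ 0])

lemma growth_ratesI: "x \<in> L \<Longrightarrow> rho x < a \<Longrightarrow> a \<in> growth_rates x"
  unfolding rho_def using cInf_lessD[OF growth_rates_nonempty, of x a] growth_rates_mono
  by (meson less_imp_le)

lemma rho_greatest: "x \<in> L \<Longrightarrow> (\<And>a. a \<in> growth_rates x \<Longrightarrow> t \<le> a) \<Longrightarrow> t \<le> rho x"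
  unfolding rho_def by (rule cInf_greatest) (auto simp: growth_rates_nonempty)

lemma rho_nonneg: "x \<in> L \<Longrightarrow> 0 \<le> rho x"
  by (rule rho_greatest) (auto simp: growth_rates_def)

text \<open>Powers of a product split by commutativity, so growth rates multiply.\<close>

lemma rho_mult:
  assumes "x \<in> L" "y \<in> L" shows "rho (x * y) \<le> rho x * rho y"
proof (rule le_mult_of_le_eps)
  fix a b assume "rho x < a" "rho y < b"
  then have ab: "a \<in> growth_rates x" "b \<in> growth_rates y" using assms growth_ratesI by auto
  obtain C0 where C0: "0 < C0" "\<And>x y. x \<in> L \<Longrightarrow> y \<in> L \<Longrightarrow> nm (x * y) \<le> C0 * nm x * nm y"
    using nm_mult_bound by auto
  obtain C where C: "0 < C" "\<And>k. nm (x ^ k) \<le> C * a ^ k" using ab by (auto elim: growth_ratesE)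
  obtain B where B: "0 < B" "\<And>k. nm (y ^ k) \<le> B * b ^ k" using ab by (auto elim: growth_ratesE)
  have pos: "0 < a" "0 < b" using ab by (auto simp: growth_rates_def)
  have "nm ((x * y) ^ k) \<le> (C0 * C * B) * (a * b) ^ k" for k
  proof -
    have "nm ((x * y) ^ k) \<le> C0 * nm (x ^ k) * nm (y ^ k)"
      using C0(2)[of "x ^ k" "y ^ k"] assms by (simp add: power_mult_distrib)
    also have "\<dots> \<le> C0 * (C * a ^ k) * (B * b ^ k)"
      using C B C0 pos by (intro mult_mono) auto
    finally show ?thesis by (simp add: algebra_simps power_mult_distrib)
  qed
  then have "a * b \<in> growth_rates (x * y)" using pos by (auto simp: growth_rates_def)
  then show "rho (x * y) \<le> a * b" by (rule rho_le)
qed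

text \<open>The binomial theorem turns growth rates \<open>a\<close> and \<open>b\<close> into the
  rate \<open>a + b\<close>; the value of a binomial coefficient under any \<open>u\<close> is at
  most the coefficient itself.\<close>

lemma rho_add:
  assumes "x \<in> L" "y \<in> L" shows "rho (x + y) \<le> rho x + rho y"
proof -
  have *: "rho (x + y) \<le> a + b" if "rho x < a" "rho y < b" for a b
  proof -
    have ab: "a \<in> growth_rates x" "b \<in> growth_rates y" using assms growth_ratesI that by auto
    obtain C0 where C0: "0 < C0" "\<And>x y. x \<in> L \<Longrightarrow> y \<in> L \<Longrightarrow> nm (x * y) \<le> C0 * nm x * nm y"
      using nm_mult_bound by auto
    obtain C where C: "0 < C" "\<And>k. nm (x ^ k) \<le> C * a ^ k" using ab by (auto elim: growth_ratesE)
    obtain B where B: "0 < B" "\<And>k. nm (y ^ k) \<le> B * b ^ k" using ab by (auto elim: growth_ratesE)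
    have pos: "0 < a" "0 < b" using ab by (auto simp: growth_rates_def)
    have "nm ((x + y) ^ k) \<le> (C0 * C * B) * (a + b) ^ k" for k
    proof -
      have "(x + y) ^ k = (\<Sum>i\<le>k. of_rat (of_nat (k choose i)) * (x ^ i * y ^ (k - i)))"
        by (simp add: binomial_ring algebra_simps)
      also have "nm \<dots> \<le> (\<Sum>i\<le>k. nm (of_rat (of_nat (k choose i)) * (x ^ i * y ^ (k - i))))"
        using assms by (intro nm_sum mult_mem of_rat_mem) auto
      also have "\<dots> \<le> (\<Sum>i\<le>k. real (k choose i) * (C0 * (C * a ^ i) * (B * b ^ (k - i))))"
      proof (intro sum_mono)
        fix i
        have "nm (of_rat (of_nat (k choose i)) * (x ^ i * y ^ (k - i)))
              = u (of_nat (k choose i)) * nm (x ^ i * y ^ (k - i))"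
          using assms by (intro nm_scale) auto
        also have "\<dots> \<le> real (k choose i) * (C0 * nm (x ^ i) * nm (y ^ (k - i)))"
          using assms C0 by (intro mult_mono u_of_nat) auto
        also have "\<dots> \<le> real (k choose i) * (C0 * (C * a ^ i) * (B * b ^ (k - i)))"
          using C B C0 pos by (intro mult_mono mult_left_mono) auto
        finally show "nm (of_rat (of_nat (k choose i)) * (x ^ i * y ^ (k - i))) \<le> \<dots>" .
      qed
      also have "\<dots> = (C0 * C * B) * (a + b) ^ k"
        by (simp add: binomial_ring sum_distrib_left algebra_simps)
      finally show ?thesis .
    qed
    then have "a + b \<in> growth_rates (x + y)" using pos by (auto simp: growth_rates_def)
    then show ?thesis by (rule rho_le)
  qed
  show ?thesis
  proof (rule field_le_epsilon)
    fix d :: real assume "0 < d"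
    then show "rho (x + y) \<le> rho x + rho y + d" using *[of "rho x + d / 2" "rho y + d / 2"] by simp
  qed
qed

text \<open>A rate \<open>b\<close> for the even powers gives the rate \<open>sqrt b\<close> for all
  powers: an odd power costs one more factor \<open>x\<close>, which the second summand of the
  constant \<open>B\<close> absorbs.\<close>

lemma rho_square:
  assumes x: "x \<in> L" shows "rho (x\<^sup>2) = (rho x)\<^sup>2"
proof (rule antisym)
  show "rho (x\<^sup>2) \<le> (rho x)\<^sup>2" using rho_mult[OF x x] by (simp add: power2_eq_square)
  show "(rho x)\<^sup>2 \<le> rho (x\<^sup>2)"
  proof (rule rho_greatest)
    fix b assume b: "b \<in> growth_rates (x\<^sup>2)"
    then obtain C where C: "0 < C" "\<And>k. nm ((x\<^sup>2) ^ k) \<le> C * b ^ k" by (auto elim: growth_ratesE)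
    obtain C0 where C0: "0 < C0" "\<And>x y. x \<in> L \<Longrightarrow> y \<in> L \<Longrightarrow> nm (x * y) \<le> C0 * nm x * nm y"
      using nm_mult_bound by auto
    have "0 < b" using b by (auto simp: growth_rates_def)
    define B where "B = C + C0 * nm x * C / sqrt b"
    have "nm (x ^ k) \<le> B * sqrt b ^ k" for k
    proof (cases "even k")
      case True
      then obtain m where k: "k = 2 * m" by (auto elim: evenE)
      have "nm (x ^ k) \<le> C * sqrt b ^ k" using C(2)[of m] \<open>0 < b\<close> by (simp add: k power_mult)
      also have "\<dots> \<le> B * sqrt b ^ k" using C C0 \<open>0 < b\<close> by (intro mult_right_mono) (auto simp: B_def)
      finally show ?thesis .
    next
      case False
      then obtain m where k: "k = 2 * m + 1" by (auto elim: oddE)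
      have "nm (x ^ k) \<le> C0 * nm x * nm ((x\<^sup>2) ^ m)" 
        using C0(2)[of x "(x\<^sup>2) ^ m"] x by (simp add: k power_mult)
      also have "\<dots> \<le> C0 * nm x * (C * b ^ m)" using C(2)[of m] C0 by (intro mult_left_mono) auto
      also have "\<dots> = C0 * nm x * C / sqrt b * sqrt b ^ k" using \<open>0 < b\<close> by (simp add: k power_mult)
      also have "\<dots> \<le> B * sqrt b ^ k" using C C0 \<open>0 < b\<close> by (intro mult_right_mono) (auto simp: B_def)
      finally show ?thesis .
    qed
    then have "sqrt b \<in> growth_rates x" using \<open>0 < b\<close> by (auto simp: growth_rates_def)
    then have "rho x \<le> sqrt b" by (rule rho_le)
    then show "(rho x)\<^sup>2 \<le> b" using \<open>0 < b\<close> rho_nonneg[OF x] 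
      by (metis less_eq_real_def power_mono real_sqrt_pow2)
  qed (use x in auto)
qed

lemma rho_of_rat: "rho (of_rat q) \<le> u q"
proof (rule dense_ge)
  fix a assume a: "u q < a"
  have "nm ((of_rat q) ^ k) \<le> nm 1 * a ^ k" for k
  proof -
    have "nm ((of_rat q) ^ k) = u q ^ k * nm 1"
      using nm_scale[of 1 "q ^ k"] by (simp add: of_rat_power u_power)
    also have "\<dots> \<le> a ^ k * nm 1" using a by (intro mult_right_mono power_mono) auto
    finally show ?thesis by (simp add: mult.commute)
  qed
  moreover have "0 < a" using a u_nonneg[of q] by linarith
  ultimately show "rho (of_rat q) \<le> a" by (intro rho_le) (auto simp: growth_rates_def)
qed

lemma rho_1: "rho 1 = 1"
proof (rule antisym)
  show "rho 1 \<le> 1" using rho_of_rat[of 1] by simp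
  show "1 \<le> rho 1"
  proof (rule rho_greatest)
    fix a assume "a \<in> growth_rates 1"
    then obtain C where "0 < a" "\<And>k. nm 1 \<le> C * a ^ k" by (auto simp: growth_rates_def)
    moreover have "0 < nm 1" by (rule nm_pos) auto
    ultimately have "1 ^ k \<le> (C / nm 1) * a ^ k" for k by (simp add: field_simps)
    then show "1 \<le> a" using \<open>0 < a\<close> le_of_pow_le by blast
  qed auto
qed


text \<open>Multiplicativity is weakened to squares, a condition that holds for \<open>rho\<close>
  and is inherited by infima of chains and by limits of \<open>s (x * f ^ n) / s f ^ n\<close>. On
  the rationals only an upper bound by \<open>u\<close> is imposed; once \<open>s\<close> is
  multiplicative, applying it to \<open>q\<close> and to its inverse gives equality.\<close>

definition power_seminorm :: "('a \<Rightarrow> real) \<Rightarrow> bool" where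
  "power_seminorm s \<longleftrightarrow> (\<forall>x\<in>L. \<forall>y\<in>L. s (x + y) \<le> s x + s y \<and> s (x * y) \<le> s x * s y) \<and>
     (\<forall>x\<in>L. 0 \<le> s x \<and> s (x\<^sup>2) = (s x)\<^sup>2) \<and> s 1 = 1 \<and> (\<forall>q. s (of_rat q) \<le> u q)"

lemma power_seminorm_add: "power_seminorm s \<Longrightarrow> x \<in> L \<Longrightarrow> y \<in> L \<Longrightarrow> s (x + y) \<le> s x + s y"
  and power_seminorm_mult: "power_seminorm s \<Longrightarrow> x \<in> L \<Longrightarrow> y \<in> L \<Longrightarrow> s (x * y) \<le> s x * s y"
  and power_seminorm_nonneg: "power_seminorm s \<Longrightarrow> x \<in> L \<Longrightarrow> 0 \<le> s x"
  and power_seminorm_square: "power_seminorm s \<Longrightarrow> x \<in> L \<Longrightarrow> s (x\<^sup>2) = (s x)\<^sup>2"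
  and power_seminorm_1: "power_seminorm s \<Longrightarrow> s 1 = 1"
  and power_seminorm_of_rat: "power_seminorm s \<Longrightarrow> s (of_rat q) \<le> u q"
  by (simp_all add: power_seminorm_def)

lemma power_seminorm_0: "power_seminorm s \<Longrightarrow> s 0 = 0"
  using power_seminorm_of_rat[of s 0] power_seminorm_nonneg[of s 0] by simp

lemma power_seminorm_rho: "power_seminorm rho"
  by (simp add: power_seminorm_def rho_add rho_mult rho_nonneg rho_square rho_1 rho_of_rat)

lemma power_seminorm_pos:
  assumes "power_seminorm s" "x \<in> L" "x \<noteq> 0" shows "0 < s x"
proof -
  have "1 \<le> s x * s (inverse x)"
    using power_seminorm_mult[OF assms(1,2), of "inverse x"] assms by (simp add: power_seminorm_1[OF assms(1)])
  then show ?thesis using power_seminorm_nonneg[OF assms(1,2)] by (cases "s x = 0") auto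
qed

text \<open>Iterated squaring settles the exponents \<open>2 ^ k\<close>. A general exponent
  \<open>n\<close> is filled up to \<open>2 ^ n\<close>; submultiplicativity on the complement
  \<open>2 ^ n - n\<close> leaves the missing inequality after cancellation.\<close>

lemma power_seminorm_power:
  assumes "power_seminorm s" "f \<in> L" shows "s (f ^ n) = s f ^ n"
proof (rule antisym)
  have mult: "s (x * y) \<le> s x * s y" if "x \<in> L" "y \<in> L" for x y using assms that by (auto simp: power_seminorm_def)
  have nonneg: "0 \<le> s x" if "x \<in> L" for x using assms that by (auto simp: power_seminorm_def)
  have one: "s 1 = 1" using assms by (auto simp: power_seminorm_def)
  have le: "s (f ^ n) \<le> s f ^ n" for n
  proof (induction n)
    case (Suc n)
    have "s (f ^ Suc n) \<le> s f * s (f ^ n)" using mult[of f "f ^ n"] assms by simp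
    also have "\<dots> \<le> s f * s f ^ n" using Suc nonneg assms by (intro mult_left_mono) auto
    finally show ?case by simp
  qed (simp add: one)
  then show "s (f ^ n) \<le> s f ^ n" .
  have two: "s (f ^ 2 ^ k) = s f ^ 2 ^ k" for k
  proof (induction k)
    case (Suc k)
    have "s (f ^ 2 ^ Suc k) = s ((f ^ 2 ^ k)\<^sup>2)" by (simp add: mult.commute flip: power_mult)
    also have "\<dots> = (s (f ^ 2 ^ k))\<^sup>2" using assms by (auto simp: power_seminorm_def)
    finally show ?case using Suc by (simp add: mult.commute flip: power_mult)
  qed simp
  show "s f ^ n \<le> s (f ^ n)"
  proof (cases "n = 0 \<or> s f = 0")
    case True
    then show ?thesis using one nonneg[of "f ^ n"] assms by (cases "n = 0") (auto simp: power_0_left)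
  next
    case False
    then have pos: "0 < s f" using nonneg[of f] assms by auto
    define m where "m = 2 ^ n - n"
    have m: "2 ^ n = n + m" unfolding m_def using less_exp[of n] by simp
    have "s f ^ n * s f ^ m = s (f ^ n * f ^ m)" using two[of n] by (simp add: m power_add)
    also have "\<dots> \<le> s (f ^ n) * s f ^ m"
      using assms by (intro order_trans[OF mult] mult_left_mono le nonneg) auto
    finally show ?thesis using pos by simp
  qed
qed

text \<open>The limit of \<open>s (x * f ^ n) / s f ^ n\<close> is again a seminorm; it is strictly smaller than \<open>s\<close>
  unless multiplication by \<open>f\<close> is multiplicative for \<open>s\<close>.\<close>

lemma power_seminorm_shift:
  assumes s: "power_seminorm s" and f: "f \<in> L" "f \<noteq> 0"
  obtains s' where "power_seminorm s'" "\<And>x. x \<in> L \<Longrightarrow> s' x \<le> s x" "\<And>x. x \<in> L \<Longrightarrow> s' x * s f \<le> s (x * f)"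
proof -
  have mult: "s (x * y) \<le> s x * s y" if "x \<in> L" "y \<in> L" for x y using s that by (auto simp: power_seminorm_def)
  have add: "s (x + y) \<le> s x + s y" if "x \<in> L" "y \<in> L" for x y using s that by (auto simp: power_seminorm_def)
  have nonneg: "0 \<le> s x" if "x \<in> L" for x using s that by (auto simp: power_seminorm_def)
  have sq: "s (x\<^sup>2) = (s x)\<^sup>2" if "x \<in> L" for x using s that by (auto simp: power_seminorm_def)
  have pos: "0 < s f" using power_seminorm_pos s f by auto
  define t where "t x n = s (x * f ^ n) / s f ^ n" for x n
  have "\<exists>l. t x \<longlonglongrightarrow> l \<and> (\<forall>n. l \<le> t x n)" if x: "x \<in> L" for x
  proof -
    have "decseq (t x)"
    proof (rule decseq_SucI)
      fix n
      have "s (x * f ^ Suc n) \<le> s (x * f ^ n) * s f"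
        using mult[of "x * f ^ n" f] x f by (simp add: ac_simps)
      then show "t x (Suc n) \<le> t x n" using pos by (simp add: t_def field_simps)
    qed
    moreover have "0 \<le> t x n" for n unfolding t_def using nonneg x f pos by simp
    ultimately show ?thesis using decseq_convergent[of "t x" 0] by metis
  qed
  then obtain s' where lim: "\<And>x. x \<in> L \<Longrightarrow> t x \<longlonglongrightarrow> s' x" and le: "\<And>x n. x \<in> L \<Longrightarrow> s' x \<le> t x n"
    by metis
  \<comment> \<open>Along even indices the numerator \<open>x * y * f ^ (2 * n)\<close> splits into
    one factor for \<open>x\<close> and one for \<open>y\<close>, and for squares it is a square;
    hence the passage to a subsequence.\<close>
  have lim2: "(\<lambda>n. t x (2 * n)) \<longlonglongrightarrow> s' x" if "x \<in> L" for x
    using LIMSEQ_subseq_LIMSEQ[OF lim[OF that], of "\<lambda>n. 2 * n"] by (simp add: strict_mono_def comp_def)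
  have s_le: "s' x \<le> s x" if "x \<in> L" for x using le[OF that, of 0] by (simp add: t_def)
  have nonneg': "0 \<le> s' x" if "x \<in> L" for x
    using that f pos nonneg by (intro LIMSEQ_le_const[OF lim]) (auto simp: t_def)
  have "power_seminorm s'" unfolding power_seminorm_def
  proof (intro conjI ballI allI)
    fix x y assume xy: "x \<in> L" "y \<in> L"
    have "t (x + y) n \<le> t x n + t y n" for n
      unfolding t_def add_divide_distrib[symmetric] using add[of "x * f ^ n" "y * f ^ n"] xy f pos
      by (intro divide_right_mono) (auto simp: distrib_right)
    then show "s' (x + y) \<le> s' x + s' y"
      using xy by (intro LIMSEQ_le[OF lim tendsto_add[OF lim lim]]) auto
    have "t (x * y) (2 * n) \<le> t x n * t y n" for n
    proof -
      have "s (x * y * f ^ (2 * n)) \<le> s (x * f ^ n) * s (y * f ^ n)"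
        using mult[of "x * f ^ n" "y * f ^ n"] xy f unfolding mult_2 power_add by (simp add: ac_simps)
      then have "s (x * y * f ^ (2 * n)) / s f ^ (2 * n) \<le> s (x * f ^ n) * s (y * f ^ n) / s f ^ (2 * n)"
        using pos by (intro divide_right_mono) auto
      then show ?thesis by (simp add: t_def mult_2 power_add)
    qed
    then show "s' (x * y) \<le> s' x * s' y"
      using xy by (intro LIMSEQ_le[OF lim2 tendsto_mult[OF lim lim]]) auto
  next
    fix x assume x: "x \<in> L"
    show "0 \<le> s' x" using nonneg' x .
    have "t (x\<^sup>2) (2 * n) = (t x n)\<^sup>2" for n
      using sq[of "x * f ^ n"] x f by (simp add: t_def power_divide power_mult_distrib power_even_eq)
    then have "(\<lambda>n. t (x\<^sup>2) (2 * n)) \<longlonglongrightarrow> (s' x)\<^sup>2" using x by (auto intro!: tendsto_power lim)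
    then show "s' (x\<^sup>2) = (s' x)\<^sup>2" using lim2[of "x\<^sup>2"] x LIMSEQ_unique by fastforce
  next
    have "t 1 n = 1" for n using pos by (simp add: t_def power_seminorm_power s f)
    then have "t 1 = (\<lambda>_. 1)" by auto
    then show "s' 1 = 1" using lim[of 1] LIMSEQ_unique[of "\<lambda>_. 1" "s' 1" 1] by auto
  next
    fix q show "s' (of_rat q) \<le> u q" using s_le[of "of_rat q"] power_seminorm_of_rat[OF s, of q] by simp
  qed
  moreover have "s' x * s f \<le> s (x * f)" if "x \<in> L" for x
    using le[OF that, of 1] pos by (simp add: t_def field_simps)
  ultimately show ?thesis using s_le that by blast
qed

text \<open>Zorn's lemma. The pointwise infimum of a chain is again a power-multiplicative seminorm,
  because a chain has a member close to the infimum at two given points simultaneously.\<close>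

lemma minimal_power_seminorm:
  assumes s0: "power_seminorm s0"
  shows "\<exists>s. power_seminorm s \<and> (\<forall>x\<in>L. s x \<le> s0 x) \<and>
    (\<forall>t. power_seminorm t \<longrightarrow> (\<forall>y\<in>L. t y \<le> s y) \<longrightarrow> (\<forall>x\<in>L. t x = s x))"
proof -
  \<comment> \<open>Setting the members to 0 off \<open>L\<close> makes the pointwise order on the
    whole type agree with the order on \<open>L\<close>.\<close>
  define A where "A = {s. power_seminorm s \<and> (\<forall>x. x \<notin> L \<longrightarrow> s x = 0) \<and> (\<forall>x\<in>L. s x \<le> s0 x)}"
  let ?P = "\<lambda>(s::'a \<Rightarrow> real) t. t \<le> s"
  have cut: "power_seminorm (\<lambda>x. if x \<in> L then s x else 0)" if "power_seminorm s" for s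
    using that by (auto simp: power_seminorm_def)
  have "\<exists>m\<in>A. \<forall>a\<in>A. ?P m a \<longrightarrow> a = m"
  proof (rule predicate_Zorn)
    show "partial_order_on A (relation_of ?P A)"
      by (rule partial_order_on_relation_ofI) auto
    fix C assume C: "C \<in> Chains (relation_of ?P A)"
    then have CA: "C \<subseteq> A" by (auto simp: Chains_def relation_of_def)
    have tot: "s \<le> t \<or> t \<le> s" if "s \<in> C" "t \<in> C" for s t
      using C that by (auto simp: Chains_def relation_of_def)
    show "\<exists>w\<in>A. \<forall>a\<in>C. ?P a w"
    proof (cases "C = {}")
      case True
      have "(\<lambda>x. if x \<in> L then s0 x else 0) \<in> A" using cut[OF s0] by (auto simp: A_def)
      with True show ?thesis by auto
    next
      case False
      define w where "w x = (INF s\<in>C. s x)" for x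
      have pC: "power_seminorm s" if "s \<in> C" for s using that CA by (auto simp: A_def)
      have nn: "0 \<le> s x" if "s \<in> C" for s x
        using that CA pC[OF that] by (cases "x \<in> L") (auto simp: A_def power_seminorm_def)
      have bdd: "bdd_below ((\<lambda>s. s x) ` C)" for x using nn by (intro bdd_belowI[of _ 0]) auto
      have w_le: "w x \<le> s x" if "s \<in> C" for s x
        unfolding w_def using that bdd by (intro cINF_lower) auto
      have w_ge: "c \<le> w x" if "\<And>s. s \<in> C \<Longrightarrow> c \<le> s x" for c x
        unfolding w_def using that False by (intro cINF_greatest) auto
      have w_less: "\<exists>s\<in>C. s x < c" if "w x < c" for c x
        using that bdd False unfolding w_def by (subst (asm) cINF_less_iff) auto
      have two: "\<exists>s\<in>C. s x < a \<and> s y < b" if wab: "w x < a" "w y < b" for x y a b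
      proof -
        obtain s t where st: "s \<in> C" "s x < a" "t \<in> C" "t y < b" using w_less[of x a] w_less[of y b] wab by auto
        from tot[OF st(1,3)] show ?thesis
        proof
          assume "s \<le> t"
          then have "s y < b" using st by (meson le_fun_def le_less_trans)
          then show ?thesis using st by auto
        next
          assume "t \<le> s"
          then have "t x < a" using st by (meson le_fun_def le_less_trans)
          then show ?thesis using st by auto
        qed
      qed
      obtain s1 where s1: "s1 \<in> C" using False by auto
      with CA have s1A: "s1 \<in> A" by auto
      have "power_seminorm w" unfolding power_seminorm_def
      proof (intro conjI ballI allI)
        fix x y assume xy: "x \<in> L" "y \<in> L"
        show "w (x * y) \<le> w x * w y"
        proof (rule le_mult_of_le_eps)
          fix a b assume "w x < a" "w y < b"
          then obtain s where s: "s \<in> C" "s x < a" "s y < b" using two by blast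
          have "w (x * y) \<le> s (x * y)" using w_le s by auto
          also have "\<dots> \<le> s x * s y" using pC[OF s(1)] xy by (auto simp: power_seminorm_def)
          also have "\<dots> \<le> a * b" using nn[OF s(1)] s by (intro mult_mono) (auto intro: less_imp_le order_trans[OF nn[OF s(1)]])
          finally show "w (x * y) \<le> a * b" .
        qed
        show "w (x + y) \<le> w x + w y"
        proof (rule field_le_epsilon)
          fix d :: real assume "0 < d"
          then obtain s where s: "s \<in> C" "s x < w x + d / 2" "s y < w y + d / 2"
            using two[of x "w x + d / 2" y "w y + d / 2"] by auto
          have "w (x + y) \<le> s (x + y)" using w_le s by auto
          also have "\<dots> \<le> s x + s y" using pC[OF s(1)] xy by (auto simp: power_seminorm_def)
          finally show "w (x + y) \<le> w x + w y + d" using s by simp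
        qed
      next
        fix x assume x: "x \<in> L"
        show w0: "0 \<le> w x" using w_ge nn by auto
        have sq: "s (x\<^sup>2) = (s x)\<^sup>2" if "s \<in> C" for s using pC[OF that] x by (auto simp: power_seminorm_def)
        show "w (x\<^sup>2) = (w x)\<^sup>2"
        proof (rule antisym)
          show "(w x)\<^sup>2 \<le> w (x\<^sup>2)" using w0 w_le by (intro w_ge) (auto simp: sq intro: power_mono)
          show "w (x\<^sup>2) \<le> (w x)\<^sup>2" unfolding power2_eq_square[of "w x"]
          proof (rule le_mult_of_le_eps)
            fix a b assume "w x < a" "w x < b"
            then obtain s where s: "s \<in> C" "s x < a" "s x < b" using two[of x a x b] by blast
            have "w (x\<^sup>2) \<le> s x * s x" using w_le[OF s(1), of "x\<^sup>2"] sq[OF s(1)] by (simp add: power2_eq_square)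
            also have "\<dots> \<le> a * b" using nn[OF s(1)] s by (intro mult_mono) (auto intro: less_imp_le order_trans[OF nn[OF s(1)]])
            finally show "w (x\<^sup>2) \<le> a * b" .
          qed
        qed
      next
        show "w 1 = 1"
        proof (rule antisym)
          show "w 1 \<le> 1" using w_le[OF s1, of 1] by (simp add: power_seminorm_1[OF pC[OF s1]])
          show "1 \<le> w 1"
          proof (rule w_ge)
            fix s assume "s \<in> C"
            then show "1 \<le> s 1" using power_seminorm_1[OF pC, of s] by simp
          qed
        qed
        fix q show "w (of_rat q) \<le> u q"
          using w_le[OF s1, of "of_rat q"] power_seminorm_of_rat[OF pC[OF s1], of q] by linarith
      qed
      moreover have "w x = 0" if "x \<notin> L" for x
      proof (rule antisym)
        show "w x \<le> 0" using w_le[OF s1, of x] s1A that by (simp add: A_def)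
        show "0 \<le> w x" using w_ge nn by blast
      qed
      moreover have "w x \<le> s0 x" if "x \<in> L" for x
        using order_trans[OF w_le[OF s1]] s1A that by (simp add: A_def)
      ultimately have "w \<in> A" by (auto simp: A_def)
      moreover have "w \<le> s" if "s \<in> C" for s using w_le[OF that] by (auto simp: le_fun_def)
      ultimately show ?thesis by auto
    qed
  qed
  then obtain s where sA: "s \<in> A" and min: "\<And>t. t \<in> A \<Longrightarrow> t \<le> s \<Longrightarrow> t = s" by blast
  show ?thesis
  proof (intro exI conjI allI impI)
    show "power_seminorm s" "\<forall>x\<in>L. s x \<le> s0 x" using sA by (auto simp: A_def)
    fix t assume t: "power_seminorm t" "\<forall>y\<in>L. t y \<le> s y"
    let ?t = "\<lambda>x. if x \<in> L then t x else 0"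
    have "?t \<in> A" using cut[OF t(1)] t(2) sA by (auto simp: A_def intro: order_trans)
    moreover have "?t \<le> s" using t(2) sA by (auto simp: le_fun_def A_def)
    ultimately have "?t = s" by (rule min)
    then show "\<forall>x\<in>L. t x = s x" by (metis (mono_tags))
  qed
qed

section \<open>Extensions of the absolute value to the number field\<close>

definition extends :: "('a \<Rightarrow> real) \<Rightarrow> bool" where
  "extends v \<longleftrightarrow> absolute_value L v \<and> (\<forall>q. v (of_rat q) = u q)"

lemma extends_of_rat: "extends v \<Longrightarrow> v (of_rat q) = u q"
  by (simp add: extends_def)

lemma extends_mult: "extends v \<Longrightarrow> x \<in> L \<Longrightarrow> y \<in> L \<Longrightarrow> v (x * y) = v x * v y"
  and extends_add: "extends v \<Longrightarrow> x \<in> L \<Longrightarrow> y \<in> L \<Longrightarrow> v (x + y) \<le> v x + v y"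
  and extends_nonneg: "extends v \<Longrightarrow> x \<in> L \<Longrightarrow> 0 \<le> v x"
  and extends_eq_0_iff: "extends v \<Longrightarrow> x \<in> L \<Longrightarrow> v x = 0 \<longleftrightarrow> x = 0"
  by (simp_all add: extends_def absolute_value_def)

lemma extends_pos: "extends v \<Longrightarrow> x \<in> L \<Longrightarrow> 0 < v x \<longleftrightarrow> x \<noteq> 0"
  using extends_nonneg extends_eq_0_iff by (metis less_le)

lemma extends_0: "extends v \<Longrightarrow> v 0 = 0"
  using extends_eq_0_iff[of v 0] by simp

lemma extends_1: "extends v \<Longrightarrow> v 1 = 1"
  using extends_of_rat[of v 1] by simp

lemma extends_minus: "extends v \<Longrightarrow> x \<in> L \<Longrightarrow> v (- x) = v x"
  using extends_mult[of v "of_rat (-1)" x] extends_of_rat[of v "-1"] by simp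

lemma extends_diff: "extends v \<Longrightarrow> x \<in> L \<Longrightarrow> y \<in> L \<Longrightarrow> v (x - y) \<le> v x + v y"
  using extends_add[of v x "- y"] extends_minus[of v y] by simp

lemma extends_power: "extends v \<Longrightarrow> x \<in> L \<Longrightarrow> v (x ^ n) = v x ^ n"
  by (induction n) (auto simp: extends_1 extends_mult)

lemma extends_inverse: "extends v \<Longrightarrow> x \<in> L \<Longrightarrow> v (inverse x) = inverse (v x)"
  using extends_mult[of v x "inverse x"] extends_eq_0_iff[of v x] extends_1[of v] extends_0[of v]
  by (cases "x = 0") (auto simp: field_simps)

lemma extends_divide: "extends v \<Longrightarrow> x \<in> L \<Longrightarrow> y \<in> L \<Longrightarrow> v (x / y) = v x / v y"
  using extends_mult[of v x "inverse y"] extends_inverse[of v y] by (simp add: divide_inverse)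

lemmas extends_simps = extends_of_rat extends_mult extends_nonneg extends_eq_0_iff extends_pos
  extends_0 extends_1 extends_minus extends_power extends_inverse extends_divide

lemma extends_sum:
  assumes v: "extends v" and "\<And>i. i \<in> A \<Longrightarrow> f i \<in> L"
  shows "v (sum f A) \<le> (\<Sum>i\<in>A. v (f i))"
  using assms(2)
proof (induction A rule: infinite_finite_induct)
  case (insert a A)
  then show ?case using extends_add[OF v, of "f a" "sum f A"] by (force simp: sum_mem)
qed (auto simp: extends_0[OF v])

lemma extends_le_nm:
  assumes v: "extends v" obtains C where "0 < C" "\<And>x. x \<in> L \<Longrightarrow> v x \<le> C * nm x"
proof
  define C where "C = 1 + (\<Sum>i<D. v (e i))"
  show "0 < C" unfolding C_def by (intro add_pos_nonneg sum_nonneg) (auto simp: extends_simps[OF v])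
  fix x assume x: "x \<in> L"
  have "v x \<le> (\<Sum>i<D. v (of_rat (co x i) * e i))"
    by (subst co_expand[OF x], rule extends_sum[OF v]) auto
  also have "\<dots> \<le> (\<Sum>i<D. nm x * v (e i))"
    using u_co_le_nm by (intro sum_mono) (auto simp: extends_simps[OF v] intro: mult_right_mono)
  also have "\<dots> \<le> C * nm x" by (simp add: C_def sum_distrib_left algebra_simps)
  finally show "v x \<le> C * nm x" .
qed

text \<open>Multiplicativity makes \<open>v x ^ k\<close> the value at a power of \<open>x\<close>,
  so the linear bound by \<open>nm\<close> becomes a bound by every growth rate once the constant is
  removed.\<close>

lemma extends_le_rho:
  assumes v: "extends v" and x: "x \<in> L" shows "v x \<le> rho x"
proof (rule rho_greatest[OF x])
  fix a assume "a \<in> growth_rates x"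
  then obtain B where B: "0 < B" "\<And>k. nm (x ^ k) \<le> B * a ^ k" and "0 < a"
    by (metis (mono_tags, lifting) growth_ratesE growth_rates_def mem_Collect_eq)
  obtain C where C: "0 < C" "\<And>x. x \<in> L \<Longrightarrow> v x \<le> C * nm x" using extends_le_nm[OF v] by auto
  have "v x ^ k \<le> (C * B) * a ^ k" for k
    using order_trans[OF C(2)[of "x ^ k"] mult_left_mono[OF B(2)[of k], of C]] C(1) x
    by (simp add: extends_simps[OF v])
  then show "v x \<le> a" using \<open>0 < a\<close> le_of_pow_le by blast
qed

text \<open>Shifting \<open>rho\<close> by \<open>f\<close> prepares the value at \<open>f\<close>:
  the shifted seminorm \<open>s1\<close> is at most \<open>1 / rho f\<close> at
  \<open>inverse f\<close>. A minimal seminorm below \<open>s1\<close> is multiplicative, since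
  shifting it by any nonzero \<open>y\<close> cannot make it smaller. It is therefore an absolute
  value, for which the upper bound at \<open>inverse f\<close> is a lower bound at
  \<open>f\<close>.\<close>

lemma extends_attaining_rho:
  assumes f: "f \<in> L" "f \<noteq> 0"
  obtains v where "v \<in> extensional L" "extends v" "v f = rho f"
proof -
  obtain s1 where s1: "power_seminorm s1" "\<And>x. x \<in> L \<Longrightarrow> s1 x \<le> rho x" "\<And>x. x \<in> L \<Longrightarrow> s1 x * rho f \<le> rho (x * f)"
    by (rule power_seminorm_shift[OF power_seminorm_rho f]) (rule that)
  obtain s where s: "power_seminorm s" "\<And>x. x \<in> L \<Longrightarrow> s x \<le> s1 x"
    and min: "\<forall>t. power_seminorm t \<longrightarrow> (\<forall>y\<in>L. t y \<le> s y) \<longrightarrow> (\<forall>x\<in>L. t x = s x)"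
    using minimal_power_seminorm[OF s1(1)] by blast
  have mult: "s (x * y) = s x * s y" if xy: "x \<in> L" "y \<in> L" for x y
  proof (cases "y = 0")
    case True
    then show ?thesis using power_seminorm_0[OF s(1)] by simp
  next
    case False
    obtain s' where s': "power_seminorm s'" "\<And>x. x \<in> L \<Longrightarrow> s' x \<le> s x" "\<And>x. x \<in> L \<Longrightarrow> s' x * s y \<le> s (x * y)"
      by (rule power_seminorm_shift[OF s(1) xy(2) False]) (rule that)
    have "s' x = s x" using min s' xy by blast
    then show ?thesis using s'(3)[OF xy(1)] power_seminorm_mult[OF s(1) xy] by simp
  qed
  define v where "v = restrict s L"
  have rat: "s (of_rat q) = u q" for q
  proof (cases "q = 0")
    case True then show ?thesis using power_seminorm_0[OF s(1)] by simp
  next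
    case False
    have "s (of_rat q) * s (of_rat (inverse q)) = s 1" using False
      by (subst mult[symmetric]) (auto simp flip: of_rat_mult)
    then have "1 = s (of_rat q) * s (of_rat (inverse q))" using power_seminorm_1[OF s(1)] by simp
    also have "\<dots> \<le> s (of_rat q) * u (inverse q)" using s(1) by (intro mult_left_mono power_seminorm_of_rat power_seminorm_nonneg) auto
    finally have "u q \<le> s (of_rat q)" using False unfolding u_inverse by (simp add: field_simps)
    then show ?thesis using power_seminorm_of_rat[OF s(1), of q] by simp
  qed
  have s0: "s x = 0 \<longleftrightarrow> x = 0" if "x \<in> L" for x
    using power_seminorm_pos[OF s(1) that] power_seminorm_0[OF s(1)] by fastforce
  have "absolute_value L v"
    using s0 mult power_seminorm_nonneg[OF s(1)] power_seminorm_add[OF s(1)] by (auto simp: absolute_value_def v_def)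
  then have "extends v" using rat by (auto simp: extends_def v_def)
  moreover have "v f = rho f"
  proof (rule antisym)
    show "v f \<le> rho f" using extends_le_rho[OF \<open>extends v\<close> f(1)] .
    have rf: "0 < rho f" using power_seminorm_pos[OF power_seminorm_rho f] .
    have "s (inverse f) * rho f \<le> s1 (inverse f) * rho f"
      using s(2)[of "inverse f"] f rf by (intro mult_right_mono) auto
    also have "\<dots> \<le> 1" using s1(3)[of "inverse f"] f rho_1 by simp
    finally have "s (inverse f) * rho f \<le> 1" .
    moreover have "s (inverse f) = inverse (v f)"
      using extends_inverse[OF \<open>extends v\<close> f(1)] f by (simp add: v_def)
    ultimately show "rho f \<le> v f"
      using \<open>extends v\<close> f extends_pos[of v f] by (simp add: field_simps)
  qed
  ultimately show ?thesis using that[of v] by (auto simp: v_def)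
qed

end

section \<open>Norm and trace\<close>

text \<open>Induction on the size by means of the derivative of the characteristic polynomial, which
  is the sum of the characteristic polynomials of the matrices with row and column \<open>i\<close>
  deleted.\<close>

lemma coeff_char_poly_trace:
  fixes A :: "'b :: field_char_0 mat"
  assumes "A \<in> carrier_mat n n" "0 < n"
  shows "coeff (char_poly A) (n - 1) = - (\<Sum>i<n. A $$ (i, i))"
  using assms
proof (induction n arbitrary: A)
  case (Suc n)
  show ?case
  proof (cases "n = 0")
    case True
    then have "char_poly A = [:- A $$ (0, 0), 1:]"
      using Suc.prems by (simp add: char_poly_def char_poly_matrix_def det_single)
    then show ?thesis using True by simp
  next
    case False
    have del: "mat_delete A i i \<in> carrier_mat n n" if "i < Suc n" for i
      using Suc.prems that by (auto simp: mat_delete_def)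
    have "of_nat n * coeff (char_poly A) n = coeff (pderiv (char_poly A)) (n - 1)"
      using False by (simp add: coeff_pderiv)
    also have "\<dots> = (\<Sum>i<Suc n. coeff (char_poly (mat_delete A i i)) (n - 1))"
      by (simp only: pderiv_char_poly[OF Suc.prems(1)] coeff_sum)
    also have "\<dots> = (\<Sum>i<Suc n. - (\<Sum>j<n. mat_delete A i i $$ (j, j)))"
      by (intro sum.cong refl Suc.IH del) (use False in auto)
    \<comment> \<open>Deleting row and column \<open>i\<close> removes exactly the diagonal entry
      \<open>i\<close> from the trace, so that in the sum over the \<open>Suc n\<close> deletions
      every entry is counted \<open>n\<close> times.\<close>
    also have "\<dots> = (\<Sum>i<Suc n. A $$ (i, i) - (\<Sum>j<Suc n. A $$ (j, j)))"
    proof (intro sum.cong refl)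
      fix i assume i: "i \<in> {..<Suc n}"
      have "(\<Sum>j<n. mat_delete A i i $$ (j, j))
            = (\<Sum>j<n. A $$ (if j < i then j else Suc j, if j < i then j else Suc j))"
        using Suc.prems by (intro sum.cong refl) (auto simp: mat_delete_def)
      also have "\<dots> = (\<Sum>j\<in>{..<Suc n} - {i}. A $$ (j, j))"
        by (rule sum.reindex_bij_witness[of _ "\<lambda>j. if j < i then j else j - 1" "\<lambda>j. if j < i then j else Suc j"])
           (use i in \<open>auto split: if_splits\<close>)
      also have "\<dots> = (\<Sum>j<Suc n. A $$ (j, j)) - A $$ (i, i)"
        using i by (subst sum.remove[of "{..<Suc n}" i]) auto
      finally show "- (\<Sum>j<n. mat_delete A i i $$ (j, j)) = A $$ (i, i) - (\<Sum>j<Suc n. A $$ (j, j))"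
        by simp
    qed
    also have "\<dots> = - of_nat n * (\<Sum>j<Suc n. A $$ (j, j))"
      by (simp only: sum_subtractf) (simp add: algebra_simps)
    finally have "of_nat n * coeff (char_poly A) n = of_nat n * (- (\<Sum>j<Suc n. A $$ (j, j)))"
      by (simp add: algebra_simps)
    from this[unfolded mult_cancel_left] False show ?thesis by simp
  qed
qed simp

text \<open>Lagrange interpolation at the nodes \<open>0, ..., d\<close>. The weights do not depend
  on \<open>P\<close>, so that bounds on the values at the nodes become bounds on the
  coefficient.\<close>

lemma coeff_interpolation:
  "\<exists>lam :: nat \<Rightarrow> 'b::field_char_0. \<forall>P. degree P \<le> d \<longrightarrow> coeff P k = (\<Sum>i\<le>d. lam i * poly P (of_nat i))"
proof -
  define ell :: "nat \<Rightarrow> 'b poly"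
    where "ell i = (\<Prod>j\<in>{..d} - {i}. smult (inverse (of_nat i - of_nat j)) [:- of_nat j, 1:])" for i
  have eval: "poly (ell i) x = (\<Prod>j\<in>{..d} - {i}. inverse (of_nat i - of_nat j) * (x - of_nat j))" for i x
    unfolding ell_def poly_prod by (intro prod.cong refl) (simp add: algebra_simps)
  have ell: "poly (ell i) (of_nat m) = (if m = i then 1 else 0)" if "i \<le> d" "m \<le> d" for i m
  proof (cases "m = i")
    case True
    then show ?thesis unfolding eval by (auto intro!: prod.neutral)
  next
    case False
    then show ?thesis unfolding eval using that by (auto intro!: prod_zero bexI[of _ m])
  qed
  have deg: "degree (ell i) \<le> d" if "i \<le> d" for i
  proof -
    have "degree (ell i) \<le> (\<Sum>j\<in>{..d} - {i}. degree (smult (inverse (of_nat i - of_nat j)) [:- of_nat j :: 'b, 1:]))"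
      unfolding ell_def by (rule order_trans[OF degree_prod_sum_le]) (simp_all only: comp_def finite_Diff finite_atMost order_refl)
    also have "\<dots> \<le> (\<Sum>j\<in>{..d} - {i}. 1)"
      by (intro sum_mono order_trans[OF degree_smult_le]) simp
    also have "\<dots> = d" using that by simp
    finally show ?thesis .
  qed
  have "coeff P k = (\<Sum>i\<le>d. coeff (ell i) k * poly P (of_nat i))" if P: "degree P \<le> d" for P
  proof -
    define Q where "Q = (\<Sum>i\<le>d. smult (poly P (of_nat i)) (ell i))"
    have "P = Q"
    proof (rule poly_eqI_degree)
      fix x :: 'b assume "x \<in> of_nat ` {..d}"
      then obtain m where m: "x = of_nat m" "m \<le> d" by auto
      have "poly Q x = (\<Sum>i\<le>d. poly P (of_nat i) * (if m = i then 1 else 0))"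
        unfolding Q_def poly_sum using m ell by (intro sum.cong) auto
      also have "\<dots> = (\<Sum>i\<le>d. if m = i then poly P (of_nat i) else 0)" by (intro sum.cong) auto
      also have "\<dots> = poly P x" using m by simp
      finally show "poly P x = poly Q x" by simp
    next
      have c: "card (of_nat ` {..d} :: 'b set) = Suc d" by (subst card_image) (auto simp: inj_on_def)
      then show "degree P < card (of_nat ` {..d} :: 'b set)" using P by simp
      have "degree Q \<le> d" unfolding Q_def
        by (intro degree_sum_le order_trans[OF degree_smult_le] deg) auto
      then show "degree Q < card (of_nat ` {..d} :: 'b set)" using c by simp
    qed
    then have "coeff P k = coeff Q k" by simp
    then show ?thesis by (simp add: Q_def coeff_sum mult.commute)
  qed
  then show ?thesis by (intro exI allI impI)
qed

context number_field_abs
begin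

lemma u_power_int: "u (q powi k) = u q powi k"
  by (cases k) (auto simp: power_int_def u_power u_inverse)

text \<open>The sizes of the powers of \<open>inverse c\<close> form a geometric progression with
  ratio \<open>\<kappa> = 1 / u c\<close>, so one of them lies between \<open>r\<close> and
  \<open>\<kappa> * r\<close>.\<close>

lemma u_dense:
  obtains \<kappa> where "1 < \<kappa>" "\<And>r. 0 < r \<Longrightarrow> \<exists>s. s \<noteq> 0 \<and> r \<le> u s \<and> u s \<le> \<kappa> * r"
proof -
  obtain c where c: "c \<noteq> 0" "u c < 1" using u_nontrivial by auto
  define \<beta> where "\<beta> = u (inverse c)"
  have "0 < u c" using c by simp
  then have \<beta>: "1 < \<beta>" using c unfolding \<beta>_def u_inverse by (simp add: one_less_inverse)
  have "\<exists>s. s \<noteq> 0 \<and> r \<le> u s \<and> u s \<le> \<beta> * r" if r: "0 < r" for r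
  proof (intro exI conjI)
    define k where "k = \<lceil>log \<beta> r\<rceil>"
    have us: "u (inverse c powi k) = \<beta> powr k"
      using \<beta> unfolding u_power_int \<beta>_def[symmetric] by (simp add: powr_real_of_int')
    show "inverse c powi k \<noteq> 0" using c by (simp add: power_int_def)
    have "log \<beta> r \<le> k" unfolding k_def by linarith
    then have "\<beta> powr log \<beta> r \<le> \<beta> powr k" using \<beta> by (intro powr_mono) auto
    then show "r \<le> u (inverse c powi k)" using us r \<beta> by simp
    have "k \<le> log \<beta> r + 1" unfolding k_def by linarith
    then have "\<beta> powr k \<le> \<beta> powr (log \<beta> r + 1)" using \<beta> by (intro powr_mono) auto
    then show "u (inverse c powi k) \<le> \<beta> * r" using us r \<beta> by (simp add: powr_add mult.commute)
  qed
  with \<beta> show ?thesis using that by blast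
qed

text \<open>Leibniz expansion. The bound may vary with the column, because the columns of a matrix
  in an adapted basis belong to different places.\<close>

lemma u_det_le:
  assumes "A \<in> carrier_mat n n" "\<And>i j. i < n \<Longrightarrow> j < n \<Longrightarrow> u (A $$ (i, j)) \<le> c j"
  shows "u (Determinant.det A) \<le> fact n * (\<Prod>j<n. c j)"
proof -
  have "u (Determinant.det A) \<le> (\<Sum>p | p permutes {0..<n}. u (signof p * (\<Prod>i = 0..<n. A $$ (i, p i))))"
    unfolding det_def'[OF assms(1)] by (rule u_sum)
  also have "\<dots> \<le> (\<Sum>p | p permutes {0..<n}. \<Prod>j<n. c j)"
  proof (rule sum_mono)
    fix p assume p: "p \<in> {p. p permutes {0..<n}}"
    have "u (signof p :: rat) = 1" using signof_pm_one[of p, where 'a = rat] by auto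
    then have "u (signof p * (\<Prod>i = 0..<n. A $$ (i, p i))) = (\<Prod>i = 0..<n. u (A $$ (i, p i)))"
      by (simp add: u_mult u_prod)
    also have "\<dots> \<le> (\<Prod>i = 0..<n. c (p i))"
      using p permutes_in_image[of p "{0..<n}"] by (intro prod_mono) (auto intro!: assms(2))
    also have "\<dots> = (\<Prod>i = 0..<n. c i)" using p by (intro prod.permute[symmetric, unfolded comp_def]) auto
    finally show "u (signof p * (\<Prod>i = 0..<n. A $$ (i, p i))) \<le> (\<Prod>j<n. c j)" by (simp add: atLeast0LessThan)
  qed
  also have "\<dots> = fact n * (\<Prod>j<n. c j)" by (simp add: card_permutations)
  finally show ?thesis .
qed

section \<open>Multiplication matrices, field norm and field trace\<close>

definition mult_mat :: "'a \<Rightarrow> rat mat" where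
  "mult_mat x = mat D D (\<lambda>(i, j). co (x * e j) i)"

text \<open>The determinant depends on the basis but not on \<open>u\<close>; thus one rational
  number serves all absolute values in the product formula.\<close>

definition field_norm :: "'a \<Rightarrow> rat" where "field_norm x = Determinant.det (mult_mat x)"

definition field_trace :: "'a \<Rightarrow> rat" where "field_trace x = (\<Sum>i<D. co (x * e i) i)"

lemma mult_mat_carrier [simp]: "mult_mat x \<in> carrier_mat D D"
  by (simp add: mult_mat_def)

lemma co_mult: "x \<in> L \<Longrightarrow> y \<in> L \<Longrightarrow> i < D \<Longrightarrow> co (x * y) i = (\<Sum>j<D. co (x * e j) i * co y j)"
proof -
  assume *: "x \<in> L" "y \<in> L" "i < D"
  have "x * y = (\<Sum>j<D. of_rat (co y j) * (x * e j))"
    by (subst co_expand[OF *(2)]) (simp add: sum_distrib_left mult_ac)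
  then have "co (x * y) i = (\<Sum>j<D. co (of_rat (co y j) * (x * e j)) i)"
    using * by (simp only:) (rule co_sum, auto)
  also have "\<dots> = (\<Sum>j<D. co (x * e j) i * co y j)"
    using * by (intro sum.cong refl) (subst co_scale, auto)
  finally show ?thesis .
qed

lemma co_e: "i < D \<Longrightarrow> j < D \<Longrightarrow> co (e j) i = (if i = j then 1 else 0)"
  by (rule co_unique) (auto simp: if_distrib[of of_rat] if_distrib[of "\<lambda>x. x * _"] sum.delta cong: if_cong)

lemma mult_mat_mult: "x \<in> L \<Longrightarrow> y \<in> L \<Longrightarrow> mult_mat (x * y) = mult_mat x * mult_mat y"
  by (rule eq_matI) (auto simp: mult_mat_def scalar_prod_def co_mult[of x "y * e _"] mult.assoc lessThan_atLeast0)

lemma mult_mat_1: "mult_mat 1 = 1\<^sub>m D"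
  by (rule eq_matI) (auto simp: mult_mat_def co_e)

lemma field_norm_mult: "x \<in> L \<Longrightarrow> y \<in> L \<Longrightarrow> field_norm (x * y) = field_norm x * field_norm y"
  by (simp add: field_norm_def mult_mat_mult det_mult[of _ D])

lemma field_norm_1: "field_norm 1 = 1"
  by (simp add: field_norm_def mult_mat_1)

lemma field_norm_power: "x \<in> L \<Longrightarrow> field_norm (x ^ k) = field_norm x ^ k"
  by (induction k) (auto simp: field_norm_1 field_norm_mult)

lemma field_norm_nonzero: "x \<in> L \<Longrightarrow> x \<noteq> 0 \<Longrightarrow> field_norm x \<noteq> 0"
  using field_norm_mult[of x "inverse x"] by (auto simp: field_norm_1)

lemma u_field_norm_le_nm:
  obtains C where "\<And>x. x \<in> L \<Longrightarrow> u (field_norm x) \<le> C * nm x ^ D"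
proof -
  obtain C0 where C0: "0 < C0" "\<And>x y. x \<in> L \<Longrightarrow> y \<in> L \<Longrightarrow> nm (x * y) \<le> C0 * nm x * nm y"
    using nm_mult_bound by auto
  define B where "B = C0 * (\<Sum>j<D. nm (e j))"
  have "u (field_norm x) \<le> fact D * B ^ D * nm x ^ D" if x: "x \<in> L" for x
  proof -
    have "u (mult_mat x $$ (i, j)) \<le> B * nm x" if ij: "i < D" "j < D" for i j
    proof -
      have "u (mult_mat x $$ (i, j)) \<le> nm (x * e j)" using ij u_co_le_nm by (simp add: mult_mat_def)
      also have "\<dots> \<le> C0 * nm x * nm (e j)" using C0 x ij by simp
      also have "\<dots> \<le> C0 * nm x * (\<Sum>j<D. nm (e j))"
        using C0 ij by (intro mult_left_mono member_le_sum) auto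
      finally show ?thesis by (simp add: B_def mult_ac)
    qed
    then have "u (field_norm x) \<le> fact D * (\<Prod>j<D. B * nm x)"
      unfolding field_norm_def by (intro u_det_le) auto
    then show ?thesis by (simp add: power_mult_distrib)
  qed
  then show ?thesis by (rule that)
qed

text \<open>The entries of the multiplication matrix are of order \<open>nm x\<close>. Applied to
  powers of \<open>x\<close>, with the norm being multiplicative, this replaces \<open>nm\<close> by
  the spectral seminorm and removes the constant.\<close>

lemma u_field_norm_le_rho:
  assumes x: "x \<in> L" shows "u (field_norm x) \<le> rho x ^ D"
proof -
  obtain C where C: "\<And>x. x \<in> L \<Longrightarrow> u (field_norm x) \<le> C * nm x ^ D" using u_field_norm_le_nm by blast
  have *: "u (field_norm x) \<le> a ^ D" if a: "rho x < a" for a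
  proof -
    have "a \<in> growth_rates x" using growth_ratesI x a by auto
    then obtain B where B: "0 < B" "\<And>k. nm (x ^ k) \<le> B * a ^ k" by (auto elim: growth_ratesE)
    have "0 < a" using rho_nonneg[OF x] a by linarith
    have "u (field_norm x) ^ k \<le> (\<bar>C\<bar> * B ^ D) * (a ^ D) ^ k" for k
    proof -
      have "u (field_norm x) ^ k \<le> C * nm (x ^ k) ^ D" using C[of "x ^ k"] x by (simp add: field_norm_power u_power)
      also have "\<dots> \<le> \<bar>C\<bar> * (B * a ^ k) ^ D" using B by (intro mult_mono power_mono) auto
      finally show ?thesis by (simp add: power_mult_distrib mult_ac flip: power_mult)
    qed
    then show ?thesis using \<open>0 < a\<close> by (intro le_of_pow_le[of "a ^ D" "u (field_norm x)"]) auto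
  qed
  have "((\<lambda>d. (rho x + d) ^ D) \<longlongrightarrow> (rho x + 0) ^ D) (at_right 0)"
    by (intro tendsto_intros)
  moreover have "\<forall>\<^sub>F d in at_right 0. u (field_norm x) \<le> (rho x + d) ^ D"
    using eventually_at_right_less[of "0::real"] by eventually_elim (rule *, auto)
  ultimately show ?thesis
    using tendsto_lowerbound[of _ "(rho x + 0) ^ D" "at_right (0::real)"] by simp
qed

lemma poly_char_poly_mult_mat:
  assumes "x \<in> L" shows "poly (char_poly (mult_mat x)) t = field_norm (of_rat t - x)"
proof -
  have "- char_matrix (mult_mat x) t = mult_mat (of_rat t - x)"
  proof (rule eq_matI)
    fix i j assume "i < dim_row (mult_mat (of_rat t - x))" "j < dim_col (mult_mat (of_rat t - x))"
    then have ij: "i < D" "j < D" by (simp_all add: mult_mat_def) 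
    have "co ((of_rat t - x) * e j) i = co (of_rat t * e j) i + co (of_rat (-1) * (x * e j)) i"
      using assms ij by (subst co_add[symmetric]) (auto simp: algebra_simps)
    also have "\<dots> = t * (if i = j then 1 else 0) - co (x * e j) i"
      using assms ij by (simp only: co_scale mult_mem e_mem co_e)
    finally show "(- char_matrix (mult_mat x) t) $$ (i, j) = mult_mat (of_rat t - x) $$ (i, j)"
      using ij by (auto simp: char_matrix_def mult_mat_def)
  qed (auto simp: char_matrix_def mult_mat_def)
  then show ?thesis by (simp add: char_poly_matrix[of _ D] field_norm_def)
qed

text \<open>The trace is read off the characteristic polynomial by interpolation at \<open>D + 1\<close> points
  of size comparable to \<open>rho x\<close>, where the field norm is controlled.\<close>

lemma u_field_trace_le_rho:
  obtains C where "0 < C" "\<And>x. x \<in> L \<Longrightarrow> u (field_trace x) \<le> C * rho x"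
proof -
  obtain lam :: "nat \<Rightarrow> rat"
    where lam: "\<And>P. degree P \<le> D \<Longrightarrow> coeff P (D - 1) = (\<Sum>i\<le>D. lam i * poly P (of_nat i))"
    using coeff_interpolation[of D "D - 1", where 'b = rat] by blast
  obtain \<kappa> where \<kappa>: "1 < \<kappa>" "\<And>r. 0 < r \<Longrightarrow> \<exists>s. s \<noteq> 0 \<and> r \<le> u s \<and> u s \<le> \<kappa> * r"
    by (rule u_dense) blast
  define B where "B = (\<Sum>i\<le>D. u (lam i) * (real i + 1) ^ D)"
  have "u (field_trace x) \<le> (1 + B) * \<kappa> * rho x" if x: "x \<in> L" "x \<noteq> 0" for x
  proof -
    obtain s where s: "s \<noteq> 0" "rho x \<le> u s" "u s \<le> \<kappa> * rho x"
      using \<kappa>(2)[of "rho x"] power_seminorm_pos[OF power_seminorm_rho x] by auto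
    define p where "p = char_poly (mult_mat x)"
    \<comment> \<open>The nodes \<open>i\<close> are rescaled to \<open>s * i\<close>, of size
      comparable to \<open>rho x\<close>. The coefficient of degree \<open>D - 1\<close> acquires
      the factor \<open>s ^ (D - 1)\<close>, while the values are of order \<open>u s ^ D\<close>;
      after cancellation one factor \<open>u s\<close> remains.\<close>
    define P where "P = pcompose p [:0, s:]"
    have "degree p = D" using degree_monic_char_poly[of "mult_mat x" D] by (simp add: p_def)
    then have "degree P \<le> D" using degree_pcompose_le[of p "[:0, s:]"] by (simp add: P_def s)
    have "coeff P (D - 1) = s ^ (D - 1) * - field_trace x"
      using coeff_char_poly_trace[of "mult_mat x" D] D_pos
      by (simp add: P_def p_def coeff_pcompose_linear field_trace_def) (simp add: mult_mat_def)
    then have "u s ^ (D - 1) * u (field_trace x) = u (coeff P (D - 1))"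
      by (simp add: u_mult u_power)
    also have "\<dots> \<le> (\<Sum>i\<le>D. u (lam i * poly P (of_nat i)))"
      unfolding lam[OF \<open>degree P \<le> D\<close>] by (rule u_sum)
    also have "\<dots> \<le> (\<Sum>i\<le>D. u (lam i) * ((real i + 1) ^ D * u s ^ D))"
    proof (rule sum_mono)
      fix i
      have "poly P (of_nat i) = field_norm (of_rat (s * of_nat i) - x)"
        using poly_char_poly_mult_mat[OF x(1), of "s * of_nat i"]
        by (simp add: P_def p_def poly_pcompose mult.commute)
      then have "u (poly P (of_nat i)) \<le> rho (of_rat (s * of_nat i) + - x) ^ D"
        using u_field_norm_le_rho[of "of_rat (s * of_nat i) - x"] x by simp
      also have "\<dots> \<le> ((real i + 1) * u s) ^ D"
      proof (rule power_mono)
        have "rho (- x) \<le> rho (of_rat (- 1)) * rho x" using rho_mult[of "of_rat (-1)" x] x by simp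
        also have "\<dots> \<le> 1 * rho x" using rho_of_rat[of "-1"] rho_nonneg[OF x(1)] by (intro mult_right_mono) auto
        finally have 1: "rho (- x) \<le> u s" using s by simp
        have "rho (of_rat (s * of_nat i)) \<le> u s * u (of_nat i)" using rho_of_rat[of "s * of_nat i"] by (simp add: u_mult)
        also have "\<dots> \<le> u s * real i" using u_of_nat by (intro mult_left_mono) auto
        finally show "rho (of_rat (s * of_nat i) + - x) \<le> (real i + 1) * u s"
          using rho_add[of "of_rat (s * of_nat i)" "- x"] 1 x by (simp add: algebra_simps)
      qed (use x in \<open>auto intro!: rho_nonneg\<close>)
      finally have "u (poly P (of_nat i)) \<le> ((real i + 1) * u s) ^ D" .
      then show "u (lam i * poly P (of_nat i)) \<le> u (lam i) * ((real i + 1) ^ D * u s ^ D)"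
        by (simp add: u_mult power_mult_distrib mult_left_mono)
    qed
    also have "\<dots> = B * u s ^ D" by (simp add: B_def sum_distrib_right mult.assoc)
    also have "\<dots> = u s ^ (D - 1) * (B * u s)" using D_pos by (cases D) auto
    finally have "u (field_trace x) \<le> B * u s" using s by simp
    also have "\<dots> \<le> (1 + B) * (\<kappa> * rho x)"
      using s by (intro mult_mono) (auto simp: B_def intro!: add_nonneg_nonneg sum_nonneg)
    finally show ?thesis by simp
  qed
  moreover have "0 < (1 + B) * \<kappa>" using \<kappa> unfolding B_def by (intro mult_pos_pos add_pos_nonneg sum_nonneg) auto
  moreover have "field_trace 0 = 0" by (simp add: field_trace_def)
  ultimately show ?thesis using that[of "(1 + B) * \<kappa>"] rho_nonneg by (metis mult_nonneg_nonneg less_imp_le u_0 zero_mem)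
qed

lemma field_trace_lincomb:
  assumes "x \<in> L" "y \<in> L" shows "field_trace (x * y) = (\<Sum>i<D. co x i * field_trace (e i * y))"
proof -
  have "x * y * e j = (\<Sum>i<D. of_rat (co x i) * (e i * y * e j))" for j
    by (subst co_expand[OF assms(1)]) (simp add: sum_distrib_right mult.assoc)
  then have "co (x * y * e j) j = (\<Sum>i<D. co x i * co (e i * y * e j) j)" if "j < D" for j
    using that assms by (subst \<open>x * y * e j = _\<close>, subst co_sum) (auto simp: co_scale)
  then have "field_trace (x * y) = (\<Sum>j<D. \<Sum>i<D. co x i * co (e i * y * e j) j)"
    by (simp add: field_trace_def)
  also have "\<dots> = (\<Sum>i<D. co x i * field_trace (e i * y))"
    unfolding field_trace_def sum_distrib_left by (rule sum.swap)
  finally show ?thesis .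
qed

lemma field_trace_1: "field_trace 1 = of_nat D"
  by (simp add: field_trace_def co_e)

text \<open>The coordinates of \<open>x\<close> are recovered from the traces of
  \<open>x * e j\<close> by inverting the Gram matrix of the trace form, and traces are bounded by
  \<open>rho\<close>. The form is nondegenerate: a nonzero \<open>y\<close> in its kernel would make
  the trace of \<open>inverse y * y = 1\<close> vanish, whereas that trace is
  \<open>D\<close>.\<close>

lemma nm_le_rho:
  obtains C where "0 < C" "\<And>x. x \<in> L \<Longrightarrow> nm x \<le> C * rho x"
proof -
  define G where "G = mat D D (\<lambda>(j, i). field_trace (e i * e j))"
  have G: "G \<in> carrier_mat D D" by (simp add: G_def)
  have "Determinant.det G \<noteq> 0"
  proof
    assume "Determinant.det G = 0"
    then obtain v where v: "v \<in> carrier_vec D" "v \<noteq> 0\<^sub>v D" "G *\<^sub>v v = 0\<^sub>v D"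
      using det_0_iff_vec_prod_zero[OF G] by auto
    define y where "y = (\<Sum>i<D. of_rat (vec_index v i) * e i)"
    have y: "y \<in> L" by (simp add: y_def)
    have "field_trace (y * e j) = 0" if "j < D" for j
    proof -
      have "field_trace (y * e j) = (\<Sum>i<D. vec_index v i * field_trace (e i * e j))"
        using that by (subst field_trace_lincomb[OF y]) (auto simp: y_def)
      also have "\<dots> = vec_index (G *\<^sub>v v) j"
        using that v(1) by (simp add: G_def scalar_prod_def mult.commute lessThan_atLeast0)
      finally show ?thesis using v(3) that by simp
    qed
    then have "field_trace (w * y) = 0" if "w \<in> L" for w
      using field_trace_lincomb[OF that y] by (simp add: mult.commute)
    moreover have "y \<noteq> 0"
    proof
      assume "y = 0"
      then have "vec_index v i = 0" if "i < D" for i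
        using co_lincomb[OF that, of "\<lambda>i. vec_index v i"] that by (simp flip: y_def)
      then have "v = 0\<^sub>v D" using v(1) by (intro eq_vecI) auto
      with v show False by simp
    qed
    ultimately have "field_trace 1 = 0" using y by (metis inverse_mem left_inverse)
    then show False using D_pos by (simp add: field_trace_1)
  qed
  define H where "H = inverse (Determinant.det G) \<cdot>\<^sub>m adj_mat G"
  have H: "H \<in> carrier_mat D D" using adj_mat(1)[OF G] by (simp add: H_def)
  have HG: "H * G = 1\<^sub>m D"
    using adj_mat[OF G] \<open>Determinant.det G \<noteq> 0\<close> G unfolding H_def
    by (subst mult_smult_assoc_mat[of _ D D]) (auto intro!: eq_matI)
  obtain C where C: "0 < C" "\<And>x. x \<in> L \<Longrightarrow> u (field_trace x) \<le> C * rho x"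
    using u_field_trace_le_rho by blast
  define B where "B = (\<Sum>i<D. \<Sum>j<D. u (H $$ (i, j)) * (C * rho (e j)))"
  have "nm x \<le> B * rho x" if x: "x \<in> L" for x
  proof -
    define v where "v = Matrix.vec D (co x)"
    have v: "v \<in> carrier_vec D" by (simp add: v_def)
    have Gv: "vec_index (G *\<^sub>v v) j = field_trace (x * e j)" if "j < D" for j
      using that x by (simp add: field_trace_lincomb G_def v_def scalar_prod_def mult.commute lessThan_atLeast0)
    have "H *\<^sub>v (G *\<^sub>v v) = v" using H G v HG by (simp flip: assoc_mult_mat_vec)
    then have co: "co x i = (\<Sum>j<D. H $$ (i, j) * field_trace (x * e j))" if "i < D" for i
      using that H Gv G by (subst (asm) vec_eq_iff) (auto simp: v_def scalar_prod_def lessThan_atLeast0)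
    have "nm x \<le> (\<Sum>i<D. \<Sum>j<D. u (H $$ (i, j) * field_trace (x * e j)))"
      unfolding nm_def by (intro sum_mono) (simp add: co u_sum)
    also have "\<dots> \<le> (\<Sum>i<D. \<Sum>j<D. u (H $$ (i, j)) * (C * rho (e j)) * rho x)"
    proof (intro sum_mono)
      fix i j assume "i \<in> {..<D}" "j \<in> {..<D}"
      then have "u (field_trace (x * e j)) \<le> C * (rho x * rho (e j))"
        using C rho_mult[of x "e j"] x by (intro order_trans[OF C(2)] mult_left_mono) auto
      then have "u (H $$ (i, j)) * u (field_trace (x * e j)) \<le> u (H $$ (i, j)) * (C * (rho x * rho (e j)))"
        by (rule mult_left_mono) auto
      then show "u (H $$ (i, j) * field_trace (x * e j)) \<le> u (H $$ (i, j)) * (C * rho (e j)) * rho x"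
        by (simp add: u_mult mult_ac)
    qed
    also have "\<dots> = B * rho x" by (simp add: B_def sum_distrib_right)
    finally show ?thesis .
  qed
  moreover have "0 \<le> B" unfolding B_def using C by (intro sum_nonneg mult_nonneg_nonneg) (auto intro: rho_nonneg)
  ultimately have "nm x \<le> (1 + B) * rho x" if "x \<in> L" for x
    using that rho_nonneg[OF that] by (simp add: algebra_simps add_increasing)
  with \<open>0 \<le> B\<close> show ?thesis using that[of "1 + B"] by auto
qed

text \<open>The constant is uniform, while the absolute value is an extension attaining the spectral
  seminorm at the given \<open>x\<close>. In this form all extensions together control the
  coordinates.\<close>

lemma nm_le_extends:
  obtains C where "0 < C" "\<And>x. x \<in> L \<Longrightarrow> \<exists>v\<in>extensional L. extends v \<and> nm x \<le> C * v x"
proof -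
  obtain C where C: "0 < C" "\<And>x. x \<in> L \<Longrightarrow> nm x \<le> C * rho x" using nm_le_rho by blast
  have *: "\<exists>v\<in>extensional L. extends v \<and> nm x \<le> C * v x" if x: "x \<in> L" "x \<noteq> 0" for x
  proof -
    obtain v where "v \<in> extensional L" "extends v" "v x = rho x" using extends_attaining_rho[OF x] by blast
    then show ?thesis using C(2)[OF x(1)] by (intro bexI[of _ v]) auto
  qed
  show ?thesis
  proof (rule that[OF C(1)])
    fix x assume x: "x \<in> L"
    show "\<exists>v\<in>extensional L. extends v \<and> nm x \<le> C * v x"
    proof (cases "x = 0")
      case True
      obtain v where v: "v \<in> extensional L" "extends v" using *[of 1] by auto
      then show ?thesis using True by (intro bexI[of _ v]) (auto simp: extends_0[OF v(2)])
    qed (use * x in auto)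
  qed
qed

end

section \<open>Local degrees\<close>

text \<open>Gaussian elimination: an equation with a nonzero coefficient at \<open>i0\<close>
  determines that unknown, and the other equations are reduced by multiples of it.\<close>

lemma underdetermined_system:
  fixes a :: "'j \<Rightarrow> 'i \<Rightarrow> 'b::field"
  assumes "finite J" "finite I" "card J < card I"
  shows "\<exists>q. (\<exists>i\<in>I. q i \<noteq> 0) \<and> (\<forall>j\<in>J. (\<Sum>i\<in>I. a j i * q i) = 0)"
  using assms
proof (induction J arbitrary: I a rule: finite_induct)
  case empty
  then have "I \<noteq> {}" by auto
  then show ?case by (intro exI[of _ "\<lambda>_. 1"]) auto
next
  case (insert j J)
  show ?case
  proof (cases "\<forall>i\<in>I. a j i = 0")
    case True
    have "card J < card I" using insert.prems insert.hyps by simp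
    then obtain q where "\<exists>i\<in>I. q i \<noteq> 0" "\<forall>j\<in>J. (\<Sum>i\<in>I. a j i * q i) = 0"
      using insert.IH[OF insert.prems(1), of a] by auto
    then show ?thesis using True by (intro exI[of _ q]) auto
  next
    case False
    then obtain i0 where i0: "i0 \<in> I" "a j i0 \<noteq> 0" by auto
    have "card J < card (I - {i0})" using insert.prems insert.hyps i0 by simp
    then obtain q where q: "\<exists>i\<in>I - {i0}. q i \<noteq> 0"
      "\<forall>k\<in>J. (\<Sum>i\<in>I - {i0}. (a k i - a k i0 * a j i / a j i0) * q i) = 0"
      using insert.IH[of "I - {i0}" "\<lambda>k i. a k i - a k i0 * a j i / a j i0"] insert.prems by auto
    define q' where "q' = q(i0 := - (\<Sum>i\<in>I - {i0}. a j i * q i) / a j i0)"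
    have split: "(\<Sum>i\<in>I. a k i * q' i) = a k i0 * q' i0 + (\<Sum>i\<in>I - {i0}. a k i * q i)" for k
      using insert.prems i0 by (subst sum.remove[of I i0]) (auto simp: q'_def intro!: sum.cong)
    have "(\<Sum>i\<in>I. a j i * q' i) = 0" unfolding split using i0 by (simp add: q'_def)
    moreover have "(\<Sum>i\<in>I. a k i * q' i) = 0" if "k \<in> J" for k
    proof -
      have "a k i0 * q' i0 = - (\<Sum>i\<in>I - {i0}. (a k i0 * a j i / a j i0) * q i)"
        by (simp add: q'_def sum_distrib_left sum_divide_distrib mult_ac)
      then show ?thesis
        unfolding split using bspec[OF q(2) that] by (simp add: left_diff_distrib sum_subtractf)
    qed
    ultimately show ?thesis using q(1) by (intro exI[of _ q']) (auto simp: q'_def)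
  qed
qed

context number_field_abs
begin

section \<open>Separation of places and weak approximation\<close>

definition places_over :: "('a \<Rightarrow> real) set" where
  "places_over = {v \<in> extensional L. extends v}"

lemma places_overD: "v \<in> places_over \<Longrightarrow> extends v"
  by (simp add: places_over_def)

text \<open>A power of \<open>x\<close> widens the ratio of \<open>w\<close> to \<open>v\<close>
  beyond \<open>\<kappa>\<^sup>2\<close>. A rational number then has size strictly between the two
  values, and division by it moves them to opposite sides of 1.\<close>

lemma separate_aux:
  assumes v: "extends v" and w: "extends w" and x: "x \<in> L" "x \<noteq> 0" "v x < w x"
  shows "\<exists>y\<in>L. v y < 1 \<and> 1 < w y"
proof -
  obtain \<kappa> where \<kappa>: "1 < \<kappa>" "\<And>r. 0 < r \<Longrightarrow> \<exists>s. s \<noteq> 0 \<and> r \<le> u s \<and> u s \<le> \<kappa> * r"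
    by (rule u_dense) blast
  have pos: "0 < v x" "0 < w x" using x extends_pos[OF v x(1)] extends_pos[OF w x(1)] by auto
  then have "1 < w x / v x" using x by simp
  then obtain m where m: "\<kappa>\<^sup>2 < (w x / v x) ^ m" using real_arch_pow by blast
  obtain s where s: "s \<noteq> 0" "\<kappa> * v x ^ m \<le> u s" "u s \<le> \<kappa> * (\<kappa> * v x ^ m)"
    using \<kappa>(2)[of "\<kappa> * v x ^ m"] \<kappa>(1) pos by auto
  have us: "0 < u s" using s by simp
  have "v x ^ m < \<kappa> * v x ^ m" using \<kappa>(1) pos by simp
  then have 1: "v x ^ m < u s" using s by simp
  have "\<kappa>\<^sup>2 * v x ^ m < w x ^ m" using m pos by (simp add: power_divide field_simps)
  then have 2: "u s < w x ^ m" using s by (simp add: power2_eq_square mult.assoc)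
  have "v (x ^ m / of_rat s) = v x ^ m / u s" "w (x ^ m / of_rat s) = w x ^ m / u s"
    using x by (simp_all add: extends_simps[OF v] extends_simps[OF w])
  then show ?thesis using 1 2 us x by (intro bexI[of _ "x ^ m / of_rat s"]) auto
qed

text \<open>Different places differ at some \<open>x\<close>; if the inequality points the wrong
  way, \<open>inverse x\<close> reverses it.\<close>

lemma separate:
  assumes "v \<in> places_over" "w \<in> places_over" "v \<noteq> w"
  shows "\<exists>y\<in>L. v y < 1 \<and> 1 < w y"
proof -
  have v: "extends v" and w: "extends w" using assms by (auto simp: places_over_def)
  have "\<exists>x\<in>L. v x \<noteq> w x"
  proof (rule ccontr)
    assume "\<not> ?thesis"
    then have "v = w" using assms by (intro extensionalityI[of v L w]) (auto simp: places_over_def)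
    with assms show False by simp
  qed
  then obtain x where x: "x \<in> L" "v x \<noteq> w x" by auto
  then have "x \<noteq> 0" using extends_0[OF v] extends_0[OF w] by auto
  show ?thesis
  proof (cases "v x < w x")
    case True
    then show ?thesis using separate_aux[OF v w x(1) \<open>x \<noteq> 0\<close>] by simp
  next
    case False
    then have "w x < v x" "0 < w x" using x \<open>x \<noteq> 0\<close> extends_pos[OF w x(1)] by auto
    then have "v (inverse x) < w (inverse x)"
      using x by (simp add: extends_inverse[OF v] extends_inverse[OF w] less_imp_inverse_less)
    then show ?thesis using separate_aux[OF v w, of "inverse x"] x \<open>x \<noteq> 0\<close> by simp
  qed
qed

text \<open>The expression \<open>y ^ k / (1 + y ^ k)\<close> tends to 0 where \<open>y\<close> is
  small and to 1 where \<open>y\<close> is large, so it approximates an idempotent of the product of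
  the completions. This is the first of the two limits.\<close>

lemma quotient_tendsto_0:
  assumes v: "extends v" and y: "y \<in> L" "v y < 1"
  shows "(\<lambda>k. v (y ^ k / (1 + y ^ k))) \<longlonglongrightarrow> 0"
proof -
  have nonneg: "0 \<le> v y" using extends_nonneg[OF v y(1)] .
  have lim: "(\<lambda>k. v y ^ k) \<longlonglongrightarrow> 0" using y nonneg by (intro LIMSEQ_realpow_zero) auto
  have lim2: "(\<lambda>k. v y ^ k / (1 - v y ^ k)) \<longlonglongrightarrow> 0 / (1 - 0)" by (intro tendsto_intros lim) simp
  show ?thesis
  proof (rule tendsto_sandwich[OF _ _ tendsto_const])
    show "\<forall>\<^sub>F k in sequentially. 0 \<le> v (y ^ k / (1 + y ^ k))"
      using y by (intro always_eventually allI extends_nonneg[OF v]) auto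
    show "(\<lambda>k. v y ^ k / (1 - v y ^ k)) \<longlonglongrightarrow> 0" using lim2 by simp
    show "\<forall>\<^sub>F k in sequentially. v (y ^ k / (1 + y ^ k)) \<le> v y ^ k / (1 - v y ^ k)"
      using order_tendstoD(2)[OF lim, of 1, simplified]
    proof eventually_elim
      case (elim k)
      have "v 1 \<le> v (1 + y ^ k) + v (y ^ k)" using extends_diff[OF v, of "1 + y ^ k" "y ^ k"] y by simp
      then have "1 - v y ^ k \<le> v (1 + y ^ k)" using y by (simp add: extends_simps[OF v])
      then have "v y ^ k / v (1 + y ^ k) \<le> v y ^ k / (1 - v y ^ k)"
        using elim nonneg by (intro divide_left_mono mult_pos_pos) auto
      then show ?case using y by (simp add: extends_simps[OF v])
    qed
  qed
qed

text \<open>After division by \<open>y ^ k\<close>, the deviation from 1 is the negative of the same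
  expression for \<open>inverse y\<close>, which is small at \<open>v\<close>.\<close>

lemma quotient_tendsto_1:
  assumes v: "extends v" and y: "y \<in> L" "1 < v y"
  shows "(\<lambda>k. v (y ^ k / (1 + y ^ k) - 1)) \<longlonglongrightarrow> 0"
proof -
  have y0: "y \<noteq> 0" using y extends_0[OF v] by auto
  have "v (inverse y) < 1" using y by (simp add: extends_inverse[OF v] inverse_less_1_iff)
  then have lim: "(\<lambda>k. v (inverse y ^ k / (1 + inverse y ^ k))) \<longlonglongrightarrow> 0"
    using quotient_tendsto_0[OF v, of "inverse y"] y by simp
  have eq: "v (y ^ k / (1 + y ^ k) - 1) = v (inverse y ^ k / (1 + inverse y ^ k))" if "1 \<le> k" for k
  proof -
    have "1 < v (y ^ k)" using y that by (simp add: extends_simps[OF v])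
    then have ne: "1 + y ^ k \<noteq> 0"
      by (metis add.commute add_eq_0_iff extends_1[OF v] extends_minus[OF v] one_mem less_irrefl)
    then have "1 + inverse y ^ k \<noteq> 0" using y0 by (simp add: field_simps power_inverse)
    then have "y ^ k / (1 + y ^ k) - 1 = - (inverse y ^ k / (1 + inverse y ^ k))"
      using ne y0 by (simp add: field_simps power_inverse)
    then show ?thesis using y by (simp add: extends_minus[OF v])
  qed
  have "\<forall>\<^sub>F k in sequentially. v (inverse y ^ k / (1 + inverse y ^ k)) = v (y ^ k / (1 + y ^ k) - 1)"
    using eventually_ge_at_top[of "1::nat"] by eventually_elim (rule eq[symmetric])
  then show ?thesis using lim by (rule Lim_transform_eventually[rotated])
qed

text \<open>Induction on \<open>P\<close>. Let \<open>y\<close> be good for \<open>P\<close> and let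
  \<open>t\<close> separate the new place \<open>w\<close> from \<open>v\<close>. If
  \<open>w y \<le> 1\<close>, then \<open>y ^ k * t\<close> works for some \<open>k\<close>.
  Otherwise \<open>y ^ k\<close> is damped to \<open>y ^ k / (1 + y ^ k)\<close>, which is close to
  1 at both \<open>v\<close> and \<open>w\<close> and close to 0 on \<open>P\<close>.\<close>

lemma separate_finite:
  assumes "finite P" "P \<subseteq> places_over" "v \<in> places_over" "v \<notin> P"
  shows "\<exists>y\<in>L. 1 < v y \<and> (\<forall>w\<in>P. w y < 1)"
  using assms
proof (induction P rule: finite_induct)
  case empty
  obtain c where c: "c \<noteq> 0" "u c < 1" using u_nontrivial by auto
  have "1 < u (inverse c)" unfolding u_inverse using c by (simp add: one_less_inverse)
  then show ?case using places_overD[OF empty(2)] by (intro bexI[of _ "of_rat (inverse c)"]) (auto simp: extends_of_rat simp del: of_rat_inverse)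
next
  case (insert w P)
  have v: "extends v" and w: "extends w" using insert.prems by (auto simp: places_over_def)
  have P: "extends w'" if "w' \<in> P" for w' using insert.prems that by (auto simp: places_over_def)
  obtain y where y: "y \<in> L" "1 < v y" "\<And>w'. w' \<in> P \<Longrightarrow> w' y < 1" using insert by auto
  obtain t where t: "t \<in> L" "w t < 1" "1 < v t" using separate[of w v] insert.prems by auto
  show ?case
  proof (cases "w y \<le> 1")
    case True
    have "\<forall>\<^sub>F k in sequentially. \<forall>w'\<in>P. w' (y ^ k * t) < 1"
    proof (rule eventually_ball_finite[OF insert.hyps(1)], rule ballI)
      fix w' assume w': "w' \<in> P"
      have "(\<lambda>k. w' y ^ k * w' t) \<longlonglongrightarrow> 0 * w' t"
        using y(3)[OF w'] extends_nonneg[OF P[OF w'] y(1)] by (intro tendsto_intros LIMSEQ_realpow_zero) auto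
      then have "\<forall>\<^sub>F k in sequentially. w' y ^ k * w' t < 1" using order_tendstoD(2)[of _ "0 * w' t" _ 1] by simp
      then show "\<forall>\<^sub>F k in sequentially. w' (y ^ k * t) < 1" using y t by (simp add: extends_simps[OF P[OF w']])
    qed
    then have "\<exists>k. \<forall>w'\<in>P. w' (y ^ k * t) < 1" using eventually_happens by fastforce
    then obtain k where k: "\<And>w'. w' \<in> P \<Longrightarrow> w' (y ^ k * t) < 1" by blast
    have "1 * 1 < v y ^ k * v t" using y t by (intro mult_le_less_imp_less one_le_power) auto
    moreover have "w y ^ k * w t \<le> 1 * w t"
      using True extends_nonneg[OF w] y t by (intro mult_right_mono power_le_one) auto
    ultimately show ?thesis using k y t
      by (intro bexI[of _ "y ^ k * t"]) (auto simp: extends_simps[OF v] extends_simps[OF w])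
  next
    case False
    define q where "q k = y ^ k / (1 + y ^ k)" for k
    have q: "q k \<in> L" for k using y by (simp add: q_def)
    have vq: "v (q k * t) = v (q k) * v t" "w (q k * t) = w (q k) * w t" for k
      using q t by (simp_all add: extends_simps[OF v] extends_simps[OF w])
    have lim1: "(\<lambda>k. v' (q k)) \<longlonglongrightarrow> 1" if v': "extends v'" "1 < v' y" for v'
    proof -
      have lim: "(\<lambda>k. v' (q k - 1)) \<longlonglongrightarrow> 0" using quotient_tendsto_1[OF v'(1) y(1) v'(2)] by (simp add: q_def)
      have "\<bar>v' (q k) - 1\<bar> \<le> v' (q k - 1)" for k
        using extends_add[OF v'(1), of "q k - 1" 1] extends_diff[OF v'(1), of "q k" "q k - 1"] q[of k]
          extends_1[OF v'(1)] by auto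
      then have "(\<lambda>k. v' (q k) - 1) \<longlonglongrightarrow> 0" by (intro Lim_null_comparison[OF _ lim]) auto
      then show ?thesis by (simp add: LIM_zero_iff)
    qed
    have "(\<lambda>k. v (q k * t)) \<longlonglongrightarrow> 1 * v t" unfolding vq by (intro tendsto_intros lim1 v y)
    then have e1: "\<forall>\<^sub>F k in sequentially. 1 < v (q k * t)" using t by (intro order_tendstoD(1)) auto
    have "(\<lambda>k. w (q k * t)) \<longlonglongrightarrow> 1 * w t" unfolding vq using False by (intro tendsto_intros lim1 w) auto
    then have e2: "\<forall>\<^sub>F k in sequentially. w (q k * t) < 1" using t by (intro order_tendstoD(2)) auto
    have e3: "\<forall>\<^sub>F k in sequentially. \<forall>w'\<in>P. w' (q k * t) < 1"
    proof (rule eventually_ball_finite[OF insert.hyps(1)], rule ballI)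
      fix w' assume w': "w' \<in> P"
      have "(\<lambda>k. w' (q k) * w' t) \<longlonglongrightarrow> 0 * w' t"
        using quotient_tendsto_0[OF P[OF w'] y(1) y(3)[OF w']] by (intro tendsto_intros) (simp add: q_def)
      then have "\<forall>\<^sub>F k in sequentially. w' (q k) * w' t < 1" using order_tendstoD(2)[of _ "0 * w' t" _ 1] by simp
      then show "\<forall>\<^sub>F k in sequentially. w' (q k * t) < 1" using q t by (simp add: extends_simps[OF P[OF w']])
    qed
    have "\<exists>k. 1 < v (q k * t) \<and> w (q k * t) < 1 \<and> (\<forall>w'\<in>P. w' (q k * t) < 1)"
      using eventually_happens[OF eventually_conj[OF e1 eventually_conj[OF e2 e3]]] by auto
    then obtain k where "1 < v (q k * t)" "w (q k * t) < 1" "\<forall>w'\<in>P. w' (q k * t) < 1" by blast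
    then show ?thesis using q t by (intro bexI[of _ "q k * t"]) auto
  qed
qed

lemma weak_approximation:
  assumes "finite P" "P \<subseteq> places_over" "v \<in> P" "0 < \<eta>"
  shows "\<exists>x\<in>L. \<forall>w\<in>P. w (x - (if w = v then 1 else 0)) < \<eta>"
proof -
  obtain y where y: "y \<in> L" "1 < v y" "\<And>w. w \<in> P - {v} \<Longrightarrow> w y < 1"
    using separate_finite[of "P - {v}" v] assms by auto
  have "\<forall>\<^sub>F k in sequentially. \<forall>w\<in>P. w (y ^ k / (1 + y ^ k) - (if w = v then 1 else 0)) < \<eta>"
  proof (rule eventually_ball_finite[OF assms(1)], rule ballI)
    fix w assume w: "w \<in> P"
    then have ext: "extends w" using assms(2) by (auto simp: places_over_def)
    have "(\<lambda>k. w (y ^ k / (1 + y ^ k) - (if w = v then 1 else 0))) \<longlonglongrightarrow> 0"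
      using quotient_tendsto_0[OF ext y(1)] quotient_tendsto_1[OF ext y(1)] y(2) y(3)[of w] w by auto
    then show "\<forall>\<^sub>F k in sequentially. w (y ^ k / (1 + y ^ k) - (if w = v then 1 else 0)) < \<eta>"
      using assms(4) by (rule order_tendstoD(2))
  qed
  then have "\<exists>k. \<forall>w\<in>P. w (y ^ k / (1 + y ^ k) - (if w = v then 1 else 0)) < \<eta>"
    using eventually_happens by fastforce
  then obtain k where "\<forall>w\<in>P. w (y ^ k / (1 + y ^ k) - (if w = v then 1 else 0)) < \<eta>" by blast
  then show ?thesis using y by (intro bexI[of _ "y ^ k / (1 + y ^ k)"]) auto
qed


text \<open>Independence over the completion of the rationals at \<open>u\<close>, expressed by a quantitative
  condition on rational coefficients only.\<close>

definition independent_at :: "('a \<Rightarrow> real) \<Rightarrow> nat set \<Rightarrow> bool" where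
  "independent_at v J \<longleftrightarrow>
     (\<exists>\<delta>>0. \<forall>q. \<forall>j\<in>J. \<delta> * u (q j) \<le> v (\<Sum>i\<in>J. of_rat (q i) * e i))"

lemma independent_at_empty: "independent_at v {}"
  by (auto simp: independent_at_def intro: exI[of _ 1])

definition local_basis :: "('a \<Rightarrow> real) \<Rightarrow> nat set" where
  "local_basis v = (ARG_MAX card J. J \<subseteq> {..<D} \<and> independent_at v J)"

text \<open>The maximum is attained because cardinalities are at most \<open>D\<close> and the empty
  set is admissible.\<close>

lemma local_basis:
  shows local_basis_subset: "local_basis v \<subseteq> {..<D}"
    and independent_local_basis: "independent_at v (local_basis v)"
    and card_le_local_basis: "J \<subseteq> {..<D} \<Longrightarrow> independent_at v J \<Longrightarrow> card J \<le> card (local_basis v)"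
proof -
  let ?P = "\<lambda>J. J \<subseteq> {..<D} \<and> independent_at v J"
  have "card J < Suc D" if "?P J" for J
    using card_mono[of "{..<D}" J] that by simp
  then have "?P (local_basis v)" and *: "\<And>J. ?P J \<Longrightarrow> card J \<le> card (local_basis v)"
    unfolding local_basis_def
    using arg_max_natI[of ?P "{}" card "Suc D"] arg_max_nat_le[of ?P _ card "Suc D"] independent_at_empty
    by auto
  then show "local_basis v \<subseteq> {..<D}" "independent_at v (local_basis v)"
    "J \<subseteq> {..<D} \<Longrightarrow> independent_at v J \<Longrightarrow> card J \<le> card (local_basis v)" by auto
qed

lemma finite_local_basis [simp]: "finite (local_basis v)"
  using finite_subset[OF local_basis_subset] by simp

lemma lincomb_subset_mem: "J \<subseteq> {..<D} \<Longrightarrow> (\<Sum>i\<in>J. of_rat (q i) * e i) \<in> L"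
  by (intro sum_mem) auto

text \<open>If \<open>e i\<close> kept the distance \<open>\<eta>\<close> from the rational span of
  the local basis, adjoining \<open>i\<close> would preserve independence, against maximality. The
  local basis therefore spans densely at \<open>v\<close>.\<close>

lemma approx_e_local_basis:
  assumes v: "extends v" and i: "i < D" and \<eta>: "0 < \<eta>"
  shows "\<exists>q. v (e i - (\<Sum>j\<in>local_basis v. of_rat (q j) * e j)) < \<eta>"
proof (cases "i \<in> local_basis v")
  case True
  have "(\<Sum>j\<in>local_basis v. of_rat (if j = i then 1 else 0) * e j) = (\<Sum>j\<in>local_basis v. if j = i then e j else 0)"
    by (intro sum.cong) auto
  also have "\<dots> = e i" using True by simp
  finally show ?thesis using \<eta> by (intro exI[of _ "\<lambda>j. if j = i then 1 else 0"]) (simp add: extends_0[OF v])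
next
  case False
  let ?J = "local_basis v"
  have J: "?J \<subseteq> {..<D}" by (rule local_basis_subset)
  show ?thesis
  proof (rule ccontr)
    assume "\<not> ?thesis"
    then have far: "\<eta> \<le> v (e i - (\<Sum>j\<in>?J. of_rat (q j) * e j))" for q by (simp add: not_less)
    obtain \<delta> where \<delta>: "0 < \<delta>" "\<And>q j. j \<in> ?J \<Longrightarrow> \<delta> * u (q j) \<le> v (\<Sum>i\<in>?J. of_rat (q i) * e i)"
      using independent_local_basis[of v] by (auto simp: independent_at_def)
    \<comment> \<open>In a combination \<open>T = q i * e i + S\<close>, the distance hypothesis
      bounds \<open>u (q i)\<close> by \<open>v T / \<eta>\<close>, and therefore \<open>v S\<close>
      by \<open>v T * (1 + v (e i) / \<eta>)\<close>. The two entries of the minimum serve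
      \<open>q i\<close> and the remaining coefficients.\<close>
    define \<delta>' where "\<delta>' = min \<eta> (\<delta> / (1 + v (e i) / \<eta>))"
    have ve: "0 \<le> v (e i)" using i by (simp add: extends_nonneg[OF v])
    then have den: "0 < 1 + v (e i) / \<eta>" using \<eta> by (intro add_pos_nonneg) auto
    then have "0 < \<delta>'" using \<eta> \<delta> by (simp add: \<delta>'_def)
    have "\<delta>' * u (q j) \<le> v (\<Sum>i\<in>insert i ?J. of_rat (q i) * e i)" if j: "j \<in> insert i ?J" for q j
    proof -
      define S where "S = (\<Sum>i\<in>?J. of_rat (q i) * e i)"
      define T where "T = (\<Sum>i\<in>insert i ?J. of_rat (q i) * e i)"
      have T: "T = of_rat (q i) * e i + S" using False by (simp add: T_def S_def)
      have S: "S \<in> L" unfolding S_def by (rule lincomb_subset_mem[OF J])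
      have TL: "T \<in> L" unfolding T using S i by simp
      have 1: "\<eta> * u (q i) \<le> v T"
      proof (cases "q i = 0")
        case True
        then show ?thesis using extends_nonneg[OF v TL] by simp
      next
        case qi: False
        have "(\<Sum>j\<in>?J. of_rat (- q j / q i) * e j) = of_rat (- inverse (q i)) * S"
          by (simp add: S_def sum_distrib_left of_rat_mult of_rat_divide of_rat_inverse of_rat_minus divide_inverse mult_ac sum_negf)
        then have "e i - (\<Sum>j\<in>?J. of_rat (- q j / q i) * e j) = of_rat (inverse (q i)) * T"
          using qi by (simp add: T of_rat_minus of_rat_inverse algebra_simps)
        then have "\<eta> \<le> u (inverse (q i)) * v T"
          using far[of "\<lambda>j. - q j / q i"] TL by (simp add: extends_mult[OF v] extends_of_rat[OF v] del: of_rat_inverse)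
        then show ?thesis using qi unfolding u_inverse by (simp add: field_simps)
      qed
      show ?thesis unfolding T_def[symmetric]
      proof (cases "j = i")
        case True
        have "\<delta>' * u (q i) \<le> \<eta> * u (q i)" by (intro mult_right_mono) (auto simp: \<delta>'_def)
        then show "\<delta>' * u (q j) \<le> v T" using 1 True by simp
      next
        case False
        then have "\<delta> * u (q j) \<le> v S" unfolding S_def using j \<delta> by auto
        also have "\<dots> \<le> v T + v (of_rat (q i) * e i)"
          using extends_diff[OF v TL, of "of_rat (q i) * e i"] i by (simp add: T)
        also have "v (of_rat (q i) * e i) = u (q i) * v (e i)"
          using i by (simp add: extends_mult[OF v] extends_of_rat[OF v])
        also have "v T + u (q i) * v (e i) \<le> v T + v T / \<eta> * v (e i)"
          using 1 \<eta> ve by (intro add_left_mono mult_right_mono) (auto simp: field_simps)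
        also have "\<dots> = v T * (1 + v (e i) / \<eta>)" by (simp add: algebra_simps)
        finally have "\<delta> / (1 + v (e i) / \<eta>) * u (q j) \<le> v T" using den by (simp add: pos_divide_le_eq)
        moreover have "\<delta>' * u (q j) \<le> \<delta> / (1 + v (e i) / \<eta>) * u (q j)"
          by (intro mult_right_mono) (auto simp: \<delta>'_def)
        ultimately show "\<delta>' * u (q j) \<le> v T" by linarith
      qed
    qed
    then have "independent_at v (insert i ?J)" using \<open>0 < \<delta>'\<close> by (auto simp: independent_at_def)
    then have "card (insert i ?J) \<le> card ?J" using J i by (intro card_le_local_basis) auto
    with False show False by simp
  qed
qed

text \<open>The errors made for the individual \<open>e i\<close> are weighted by
  \<open>u (co x i)\<close>, and these weights add up to \<open>nm x\<close>; hence the rescaled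
  tolerance \<open>\<eta>'\<close>.\<close>

lemma approx_local_basis:
  assumes v: "extends v" and x: "x \<in> L" and \<eta>: "0 < \<eta>"
  shows "\<exists>q. v (x - (\<Sum>j\<in>local_basis v. of_rat (q j) * e j)) < \<eta>"
proof -
  let ?J = "local_basis v"
  define \<eta>' where "\<eta>' = \<eta> / (1 + nm x)"
  have \<eta>': "0 < \<eta>'" using \<eta> by (simp add: \<eta>'_def add_pos_nonneg)
  have "\<forall>i\<in>{..<D}. \<exists>q. v (e i - (\<Sum>j\<in>?J. of_rat (q j) * e j)) < \<eta>'"
    using approx_e_local_basis[OF v _ \<eta>'] by auto
  then obtain Q where Q: "\<And>i. i < D \<Longrightarrow> v (e i - (\<Sum>j\<in>?J. of_rat (Q i j) * e j)) < \<eta>'"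
    using bchoice[of "{..<D}"] by (metis lessThan_iff)
  have J: "?J \<subseteq> {..<D}" by (rule local_basis_subset)
  define q where "q j = (\<Sum>i<D. co x i * Q i j)" for j
  have "(\<Sum>j\<in>?J. of_rat (q j) * e j) = (\<Sum>j\<in>?J. \<Sum>i<D. of_rat (co x i) * (of_rat (Q i j) * e j))"
    by (simp add: q_def of_rat_sum of_rat_mult sum_distrib_right mult.assoc)
  also have "\<dots> = (\<Sum>i<D. of_rat (co x i) * (\<Sum>j\<in>?J. of_rat (Q i j) * e j))"
    unfolding sum_distrib_left by (rule sum.swap)
  finally have "x - (\<Sum>j\<in>?J. of_rat (q j) * e j)
      = (\<Sum>i<D. of_rat (co x i) * (e i - (\<Sum>j\<in>?J. of_rat (Q i j) * e j)))"
    by (subst co_expand[OF x]) (simp add: algebra_simps sum_subtractf)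
  also have "v \<dots> \<le> (\<Sum>i<D. v (of_rat (co x i) * (e i - (\<Sum>j\<in>?J. of_rat (Q i j) * e j))))"
    by (intro extends_sum[OF v] mult_mem diff_mem lincomb_subset_mem[OF J]) auto
  also have "\<dots> \<le> (\<Sum>i<D. u (co x i) * \<eta>')"
  proof (rule sum_mono)
    fix i assume "i \<in> {..<D}"
    then show "v (of_rat (co x i) * (e i - (\<Sum>j\<in>?J. of_rat (Q i j) * e j))) \<le> u (co x i) * \<eta>'"
      using Q[of i] lincomb_subset_mem[OF J]
      by (subst extends_mult[OF v]) (auto simp: extends_of_rat[OF v] intro!: mult_left_mono)
  qed
  also have "\<dots> = nm x * \<eta>'" by (simp add: nm_def sum_distrib_right)
  also have "\<dots> < (1 + nm x) * \<eta>'" using \<eta>' by (intro mult_strict_right_mono) auto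
  also have "\<dots> = \<eta>" using nm_nonneg[of x] by (simp add: \<eta>'_def add_nonneg_eq_0_iff)
  finally show ?thesis by blast
qed

lemma local_basis_nonempty:
  assumes v: "extends v" shows "0 < card (local_basis v)"
proof -
  have "\<exists>i<D. e i \<noteq> 0"
  proof (rule ccontr)
    assume "\<not> ?thesis"
    then have "(\<Sum>i<D. of_rat (co 1 i) * e i) = 0" by (intro sum.neutral) auto
    then show False using co_expand[of 1] by simp
  qed
  then obtain i where i: "i < D" "e i \<noteq> 0" by auto
  have "independent_at v {i}"
    unfolding independent_at_def
    using i extends_pos[OF v, of "e i"] by (intro exI[of _ "v (e i)"]) (simp add: extends_mult[OF v] extends_of_rat[OF v])
  then have "card {i} \<le> card (local_basis v)" using i by (intro card_le_local_basis) auto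
  then show ?thesis by simp
qed

text \<open>\<open>x v j\<close> imitates, up to the error \<open>\<eta>\<close>, the element of the
  product of the completions that is \<open>e j\<close> at \<open>v\<close> and 0 at the other
  places of \<open>P\<close>.\<close>

definition near_basis :: "('a \<Rightarrow> real) set \<Rightarrow> real \<Rightarrow> (('a \<Rightarrow> real) \<Rightarrow> nat \<Rightarrow> 'a) \<Rightarrow> bool" where
  "near_basis P \<eta> x \<longleftrightarrow> (\<forall>v\<in>P. \<forall>j<D. x v j \<in> L \<and>
     (\<forall>w\<in>P. w (x v j - (if w = v then e j else 0)) < \<eta>))"

lemma near_basis_exists:
  assumes P: "finite P" "P \<subseteq> places_over" and \<eta>: "0 < \<eta>"
  obtains x where "near_basis P \<eta> x"
proof -
  have ext: "extends v" if "v \<in> P" for v using P(2) that by (auto simp: places_over_def)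
  define E where "E = 1 + (\<Sum>w\<in>P. \<Sum>j<D. w (e j))"
  have nn: "0 \<le> w (e j)" if "w \<in> P" "j < D" for w j using extends_nonneg[OF ext[OF that(1)]] that by auto
  have E: "w (e j) \<le> E" if "w \<in> P" "j < D" for w j
  proof -
    have "w (e j) \<le> (\<Sum>j<D. w (e j))" using that nn by (intro member_le_sum) auto
    also have "\<dots> \<le> (\<Sum>w\<in>P. \<Sum>j<D. w (e j))"
      using that P nn by (intro member_le_sum[of w P "\<lambda>w. \<Sum>j<D. w (e j)"] sum_nonneg) auto
    finally show ?thesis by (simp add: E_def)
  qed
  have "0 < E" unfolding E_def by (intro add_pos_nonneg sum_nonneg) (auto intro: nn)
  have "\<forall>v\<in>P. \<exists>y. y \<in> L \<and> (\<forall>w\<in>P. w (y - (if w = v then 1 else 0)) < \<eta> / E)"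
    using weak_approximation[OF P _ divide_pos_pos[OF \<eta> \<open>0 < E\<close>]] by blast
  from bchoice[OF this] obtain y where y: "\<And>v. v \<in> P \<Longrightarrow> y v \<in> L"
    "\<And>v w. v \<in> P \<Longrightarrow> w \<in> P \<Longrightarrow> w (y v - (if w = v then 1 else 0)) < \<eta> / E" by blast
  have "near_basis P \<eta> (\<lambda>v j. y v * e j)"
    unfolding near_basis_def
  proof (intro ballI allI impI conjI)
    fix v j assume v: "v \<in> P" and j: "j < D"
    show "y v * e j \<in> L" using y v j by simp
    fix w assume w: "w \<in> P"
    have "y v * e j - (if w = v then e j else 0) = (y v - (if w = v then 1 else 0)) * e j"
      by (simp add: algebra_simps)
    then have "w (y v * e j - (if w = v then e j else 0)) = w (y v - (if w = v then 1 else 0)) * w (e j)"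
      using y(1)[OF v] j by (simp only:) (rule extends_mult[OF ext[OF w]], auto)
    also have "\<dots> \<le> w (y v - (if w = v then 1 else 0)) * E"
      using y(1)[OF v] E[OF w j] by (intro mult_left_mono extends_nonneg[OF ext[OF w]]) auto
    also have "\<dots> < \<eta> / E * E" using y(2)[OF v w] \<open>0 < E\<close> by (intro mult_strict_right_mono) auto
    finally show "w (y v * e j - (if w = v then e j else 0)) < \<eta>" using \<open>0 < E\<close> by simp
  qed
  then show ?thesis by (rule that)
qed

text \<open>A coefficient \<open>q m\<close> of maximal size, with \<open>m = (v, j)\<close>, is
  visible at the place \<open>v\<close>: the block of \<open>v\<close> has size at least
  \<open>d v * u (q m)\<close> there, while every error term is at most
  \<open>\<eta> * u (q m)\<close>. The constants are fixed before \<open>\<eta>\<close> and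
  \<open>x\<close>, which are later adapted to the element whose norm is estimated.\<close>

lemma near_basis_independent:
  assumes P: "finite P" "P \<subseteq> places_over"
  obtains \<delta> \<eta>0 where "0 < \<delta>" "0 < \<eta>0"
    "\<And>\<eta> x q i. near_basis P \<eta> x \<Longrightarrow> \<eta> \<le> \<eta>0 \<Longrightarrow> i \<in> Sigma P local_basis \<Longrightarrow>
       \<exists>w\<in>P. \<delta> * u (q i) \<le> w (\<Sum>(v, j)\<in>Sigma P local_basis. of_rat (q (v, j)) * x v j)"
proof -
  let ?I = "Sigma P local_basis"
  have ext: "extends v" if "v \<in> P" for v using P(2) that by (auto simp: places_over_def)
  have fin: "finite ?I" using P by (intro finite_SigmaI) auto
  have "\<forall>v\<in>P. \<exists>d>0. \<forall>q. \<forall>j\<in>local_basis v. d * u (q j) \<le> v (\<Sum>i\<in>local_basis v. of_rat (q i) * e i)"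
    using independent_local_basis by (auto simp: independent_at_def)
  from bchoice[OF this] obtain d where d: "\<And>v. v \<in> P \<Longrightarrow> 0 < d v"
    "\<And>v q j. v \<in> P \<Longrightarrow> j \<in> local_basis v \<Longrightarrow> d v * u (q j) \<le> v (\<Sum>i\<in>local_basis v. of_rat (q i) * e i)" by blast
  define d0 where "d0 = Min (insert 1 (d ` P))"
  have d0: "0 < d0" "\<And>v. v \<in> P \<Longrightarrow> d0 \<le> d v" using P d(1) by (auto simp: d0_def)
  \<comment> \<open>With this choice the \<open>card ?I\<close> error terms together amount to at
    most half of \<open>d0\<close> times the largest coefficient.\<close>
  define \<eta>0 where "\<eta>0 = d0 / (2 * (1 + real (card ?I)))"
  have "0 < \<eta>0" using d0 by (simp add: \<eta>0_def add_pos_nonneg)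
  show ?thesis
  proof (rule that[of "d0 / 2" \<eta>0])
    fix \<eta> x q i assume x: "near_basis P \<eta> x" and \<eta>: "\<eta> \<le> \<eta>0" and i: "i \<in> ?I"
    have "?I \<noteq> {}" using i by auto
    then obtain m where m: "m \<in> ?I" "\<And>k. k \<in> ?I \<Longrightarrow> u (q k) \<le> u (q m)"
      using Max_in[of "(\<lambda>k. u (q k)) ` ?I"] Max_ge[of "(\<lambda>k. u (q k)) ` ?I"] fin
      by (smt (verit, ccfv_threshold) finite_imageI image_iff image_is_empty)
    obtain v j where vj: "m = (v, j)" "v \<in> P" "j \<in> local_basis v" using m(1) by auto
    have v: "extends v" using ext vj by auto
    define U where "U = u (q m)"
    have lb: "k < D" if "k \<in> local_basis w" for w k using local_basis_subset that by auto
    have xL: "x w k \<in> L" if "(w, k) \<in> ?I" for w k using x that lb by (auto simp: near_basis_def)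
    define c where "c = (\<lambda>(w, k). of_rat (q (w, k)) * (x w k - (if v = w then e k else 0)))"
    have cL: "c k \<in> L" if "k \<in> ?I" for k using that xL lb by (auto simp: c_def)
    have small: "v (c k) \<le> U * \<eta>" if k: "k \<in> ?I" for k
    proof -
      obtain w l where wl: "k = (w, l)" "w \<in> P" "l \<in> local_basis w" using k by auto
      have "v (x w l - (if v = w then e l else 0)) < \<eta>" using x wl vj lb by (auto simp: near_basis_def)
      moreover have "x w l - (if v = w then e l else 0) \<in> L" using xL[of w l] wl lb by auto
      ultimately have "v (c k) \<le> u (q k) * \<eta>"
        by (auto simp: c_def wl extends_mult[OF v] extends_of_rat[OF v] intro!: mult_left_mono)
      also have "0 \<le> \<eta>" using \<open>_ < \<eta>\<close> extends_nonneg[OF v \<open>_ \<in> L\<close>] by simp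
      then have "u (q k) * \<eta> \<le> U * \<eta>" using m(2)[OF k] by (intro mult_right_mono) (auto simp: U_def)
      finally show ?thesis .
    qed
    have diag: "(\<Sum>k\<in>?I. case k of (w, l) \<Rightarrow> of_rat (q (w, l)) * (if v = w then e l else 0))
        = (\<Sum>l\<in>local_basis v. of_rat (q (v, l)) * e l)"
    proof -
      have "(\<Sum>k\<in>?I. case k of (w, l) \<Rightarrow> of_rat (q (w, l)) * (if v = w then e l else 0))
          = (\<Sum>w\<in>P. \<Sum>l\<in>local_basis w. of_rat (q (w, l)) * (if v = w then e l else 0))"
        using P by (subst sum.Sigma) auto
      also have "\<dots> = (\<Sum>w\<in>P. if v = w then (\<Sum>l\<in>local_basis v. of_rat (q (v, l)) * e l) else 0)"
        by (intro sum.cong) auto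
      finally show ?thesis using P vj by simp
    qed
    have "d0 * U \<le> d v * U" using d0(2)[OF vj(2)] by (intro mult_right_mono) (auto simp: U_def)
    also have "\<dots> \<le> v (\<Sum>l\<in>local_basis v. of_rat (q (v, l)) * e l)"
      using d(2)[OF vj(2,3), of "\<lambda>l. q (v, l)"] by (simp add: U_def vj)
    also have "(\<Sum>l\<in>local_basis v. of_rat (q (v, l)) * e l)
        = (\<Sum>k\<in>?I. case k of (w, l) \<Rightarrow> of_rat (q (w, l)) * x w l) - (\<Sum>k\<in>?I. c k)"
      unfolding diag[symmetric] sum_subtractf[symmetric]
      by (intro sum.cong) (auto simp: c_def algebra_simps)
    also have "v \<dots> \<le> v (\<Sum>k\<in>?I. case k of (w, l) \<Rightarrow> of_rat (q (w, l)) * x w l) + v (\<Sum>k\<in>?I. c k)"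
      using xL cL by (intro extends_diff[OF v] sum_mem) auto
    also have "v (\<Sum>k\<in>?I. c k) \<le> (\<Sum>k\<in>?I. v (c k))" using cL by (intro extends_sum[OF v])
    also have "\<dots> \<le> (\<Sum>k\<in>?I. U * \<eta>)" by (intro sum_mono small)
    also have "\<dots> \<le> (\<Sum>k\<in>?I. U * \<eta>0)" using \<eta> by (intro sum_mono mult_left_mono) (auto simp: U_def)
    also have "\<dots> \<le> (1 + real (card ?I)) * (U * \<eta>0)"
      using \<open>0 < \<eta>0\<close> by (simp add: U_def algebra_simps)
    also have "\<dots> = d0 * U / 2" by (simp add: \<eta>0_def field_simps)
    finally have "d0 / 2 * U \<le> v (\<Sum>k\<in>?I. case k of (w, l) \<Rightarrow> of_rat (q (w, l)) * x w l)" by simp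
    moreover have "d0 / 2 * u (q i) \<le> d0 / 2 * U" using m(2)[OF i] d0 by (simp add: U_def)
    ultimately show "\<exists>w\<in>P. d0 / 2 * u (q i) \<le> w (\<Sum>(v, j)\<in>?I. of_rat (q (v, j)) * x v j)"
      using vj by (intro bexI[of _ v]) auto
  qed (use d0 \<open>0 < \<eta>0\<close> in auto)
qed

text \<open>More than \<open>D\<close> elements of a near basis satisfy a nontrivial rational
  relation. The combination is then 0, although at some place it is bounded below by a positive
  multiple of the size of a nonzero coefficient.\<close>

lemma sum_local_basis_le:
  assumes P: "finite P" "P \<subseteq> places_over"
  shows "(\<Sum>v\<in>P. card (local_basis v)) \<le> D"
proof (rule ccontr)
  let ?I = "Sigma P local_basis"
  assume "\<not> ?thesis"
  then have "card {..<D} < card ?I" using P by (simp add: card_SigmaI)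
  obtain \<delta> \<eta>0 where \<delta>: "0 < \<delta>" "0 < \<eta>0"
    "\<And>\<eta> x q i. near_basis P \<eta> x \<Longrightarrow> \<eta> \<le> \<eta>0 \<Longrightarrow> i \<in> ?I \<Longrightarrow>
       \<exists>w\<in>P. \<delta> * u (q i) \<le> w (\<Sum>(v, j)\<in>?I. of_rat (q (v, j)) * x v j)"
    using near_basis_independent[OF P] by blast
  obtain x where x: "near_basis P \<eta>0 x" using near_basis_exists[OF P \<delta>(2)] by blast
  obtain q where q: "\<exists>i\<in>?I. q i \<noteq> 0" "\<forall>r\<in>{..<D}. (\<Sum>i\<in>?I. co (x (fst i) (snd i)) r * q i) = 0"
    using underdetermined_system[of "{..<D}" ?I "\<lambda>r i. co (x (fst i) (snd i)) r"] \<open>card {..<D} < card ?I\<close> P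
    by (auto intro: finite_SigmaI)
  have xL: "x v j \<in> L" if "(v, j) \<in> ?I" for v j
    using x that local_basis_subset[of v] by (auto simp: near_basis_def)
  define S where "S = (\<Sum>(v, j)\<in>?I. of_rat (q (v, j)) * x v j)"
  have "S \<in> L" unfolding S_def using xL by (intro sum_mem) auto
  have "co S r = 0" if r: "r < D" for r
  proof -
    have "co S r = (\<Sum>i\<in>?I. co (case i of (v, j) \<Rightarrow> of_rat (q (v, j)) * x v j) r)"
      unfolding S_def using xL r by (intro co_sum) auto
    also have "\<dots> = (\<Sum>i\<in>?I. co (x (fst i) (snd i)) r * q i)"
      using xL r by (intro sum.cong) (auto simp: co_scale)
    finally show ?thesis using q(2) r by simp
  qed
  then have "S = 0" using eq_iff_co[OF \<open>S \<in> L\<close> zero_mem] by simp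
  obtain i where i: "i \<in> ?I" "q i \<noteq> 0" using q by auto
  obtain w where w: "w \<in> P" "\<delta> * u (q i) \<le> w S"
    using \<delta>(3)[OF x order_refl i(1), of q] by (auto simp: S_def)
  have "extends w" using w P by (auto simp: places_over_def)
  then have "\<delta> * u (q i) \<le> 0" using w extends_0[of w] by (simp add: \<open>S = 0\<close>)
  moreover have "0 < \<delta> * u (q i)" using \<delta>(1) i(2) by simp
  ultimately show False by simp
qed

text \<open>Every place contributes at least one element to the local bases of any finite set of
  places, and their total number is at most \<open>D\<close>.\<close>

lemma finite_places_over: "finite places_over"
proof (rule ccontr)
  assume "infinite places_over"
  then obtain P where P: "P \<subseteq> places_over" "finite P" "card P = Suc D"
    by (meson infinite_arbitrarily_large)
  have "(\<Sum>v\<in>P. 1) \<le> (\<Sum>v\<in>P. card (local_basis v))"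
  proof (rule sum_mono)
    fix v assume "v \<in> P"
    then have "extends v" using P by (auto simp: places_over_def)
    from local_basis_nonempty[OF this] show "1 \<le> card (local_basis v)" by simp
  qed
  then show False using sum_local_basis_le[OF P(2,1)] P(3) by simp
qed

lemma nm_le_place:
  obtains C where "0 < C" "\<And>x. x \<in> L \<Longrightarrow> \<exists>v\<in>places_over. nm x \<le> C * v x"
  using nm_le_extends unfolding places_over_def by (metis (mono_tags, lifting) mem_Collect_eq)

text \<open>If the local bases had fewer than \<open>D\<close> elements in total, some nonzero
  \<open>x\<close> would have a vanishing approximating combination at every place, these being
  fewer than \<open>D\<close> linear conditions on its coordinates. Then
  \<open>v x \<le> \<eta> * nm x\<close> at all places, which contradicts
  \<open>nm x \<le> C * v x\<close> at one of them.\<close>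

lemma sum_local_basis_ge: "D \<le> (\<Sum>v\<in>places_over. card (local_basis v))"
proof (rule ccontr)
  let ?I = "Sigma places_over local_basis"
  assume "\<not> ?thesis"
  then have card: "card ?I < card {..<D}" using finite_places_over by (simp add: card_SigmaI)
  obtain C where C: "0 < C" "\<And>x. x \<in> L \<Longrightarrow> \<exists>v\<in>places_over. nm x \<le> C * v x"
    using nm_le_place by blast
  define \<eta> where "\<eta> = 1 / (2 * C)"
  have \<eta>: "0 < \<eta>" using C by (simp add: \<eta>_def)
  have "\<exists>q. v (e i - (\<Sum>j\<in>local_basis v. of_rat (q j) * e j)) < \<eta>" if "v \<in> places_over" "i < D" for v i
    using approx_e_local_basis[OF places_overD[OF that(1)] that(2) \<eta>] .
  then obtain Q where Q: "\<And>v i. v \<in> places_over \<Longrightarrow> i < D \<Longrightarrow>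
      v (e i - (\<Sum>j\<in>local_basis v. of_rat (Q v i j) * e j)) < \<eta>" by metis
  obtain r where r: "\<exists>i\<in>{..<D}. r i \<noteq> 0" "\<forall>k\<in>?I. (\<Sum>i\<in>{..<D}. Q (fst k) i (snd k) * r i) = 0"
    using underdetermined_system[of ?I "{..<D}" "\<lambda>k i. Q (fst k) i (snd k)"] card finite_places_over
    by (auto intro: finite_SigmaI)
  define x where "x = (\<Sum>i<D. of_rat (r i) * e i)"
  have x: "x \<in> L" by (simp add: x_def)
  have "v x \<le> \<eta> * nm x" if v: "v \<in> places_over" for v
  proof -
    have ext: "extends v" using v by (rule places_overD)
    have J: "local_basis v \<subseteq> {..<D}" by (rule local_basis_subset)
    have "(\<Sum>i<D. of_rat (r i) * (\<Sum>j\<in>local_basis v. of_rat (Q v i j) * e j))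
        = (\<Sum>j\<in>local_basis v. \<Sum>i<D. of_rat (r i) * (of_rat (Q v i j) * e j))"
      unfolding sum_distrib_left by (rule sum.swap)
    also have "\<dots> = (\<Sum>j\<in>local_basis v. of_rat (\<Sum>i<D. Q v i j * r i) * e j)"
      by (simp add: of_rat_sum of_rat_mult sum_distrib_left mult_ac)
    also have "\<dots> = 0" using r(2) v by (intro sum.neutral) auto
    finally have "x = (\<Sum>i<D. of_rat (r i) * (e i - (\<Sum>j\<in>local_basis v. of_rat (Q v i j) * e j)))"
      by (simp add: x_def algebra_simps sum_subtractf)
    also have "v \<dots> \<le> (\<Sum>i<D. v (of_rat (r i) * (e i - (\<Sum>j\<in>local_basis v. of_rat (Q v i j) * e j))))"
      by (intro extends_sum[OF ext] mult_mem diff_mem lincomb_subset_mem[OF J]) auto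
    also have "\<dots> \<le> (\<Sum>i<D. u (r i) * \<eta>)"
    proof (rule sum_mono)
      fix i assume "i \<in> {..<D}"
      then show "v (of_rat (r i) * (e i - (\<Sum>j\<in>local_basis v. of_rat (Q v i j) * e j))) \<le> u (r i) * \<eta>"
        using Q[OF v, of i] lincomb_subset_mem[OF J]
        by (subst extends_mult[OF ext]) (auto simp: extends_of_rat[OF ext] intro!: mult_left_mono)
    qed
    also have "\<dots> = (\<Sum>i<D. u (co x i)) * \<eta>" by (simp add: x_def sum_distrib_right)
    also have "\<dots> = \<eta> * nm x" by (simp add: nm_def)
    finally show ?thesis .
  qed
  moreover obtain v where v: "v \<in> places_over" "nm x \<le> C * v x" using C(2)[OF x] by auto
  ultimately have "nm x \<le> C * (\<eta> * nm x)" using C(1) by (meson mult_left_mono less_imp_le order_trans)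
  then have "nm x \<le> nm x / 2" using C(1) by (simp add: \<eta>_def)
  moreover have "x \<noteq> 0"
  proof
    assume "x = 0"
    then have "r i = 0" if "i < D" for i using co_lincomb[OF that, of r] that by (simp flip: x_def)
    with r(1) show False by auto
  qed
  ultimately show False using nm_pos[OF x] by simp
qed

lemma sum_local_basis: "(\<Sum>v\<in>places_over. card (local_basis v)) = D"
  using sum_local_basis_le[OF finite_places_over order_refl] sum_local_basis_ge by simp


lemma e_bound:
  assumes P: "finite P" "P \<subseteq> places_over"
  obtains E where "0 < E" "\<And>w j. w \<in> P \<Longrightarrow> j < D \<Longrightarrow> w (e j) \<le> E"
proof
  have nn: "0 \<le> w (e j)" if "w \<in> P" "j < D" for w j
    using extends_nonneg[OF places_overD, of w "e j"] that P by auto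
  show "0 < 1 + (\<Sum>w\<in>P. \<Sum>j<D. w (e j))" by (intro add_pos_nonneg sum_nonneg) (auto intro: nn)
  fix w j assume wj: "w \<in> P" "j < D"
  have "w (e j) \<le> (\<Sum>j<D. w (e j))" using wj nn by (intro member_le_sum) auto
  also have "\<dots> \<le> (\<Sum>w\<in>P. \<Sum>j<D. w (e j))"
    using wj P nn by (intro member_le_sum[of w P "\<lambda>w. \<Sum>j<D. w (e j)"] sum_nonneg) auto
  finally show "w (e j) \<le> 1 + (\<Sum>w\<in>P. \<Sum>j<D. w (e j))" by simp
qed

text \<open>In a basis adapted to the places over \<open>u\<close>, the columns of the matrix of multiplication by
  \<open>a\<close> belonging to a place \<open>v\<close> have size \<open>O(v a)\<close>.\<close>

lemma u_field_norm_le_prod_const: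
  obtains B where "\<And>a. a \<in> L \<Longrightarrow> a \<noteq> 0 \<Longrightarrow>
    u (field_norm a) \<le> B * (\<Prod>v\<in>places_over. v a ^ card (local_basis v))"
proof -
  let ?P = "places_over" let ?I = "Sigma places_over local_basis"
  note fin = finite_places_over
  obtain b where b0: "bij_betw b {0..<card ?I} ?I"
    using ex_bij_betw_nat_finite[of ?I] fin by (auto intro: finite_SigmaI)
  \<comment> \<open>Since the local degrees add up to \<open>D\<close>, the near basis has exactly
    \<open>D\<close> elements and the matrix \<open>Xm\<close> formed from it is square.\<close>
  have "card ?I = D" using fin sum_local_basis by (simp add: card_SigmaI)
  then have b: "bij_betw b {..<D} ?I" using b0 by (simp add: lessThan_atLeast0)
  have bI: "b i \<in> ?I" if "i < D" for i using b that by (auto simp: bij_betw_def)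
  define bi where "bi = the_inv_into {..<D} b"
  have bi: "bi (b i) = i" if "i < D" for i
    unfolding bi_def using b that by (intro the_inv_into_f_f) (auto simp: bij_betw_def)
  obtain \<delta> \<eta>0 where \<delta>: "0 < \<delta>" "0 < \<eta>0"
    "\<And>\<eta> x q i. near_basis ?P \<eta> x \<Longrightarrow> \<eta> \<le> \<eta>0 \<Longrightarrow> i \<in> ?I \<Longrightarrow>
       \<exists>w\<in>?P. \<delta> * u (q i) \<le> w (\<Sum>(v, j)\<in>?I. of_rat (q (v, j)) * x v j)"
    using near_basis_independent[OF fin order_refl] by blast
  obtain C where C: "0 < C" "\<And>x. x \<in> L \<Longrightarrow> \<exists>v\<in>?P. nm x \<le> C * v x" using nm_le_place by blast
  obtain E where E: "0 < E" "\<And>w j. w \<in> ?P \<Longrightarrow> j < D \<Longrightarrow> w (e j) \<le> E" using e_bound[OF fin order_refl] by blast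
  have "?P \<noteq> {}" using C(2)[of 1] by auto
  have ext: "extends v" if "v \<in> ?P" for v using that by (rule places_overD)
  have lb: "j < D" if "j \<in> local_basis v" for v j using local_basis_subset that by auto
  define K where "K = C * (1 + E)"
  define B where "B = (fact D * K ^ D) * (fact D * (E / \<delta>) ^ D)"
  have "u (field_norm a) \<le> B * (\<Prod>v\<in>?P. v a ^ card (local_basis v))" if a: "a \<in> L" "a \<noteq> 0" for a
  proof -
    have pos: "0 < v a" if "v \<in> ?P" for v using extends_pos[OF ext[OF that] a(1)] a by simp
    define m0 where "m0 = Min ((\<lambda>v. v a) ` ?P)"
    define M0 where "M0 = Max ((\<lambda>v. v a) ` ?P)"
    have m0: "0 < m0" "\<And>v. v \<in> ?P \<Longrightarrow> m0 \<le> v a" using fin \<open>?P \<noteq> {}\<close> pos by (auto simp: m0_def)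
    have M0: "\<And>v. v \<in> ?P \<Longrightarrow> v a \<le> M0" using fin by (auto simp: M0_def)
    then have "0 < M0" using pos \<open>?P \<noteq> {}\<close> by (meson ex_in_conv less_le_trans)
    \<comment> \<open>The three bounds serve the independence of the near basis, the size of
      \<open>xs i\<close> at its own place, and its smallness at the other places: there even the
      largest value of \<open>a\<close> times \<open>\<eta>\<close> does not exceed the smallest
      one.\<close>
    define \<eta> where "\<eta> = min \<eta>0 (min 1 (m0 / M0))"
    have \<eta>: "0 < \<eta>" "\<eta> \<le> \<eta>0" "\<eta> \<le> 1" "M0 * \<eta> \<le> m0"
      using \<delta>(2) m0(1) \<open>0 < M0\<close> mult_left_mono[of \<eta> "m0 / M0" M0] by (auto simp: \<eta>_def)
    obtain x where x: "near_basis ?P \<eta> x" using near_basis_exists[OF fin order_refl \<eta>(1)] by blast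
    define xs where "xs i = (case b i of (v, j) \<Rightarrow> x v j)" for i
    define c where "c i = fst (b i) a" for i
    have xL: "xs i \<in> L" if "i < D" for i
      using bI[OF that] x lb by (auto simp: near_basis_def xs_def split: prod.splits)
    have col: "nm (a * xs i) \<le> K * c i" if i: "i < D" for i
    proof -
      obtain v j where vj: "b i = (v, j)" "v \<in> ?P" "j < D" using bI[OF i] lb by (cases "b i") auto
      obtain w where w: "w \<in> ?P" "nm (a * xs i) \<le> C * w (a * xs i)"
        using C(2)[of "a * xs i"] a xL[OF i] by auto
      have we: "extends w" using ext w by auto
      have near: "w (xs i - (if w = v then e j else 0)) < \<eta>"
        using x vj w by (auto simp: near_basis_def xs_def)
      have "w a * w (xs i) \<le> (1 + E) * v a"
      proof (cases "w = v")
        case True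
        have "w (xs i) \<le> w (xs i - e j) + w (e j)"
          using extends_add[OF we, of "xs i - e j" "e j"] xL[OF i] vj by simp
        also have "\<dots> \<le> 1 + E" using near True E(2)[OF w(1) vj(3)] \<eta>(3) by simp
        finally show ?thesis using pos[OF w(1)] True by (simp add: mult.commute)
      next
        case False
        then have "w a * w (xs i) \<le> M0 * \<eta>"
          using near M0[OF w(1)] \<open>0 < M0\<close> xL[OF i] by (intro mult_mono extends_nonneg[OF we]) auto
        also have "\<dots> \<le> 1 * v a" using \<eta>(4) m0(2)[OF vj(2)] by simp
        also have "\<dots> \<le> (1 + E) * v a" using E(1) pos[OF vj(2)] by (intro mult_right_mono) auto
        finally show ?thesis .
      qed
      then have "C * w (a * xs i) \<le> C * ((1 + E) * v a)"
        using C(1) a xL[OF i] by (simp add: extends_mult[OF we])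
      then show ?thesis using w(2) by (simp add: K_def c_def vj mult.assoc)
    qed
    \<comment> \<open>Change of basis to the near basis: the columns of
      \<open>mult_mat a * Xm\<close> are the coordinates of the products
      \<open>a * xs i\<close>.\<close>
    define Xm where "Xm = mat D D (\<lambda>(r, i). co (xs i) r)"
    have Xm: "Xm \<in> carrier_mat D D" by (simp add: Xm_def)
    have AX: "mult_mat a * Xm = mat D D (\<lambda>(r, i). co (a * xs i) r)"
      using a xL by (intro eq_matI)
        (auto simp: mult_mat_def Xm_def scalar_prod_def co_mult[of a "xs _"] lessThan_atLeast0)
    have 1: "u (Determinant.det (mult_mat a * Xm)) \<le> fact D * (\<Prod>i<D. K * c i)"
      unfolding AX using col by (intro u_det_le) (auto intro: order_trans[OF u_co_le_nm])
    have prod_c: "(\<Prod>i<D. c i) = (\<Prod>v\<in>?P. v a ^ card (local_basis v))"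
    proof -
      have "(\<Prod>i<D. c i) = (\<Prod>k\<in>?I. fst k a)"
        unfolding c_def by (rule prod.reindex_bij_betw[OF b])
      also have "\<dots> = (\<Prod>v\<in>?P. \<Prod>j\<in>local_basis v. v a)"
        using fin by (subst prod.Sigma) (auto intro!: prod.cong)
      finally show ?thesis by simp
    qed
    have ind: "\<exists>w\<in>?P. \<delta> * u (q i) \<le> w (\<Sum>i<D. of_rat (q i) * xs i)" if i: "i < D" for q :: "nat \<Rightarrow> rat" and i
    proof -
      have "(\<Sum>(v, j)\<in>?I. of_rat (q (bi (v, j))) * x v j) = (\<Sum>i<D. of_rat (q (bi (b i))) * xs i)"
        by (subst sum.reindex_bij_betw[OF b, symmetric]) (auto simp: xs_def split: prod.splits intro!: sum.cong)
      also have "\<dots> = (\<Sum>i<D. of_rat (q i) * xs i)" by (intro sum.cong) (auto simp: bi)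
      finally show ?thesis
        using \<delta>(3)[OF x \<eta>(2) bI[OF i], of "\<lambda>k. q (bi k)"] bi[OF i] by simp
    qed
    have comb: "co (\<Sum>i<D. of_rat (q i) * xs i) r = (\<Sum>i<D. Xm $$ (r, i) * q i)" if "r < D" for q r
    proof -
      have "co (\<Sum>i<D. of_rat (q i) * xs i) r = (\<Sum>i<D. co (of_rat (q i) * xs i) r)"
        using that xL by (intro co_sum) auto
      also have "\<dots> = (\<Sum>i<D. Xm $$ (r, i) * q i)"
        using that xL by (intro sum.cong) (auto simp: co_scale Xm_def)
      finally show ?thesis .
    qed
    have combL: "(\<Sum>i<D. of_rat (q i) * xs i) \<in> L" for q using xL by (intro sum_mem) auto
    have "Determinant.det Xm \<noteq> 0"
    proof
      assume "Determinant.det Xm = 0"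
      then obtain v where v: "v \<in> carrier_vec D" "v \<noteq> 0\<^sub>v D" "Xm *\<^sub>v v = 0\<^sub>v D"
        using det_0_iff_vec_prod_zero[OF Xm] by auto
      have "co (\<Sum>i<D. of_rat (vec_index v i) * xs i) r = 0" if "r < D" for r
      proof -
        have "vec_index (Xm *\<^sub>v v) r = (\<Sum>i<D. Xm $$ (r, i) * vec_index v i)"
          using that v(1) Xm by (simp add: scalar_prod_def lessThan_atLeast0)
        then show ?thesis using comb[OF that, of "\<lambda>i. vec_index v i"] v(3) that by simp
      qed
      then have 0: "(\<Sum>i<D. of_rat (vec_index v i) * xs i) = 0"
        using eq_iff_co[OF combL zero_mem] by simp
      have "vec_index v i = 0" if i: "i < D" for i
      proof -
        obtain w where w: "w \<in> ?P" "\<delta> * u (vec_index v i) \<le> w 0"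
          using ind[OF i, of "\<lambda>i. vec_index v i"] 0 by auto
        then have "\<delta> * u (vec_index v i) \<le> 0" using extends_0[OF ext[OF w(1)]] by simp
        then have "u (vec_index v i) \<le> 0" using \<delta>(1) by (simp add: mult_le_0_iff)
        then show ?thesis using u_nonneg[of "vec_index v i"] u_eq_0_iff[of "vec_index v i"] by linarith
      qed
      then have "v = 0\<^sub>v D" using v(1) by (intro eq_vecI) auto
      with v(2) show False by simp
    qed
    \<comment> \<open>The inverse is bounded by independence alone, since its columns express the
      \<open>e r\<close> in the near basis. In this way \<open>\<eta>\<close>, which depends on
      \<open>a\<close>, stays out of the constant \<open>B\<close>.\<close>
    define Ym where "Ym = inverse (Determinant.det Xm) \<cdot>\<^sub>m adj_mat Xm"
    have Ym: "Ym \<in> carrier_mat D D" using adj_mat(1)[OF Xm] by (simp add: Ym_def)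
    have XY: "Xm * Ym = 1\<^sub>m D"
      using adj_mat[OF Xm] \<open>Determinant.det Xm \<noteq> 0\<close> Xm unfolding Ym_def
      by (subst mult_smult_distrib[of _ D D]) (auto intro!: eq_matI)
    have "u (Ym $$ (i, r)) \<le> E / \<delta>" if i: "i < D" and r: "r < D" for i r
    proof -
      have "co (\<Sum>i<D. of_rat (Ym $$ (i, r)) * xs i) k = co (e r) k" if k: "k < D" for k
      proof -
        have "(\<Sum>i<D. Xm $$ (k, i) * Ym $$ (i, r)) = (Xm * Ym) $$ (k, r)"
          using Xm Ym k r by (simp add: scalar_prod_def lessThan_atLeast0)
        then show ?thesis using comb[OF k, of "\<lambda>i. Ym $$ (i, r)"] k r by (simp add: XY co_e)
      qed
      then have "(\<Sum>i<D. of_rat (Ym $$ (i, r)) * xs i) = e r" using eq_iff_co[OF combL e_mem[OF r]] by simp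
      then obtain w where "w \<in> ?P" "\<delta> * u (Ym $$ (i, r)) \<le> w (e r)"
        using ind[OF i, of "\<lambda>i. Ym $$ (i, r)"] by auto
      then show ?thesis using E(2)[of w r] r \<delta>(1) by (simp add: field_simps)
    qed
    then have 2: "u (Determinant.det Ym) \<le> fact D * (\<Prod>i<D. E / \<delta>)" by (intro u_det_le[OF Ym]) auto
    have "Determinant.det (mult_mat a) = Determinant.det (mult_mat a * Xm) * Determinant.det Ym"
      using det_mult[OF Xm Ym] det_mult[OF mult_mat_carrier Xm, of a] by (simp add: XY mult.assoc)
    then have "u (field_norm a) = u (Determinant.det (mult_mat a * Xm)) * u (Determinant.det Ym)"
      by (simp add: field_norm_def u_mult)
    also have "\<dots> \<le> (fact D * (\<Prod>i<D. K * c i)) * (fact D * (\<Prod>i<D. E / \<delta>))"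
      using 1 2 by (intro mult_mono) (auto intro: order_trans[OF u_nonneg])
    also have "\<dots> = B * (\<Prod>i<D. c i)" by (simp add: B_def prod.distrib)
    finally show ?thesis unfolding prod_c .
  qed
  then show ?thesis by (rule that)
qed

text \<open>Both sides are multiplicative in \<open>a\<close>, so passing to powers of
  \<open>a\<close> reduces the constant to 1.\<close>

theorem u_field_norm_le_prod:
  assumes a: "a \<in> L" "a \<noteq> 0"
  shows "u (field_norm a) \<le> (\<Prod>v\<in>places_over. v a ^ card (local_basis v))"
proof -
  let ?p = "\<lambda>a. \<Prod>v\<in>places_over. v a ^ card (local_basis v)"
  obtain B where B: "\<And>a. a \<in> L \<Longrightarrow> a \<noteq> 0 \<Longrightarrow> u (field_norm a) \<le> B * ?p a"
    using u_field_norm_le_prod_const by blast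
  have "u (field_norm a) ^ k \<le> B * ?p a ^ k" for k
  proof -
    have "?p (a ^ k) = ?p a ^ k"
      unfolding prod_power_distrib
      by (intro prod.cong refl) (simp add: extends_power[OF places_overD] a mult.commute flip: power_mult)
    then show ?thesis using B[of "a ^ k"] a by (simp add: field_norm_power u_power)
  qed
  moreover have "0 < ?p a"
    using a extends_pos[OF places_overD a(1)] by (intro prod_pos) auto
  ultimately show ?thesis by (intro le_of_pow_le[of "?p a" "u (field_norm a)" B]) auto
qed

end

section \<open>Completions\<close>

text \<open>Instances are \<open>K\<close> and \<open>L\<close> with a place and the rationals with
  a restricted one, so that completions of a field and of its subfields fall under the same
  lemmas.\<close>

locale valued_field =
  fixes K :: "'a::field_char_0 set" and v :: "'a \<Rightarrow> real"
  assumes K_one [simp]: "1 \<in> K"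
    and K_add [simp]: "x \<in> K \<Longrightarrow> y \<in> K \<Longrightarrow> x + y \<in> K"
    and K_mult [simp]: "x \<in> K \<Longrightarrow> y \<in> K \<Longrightarrow> x * y \<in> K"
    and K_uminus [simp]: "x \<in> K \<Longrightarrow> - x \<in> K"
    and K_inverse [simp]: "x \<in> K \<Longrightarrow> inverse x \<in> K"
    and absolute_value: "absolute_value K v"
begin

lemma K_zero [simp]: "0 \<in> K"
  using K_add[OF K_one K_uminus[OF K_one]] by simp

lemma K_diff [simp]: "x \<in> K \<Longrightarrow> y \<in> K \<Longrightarrow> x - y \<in> K"
  using K_add[OF _ K_uminus] by fastforce

lemma K_divide [simp]: "x \<in> K \<Longrightarrow> y \<in> K \<Longrightarrow> x / y \<in> K"
  by (simp add: divide_inverse)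

lemma K_power [simp]: "x \<in> K \<Longrightarrow> x ^ k \<in> K"
  by (induction k) auto

lemma K_sum: "(\<And>i. i \<in> A \<Longrightarrow> f i \<in> K) \<Longrightarrow> sum f A \<in> K"
  by (induction A rule: infinite_finite_induct) auto

lemma K_prod: "(\<And>i. i \<in> A \<Longrightarrow> f i \<in> K) \<Longrightarrow> prod f A \<in> K"
  by (induction A rule: infinite_finite_induct) auto

lemma K_of_nat [simp]: "of_nat n \<in> K"
  by (induction n) auto

lemma K_of_int [simp]: "of_int n \<in> K"
  by (cases n rule: int_cases2) auto

lemma K_of_rat [simp]: "of_rat q \<in> K"
  by (cases q) (simp add: of_rat_rat)

lemma v_nonneg [simp]: "x \<in> K \<Longrightarrow> 0 \<le> v x"
  and v_eq_0_iff [simp]: "x \<in> K \<Longrightarrow> v x = 0 \<longleftrightarrow> x = 0"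
  and v_mult [simp]: "x \<in> K \<Longrightarrow> y \<in> K \<Longrightarrow> v (x * y) = v x * v y"
  and v_add: "x \<in> K \<Longrightarrow> y \<in> K \<Longrightarrow> v (x + y) \<le> v x + v y"
  using absolute_value by (simp_all add: absolute_value_def)

lemma v_pos [simp]: "x \<in> K \<Longrightarrow> 0 < v x \<longleftrightarrow> x \<noteq> 0"
  using v_nonneg[of x] v_eq_0_iff[of x] by linarith

lemma v_0 [simp]: "v 0 = 0"
  by simp

lemma v_1 [simp]: "v 1 = 1"
  using v_mult[of 1 1] v_eq_0_iff[of 1] by simp

lemma v_minus [simp]: "x \<in> K \<Longrightarrow> v (- x) = v x"
proof -
  assume x: "x \<in> K"
  have "(v (- 1))\<^sup>2 = 1" using v_mult[of "-1" "-1"] by (simp add: power2_eq_square)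
  then have "v (- 1) = 1 \<or> v (- 1) = - 1" by (simp add: power2_eq_1_iff)
  moreover have "0 \<le> v (- 1)" by (rule v_nonneg) simp
  ultimately have "v (- 1) = 1" by linarith
  then show ?thesis using v_mult[of "-1" x] x by simp
qed

lemma v_diff: "x \<in> K \<Longrightarrow> y \<in> K \<Longrightarrow> v (x - y) \<le> v x + v y"
  using v_add[of x "- y"] by simp

lemma v_diff_commute: "x \<in> K \<Longrightarrow> y \<in> K \<Longrightarrow> v (x - y) = v (y - x)"
  using v_minus[of "x - y"] by simp

lemma abs_v_diff_le: "x \<in> K \<Longrightarrow> y \<in> K \<Longrightarrow> \<bar>v x - v y\<bar> \<le> v (x - y)"
  using v_add[of "x - y" y] v_add[of "y - x" x] v_diff_commute[of x y] by (auto simp: abs_le_iff)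

lemma v_power [simp]: "x \<in> K \<Longrightarrow> v (x ^ n) = v x ^ n"
  by (induction n) auto

lemma v_inverse [simp]: "x \<in> K \<Longrightarrow> v (inverse x) = inverse (v x)"
  using v_mult[of x "inverse x"] by (cases "x = 0") (auto simp: field_simps simp del: v_mult)

lemma v_divide [simp]: "x \<in> K \<Longrightarrow> y \<in> K \<Longrightarrow> v (x / y) = v x / v y"
  by (simp add: divide_inverse)

lemma v_sum: "(\<And>i. i \<in> A \<Longrightarrow> f i \<in> K) \<Longrightarrow> v (sum f A) \<le> (\<Sum>i\<in>A. v (f i))"
proof (induction A rule: infinite_finite_induct)
  case (insert a A)
  then show ?case using v_add[of "f a" "sum f A"] by (force simp: K_sum)
qed auto

lemma v_prod: "(\<And>i. i \<in> A \<Longrightarrow> f i \<in> K) \<Longrightarrow> v (prod f A) = (\<Prod>i\<in>A. v (f i))"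
  by (induction A rule: infinite_finite_induct) (auto simp: K_prod)

abbreviation Cseq :: "(nat \<Rightarrow> 'a) ring" where "Cseq \<equiv> cauchy_ring K v"
abbreviation Null :: "(nat \<Rightarrow> 'a) set" where "Null \<equiv> null_seqs K v"
abbreviation Cpl :: "'a cpl ring" where "Cpl \<equiv> completion K v"

text \<open>The class of a Cauchy sequence. Computations in the completion are carried out termwise
  on representing sequences and then transferred.\<close>

definition cls :: "(nat \<Rightarrow> 'a) \<Rightarrow> 'a cpl" where "cls s = Null +>\<^bsub>Cseq\<^esub> s"

lemma Cseq_simps [simp]:
  "s \<otimes>\<^bsub>Cseq\<^esub> t = (\<lambda>n. s n * t n)" "s \<oplus>\<^bsub>Cseq\<^esub> t = (\<lambda>n. s n + t n)"
  "\<one>\<^bsub>Cseq\<^esub> = (\<lambda>_. 1)" "\<zero>\<^bsub>Cseq\<^esub> = (\<lambda>_. 0)"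
  by (simp_all add: cauchy_ring_def)

lemma CseqI:
  "(\<And>n. s n \<in> K) \<Longrightarrow> (\<And>e. 0 < e \<Longrightarrow> \<exists>N. \<forall>m\<ge>N. \<forall>n\<ge>N. v (s m - s n) < e) \<Longrightarrow> s \<in> carrier Cseq"
  by (auto simp: cauchy_ring_def)

lemma Cseq_mem: "s \<in> carrier Cseq \<Longrightarrow> s n \<in> K"
  by (simp add: cauchy_ring_def)

lemma Cseq_cauchy: "s \<in> carrier Cseq \<Longrightarrow> 0 < e \<Longrightarrow> \<exists>N. \<forall>m\<ge>N. \<forall>n\<ge>N. v (s m - s n) < e"
  by (simp add: cauchy_ring_def)

lemma Cseq_const [simp]: "x \<in> K \<Longrightarrow> (\<lambda>_. x) \<in> carrier Cseq"
  by (rule CseqI) auto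

lemma v_Cseq_convergent:
  assumes "s \<in> carrier Cseq" shows "convergent (\<lambda>n. v (s n))"
proof -
  have "Cauchy (\<lambda>n. v (s n))"
  proof (rule metric_CauchyI)
    fix e :: real assume "0 < e"
    obtain N where N: "\<forall>m\<ge>N. \<forall>n\<ge>N. v (s m - s n) < e" by (rule exE[OF Cseq_cauchy[OF assms \<open>0 < e\<close>]]) (rule that)
    have "dist (v (s m)) (v (s n)) < e" if "m \<ge> N" "n \<ge> N" for m n
      using order.strict_trans1[OF abs_v_diff_le[of "s m" "s n"], of e] Cseq_mem[OF assms] N that
      by (simp add: dist_real_def)
    then show "\<exists>N. \<forall>m\<ge>N. \<forall>n\<ge>N. dist (v (s m)) (v (s n)) < e" by blast
  qed
  then show ?thesis by (simp add: Cauchy_convergent_iff)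
qed

lemma Cseq_bounded:
  assumes "s \<in> carrier Cseq" obtains B where "0 < B" "\<And>n. v (s n) \<le> B"
proof -
  have "Bseq (\<lambda>n. v (s n))" using v_Cseq_convergent[OF assms] by (rule convergent_imp_Bseq)
  then obtain B where "0 < B" "\<forall>n. norm (v (s n)) \<le> B" by (auto simp: Bseq_def)
  then show ?thesis by (intro that[of B]) (auto simp: abs_le_iff)
qed

lemma Cseq_add [simp]:
  assumes "s \<in> carrier Cseq" "t \<in> carrier Cseq" shows "(\<lambda>n. s n + t n) \<in> carrier Cseq"
proof (rule CseqI)
  fix e :: real assume e: "0 < e"
  obtain N where N: "\<forall>m\<ge>N. \<forall>n\<ge>N. v (s m - s n) < e / 2" using Cseq_cauchy[OF assms(1), of "e / 2"] e by auto
  obtain M where M: "\<forall>m\<ge>M. \<forall>n\<ge>M. v (t m - t n) < e / 2" using Cseq_cauchy[OF assms(2), of "e / 2"] e by auto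
  have "v (s m + t m - (s n + t n)) < e" if "m \<ge> max N M" "n \<ge> max N M" for m n
  proof -
    have "v (s m + t m - (s n + t n)) \<le> v (s m - s n) + v (t m - t n)"
      using v_add[of "s m - s n" "t m - t n"] Cseq_mem[OF assms(1)] Cseq_mem[OF assms(2)] by (simp add: algebra_simps)
    also have "\<dots> < e / 2 + e / 2" using N M that by (intro add_strict_mono) auto
    finally show ?thesis by simp
  qed
  then show "\<exists>N. \<forall>m\<ge>N. \<forall>n\<ge>N. v (s m + t m - (s n + t n)) < e" by blast
qed (use assms in \<open>auto simp: Cseq_mem\<close>)

lemma Cseq_mult [simp]:
  assumes "s \<in> carrier Cseq" "t \<in> carrier Cseq" shows "(\<lambda>n. s n * t n) \<in> carrier Cseq"
proof (rule CseqI)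
  fix e :: real assume e: "0 < e"
  obtain A where A: "0 < A" "\<And>n. v (s n) \<le> A" using Cseq_bounded[OF assms(1)] by blast
  obtain B where B: "0 < B" "\<And>n. v (t n) \<le> B" using Cseq_bounded[OF assms(2)] by blast
  obtain N where N: "\<forall>m\<ge>N. \<forall>n\<ge>N. v (s m - s n) < e / (2 * B)"
    using Cseq_cauchy[OF assms(1), of "e / (2 * B)"] e B by auto
  obtain M where M: "\<forall>m\<ge>M. \<forall>n\<ge>M. v (t m - t n) < e / (2 * A)"
    using Cseq_cauchy[OF assms(2), of "e / (2 * A)"] e A by auto
  have "v (s m * t m - s n * t n) < e" if mn: "m \<ge> max N M" "n \<ge> max N M" for m n
  proof -
    have mem: "s m \<in> K" "s n \<in> K" "t m \<in> K" "t n \<in> K" using assms Cseq_mem by auto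
    have "v (s m * t m - s n * t n) = v ((s m - s n) * t m + s n * (t m - t n))" by (simp add: algebra_simps)
    also have "\<dots> \<le> v ((s m - s n) * t m) + v (s n * (t m - t n))" using mem by (intro v_add) auto
    also have "\<dots> = v (s m - s n) * v (t m) + v (s n) * v (t m - t n)" using mem by simp
    also have "\<dots> \<le> v (s m - s n) * B + A * v (t m - t n)"
      using mem A B by (intro add_mono mult_left_mono mult_right_mono) auto
    also have "\<dots> < e / (2 * B) * B + A * (e / (2 * A))"
      using N M mn A B by (intro add_strict_mono mult_strict_right_mono mult_strict_left_mono) auto
    also have "\<dots> = e" using A B by simp
    finally show ?thesis .
  qed
  then show "\<exists>N. \<forall>m\<ge>N. \<forall>n\<ge>N. v (s m * t m - s n * t n) < e" by blast
qed (use assms in \<open>auto simp: Cseq_mem\<close>)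

lemma Cseq_uminus [simp]: "s \<in> carrier Cseq \<Longrightarrow> (\<lambda>n. - s n) \<in> carrier Cseq"
  using Cseq_mult[of "\<lambda>_. -1" s] by simp

lemma Cseq_diff [simp]: "s \<in> carrier Cseq \<Longrightarrow> t \<in> carrier Cseq \<Longrightarrow> (\<lambda>n. s n - t n) \<in> carrier Cseq"
  using Cseq_add[of s "\<lambda>n. - t n"] by simp

lemma Cseq_sum: "(\<And>i. i \<in> A \<Longrightarrow> s i \<in> carrier Cseq) \<Longrightarrow> (\<lambda>n. \<Sum>i\<in>A. s i n) \<in> carrier Cseq"
  by (induction A rule: infinite_finite_induct) auto

lemma Cseq_prod: "(\<And>i. i \<in> A \<Longrightarrow> s i \<in> carrier Cseq) \<Longrightarrow> (\<lambda>n. \<Prod>i\<in>A. s i n) \<in> carrier Cseq"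
  by (induction A rule: infinite_finite_induct) auto

lemma cring_Cseq: "cring Cseq"
proof (rule cringI)
  show "abelian_group Cseq"
  proof (rule abelian_groupI)
    fix s assume "s \<in> carrier Cseq"
    then show "\<exists>t\<in>carrier Cseq. t \<oplus>\<^bsub>Cseq\<^esub> s = \<zero>\<^bsub>Cseq\<^esub>" by (intro bexI[of _ "\<lambda>n. - s n"]) auto
  qed (auto simp: add_ac)
  show "comm_monoid Cseq" by (rule comm_monoidI) (auto simp: mult_ac)
qed (auto simp: algebra_simps)

lemma Null_iff: "s \<in> Null \<longleftrightarrow> s \<in> carrier Cseq \<and> (\<lambda>n. v (s n)) \<longlonglongrightarrow> 0"
  by (auto simp: null_seqs_def)

lemma ideal_Null: "ideal Null Cseq"
proof (rule idealI)
  show "ring Cseq" using cring_Cseq by (rule cring.axioms)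
  interpret R: cring Cseq by (rule cring_Cseq)
  have add: "(\<lambda>n. s n + t n) \<in> Null" if "s \<in> Null" "t \<in> Null" for s t
  proof -
    have st: "s \<in> carrier Cseq" "t \<in> carrier Cseq" "(\<lambda>n. v (s n)) \<longlonglongrightarrow> 0" "(\<lambda>n. v (t n)) \<longlonglongrightarrow> 0"
      using that by (auto simp: Null_iff)
    have lim: "(\<lambda>n. v (s n) + v (t n)) \<longlonglongrightarrow> 0" using tendsto_add_zero[OF st(3,4)] .
    have "(\<lambda>n. v (s n + t n)) \<longlonglongrightarrow> 0"
    proof (rule Lim_null_comparison[OF always_eventually lim], rule allI)
      show "norm (v (s n + t n)) \<le> v (s n) + v (t n)" for n
        using v_add[of "s n" "t n"] Cseq_mem[OF st(1), of n] Cseq_mem[OF st(2), of n] by simp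
    qed
    with st show ?thesis by (simp add: Null_iff)
  qed
  have mult: "(\<lambda>n. s n * t n) \<in> Null" if s: "s \<in> Null" and t: "t \<in> carrier Cseq" for s t
  proof -
    have "s \<in> carrier Cseq" "(\<lambda>n. v (s n)) \<longlonglongrightarrow> 0" using s by (auto simp: Null_iff)
    obtain r where "(\<lambda>n. v (t n)) \<longlonglongrightarrow> r" using v_Cseq_convergent[OF t] by (auto simp: convergent_def)
    then have "(\<lambda>n. v (s n) * v (t n)) \<longlonglongrightarrow> 0 * r" by (intro tendsto_mult \<open>(\<lambda>n. v (s n)) \<longlonglongrightarrow> 0\<close>)
    then have "(\<lambda>n. v (s n) * v (t n)) \<longlonglongrightarrow> 0" by simp
    then show ?thesis using \<open>s \<in> carrier Cseq\<close> t by (simp add: Null_iff Cseq_mem)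
  qed
  show "subgroup Null (add_monoid Cseq)"
  proof (rule R.add.subgroupI)
    have "(\<lambda>_. 0) \<in> Null" by (simp add: Null_iff)
    then show "Null \<noteq> {}" by auto
    show "Null \<subseteq> carrier Cseq" by (auto simp: Null_iff)
    show "s \<oplus>\<^bsub>Cseq\<^esub> t \<in> Null" if "s \<in> Null" "t \<in> Null" for s t using add[OF that] by simp
    fix s assume s: "s \<in> Null"
    have "\<ominus>\<^bsub>Cseq\<^esub> s = (\<lambda>n. - s n)" using s by (intro R.minus_equality) (auto simp: Null_iff)
    then show "\<ominus>\<^bsub>Cseq\<^esub> s \<in> Null" using mult[OF s, of "\<lambda>_. -1"] by simp
  qed
  fix s t assume st: "s \<in> Null" "t \<in> carrier Cseq"
  show "t \<otimes>\<^bsub>Cseq\<^esub> s \<in> Null" using mult[OF st] by (simp add: mult.commute)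
  show "s \<otimes>\<^bsub>Cseq\<^esub> t \<in> Null" using mult[OF st] by simp
qed

lemma cring_Cpl: "cring Cpl"
  unfolding completion_def by (rule ideal.quotient_is_cring[OF ideal_Null cring_Cseq])

lemma carrier_Cpl: "carrier Cpl = cls ` carrier Cseq"
  by (auto simp: completion_def FactRing_def A_RCOSETS_def' cls_def)

lemma cls_mem [simp]: "s \<in> carrier Cseq \<Longrightarrow> cls s \<in> carrier Cpl"
  by (simp add: carrier_Cpl)

lemma cls_add: "s \<in> carrier Cseq \<Longrightarrow> t \<in> carrier Cseq \<Longrightarrow> cls s \<oplus>\<^bsub>Cpl\<^esub> cls t = cls (\<lambda>n. s n + t n)"
  using ideal.a_rcos_sum[OF ideal_Null, of s t] by (simp add: completion_def FactRing_def cls_def)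

lemma cls_mult: "s \<in> carrier Cseq \<Longrightarrow> t \<in> carrier Cseq \<Longrightarrow> cls s \<otimes>\<^bsub>Cpl\<^esub> cls t = cls (\<lambda>n. s n * t n)"
  using ideal.rcoset_mult_add[OF ideal_Null, of s t] by (simp add: completion_def FactRing_def cls_def)

lemma cls_one: "\<one>\<^bsub>Cpl\<^esub> = cls (\<lambda>_. 1)"
  by (simp add: completion_def FactRing_def cls_def)

lemma mem_cls_iff:
  assumes "s \<in> carrier Cseq"
  shows "t \<in> cls s \<longleftrightarrow> t \<in> carrier Cseq \<and> (\<lambda>n. v (t n - s n)) \<longlonglongrightarrow> 0"
proof
  assume "t \<in> cls s"
  then obtain h where "h \<in> Null" "t = (\<lambda>n. h n + s n)" by (auto simp: cls_def a_r_coset_def')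
  then show "t \<in> carrier Cseq \<and> (\<lambda>n. v (t n - s n)) \<longlonglongrightarrow> 0" using assms by (simp add: Null_iff)
next
  assume t: "t \<in> carrier Cseq \<and> (\<lambda>n. v (t n - s n)) \<longlonglongrightarrow> 0"
  then have "(\<lambda>n. t n - s n) \<in> Null" using assms by (simp add: Null_iff)
  then show "t \<in> cls s" unfolding cls_def a_r_coset_def' by (auto intro!: bexI[of _ "\<lambda>n. t n - s n"])
qed

lemma cls_eq_iff:
  assumes "s \<in> carrier Cseq" "t \<in> carrier Cseq"
  shows "cls s = cls t \<longleftrightarrow> (\<lambda>n. v (s n - t n)) \<longlonglongrightarrow> 0"
proof
  interpret I: ideal Null Cseq by (rule ideal_Null)
  assume "cls s = cls t"
  moreover have "s \<in> cls s" using assms by (simp add: mem_cls_iff)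
  ultimately show "(\<lambda>n. v (s n - t n)) \<longlonglongrightarrow> 0" using assms by (simp add: mem_cls_iff)
next
  interpret I: ideal Null Cseq by (rule ideal_Null)
  assume "(\<lambda>n. v (s n - t n)) \<longlonglongrightarrow> 0"
  then have "s \<in> cls t" using assms by (simp add: mem_cls_iff)
  then show "cls s = cls t" using I.a_repr_independence'[of s t] assms by (simp add: cls_def)
qed

lemma cls_zero: "\<zero>\<^bsub>Cpl\<^esub> = cls (\<lambda>_. 0)"
proof -
  have "cls (\<lambda>_. 0) = Null" by (auto simp: mem_cls_iff Null_iff)
  then show ?thesis by (simp add: completion_def FactRing_def)
qed

lemma cls_eq_0_iff: "s \<in> carrier Cseq \<Longrightarrow> cls s = \<zero>\<^bsub>Cpl\<^esub> \<longleftrightarrow> (\<lambda>n. v (s n)) \<longlonglongrightarrow> 0"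
  by (simp add: cls_zero cls_eq_iff)

lemma cls_uminus: "s \<in> carrier Cseq \<Longrightarrow> \<ominus>\<^bsub>Cpl\<^esub> cls s = cls (\<lambda>n. - s n)"
proof -
  interpret C: cring Cpl by (rule cring_Cpl)
  assume "s \<in> carrier Cseq"
  then show ?thesis by (intro C.minus_equality) (auto simp: cls_add cls_zero)
qed

lemma cls_minus: "s \<in> carrier Cseq \<Longrightarrow> t \<in> carrier Cseq \<Longrightarrow> cls s \<ominus>\<^bsub>Cpl\<^esub> cls t = cls (\<lambda>n. s n - t n)"
  by (simp add: a_minus_def cls_uminus cls_add)

lemma cls_finsum:
  assumes "finite A" "\<And>i. i \<in> A \<Longrightarrow> s i \<in> carrier Cseq"
  shows "(\<Oplus>\<^bsub>Cpl\<^esub>i\<in>A. cls (s i)) = cls (\<lambda>n. \<Sum>i\<in>A. s i n)"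
  using assms
proof (induction A rule: finite_induct)
  case empty
  interpret C: cring Cpl by (rule cring_Cpl)
  show ?case by (simp add: cls_zero)
next
  case (insert a A)
  interpret C: cring Cpl by (rule cring_Cpl)
  have "(\<Oplus>\<^bsub>Cpl\<^esub>i\<in>insert a A. cls (s i)) = cls (s a) \<oplus>\<^bsub>Cpl\<^esub> (\<Oplus>\<^bsub>Cpl\<^esub>i\<in>A. cls (s i))"
    using insert by (intro C.finsum_insert) auto
  then show ?case using insert by (simp add: cls_add Cseq_sum)
qed

lemma cls_finprod:
  assumes "finite A" "\<And>i. i \<in> A \<Longrightarrow> s i \<in> carrier Cseq"
  shows "(\<Otimes>\<^bsub>Cpl\<^esub>i\<in>A. cls (s i)) = cls (\<lambda>n. \<Prod>i\<in>A. s i n)"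
  using assms
proof (induction A rule: finite_induct)
  case empty
  interpret C: cring Cpl by (rule cring_Cpl)
  show ?case by (simp add: cls_one)
next
  case (insert a A)
  interpret C: cring Cpl by (rule cring_Cpl)
  have "(\<Otimes>\<^bsub>Cpl\<^esub>i\<in>insert a A. cls (s i)) = cls (s a) \<otimes>\<^bsub>Cpl\<^esub> (\<Otimes>\<^bsub>Cpl\<^esub>i\<in>A. cls (s i))"
    using insert by (intro C.finprod_insert) auto
  then show ?case using insert by (simp add: cls_mult Cseq_prod)
qed

text \<open>Sequences that differ by a null sequence have the same limit of absolute values, so the
  definite description in \<open>cpl_abs\<close> denotes this limit.\<close>

lemma cpl_abs_cls:
  assumes s: "s \<in> carrier Cseq" and lim: "(\<lambda>n. v (s n)) \<longlonglongrightarrow> r"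
  shows "cpl_abs v (cls s) = r"
  unfolding cpl_abs_def
proof (rule the_equality)
  show "\<forall>t\<in>cls s. (\<lambda>n. v (t n)) \<longlonglongrightarrow> r"
  proof
    fix t assume "t \<in> cls s"
    then have t: "t \<in> carrier Cseq" "(\<lambda>n. v (t n - s n)) \<longlonglongrightarrow> 0" using s by (auto simp: mem_cls_iff)
    have "(\<lambda>n. v (t n) - v (s n)) \<longlonglongrightarrow> 0"
    proof (rule Lim_null_comparison[OF always_eventually t(2)], rule allI)
      show "norm (v (t n) - v (s n)) \<le> v (t n - s n)" for n
        using abs_v_diff_le[of "t n" "s n"] Cseq_mem[OF t(1), of n] Cseq_mem[OF s, of n] by simp
    qed
    from tendsto_add[OF this lim] show "(\<lambda>n. v (t n)) \<longlonglongrightarrow> r" by simp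
  qed
  fix r' assume "\<forall>t\<in>cls s. (\<lambda>n. v (t n)) \<longlonglongrightarrow> r'"
  moreover have "s \<in> cls s" using s by (simp add: mem_cls_iff)
  ultimately show "r' = r" using lim LIMSEQ_unique by blast
qed

text \<open>A Cauchy sequence that is not null is eventually bounded away from 0, which makes its
  termwise inverse Cauchy. The finitely many terms that may vanish are sent to 0 by
  \<open>inverse\<close> and do not affect the class.\<close>

lemma cls_inverse_exists:
  assumes s: "s \<in> carrier Cseq" and ne: "cls s \<noteq> \<zero>\<^bsub>Cpl\<^esub>"
  shows "(\<lambda>n. inverse (s n)) \<in> carrier Cseq" "cls s \<otimes>\<^bsub>Cpl\<^esub> cls (\<lambda>n. inverse (s n)) = \<one>\<^bsub>Cpl\<^esub>"
proof -
  obtain r where r: "(\<lambda>n. v (s n)) \<longlonglongrightarrow> r" using v_Cseq_convergent[OF s] by (auto simp: convergent_def)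
  have "0 \<le> r" using s by (intro LIMSEQ_le_const[OF r]) (auto simp: Cseq_mem)
  moreover have "r \<noteq> 0" using ne r s by (auto simp: cls_eq_0_iff)
  ultimately have "0 < r" by simp
  then have "\<forall>\<^sub>F n in sequentially. r / 2 < v (s n)" using r by (intro order_tendstoD(1)) auto
  then obtain M where M: "\<And>n. n \<ge> M \<Longrightarrow> r / 2 < v (s n)" by (auto simp: eventually_sequentially)
  have nz: "s n \<noteq> 0" if "n \<ge> M" for n using M[OF that] \<open>0 < r\<close> by auto
  show inv: "(\<lambda>n. inverse (s n)) \<in> carrier Cseq"
  proof (rule CseqI)
    fix e :: real assume e: "0 < e"
    obtain N where N: "\<forall>m\<ge>N. \<forall>n\<ge>N. v (s m - s n) < e * (r / 2 * (r / 2))"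
      using Cseq_cauchy[OF s, of "e * (r / 2 * (r / 2))"] e \<open>0 < r\<close> by auto
    have "v (inverse (s m) - inverse (s n)) < e" if mn: "m \<ge> max M N" "n \<ge> max M N" for m n
    proof -
      have mem: "s m \<in> K" "s n \<in> K" using s Cseq_mem by auto
      have "inverse (s m) - inverse (s n) = (s n - s m) / (s m * s n)" using nz mn by (simp add: field_simps)
      then have "v (inverse (s m) - inverse (s n)) = v (s n - s m) / (v (s m) * v (s n))" using mem by simp
      also have "\<dots> \<le> v (s n - s m) / (r / 2 * (r / 2))"
        using M[of m] M[of n] mn mem \<open>0 < r\<close> by (intro divide_left_mono mult_mono mult_pos_pos) auto
      also have "\<dots> < e" using N mn \<open>0 < r\<close> by (simp add: divide_less_eq)
      finally show ?thesis .
    qed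
    then show "\<exists>N. \<forall>m\<ge>N. \<forall>n\<ge>N. v (inverse (s m) - inverse (s n)) < e" by blast
  qed (use s in \<open>simp add: Cseq_mem\<close>)
  have "\<forall>\<^sub>F n in sequentially. 0 = v (s n * inverse (s n) - 1)"
    using nz by (auto simp: eventually_sequentially intro!: exI[of _ M])
  then have "(\<lambda>n. v (s n * inverse (s n) - 1)) \<longlonglongrightarrow> 0" by (rule Lim_transform_eventually[OF tendsto_const])
  then show "cls s \<otimes>\<^bsub>Cpl\<^esub> cls (\<lambda>n. inverse (s n)) = \<one>\<^bsub>Cpl\<^esub>"
    using s inv by (simp add: cls_mult cls_one cls_eq_iff)
qed

lemma Cseq_subset: "F \<subseteq> K \<Longrightarrow> s \<in> carrier (cauchy_ring F v) \<longleftrightarrow> s \<in> carrier Cseq \<and> (\<forall>n. s n \<in> F)"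
  by (auto simp: cauchy_ring_def)

lemma cpl_sub_eq: "cpl_sub K v F = cls ` carrier (cauchy_ring F v)"
  by (simp add: cpl_sub_def cls_def[abs_def])

lemma cls_one_neq_zero: "\<one>\<^bsub>Cpl\<^esub> \<noteq> \<zero>\<^bsub>Cpl\<^esub>"
  by (simp add: cls_one cls_eq_0_iff LIMSEQ_const_iff)

text \<open>Termwise inverses of sequences from \<open>F\<close> stay in \<open>F\<close>, so
  nonzero classes have their inverses in the completion of \<open>F\<close>. With \<open>F\<close>
  the rationals, the local degree becomes a dimension over a field.\<close>

lemma subfield_cpl_sub:
  assumes F: "valued_field F v" "F \<subseteq> K"
  shows "subfield (cpl_sub K v F) Cpl"
proof -
  interpret F: valued_field F v by (rule F(1))
  interpret C: cring Cpl by (rule cring_Cpl)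
  let ?S = "cpl_sub K v F"
  have S: "?S = {cls s |s. s \<in> carrier Cseq \<and> (\<forall>n. s n \<in> F)}" using Cseq_subset[OF F(2)] by (auto simp: cpl_sub_eq)
  have SI: "cls s \<in> ?S" if "s \<in> carrier Cseq" "\<And>n. s n \<in> F" for s using that by (auto simp: S)
  show ?thesis
  proof (rule C.subfieldI)
    show "subcring ?S Cpl"
    proof (rule C.subcringI', rule C.subringI)
      show "?S \<subseteq> carrier Cpl" by (auto simp: S)
      show "\<one>\<^bsub>Cpl\<^esub> \<in> ?S" unfolding cls_one by (rule SI) auto
      show "\<ominus>\<^bsub>Cpl\<^esub> c \<in> ?S" if "c \<in> ?S" for c 
      proof -
        obtain s where s: "c = cls s" "s \<in> carrier Cseq" "\<And>n. s n \<in> F" using \<open>c \<in> ?S\<close> by (auto simp: S)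
        show ?thesis unfolding s cls_uminus[OF s(2)] using s by (intro SI) auto
      qed
      show "c \<otimes>\<^bsub>Cpl\<^esub> d \<in> ?S" "c \<oplus>\<^bsub>Cpl\<^esub> d \<in> ?S" if "c \<in> ?S" "d \<in> ?S" for c d
      proof -
        obtain s t where st: "c = cls s" "d = cls t" "s \<in> carrier Cseq" "t \<in> carrier Cseq" "\<And>n. s n \<in> F" "\<And>n. t n \<in> F"
          using \<open>c \<in> ?S\<close> \<open>d \<in> ?S\<close> by (auto simp: S)
        show "c \<otimes>\<^bsub>Cpl\<^esub> d \<in> ?S" unfolding st cls_mult[OF st(3,4)] using st by (intro SI) auto
        show "c \<oplus>\<^bsub>Cpl\<^esub> d \<in> ?S" unfolding st cls_add[OF st(3,4)] using st by (intro SI) auto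
      qed
    qed
    show "Units (Cpl\<lparr>carrier := ?S\<rparr>) = ?S - {\<zero>\<^bsub>Cpl\<^esub>}"
    proof
      show "Units (Cpl\<lparr>carrier := ?S\<rparr>) \<subseteq> ?S - {\<zero>\<^bsub>Cpl\<^esub>}"
      proof
        fix c assume "c \<in> Units (Cpl\<lparr>carrier := ?S\<rparr>)"
        then obtain d where d: "c \<in> ?S" "d \<in> ?S" "c \<otimes>\<^bsub>Cpl\<^esub> d = \<one>\<^bsub>Cpl\<^esub>" by (auto simp: Units_def)
        then have dc: "d \<in> carrier Cpl" by (auto simp: S)
        have "c \<noteq> \<zero>\<^bsub>Cpl\<^esub>"
        proof
          assume "c = \<zero>\<^bsub>Cpl\<^esub>"
          then show False using C.l_null[OF dc] d(3) cls_one_neq_zero by simp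
        qed
        then show "c \<in> ?S - {\<zero>\<^bsub>Cpl\<^esub>}" using d by simp
      qed
      show "?S - {\<zero>\<^bsub>Cpl\<^esub>} \<subseteq> Units (Cpl\<lparr>carrier := ?S\<rparr>)"
      proof
        fix c assume c: "c \<in> ?S - {\<zero>\<^bsub>Cpl\<^esub>}"
        then obtain s where s: "c = cls s" "s \<in> carrier Cseq" "\<And>n. s n \<in> F" by (auto simp: S)
        then have ne: "cls s \<noteq> \<zero>\<^bsub>Cpl\<^esub>" using c by simp
        note inv = cls_inverse_exists[OF s(2) ne]
        have "cls (\<lambda>n. inverse (s n)) \<in> ?S" using inv(1) s by (intro SI) auto
        moreover have "cls (\<lambda>n. inverse (s n)) \<otimes>\<^bsub>Cpl\<^esub> c = \<one>\<^bsub>Cpl\<^esub>"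
          using inv C.m_comm[OF cls_mem[OF s(2)] cls_mem[OF inv(1)]] s(1) by simp
        ultimately show "c \<in> Units (Cpl\<lparr>carrier := ?S\<rparr>)"
          using c inv(2) s(1) by (auto simp: Units_def)
      qed
    qed
  qed
qed

end

text \<open>Bridge from the linear combinations of HOL-Algebra to termwise sums, with constant
  sequences as vectors and Cauchy sequences as coefficients.\<close>

lemma (in valued_field) combine_cls:
  assumes "length ss = length xs" "set ss \<subseteq> carrier Cseq" "set xs \<subseteq> K"
  shows "ring.combine Cpl (map cls ss) (map (\<lambda>x. cls (\<lambda>_. x)) xs)
    = cls (\<lambda>n. \<Sum>k<length xs. (ss ! k) n * xs ! k)"
proof -
  interpret C: cring Cpl by (rule cring_Cpl)
  show ?thesis
    using assms
  proof (induction ss xs rule: list_induct2)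
    case Nil
    then show ?case by (simp add: cls_zero)
  next
    case (Cons s ss x xs)
    have 1: "(\<lambda>n. s n * x) \<in> carrier Cseq" using Cons.prems Cseq_mult[of s "\<lambda>_. x"] by simp
    have 2: "(\<lambda>n. \<Sum>k<length xs. (ss ! k) n * xs ! k) \<in> carrier Cseq"
    proof (rule Cseq_sum)
      fix k assume "k \<in> {..<length xs}"
      then have "ss ! k \<in> carrier Cseq" "xs ! k \<in> K" using Cons.prems Cons.hyps by (auto simp: subset_iff)
      then show "(\<lambda>n. (ss ! k) n * xs ! k) \<in> carrier Cseq" using Cseq_mult[of "ss ! k" "\<lambda>_. xs ! k"] by simp
    qed
    have "ring.combine Cpl (map cls (s # ss)) (map (\<lambda>x. cls (\<lambda>_. x)) (x # xs))
        = (cls s \<otimes>\<^bsub>Cpl\<^esub> cls (\<lambda>_. x)) \<oplus>\<^bsub>Cpl\<^esub> cls (\<lambda>n. \<Sum>k<length xs. (ss ! k) n * xs ! k)"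
      using Cons by simp
    also have "\<dots> = cls (\<lambda>n. s n * x + (\<Sum>k<length xs. (ss ! k) n * xs ! k))"
      using Cons.prems 1 2 by (simp add: cls_mult cls_add)
    finally show ?case by (simp add: sum.lessThan_Suc_shift del: sum.lessThan_Suc)
  qed
qed

context number_field_abs
begin

lemma valued_field_extends: "extends v \<Longrightarrow> valued_field L v"
  by unfold_locales (auto simp: extends_def)

lemma Rats_subset: "\<rat> \<subseteq> L"
  by (auto simp: Rats_def)

lemma valued_field_Rats:
  assumes "extends v" shows "valued_field \<rat> v"
proof
  have "absolute_value L v" using assms by (simp add: extends_def)
  then show "absolute_value \<rat> v"
    unfolding absolute_value_def using Rats_subset by (meson subsetD)
qed auto

lemma independent_atD:
  assumes "independent_at v J"
  obtains \<delta> where "0 < \<delta>" "\<And>q j. j \<in> J \<Longrightarrow> \<delta> * u (q j) \<le> v (\<Sum>i\<in>J. of_rat (q i) * e i)"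
  using assms by (auto simp: independent_at_def)

text \<open>The constant classes of the local basis form a basis of the completion over the
  completed rationals. By the lower bound in \<open>independent_at\<close>, coefficients tend to 0
  whenever their combinations do, which gives independence. Applied to differences, the same bound
  makes the coefficients of ever better approximations Cauchy, so that density of the rational span
  becomes spanning.\<close>

theorem local_degree_eq:
  assumes v: "extends v"
  shows "local_degree L v = card (local_basis v)"
proof -
  interpret vf: valued_field L v using v by (rule valued_field_extends)
  interpret C: cring vf.Cpl by (rule vf.cring_Cpl)
  let ?Q = "cpl_sub L v \<rat>" and ?J = "local_basis v"
  have sub: "subfield ?Q vf.Cpl" using valued_field_Rats[OF v] Rats_subset by (rule vf.subfield_cpl_sub)
  obtain js where js: "set js = ?J" "distinct js" using finite_distinct_list[OF finite_local_basis[of v]] by blast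
  define xs where "xs = map e js"
  define Us where "Us = map (\<lambda>x. vf.cls (\<lambda>_. x)) xs"
  have len: "length Us = card ?J" "length xs = length js" "length Us = length js"
    using js distinct_card[of js] by (auto simp: Us_def xs_def)
  have xsL: "set xs \<subseteq> L" using js local_basis_subset[of v] by (auto simp: xs_def)
  have Us: "set Us \<subseteq> carrier vf.Cpl" using xsL by (auto simp: Us_def)
  have bij: "bij_betw ((!) js) {..<length js} ?J" using js by (intro bij_betw_nth) auto
  obtain \<delta> where \<delta>: "0 < \<delta>" "\<And>q j. j \<in> ?J \<Longrightarrow> \<delta> * u (q j) \<le> v (\<Sum>i\<in>?J. of_rat (q i) * e i)"
    using independent_atD[OF independent_local_basis] by blast
  have sum_js: "(\<Sum>k<length xs. of_rat (q (js ! k)) * xs ! k) = (\<Sum>i\<in>?J. of_rat (q i) * e i)" for q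
    unfolding sum.reindex_bij_betw[OF bij, symmetric] by (simp add: xs_def)
  have "C.independent ?Q Us"
  proof (rule ccontr)
    assume "\<not> C.independent ?Q Us"
    then obtain Ks where Ks: "length Ks = length Us" "C.combine Ks Us = \<zero>\<^bsub>vf.Cpl\<^esub>" "set Ks \<subseteq> ?Q" "set Ks \<noteq> {\<zero>\<^bsub>vf.Cpl\<^esub>}"
      using C.dependent_imp_non_trivial_combine[OF sub Us] by blast
    have "Ks \<in> lists (vf.cls ` carrier (cauchy_ring \<rat> v))" using Ks(3) by (auto simp: vf.cpl_sub_eq)
    then obtain ss where ss: "Ks = map vf.cls ss" "set ss \<subseteq> carrier (cauchy_ring \<rat> v)"
      unfolding lists_image by (auto simp: in_lists_conv_set)
    have ssC: "set ss \<subseteq> carrier vf.Cseq" using ss(2) vf.Cseq_subset[OF Rats_subset] by auto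
    have lss: "length ss = length xs" using Ks(1) ss(1) len by simp
    have ssQ: "(ss ! k) n \<in> \<rat>" if "k < length js" for k n
      using ss(2) lss len that vf.Cseq_subset[OF Rats_subset, of "ss ! k"] by (auto simp: subset_iff)
    \<comment> \<open>The rational terms are reindexed by elements of the local basis instead of
      positions in the list, which is the form of \<open>independent_at\<close>.\<close>
    define q where "q n i = (SOME r. (ss ! (the_inv_into {..<length js} ((!) js) i)) n = of_rat r)" for n i
    have q: "(ss ! k) n = of_rat (q n (js ! k))" if k: "k < length js" for k n
    proof -
      have "the_inv_into {..<length js} ((!) js) (js ! k) = k"
        using bij k by (intro the_inv_into_f_f) (auto simp: bij_betw_def)
      then show ?thesis unfolding q_def using ssQ[OF k, of n] by (auto simp: Rats_def intro: someI)
    qed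
    have "vf.cls (\<lambda>n. \<Sum>k<length xs. (ss ! k) n * xs ! k) = \<zero>\<^bsub>vf.Cpl\<^esub>"
      using Ks(2) vf.combine_cls[OF lss ssC xsL] by (simp add: ss Us_def)
    moreover have "(\<lambda>n. \<Sum>k<length xs. (ss ! k) n * xs ! k) \<in> carrier vf.Cseq"
    proof (rule vf.Cseq_sum)
      fix k assume "k \<in> {..<length xs}"
      then have "ss ! k \<in> carrier vf.Cseq" "xs ! k \<in> L" using ssC xsL lss by (auto simp: subset_iff)
      then show "(\<lambda>n. (ss ! k) n * xs ! k) \<in> carrier vf.Cseq" using vf.Cseq_mult[of "ss ! k" "\<lambda>_. xs ! k"] by simp
    qed
    ultimately have lim1: "(\<lambda>n. v (\<Sum>k<length xs. (ss ! k) n * xs ! k)) \<longlonglongrightarrow> 0" by (simp add: vf.cls_eq_0_iff)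
    have eq: "(\<Sum>k<length xs. (ss ! k) n * xs ! k) = (\<Sum>i\<in>?J. of_rat (q n i) * e i)" for n
      unfolding sum_js[symmetric] using q len by (intro sum.cong) auto
    have lim: "(\<lambda>n. v (\<Sum>i\<in>?J. of_rat (q n i) * e i)) \<longlonglongrightarrow> 0" using lim1 unfolding eq .
    have zero: "vf.cls (ss ! k) = \<zero>\<^bsub>vf.Cpl\<^esub>" if k: "k < length js" for k
    proof -
      have mem: "js ! k \<in> ?J" using nth_mem[OF k] js(1) by simp
      have lim': "(\<lambda>n. v (\<Sum>i\<in>?J. of_rat (q n i) * e i) / \<delta>) \<longlonglongrightarrow> 0"
        using tendsto_mult_left_zero[OF lim, of "inverse \<delta>"] by (simp only: divide_inverse)
      have "(\<lambda>n. v ((ss ! k) n)) \<longlonglongrightarrow> 0"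
      proof (rule Lim_null_comparison[OF always_eventually lim'], rule allI)
        fix n
        have "\<delta> * u (q n (js ! k)) \<le> v (\<Sum>i\<in>?J. of_rat (q n i) * e i)" using \<delta>(2)[OF mem] .
        then show "norm (v ((ss ! k) n)) \<le> v (\<Sum>i\<in>?J. of_rat (q n i) * e i) / \<delta>"
          using \<delta>(1) by (simp add: q[OF k] extends_of_rat[OF v] field_simps)
      qed
      moreover have "ss ! k \<in> carrier vf.Cseq" using ssC lss len k by (auto simp: subset_iff)
      ultimately show ?thesis by (simp add: vf.cls_eq_0_iff)
    qed
    have "set Ks \<subseteq> {\<zero>\<^bsub>vf.Cpl\<^esub>}" using zero lss len by (auto simp: ss(1) in_set_conv_nth)
    \<comment> \<open>Nonemptiness matters here: the set of an empty list would also differ from the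
      singleton of zero.\<close>
    moreover have "Ks \<noteq> []" using Ks(1) len local_basis_nonempty[OF v] by auto
    ultimately show False using Ks(4) by (cases Ks) auto
  qed
  moreover have "C.Span ?Q Us = carrier vf.Cpl"
  proof
    show "C.Span ?Q Us \<subseteq> carrier vf.Cpl"
      by (rule C.Span_in_carrier[OF subfieldE(3)[OF sub] Us])
    show "carrier vf.Cpl \<subseteq> C.Span ?Q Us"
    proof
      fix c assume "c \<in> carrier vf.Cpl"
      then obtain t where t: "c = vf.cls t" "t \<in> carrier vf.Cseq" by (auto simp: vf.carrier_Cpl)
      \<comment> \<open>An error below \<open>1 / (n + 1)\<close> at stage \<open>n\<close> makes
        the sequence of approximations represent the same class as \<open>t\<close>.\<close>
      have "\<exists>q. v (t n - (\<Sum>j\<in>?J. of_rat (q j) * e j)) < 1 / real (Suc n)" for n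
        by (rule approx_local_basis[OF v]) (use vf.Cseq_mem[OF t(2)] in auto)
      then obtain q where q: "\<And>n. v (t n - (\<Sum>j\<in>?J. of_rat (q n j) * e j)) < 1 / real (Suc n)" by metis
      define S where "S n = (\<Sum>j\<in>?J. of_rat (q n j) * e j)" for n
      have SL: "S n \<in> L" for n unfolding S_def by (rule lincomb_subset_mem[OF local_basis_subset])
      have tL: "t n \<in> L" for n using vf.Cseq_mem[OF t(2)] .
      have lim0: "(\<lambda>n. 1 / real (Suc n)) \<longlonglongrightarrow> 0" using LIMSEQ_inverse_real_of_nat by (simp add: inverse_eq_divide)
      have cau: "(\<lambda>n. of_rat (q n j)) \<in> carrier vf.Cseq" if j: "j \<in> ?J" for j
      proof (rule vf.CseqI)
        fix \<epsilon> :: real assume \<epsilon>: "0 < \<epsilon>"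
        then have d: "0 < \<delta> * \<epsilon> / 3" using \<delta> by simp
        obtain N where N: "\<forall>m\<ge>N. \<forall>n\<ge>N. v (t m - t n) < \<delta> * \<epsilon> / 3"
          by (rule exE[OF vf.Cseq_cauchy[OF t(2) d]]) (rule that)
        obtain M where M: "\<And>n. n \<ge> M \<Longrightarrow> 1 / real (Suc n) < \<delta> * \<epsilon> / 3"
          using order_tendstoD(2)[OF lim0 d] unfolding eventually_sequentially by blast
        have "v (of_rat (q m j) - of_rat (q n j)) < \<epsilon>" if mn: "m \<ge> max M N" "n \<ge> max M N" for m n
        proof -
          have "\<delta> * u (q m j - q n j) \<le> v (\<Sum>i\<in>?J. of_rat (q m i - q n i) * e i)"
            using \<delta>(2)[OF j, of "\<lambda>i. q m i - q n i"] .
          also have "(\<Sum>i\<in>?J. of_rat (q m i - q n i) * e i) = (t m - t n) - (t m - S m) + (t n - S n)"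
            by (simp add: S_def of_rat_diff algebra_simps sum_subtractf)
          also have "v \<dots> \<le> v ((t m - t n) - (t m - S m)) + v (t n - S n)"
            using tL SL by (intro vf.v_add) auto
          also have "v ((t m - t n) - (t m - S m)) \<le> v (t m - t n) + v (t m - S m)"
            using tL SL by (intro vf.v_diff) auto
          also have "v (t m - t n) + v (t m - S m) + v (t n - S n) < \<delta> * \<epsilon> / 3 + \<delta> * \<epsilon> / 3 + \<delta> * \<epsilon> / 3"
          proof (intro add_strict_mono)
            show "v (t m - t n) < \<delta> * \<epsilon> / 3" using N mn by auto
            show "v (t m - S m) < \<delta> * \<epsilon> / 3" using q[of m] M[of m] mn by (simp add: S_def)
            show "v (t n - S n) < \<delta> * \<epsilon> / 3" using q[of n] M[of n] mn by (simp add: S_def)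
          qed
          finally have "\<delta> * u (q m j - q n j) < \<delta> * \<epsilon>" by simp
          then have "u (q m j - q n j) < \<epsilon>" using \<delta>(1) by simp
          then show ?thesis using extends_of_rat[OF v, of "q m j - q n j"] by (simp add: of_rat_diff)
        qed
        then show "\<exists>N. \<forall>m\<ge>N. \<forall>n\<ge>N. v (of_rat (q m j) - of_rat (q n j)) < \<epsilon>" by blast
      qed simp
      define ss where "ss = map (\<lambda>j n. of_rat (q n j) :: 'a) js"
      have ssC: "set ss \<subseteq> carrier vf.Cseq" using cau js by (auto simp: ss_def)
      have lss: "length ss = length xs" by (simp add: ss_def xs_def)
      have comb: "C.combine (map vf.cls ss) Us = vf.cls S"
      proof -
        have "(\<Sum>k<length xs. (ss ! k) n * xs ! k) = S n" for n
          unfolding S_def sum_js[symmetric] using len by (intro sum.cong) (auto simp: ss_def)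
        then show ?thesis using vf.combine_cls[OF lss ssC xsL] by (simp add: Us_def)
      qed
      have "S = (\<lambda>n. \<Sum>j\<in>?J. of_rat (q n j) * e j)" by (simp add: S_def fun_eq_iff)
      moreover have "(\<lambda>n. \<Sum>j\<in>?J. of_rat (q n j) * e j) \<in> carrier vf.Cseq"
      proof (rule vf.Cseq_sum)
        fix j assume j: "j \<in> ?J"
        then have "e j \<in> L" using local_basis_subset[of v] by auto
        then show "(\<lambda>n. of_rat (q n j) * e j) \<in> carrier vf.Cseq"
          using vf.Cseq_mult[OF cau[OF j], of "\<lambda>_. e j"] by simp
      qed
      ultimately have S: "S \<in> carrier vf.Cseq" by simp
      have "(\<lambda>n. v (t n - S n)) \<longlonglongrightarrow> 0"
      proof (rule Lim_null_comparison[OF always_eventually lim0], rule allI)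
        show "norm (v (t n - S n)) \<le> 1 / real (Suc n)" for n using q[of n] tL SL by (simp add: S_def less_imp_le)
      qed
      then have "c = C.combine (map vf.cls ss) Us" using t S by (simp add: comb vf.cls_eq_iff)
      moreover have "set (map vf.cls ss) \<subseteq> ?Q"
      proof -
        have "s \<in> carrier (cauchy_ring \<rat> v)" if "s \<in> set ss" for s
          using that ssC vf.Cseq_subset[OF Rats_subset, of s] by (auto simp: ss_def)
        then show ?thesis by (auto simp: vf.cpl_sub_eq)
      qed
      moreover have "length (map vf.cls ss) = length Us" using lss len by simp
      ultimately show "c \<in> C.Span ?Q Us" using C.Span_mem_iff_length_version[OF sub Us] by blast
    qed
  qed
  ultimately have "C.dimension (length Us) ?Q (carrier vf.Cpl)"
    using C.dimension_independent by metis
  then have "C.dim ?Q (carrier vf.Cpl) = length Us"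
    using C.dimI[OF sub] by (simp add: over_def)
  then show ?thesis using len by (simp add: local_degree_def)
qed

end

section \<open>The absolute values of the rationals\<close>

text \<open>The definition refers to the reduced fraction; common factors cancel in the difference
  of multiplicities, so any fraction may be used.\<close>

lemma padic_abs_fraction:
  assumes p: "Factorial_Ring.prime p" and ab: "a \<noteq> 0" "b \<noteq> 0"
  shows "padic_abs p (of_int a / of_int b)
    = real p powi (int (multiplicity (int p) b) - int (multiplicity (int p) a))"
proof -
  obtain n d where nd: "quotient_of (of_int a / of_int b) = (n, d)" by fastforce
  have d: "d > 0" using quotient_of_denom_pos[OF nd] .
  have eq: "(of_int a :: rat) / of_int b = of_int n / of_int d" using quotient_of_div[OF nd] .
  have n: "n \<noteq> 0" using eq ab d by auto
  have "(of_int (a * d) :: rat) = of_int (n * b)" using eq ab d by (simp add: field_simps)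
  then have "a * d = n * b" by linarith
  then have "multiplicity (int p) (a * d) = multiplicity (int p) (n * b)" by simp
  then have "multiplicity (int p) a + multiplicity (int p) d = multiplicity (int p) n + multiplicity (int p) b"
    using p ab n d by (simp add: prime_elem_multiplicity_mult_distrib)
  then have "int (multiplicity (int p) d) - int (multiplicity (int p) n)
      = int (multiplicity (int p) b) - int (multiplicity (int p) a)" by linarith
  then show ?thesis using ab by (simp add: padic_abs_def nd)
qed

lemma rat_fraction:
  fixes q :: rat
  assumes "q \<noteq> 0" obtains a b where "a \<noteq> 0" "b \<noteq> 0" "q = of_int a / of_int b"
proof -
  obtain n d where nd: "quotient_of q = (n, d)" by fastforce
  show ?thesis using that[of n d] assms quotient_of_div[OF nd] quotient_of_denom_pos[OF nd] by auto
qed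

lemma padic_abs_of_int_le_1: "Factorial_Ring.prime p \<Longrightarrow> padic_abs p (of_int a) \<le> 1"
  using padic_abs_fraction[of p a 1] prime_gt_1_nat[of p]
  by (cases "a = 0") (auto simp: padic_abs_def power_int_minus divide_simps)

lemma padic_abs_mult:
  assumes p: "Factorial_Ring.prime p" shows "padic_abs p (q * r) = padic_abs p q * padic_abs p r"
proof (cases "q = 0 \<or> r = 0")
  case False
  obtain a b where ab: "a \<noteq> 0" "b \<noteq> 0" "q = of_int a / of_int b" using False rat_fraction by blast
  obtain c d where cd: "c \<noteq> 0" "d \<noteq> 0" "r = of_int c / of_int d" using False rat_fraction by blast
  let ?m = "\<lambda>x. int (multiplicity (int p) x)"
  have "q * r = of_int (a * c) / of_int (b * d)" using ab cd by simp
  then have "padic_abs p (q * r) = real p powi (?m (b * d) - ?m (a * c))"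
    using padic_abs_fraction[OF p, of "a * c" "b * d"] ab cd by simp
  also have "?m (b * d) - ?m (a * c) = (?m b - ?m a) + (?m d - ?m c)"
    using p ab cd by (simp add: prime_elem_multiplicity_mult_distrib)
  also have "real p powi \<dots> = real p powi (?m b - ?m a) * real p powi (?m d - ?m c)"
    using prime_gt_0_nat[OF p] by (intro power_int_add) simp
  also have "\<dots> = padic_abs p q * padic_abs p r"
    unfolding ab(3) cd(3) padic_abs_fraction[OF p ab(1,2)] padic_abs_fraction[OF p cd(1,2)] ..
  finally show ?thesis .
qed (auto simp: padic_abs_def)

lemma padic_abs_nonneg [simp]: "0 \<le> padic_abs p q"
  by (simp add: padic_abs_def)

lemma padic_abs_eq_0_iff: "Factorial_Ring.prime p \<Longrightarrow> padic_abs p q = 0 \<longleftrightarrow> q = 0"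
  by (simp add: padic_abs_def prime_gt_0_nat)

text \<open>After division by the larger of the two, it remains to see that adding 1 to a number of
  size at most 1 keeps it in that range. The reduced denominator of such a number is prime to
  \<open>p\<close>, and it also serves as a denominator of the sum.\<close>

lemma padic_abs_add:
  assumes p: "Factorial_Ring.prime p" shows "padic_abs p (q + r) \<le> max (padic_abs p q) (padic_abs p r)"
proof -
  have main: "padic_abs p (q + r) \<le> padic_abs p r"
    if ne: "r \<noteq> 0" and le: "padic_abs p q \<le> padic_abs p r" for q r
  proof -
    have "padic_abs p (q / r) \<le> 1"
    proof -
      have "padic_abs p (q / r) * padic_abs p r \<le> 1 * padic_abs p r"
        using ne le by (simp flip: padic_abs_mult[OF p])
      moreover have "0 < padic_abs p r" using ne padic_abs_eq_0_iff[OF p, of r] padic_abs_nonneg[of p r] by linarith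
      ultimately show ?thesis by (rule mult_right_le_imp_le)
    qed
    have "padic_abs p (q / r + 1) \<le> 1"
    proof (cases "q / r + 1 = 0")
      case False
      obtain n d where nd: "quotient_of (q / r) = (n, d)" by fastforce
      have d: "d > 0" "coprime n d" "q / r = of_int n / of_int d"
        using quotient_of_denom_pos[OF nd] quotient_of_coprime[OF nd] quotient_of_div[OF nd] by auto
      have "\<not> int p dvd d"
      proof
        assume dvd: "int p dvd d"
        then have "\<not> int p dvd n" using d(2) p by (meson not_prime_unit coprime_common_divisor prime_nat_int_transfer)
        then have "n \<noteq> 0" "multiplicity (int p) n = 0" by (auto simp: not_dvd_imp_multiplicity_0)
        moreover have "1 \<le> multiplicity (int p) d" using dvd d p
          by (intro multiplicity_geI) (auto simp: prime_gt_1_nat)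
        ultimately have "1 < padic_abs p (q / r)"
          using d padic_abs_fraction[OF p, of n d] prime_gt_1_nat[OF p] by (simp add: one_less_power)
        with \<open>padic_abs p (q / r) \<le> 1\<close> show False by simp
      qed
      then have md: "multiplicity (int p) d = 0" by (rule not_dvd_imp_multiplicity_0)
      have eq: "q / r + 1 = of_int (n + d) / of_int d" using d by (simp add: field_simps)
      moreover have "n + d \<noteq> 0" using False unfolding eq by auto
      ultimately have "padic_abs p (q / r + 1) = real p powi (- int (multiplicity (int p) (n + d)))"
        using padic_abs_fraction[OF p, of "n + d" d] d md by simp
      also have "\<dots> \<le> 1"
        using prime_gt_1_nat[OF p] by (simp only: power_int_minus power_int_of_nat) (simp add: inverse_le_1_iff)
      finally show ?thesis .
    qed (simp add: padic_abs_def)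
    then have "padic_abs p (q / r + 1) * padic_abs p r \<le> 1 * padic_abs p r" by (rule mult_right_mono) simp
    then show ?thesis using ne by (simp add: distrib_right flip: padic_abs_mult[OF p])
  qed
  show ?thesis
  proof (cases "q = 0 \<or> r = 0")
    case False
    then show ?thesis
      using main[of r q] main[of q r] by (cases "padic_abs p q \<le> padic_abs p r") (auto simp: add.commute)
  qed (auto simp: padic_abs_def)
qed

lemma absolute_value_padic:
  assumes p: "Factorial_Ring.prime p" shows "absolute_value UNIV (padic_abs p)"
proof -
  have "padic_abs p (x + y) \<le> padic_abs p x + padic_abs p y" for x y
    using padic_abs_add[OF p, of x y] padic_abs_nonneg[of p x] padic_abs_nonneg[of p y] by linarith
  then show ?thesis by (simp add: absolute_value_def padic_abs_eq_0_iff[OF p] padic_abs_mult[OF p])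
qed

lemma padic_abs_nontrivial: "Factorial_Ring.prime p \<Longrightarrow> \<exists>c. c \<noteq> 0 \<and> padic_abs p c < 1"
proof -
  assume p: "Factorial_Ring.prime p"
  have "padic_abs p (of_nat p) = inverse (real p)"
    using padic_abs_fraction[OF p, of "int p" 1] prime_gt_0_nat[OF p] p by (simp add: power_int_minus)
  then show ?thesis using prime_gt_1_nat[OF p] by (intro exI[of _ "of_nat p"]) (simp add: inverse_less_1_iff)
qed

lemma absolute_value_rat: "absolute_value UNIV (\<lambda>q::rat. real_of_rat \<bar>q\<bar>)"
  by (auto simp: absolute_value_def of_rat_mult abs_mult of_rat_less_eq
      simp flip: of_rat_add intro: abs_triangle_ineq)

lemma rat_abs_nontrivial: "\<exists>c::rat. c \<noteq> 0 \<and> real_of_rat \<bar>c\<bar> < 1"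
  by (intro exI[of _ "1 / 2"]) (simp add: of_rat_divide)

lemma ln_abs_int_eq_sum:
  fixes a :: int
  assumes S: "finite S" "\<And>p. p \<in> S \<Longrightarrow> Factorial_Ring.prime p" "a \<noteq> 0" "\<And>p. Factorial_Ring.prime p \<Longrightarrow> int p dvd a \<Longrightarrow> p \<in> S"
  shows "ln \<bar>real_of_int a\<bar> = (\<Sum>p\<in>S. real (multiplicity (int p) a) * ln (real p))"
proof -
  have sub: "prime_factors a \<subseteq> int ` S"
  proof
    fix p assume "p \<in> prime_factors a"
    then have p: "Factorial_Ring.prime p" "p dvd a" by (auto simp: in_prime_factors_iff)
    then have "0 \<le> p" by (simp add: prime_ge_0_int)
    then obtain n where n: "p = int n" by (rule nonneg_int_cases)
    then have "Factorial_Ring.prime n" using p(1) by (simp only: prime_nat_int_transfer)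
    then have "n \<in> S" using S(4) p(2) n by simp
    then show "p \<in> int ` S" using n by simp
  qed
  have "\<bar>a\<bar> = (\<Prod>p\<in>prime_factors a. p ^ multiplicity p a)"
    using Factorial_Ring.prod_prime_factors[OF S(3)] by simp
  also have "\<dots> = (\<Prod>p\<in>int ` S. p ^ multiplicity p a)"
  proof (rule prod.mono_neutral_left)
    show "\<forall>p\<in>int ` S - prime_factors a. p ^ multiplicity p a = 1"
      using S by (auto simp: in_prime_factors_iff not_dvd_imp_multiplicity_0)
  qed (use S sub in auto)
  also have "\<dots> = (\<Prod>p\<in>S. int p ^ multiplicity (int p) a)"
    by (subst prod.reindex) (auto simp: inj_on_def)
  finally have "real_of_int \<bar>a\<bar> = (\<Prod>p\<in>S. real p ^ multiplicity (int p) a)" by simp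
  then have "ln \<bar>real_of_int a\<bar> = ln (\<Prod>p\<in>S. real p ^ multiplicity (int p) a)" by simp
  also have "\<dots> = (\<Sum>p\<in>S. ln (real p ^ multiplicity (int p) a))"
    using S by (intro ln_prod) (auto simp: prime_gt_0_nat)
  also have "\<dots> = (\<Sum>p\<in>S. real (multiplicity (int p) a) * ln (real p))"
    using S by (intro sum.cong) (auto simp: ln_realpow prime_gt_0_nat)
  finally show ?thesis .
qed

text \<open>The formula holds on every finite set of primes containing \<open>S0\<close>, because it
  will be evaluated on a set that also has to accommodate a height and a distinguished
  place.\<close>

lemma rat_product_formula:
  fixes q :: rat
  assumes q: "q \<noteq> 0"
  obtains S0 where "finite S0" "\<And>p. p \<in> S0 \<Longrightarrow> Factorial_Ring.prime p"
    "\<And>S. finite S \<Longrightarrow> S0 \<subseteq> S \<Longrightarrow> (\<And>p. p \<in> S \<Longrightarrow> Factorial_Ring.prime p) \<Longrightarrow>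
      ln (real_of_rat \<bar>q\<bar>) + (\<Sum>p\<in>S. ln (padic_abs p q)) = 0"
proof -
  obtain a b where ab: "a \<noteq> 0" "b \<noteq> 0" "q = of_int a / of_int b" using q rat_fraction by blast
  define S0 where "S0 = {p. Factorial_Ring.prime p \<and> int p dvd a * b}"
  have "S0 \<subseteq> {..nat \<bar>a * b\<bar>}"
  proof
    fix p assume "p \<in> S0"
    then have "int p dvd a * b" by (simp add: S0_def)
    then have "\<bar>int p\<bar> \<le> \<bar>a * b\<bar>" using ab by (intro dvd_imp_le_int) auto
    then show "p \<in> {..nat \<bar>a * b\<bar>}" by simp
  qed
  then have "finite S0" by (rule finite_subset) simp
  moreover have "ln (real_of_rat \<bar>q\<bar>) + (\<Sum>p\<in>S. ln (padic_abs p q)) = 0"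
    if S: "finite S" "S0 \<subseteq> S" "\<And>p. p \<in> S \<Longrightarrow> Factorial_Ring.prime p" for S
  proof -
    have "ln (padic_abs p q) = real (multiplicity (int p) b) * ln (real p) - real (multiplicity (int p) a) * ln (real p)"
      if "p \<in> S" for p
    proof -
      have "padic_abs p q = real p powi (int (multiplicity (int p) b) - int (multiplicity (int p) a))"
        unfolding ab(3) by (rule padic_abs_fraction) (use S that ab in auto)
      then show ?thesis using prime_gt_0_nat[OF S(3)[OF that]]
        by (simp add: power_int_diff ln_div ln_realpow)
    qed
    then have "(\<Sum>p\<in>S. ln (padic_abs p q))
        = (\<Sum>p\<in>S. real (multiplicity (int p) b) * ln (real p)) - (\<Sum>p\<in>S. real (multiplicity (int p) a) * ln (real p))"
      by (simp add: sum_subtractf)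
    moreover have "ln \<bar>real_of_int a\<bar> = (\<Sum>p\<in>S. real (multiplicity (int p) a) * ln (real p))"
      using S ab by (intro ln_abs_int_eq_sum) (auto simp: S0_def)
    moreover have "ln \<bar>real_of_int b\<bar> = (\<Sum>p\<in>S. real (multiplicity (int p) b) * ln (real p))"
      using S ab by (intro ln_abs_int_eq_sum) (auto simp: S0_def)
    moreover have "ln (real_of_rat \<bar>q\<bar>) = ln \<bar>real_of_int a\<bar> - ln \<bar>real_of_int b\<bar>"
      using ab by (simp add: of_rat_divide abs_divide ln_div flip: of_int_abs)
    ultimately show ?thesis by simp
  qed
  ultimately show ?thesis by (intro that[of S0]) (auto simp: S0_def)
qed

section \<open>Bases of number fields\<close>

text \<open>Passage from the operations of the ring record to those of the type class.\<close>

lemma number_field_closed: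
  assumes "number_field L"
  shows "1 \<in> L" "x \<in> L \<Longrightarrow> y \<in> L \<Longrightarrow> x + y \<in> L" "x \<in> L \<Longrightarrow> y \<in> L \<Longrightarrow> x * y \<in> L"
    "x \<in> L \<Longrightarrow> - x \<in> L" "x \<in> L \<Longrightarrow> inverse x \<in> L"
proof -
  let ?R = "ring_of_type_algebra :: 'a ring"
  interpret R: field ?R by (rule field_from_type_algebra)
  have simps: "x \<otimes>\<^bsub>?R\<^esub> y = x * y" "x \<oplus>\<^bsub>?R\<^esub> y = x + y" "\<one>\<^bsub>?R\<^esub> = 1" "\<zero>\<^bsub>?R\<^esub> = 0" "carrier ?R = UNIV" for x y :: 'a
    by (simp_all add: ring_of_type_algebra_def)
  have uminus: "\<ominus>\<^bsub>?R\<^esub> x = - x" for x by (rule R.minus_equality) (auto simp: simps)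
  have sub: "subfield L ?R" using assms by (simp add: number_field_def)
  note subE = subringE[OF subfieldE(1)[OF sub]]
  show "1 \<in> L" "x \<in> L \<Longrightarrow> y \<in> L \<Longrightarrow> x + y \<in> L" "x \<in> L \<Longrightarrow> y \<in> L \<Longrightarrow> x * y \<in> L" "x \<in> L \<Longrightarrow> - x \<in> L"
    using subE(3,5,6,7) by (auto simp: simps uminus)
  assume x: "x \<in> L"
  show "inverse x \<in> L"
  proof (cases "x = 0")
    case False
    then have "x \<in> Units (?R\<lparr>carrier := L\<rparr>)" using subfield.subfield_Units[OF sub] x by (simp add: simps)
    then obtain y where "y \<in> L" "y * x = 1" by (auto simp: Units_def simps)
    then show ?thesis using inverse_unique[of x y] by (simp add: mult.commute)
  qed (use x in simp)
qed

lemma subfield_Rats: "subfield \<rat> (ring_of_type_algebra :: 'a::field_char_0 ring)"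
proof -
  let ?R = "ring_of_type_algebra :: 'a ring"
  interpret R: field ?R by (rule field_from_type_algebra)
  have simps: "x \<otimes>\<^bsub>?R\<^esub> y = x * y" "x \<oplus>\<^bsub>?R\<^esub> y = x + y" "\<one>\<^bsub>?R\<^esub> = 1" "\<zero>\<^bsub>?R\<^esub> = 0" "carrier ?R = UNIV" for x y :: 'a
    by (simp_all add: ring_of_type_algebra_def)
  have uminus: "\<ominus>\<^bsub>?R\<^esub> x = - x" for x by (rule R.minus_equality) (auto simp: simps)
  have inv: "inv\<^bsub>?R\<^esub> x = inverse x" if "x \<noteq> 0" for x
    using that by (intro R.comm_inv_char) (auto simp: simps)
  show ?thesis
    by (rule R.subfieldI'[OF R.subringI]) (auto simp: simps uminus inv)
qed

lemma combine_ring_of_type_algebra: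
  "length Ks = length Us \<Longrightarrow>
    ring.combine (ring_of_type_algebra :: 'a::field_char_0 ring) Ks Us = (\<Sum>i<length Us. Ks ! i * Us ! i)"
proof -
  let ?R = "ring_of_type_algebra :: 'a ring"
  interpret R: field ?R by (rule field_from_type_algebra)
  have simps: "x \<otimes>\<^bsub>?R\<^esub> y = x * y" "x \<oplus>\<^bsub>?R\<^esub> y = x + y" "\<one>\<^bsub>?R\<^esub> = 1" "\<zero>\<^bsub>?R\<^esub> = 0" "carrier ?R = UNIV" for x y :: 'a
    by (simp_all add: ring_of_type_algebra_def)
  show "length Ks = length Us \<Longrightarrow> R.combine Ks Us = (\<Sum>i<length Us. Ks ! i * Us ! i)"
    by (induction Ks Us rule: list_induct2) (auto simp: simps sum.lessThan_Suc_shift simp del: sum.lessThan_Suc)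
qed

text \<open>A basis list over the subfield of rationals becomes an indexed family, and its
  coefficients are pulled back from the ambient field to the type of rational numbers. Uniqueness is
  the absence of nontrivial relations, applied to a difference.\<close>

lemma number_field_basis_exists:
  fixes L :: "'a::field_char_0 set"
  assumes L: "number_field L"
  shows "\<exists>e co. number_field_basis L (field_degree L) e co"
proof -
  let ?R = "ring_of_type_algebra :: 'a ring"
  interpret R: field ?R by (rule field_from_type_algebra)
  have carr: "carrier ?R = UNIV" "\<zero>\<^bsub>?R\<^esub> = 0" by (simp_all add: ring_of_type_algebra_def)
  let ?D = "field_degree L"
  have "R.finite_dimension \<rat> L" using L by (simp add: number_field_def)
  from R.finite_dimensionE[OF subfield_Rats this] have "R.dimension ?D \<rat> L"
    by (simp add: field_degree_def over_def)
  from R.exists_base[OF subfield_Rats this]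
  obtain Vs where Vs: "R.independent \<rat> Vs" "length Vs = ?D" "R.Span \<rat> Vs = L" by blast
  define e where "e i = Vs ! i" for i
  have comb: "R.combine (map (\<lambda>i. of_rat (q i)) [0..<?D]) Vs = (\<Sum>i<?D. of_rat (q i) * e i)" for q
    using Vs(2) by (subst combine_ring_of_type_algebra) (auto simp: e_def intro!: sum.cong)
  have ex: "\<exists>q. x = (\<Sum>i<?D. of_rat (q i) * e i)" if "x \<in> L" for x
  proof -
    have "\<exists>Ks. set Ks \<subseteq> \<rat> \<and> length Ks = length Vs \<and> x = R.combine Ks Vs"
      using R.Span_mem_iff_length_version[OF subfield_Rats, of Vs x] that Vs(3) carr by auto
    then obtain Ks where Ks: "set Ks \<subseteq> \<rat>" "length Ks = ?D" "x = R.combine Ks Vs" using Vs(2) by auto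
    have "\<forall>i\<in>{..<?D}. \<exists>r. Ks ! i = of_rat r" using Ks(1,2) by (force simp: Rats_def subset_iff in_set_conv_nth)
    from bchoice[OF this] obtain q where q: "\<And>i. i < ?D \<Longrightarrow> Ks ! i = of_rat (q i)" by auto
    then have "Ks = map (\<lambda>i. of_rat (q i)) [0..<?D]" using Ks(2) by (intro nth_equalityI) auto
    then show ?thesis using Ks(3) comb by auto
  qed
  have uniq: "q i = r i" if eq: "(\<Sum>i<?D. of_rat (q i) * e i) = (\<Sum>i<?D. of_rat (r i) * e i)" and i: "i < ?D" for q r i
  proof -
    have "(\<Sum>i<?D. of_rat (q i - r i) * e i) = 0" using eq by (simp add: of_rat_diff algebra_simps sum_subtractf)
    then have "R.combine (map (\<lambda>i. of_rat (q i - r i)) [0..<?D]) Vs = \<zero>\<^bsub>?R\<^esub>"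
      using comb[of "\<lambda>i. q i - r i"] carr by simp
    moreover have "set (map (\<lambda>i. of_rat (q i - r i) :: 'a) [0..<?D]) \<subseteq> \<rat>" by auto
    ultimately have "set (take (length Vs) (map (\<lambda>i. of_rat (q i - r i) :: 'a) [0..<?D])) \<subseteq> {\<zero>\<^bsub>?R\<^esub>}"
      using R.independent_imp_trivial_combine[OF subfield_Rats Vs(1)] by blast
    moreover have "take (length Vs) (map (\<lambda>i. of_rat (q i - r i) :: 'a) [0..<?D]) = map (\<lambda>i. of_rat (q i - r i)) [0..<?D]"
      using Vs(2) by (intro take_all) simp
    moreover have "of_rat (q i - r i) \<in> set (map (\<lambda>i. of_rat (q i - r i) :: 'a) [0..<?D])"
      unfolding set_map using i by (intro imageI) simp
    ultimately have "of_rat (q i - r i) \<in> {0 :: 'a}" unfolding carr by (metis subsetD)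
    then have "of_rat (q i - r i) = (0 :: 'a)" by (simp only: singleton_iff)
    then show ?thesis by (simp only: of_rat_eq_0_iff right_minus_eq of_rat_diff of_rat_eq_iff)
  qed
  define co where "co x = (SOME q. x = (\<Sum>i<?D. of_rat (q i) * e i))" for x
  have co: "x = (\<Sum>i<?D. of_rat (co x i) * e i)" if "\<exists>q. x = (\<Sum>i<?D. of_rat (q i) * e i)" for x
    unfolding co_def using that by (rule someI_ex)
  have "number_field_basis L ?D e co"
  proof
    show "e i \<in> L" if "i < ?D" for i
      using R.Span_base_incl[OF subfield_Rats, of Vs] that Vs carr by (auto simp: e_def)
    show "x = (\<Sum>i<?D. of_rat (co x i) * e i)" if "x \<in> L" for x using co ex[OF that] by blast
    show "co x i = q i" if "x = (\<Sum>i<?D. of_rat (q i) * e i)" "i < ?D" for x q i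
      using co[of x] that by (intro uniq) metis+
  qed (use number_field_closed[OF L] in auto)
  then show ?thesis by blast
qed

section \<open>The product formula and heights\<close>

definition places_above :: "'a::field_char_0 set \<Rightarrow> (rat \<Rightarrow> real) \<Rightarrow> ('a \<Rightarrow> real) set" where
  "places_above L u = {v \<in> extensional L. absolute_value L v \<and> (\<forall>q. v (of_rat q) = u q)}"

definition arch_places :: "'a::field_char_0 set \<Rightarrow> ('a \<Rightarrow> real) set" where
  "arch_places L = places_above L (\<lambda>q. real_of_rat \<bar>q\<bar>)"

definition padic_places :: "'a::field_char_0 set \<Rightarrow> nat \<Rightarrow> ('a \<Rightarrow> real) set" where
  "padic_places L p = places_above L (padic_abs p)"

lemma places_eq: "places L = arch_places L \<union> (\<Union>p\<in>{p. Factorial_Ring.prime p}. padic_places L p)"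
  by (auto simp: places_def arch_places_def padic_places_def places_above_def)

lemma (in number_field_abs) places_over_eq: "places_over = places_above L u"
  by (auto simp: places_over_def places_above_def extends_def)

context
  fixes L :: "'a::field_char_0 set"
  assumes L: "number_field L"
begin

text \<open>The basis is chosen before \<open>u\<close>, so that norms formed for different absolute
  values are the same rational number.\<close>

lemma number_field_abs_exists:
  obtains e co where "\<And>u. absolute_value UNIV u \<Longrightarrow> \<exists>c. c \<noteq> 0 \<and> u c < 1 \<Longrightarrow>
    number_field_abs L (field_degree L) e co u"
proof -
  obtain e co where "number_field_basis L (field_degree L) e co" using number_field_basis_exists[OF L] by blast
  then show ?thesis by (intro that[of e co]) (simp add: number_field_abs_def number_field_abs_axioms_def)
qed

lemma places_above_local_degree:
  assumes u: "absolute_value UNIV u" "\<exists>c. c \<noteq> 0 \<and> u c < 1"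
  shows finite_places_above: "finite (places_above L u)"
    and sum_local_degree: "(\<Sum>v\<in>places_above L u. local_degree L v) = field_degree L"
    and local_degree_pos: "v \<in> places_above L u \<Longrightarrow> 0 < local_degree L v"
proof -
  obtain e co where ex: "\<And>u. absolute_value UNIV u \<Longrightarrow> \<exists>c. c \<noteq> 0 \<and> u c < 1 \<Longrightarrow>
    number_field_abs L (field_degree L) e co u" using number_field_abs_exists by blast
  interpret N: number_field_abs L "field_degree L" e co u by (rule ex[OF u])
  show "finite (places_above L u)" using N.finite_places_over by (simp add: N.places_over_eq)
  have deg: "local_degree L v = card (N.local_basis v)" if "v \<in> places_above L u" for v
    using that by (intro N.local_degree_eq N.places_overD) (simp add: N.places_over_eq)
  then show "(\<Sum>v\<in>places_above L u. local_degree L v) = field_degree L"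
    using N.sum_local_basis by (simp add: N.places_over_eq)
  show "0 < local_degree L v" if "v \<in> places_above L u"
    using that deg[OF that] by (simp only:) (intro N.local_basis_nonempty N.places_overD, simp add: N.places_over_eq)
qed

lemma field_degree_pos: "0 < field_degree L"
proof -
  obtain e co where "number_field_basis L (field_degree L) e co" using number_field_basis_exists[OF L] by blast
  then show ?thesis by (rule number_field_basis.D_pos)
qed

text \<open>\<open>q\<close> is the field norm of \<open>a\<close>, fixed before \<open>u\<close>.
  The inequality is the logarithm of the local bound for it, with the cardinalities of local bases
  read as local degrees.\<close>

lemma norm_inequality:
  assumes a: "a \<in> L" "a \<noteq> 0"
  obtains q :: rat where "q \<noteq> 0"
    "\<And>u. absolute_value UNIV u \<Longrightarrow> \<exists>c. c \<noteq> 0 \<and> u c < 1 \<Longrightarrow>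
       ln (u q) \<le> (\<Sum>v\<in>places_above L u. real (local_degree L v) * ln (v a))"
proof -
  obtain e co where ex: "\<And>u. absolute_value UNIV u \<Longrightarrow> \<exists>c. c \<noteq> 0 \<and> u c < 1 \<Longrightarrow>
    number_field_abs L (field_degree L) e co u" using number_field_abs_exists by blast
  define q where "q = number_field_abs.field_norm (field_degree L) e co a"
  have q0: "q \<noteq> 0"
    unfolding q_def using number_field_abs.field_norm_nonzero[OF ex[OF absolute_value_rat rat_abs_nontrivial] a] .
  have main: "ln (u q) \<le> (\<Sum>v\<in>places_above L u. real (local_degree L v) * ln (v a))"
    if u: "absolute_value UNIV u" "\<exists>c. c \<noteq> 0 \<and> u c < 1" for u
  proof -
    interpret N: number_field_abs L "field_degree L" e co u by (rule ex[OF u])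
    have pos: "0 < v a" if "v \<in> places_above L u" for v
      using that a N.extends_pos[OF N.places_overD a(1)] by (simp add: N.places_over_eq)
    have "u q \<le> (\<Prod>v\<in>places_above L u. v a ^ card (N.local_basis v))"
      using N.u_field_norm_le_prod[OF a] by (simp add: q_def N.places_over_eq)
    then have "ln (u q) \<le> ln (\<Prod>v\<in>places_above L u. v a ^ card (N.local_basis v))"
      using q0 by (intro ln_mono) auto
    also have "\<dots> = (\<Sum>v\<in>places_above L u. ln (v a ^ card (N.local_basis v)))"
    proof (rule ln_prod)
      show "v a ^ card (N.local_basis v) \<noteq> 0" if "v \<in> places_above L u" for v using pos[OF that] by simp
    qed (rule finite_places_above[OF u])
    also have "\<dots> = (\<Sum>v\<in>places_above L u. real (local_degree L v) * ln (v a))"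
    proof (intro sum.cong refl)
      fix v assume v: "v \<in> places_above L u"
      have "local_degree L v = card (N.local_basis v)"
        using v by (intro N.local_degree_eq N.places_overD) (simp add: N.places_over_eq)
      then show "ln (v a ^ card (N.local_basis v)) = real (local_degree L v) * ln (v a)"
        using pos[OF v] by (simp add: ln_realpow)
    qed
    finally show ?thesis .
  qed
  show ?thesis by (rule that[OF q0 main])
qed

end

text \<open>Binomial expansion of \<open>(x + y) ^ k\<close>: if integers are bounded by 1, there
  are \<open>k + 1\<close> terms of size at most \<open>M ^ k\<close>, and this linear factor loses
  against the exponential growth of \<open>(v (x + y) / M) ^ k\<close>.\<close>

lemma (in valued_field) ultrametric:
  assumes int: "\<And>n::nat. v (of_nat n) \<le> 1" and xy: "x \<in> K" "y \<in> K"
  shows "v (x + y) \<le> max (v x) (v y)"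
proof (rule ccontr)
  define M where "M = max (v x) (v y)"
  assume "\<not> ?thesis"
  then have less: "M < v (x + y)" unfolding M_def by (simp only: not_le)
  have M: "0 \<le> M" "v x \<le> M" "v y \<le> M" using xy by (auto simp: M_def max_def)
  have bound: "v (x + y) ^ k \<le> (real k + 1) * M ^ k" for k
  proof -
    have "(x + y) ^ k = (\<Sum>i\<le>k. of_nat (k choose i) * x ^ i * y ^ (k - i))" by (rule binomial_ring)
    then have "v (x + y) ^ k \<le> (\<Sum>i\<le>k. v (of_nat (k choose i) * x ^ i * y ^ (k - i)))"
      using xy v_sum[of "{..k}" "\<lambda>i. of_nat (k choose i) * x ^ i * y ^ (k - i)"] v_power[of "x + y" k]
      by (simp del: v_power v_mult)
    also have "\<dots> \<le> (\<Sum>i\<le>k. M ^ k)"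
    proof (rule sum_mono)
      fix i assume i: "i \<in> {..k}"
      have "v (of_nat (k choose i) * x ^ i * y ^ (k - i)) = v (of_nat (k choose i)) * v x ^ i * v y ^ (k - i)"
        using xy by simp
      also have "\<dots> \<le> 1 * M ^ i * M ^ (k - i)"
        using xy M int by (intro mult_mono power_mono) (auto intro: power_mono)
      also have "\<dots> = M ^ k" using i by (simp flip: power_add)
      finally show "v (of_nat (k choose i) * x ^ i * y ^ (k - i)) \<le> M ^ k" .
    qed
    finally show ?thesis by (simp add: add.commute)
  qed
  have "0 < M"
  proof (rule ccontr)
    assume "\<not> 0 < M"
    then have "M = 0" using M by simp
    then show False using bound[of 1] less by simp
  qed
  define b where "b = v (x + y) / M"
  have b: "1 < b" using less \<open>0 < M\<close> by (simp add: b_def)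
  have "b ^ k \<le> real k + 1" for k
    using bound[of k] \<open>0 < M\<close> by (simp add: b_def power_divide pos_divide_le_eq)
  then have "1 \<le> (real k + 1) / b ^ k" for k using b by (simp add: pos_le_divide_eq)
  moreover have "(\<lambda>k. of_nat k / b ^ k) \<longlonglongrightarrow> 0" using b by (intro lim_n_over_pown) simp
  moreover have "(\<lambda>k. 1 / b ^ k) \<longlonglongrightarrow> 0" using LIMSEQ_inverse_realpow_zero[OF b] by (simp add: inverse_eq_divide)
  ultimately have "(\<lambda>k. (real k + 1) / b ^ k) \<longlonglongrightarrow> 0 + 0"
    unfolding add_divide_distrib by (intro tendsto_add)
  then have "\<forall>\<^sub>F k in sequentially. (real k + 1) / b ^ k < 1" by (intro order_tendstoD(2)) auto
  then obtain k where "(real k + 1) / b ^ k < 1" by (auto simp: eventually_sequentially)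
  with \<open>\<And>k. 1 \<le> (real k + 1) / b ^ k\<close>[of k] show False by simp
qed

lemma (in valued_field) ultrametric_sum:
  assumes int: "\<And>n::nat. v (of_nat n) \<le> 1" and f: "\<And>i. i \<in> A \<Longrightarrow> f i \<in> K" "\<And>i. i \<in> A \<Longrightarrow> v (f i) \<le> M" and "0 \<le> M"
  shows "v (sum f A) \<le> M"
  using f
proof (induction A rule: infinite_finite_induct)
  case (insert a A)
  have "v (f a + sum f A) \<le> max (v (f a)) (v (sum f A))"
    using insert by (intro ultrametric int K_sum) auto
  also have "\<dots> \<le> M" using insert by auto
  finally show ?case using insert by simp
qed (use \<open>0 \<le> M\<close> in auto)

lemma valued_field_place:
  assumes "number_field L" "v \<in> places_above L u" shows "valued_field L v"
  using number_field_closed[OF assms(1)] assms(2) by unfold_locales (auto simp: places_above_def)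

lemma padic_place_of_int:
  assumes "Factorial_Ring.prime p" "v \<in> padic_places L p" shows "v (of_int n) \<le> 1"
proof -
  have "v (of_rat (of_int n)) = padic_abs p (of_int n)"
    using assms(2) by (simp only: padic_places_def places_above_def mem_Collect_eq)
  then show ?thesis using padic_abs_of_int_le_1[OF assms(1)] by simp
qed

lemma finite_padic_abs_gt_1: "finite {p. Factorial_Ring.prime p \<and> 1 < padic_abs p r}"
proof (cases "r = 0")
  case False
  obtain n d where nd: "quotient_of r = (n, d)" by fastforce
  have d: "d > 0" "r = of_int n / of_int d" using quotient_of_denom_pos[OF nd] quotient_of_div[OF nd] by auto
  have n: "n \<noteq> 0" using False d by auto
  have "{p. Factorial_Ring.prime p \<and> 1 < padic_abs p r} \<subseteq> {..nat d}"
  proof safe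
    fix p assume p: "Factorial_Ring.prime p" "1 < padic_abs p r"
    have "int p dvd d"
    proof (rule ccontr)
      assume "\<not> int p dvd d"
      then have m: "multiplicity (int p) d = 0" by (rule not_dvd_imp_multiplicity_0)
      have "padic_abs p r = real p powi (- int (multiplicity (int p) n))"
        using padic_abs_fraction[OF p(1) n, of d] d m by simp
      also have "\<dots> \<le> 1"
        using prime_gt_1_nat[OF p(1)] by (simp only: power_int_minus power_int_of_nat) (simp add: inverse_le_1_iff)
      finally show False using p(2) by simp
    qed
    then have "int p \<le> d" using d by (intro zdvd_imp_le)
    then show "p \<le> nat d" by simp
  qed
  then show ?thesis by (rule finite_subset) simp
qed (simp add: padic_abs_def)

text \<open>The \<open>D + 1\<close> powers \<open>1, x, ..., x ^ D\<close> are linearly dependent,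
  so \<open>x\<close> is a root of a monic rational polynomial. At a prime where its coefficients
  have size at most 1, a value of \<open>x\<close> above 1 would let the leading power dominate all
  other terms together.\<close>

lemma integral_outside_finite:
  assumes L: "number_field L" and x: "x \<in> L"
  shows "\<exists>S. finite S \<and> (\<forall>p v. Factorial_Ring.prime p \<longrightarrow> p \<notin> S \<longrightarrow> v \<in> padic_places L p \<longrightarrow> v x \<le> 1)"
proof -
  obtain e co where "number_field_basis L (field_degree L) e co" using number_field_basis_exists[OF L] by blast
  then interpret B: number_field_basis L "field_degree L" e co .
  let ?D = "field_degree L"
  obtain q where q: "\<exists>i\<in>{..?D}. q i \<noteq> 0" "\<forall>j\<in>{..<?D}. (\<Sum>i\<in>{..?D}. co (x ^ i) j * q i) = 0"
    using underdetermined_system[of "{..<?D}" "{..?D}" "\<lambda>j i. co (x ^ i) j"] by auto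
  have rel: "(\<Sum>i\<le>?D. of_rat (q i) * x ^ i) = 0"
  proof -
    have mem: "(\<Sum>i\<le>?D. of_rat (q i) * x ^ i) \<in> L" using x by (intro B.sum_mem) auto
    have "co (\<Sum>i\<le>?D. of_rat (q i) * x ^ i) j = 0" if j: "j < ?D" for j
    proof -
      have "co (\<Sum>i\<le>?D. of_rat (q i) * x ^ i) j = (\<Sum>i\<le>?D. co (of_rat (q i) * x ^ i) j)"
        using x j by (intro B.co_sum) auto
      also have "\<dots> = (\<Sum>i\<le>?D. co (x ^ i) j * q i)"
        using x j by (intro sum.cong) (auto simp: B.co_scale)
      finally show ?thesis using q(2) j by simp
    qed
    then show ?thesis using B.eq_iff_co[OF mem B.zero_mem] by simp
  qed
  define m where "m = Max {i. i \<le> ?D \<and> q i \<noteq> 0}"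
  have fin: "finite {i. i \<le> ?D \<and> q i \<noteq> 0}" by simp
  have "m \<in> {i. i \<le> ?D \<and> q i \<noteq> 0}" unfolding m_def by (rule Max_in[OF fin]) (use q(1) in auto)
  then have m: "m \<le> ?D" "q m \<noteq> 0" by auto
  have above: "q i = 0" if i: "i \<le> ?D" "m < i" for i
  proof (rule ccontr)
    assume "q i \<noteq> 0"
    then have "i \<le> m" unfolding m_def by (intro Max_ge[OF fin]) (use i in auto)
    with i show False by simp
  qed
  define r where "r i = - q i / q m" for i
  have "(\<Sum>i\<le>?D. of_rat (q i) * x ^ i) = (\<Sum>i\<le>m. of_rat (q i) * x ^ i)"
    using m above by (intro sum.mono_neutral_right) auto
  also have "\<dots> = (\<Sum>i<m. of_rat (q i) * x ^ i) + of_rat (q m) * x ^ m"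
    by (simp flip: lessThan_Suc_atMost)
  finally have "of_rat (q m) * x ^ m = - (\<Sum>i<m. of_rat (q i) * x ^ i)" using rel by (simp add: eq_neg_iff_add_eq_0 add.commute)
  moreover have "of_rat (q m) * (\<Sum>i<m. of_rat (r i) * x ^ i) = - (\<Sum>i<m. of_rat (q i) * x ^ i)"
    using m by (simp add: r_def sum_distrib_left of_rat_divide of_rat_minus sum_negf)
  ultimately have "of_rat (q m) * x ^ m = of_rat (q m) * (\<Sum>i<m. of_rat (r i) * x ^ i)" by simp
  then have xm: "x ^ m = (\<Sum>i<m. of_rat (r i) * x ^ i)" using m by simp
  define S where "S = (\<Union>i<m. {p. Factorial_Ring.prime p \<and> 1 < padic_abs p (r i)})"
  have "finite S" unfolding S_def using finite_padic_abs_gt_1 by auto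
  moreover have "v x \<le> 1" if p: "Factorial_Ring.prime p" "p \<notin> S" and v: "v \<in> padic_places L p" for p v
  proof (rule ccontr)
    interpret V: valued_field L v using valued_field_place[OF L] v by (simp add: padic_places_def)
    have int: "v (of_nat n) \<le> 1" for n using padic_place_of_int[OF p(1) v, of "int n"] by simp
    have rat: "v (of_rat q) = padic_abs p q" for q using v by (simp add: padic_places_def places_above_def)
    assume "\<not> v x \<le> 1"
    then have gt: "1 < v x" by simp
    have "m \<noteq> 0" using xm by (intro notI) simp
    have "v (x ^ m) \<le> v x ^ (m - 1)"
      unfolding xm
    proof (rule V.ultrametric_sum[OF int])
      fix i assume i: "i \<in> {..<m}"
      have "v (of_rat (r i) * x ^ i) = padic_abs p (r i) * v x ^ i" using x by (simp add: rat)
      also have "\<dots> \<le> 1 * v x ^ (m - 1)"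
      proof (intro mult_mono power_increasing)
        show "padic_abs p (r i) \<le> 1" using i p unfolding S_def by (auto simp: not_less)
      qed (use i gt in auto)
      finally show "v (of_rat (r i) * x ^ i) \<le> v x ^ (m - 1)" by simp
    qed (use x gt in auto)
    moreover have "v x ^ (m - 1) < v x ^ m" using gt \<open>m \<noteq> 0\<close> by (intro power_strict_increasing) auto
    ultimately show False using x by simp
  qed
  ultimately show ?thesis by blast
qed

definition max_abs :: "('a \<Rightarrow> real) \<Rightarrow> 'a ^ 'n::finite \<Rightarrow> real" where
  "max_abs v z = Max (insert 1 (range (\<lambda>i. v (z $ i))))"

lemma max_abs_ge_1: "1 \<le> max_abs v z"
  by (simp add: max_abs_def)

lemma le_max_abs: "v (z $ i) \<le> max_abs v z"
  unfolding max_abs_def by (rule Max_ge) auto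

lemma weil_height_nonneg: "0 \<le> weil_height L z"
  unfolding weil_height_def max_abs_def[symmetric]
  by (intro divide_nonneg_nonneg infsum_nonneg mult_nonneg_nonneg ln_ge_zero max_abs_ge_1) auto

lemma places_above_disjoint: "u \<noteq> u' \<Longrightarrow> places_above L u \<inter> places_above L u' = {}"
  unfolding places_above_def by auto

lemma padic_abs_inj:
  assumes "Factorial_Ring.prime p" "Factorial_Ring.prime p'" "padic_abs p = padic_abs p'" shows "p = p'"
proof (rule ccontr)
  assume "p \<noteq> p'"
  then have "\<not> int p' dvd int p" using assms primes_dvd_imp_eq by auto
  then have m: "multiplicity (int p') (int p) = 0" by (rule not_dvd_imp_multiplicity_0)
  have "padic_abs p (of_nat p) = inverse (real p)"
    using padic_abs_fraction[OF assms(1), of "int p" 1] prime_gt_0_nat[OF assms(1)] assms(1) by (simp add: power_int_minus)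
  moreover have "padic_abs p' (of_nat p) = 1"
    using padic_abs_fraction[OF assms(2), of "int p" 1] prime_gt_0_nat[OF assms(1)] m by simp
  ultimately show False using assms(3) prime_gt_1_nat[OF assms(1)] by simp
qed

lemma padic_abs_neq_abs: "Factorial_Ring.prime p \<Longrightarrow> padic_abs p \<noteq> (\<lambda>q. real_of_rat \<bar>q\<bar>)"
proof
  assume "Factorial_Ring.prime p" "padic_abs p = (\<lambda>q. real_of_rat \<bar>q\<bar>)"
  then show False using padic_abs_of_int_le_1[of p 2] by simp
qed

text \<open>Integrality of the coordinates outside a finite set makes almost all summands vanish.
  The freedom in \<open>S\<close> allows the height to be evaluated on the same primes as the
  product formula; \<open>S1\<close> may contain numbers that are not prime, hence the
  filter.\<close>

lemma weil_height_eq: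
  fixes z :: "'a::field_char_0 ^ 'n::finite"
  assumes L: "number_field L" and z: "\<And>i. z $ i \<in> L"
  shows "\<exists>S1. finite S1 \<and> (\<forall>S. finite S \<longrightarrow> (\<forall>p\<in>S. Factorial_Ring.prime p) \<longrightarrow> {p\<in>S1. Factorial_Ring.prime p} \<subseteq> S \<longrightarrow>
    real (field_degree L) * weil_height L z =
      (\<Sum>v\<in>arch_places L. real (local_degree L v) * ln (max_abs v z))
      + (\<Sum>p\<in>S. \<Sum>v\<in>padic_places L p. real (local_degree L v) * ln (max_abs v z)))"
proof -
  have "\<forall>i\<in>UNIV. \<exists>S. finite S \<and> (\<forall>p v. Factorial_Ring.prime p \<longrightarrow> p \<notin> S \<longrightarrow> v \<in> padic_places L p \<longrightarrow> v (z $ i) \<le> 1)"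
    using integral_outside_finite[OF L z] by blast
  from bchoice[OF this] obtain T where T: "\<And>i. finite (T i)"
    "\<And>i p v. Factorial_Ring.prime p \<Longrightarrow> p \<notin> T i \<Longrightarrow> v \<in> padic_places L p \<Longrightarrow> v (z $ i) \<le> 1" by auto
  define S1 where "S1 = (\<Union>i. T i)"
  have "finite S1" unfolding S1_def using T by auto
  have one: "max_abs v z = 1" if "Factorial_Ring.prime p" "p \<notin> S1" "v \<in> padic_places L p" for p v
  proof (rule antisym)
    show "max_abs v z \<le> 1" unfolding max_abs_def using T(2)[OF that(1) _ that(3)] that(2)
      by (intro Max.boundedI) (auto simp: S1_def)
  qed (rule max_abs_ge_1)
  let ?f = "\<lambda>v. real (local_degree L v) * ln (max_abs v z)"
  have main: "real (field_degree L) * weil_height L z = (\<Sum>v\<in>arch_places L. ?f v) + (\<Sum>p\<in>S. \<Sum>v\<in>padic_places L p. ?f v)"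
    if S: "finite S" "\<forall>p\<in>S. Factorial_Ring.prime p" "{p\<in>S1. Factorial_Ring.prime p} \<subseteq> S" for S
  proof -
    have finA: "finite (arch_places L)"
      unfolding arch_places_def by (rule finite_places_above[OF L absolute_value_rat rat_abs_nontrivial])
    have finP: "finite (padic_places L p)" if "p \<in> S" for p
      unfolding padic_places_def using S(2) that
      by (intro finite_places_above[OF L absolute_value_padic padic_abs_nontrivial]) auto
    define P where "P = arch_places L \<union> (\<Union>p\<in>S. padic_places L p)"
    have P: "finite P" "P \<subseteq> places L" unfolding P_def places_eq using finA finP S by auto
    have "infsum ?f (places L) = infsum ?f P"
    proof (rule infsum_cong_neutral)
      fix v assume v: "v \<in> places L - P"
      then obtain p where p: "Factorial_Ring.prime p" "v \<in> padic_places L p" "p \<notin> S" by (auto simp: places_eq P_def)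
      then have "p \<notin> S1" using S(3) by blast
      then show "?f v = 0" using one[OF p(1) _ p(2)] by simp
    qed (use P in auto)
    also have "\<dots> = sum ?f P" using P by simp
    also have "\<dots> = (\<Sum>v\<in>arch_places L. ?f v) + (\<Sum>v\<in>(\<Union>p\<in>S. padic_places L p). ?f v)"
      unfolding P_def
    proof (rule sum.union_disjoint)
      have "arch_places L \<inter> padic_places L p = {}" if "p \<in> S" for p
        using places_above_disjoint[OF padic_abs_neq_abs, of p L] S(2) that
        unfolding arch_places_def padic_places_def by (simp add: Int_commute)
      then show "arch_places L \<inter> (\<Union>p\<in>S. padic_places L p) = {}" by auto
    qed (use finA finP S in auto)
    also have "(\<Sum>v\<in>(\<Union>p\<in>S. padic_places L p). ?f v) = (\<Sum>p\<in>S. \<Sum>v\<in>padic_places L p. ?f v)"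
    proof (rule sum.UNION_disjoint)
      show "\<forall>i\<in>S. \<forall>j\<in>S. i \<noteq> j \<longrightarrow> padic_places L i \<inter> padic_places L j = {}"
        unfolding padic_places_def using S(2) padic_abs_inj by (intro ballI impI places_above_disjoint) blast
    qed (use finP S in auto)
    finally have "infsum ?f (places L) = (\<Sum>v\<in>arch_places L. ?f v) + (\<Sum>p\<in>S. \<Sum>v\<in>padic_places L p. ?f v)" .
    then show ?thesis using field_degree_pos[OF L] by (simp add: weil_height_def max_abs_def)
  qed
  show ?thesis using \<open>finite S1\<close> main by (intro exI[of _ S1]) blast
qed

text \<open>Weighted by local degrees, the logarithms of the values of \<open>a\<close> have a
  nonnegative sum. The term \<open>A\<close> is charged at archimedean places only, whose local
  degrees add up to the degree of \<open>L\<close>, and the gain \<open>g\<close> occurs at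
  \<open>w\<close>, whose local degree is at least 1.\<close>

theorem liouville_inequality:
  fixes z :: "'a::field_char_0 ^ 'n::finite"
  assumes L: "number_field L" and z: "\<And>i. z $ i \<in> L" and a: "a \<in> L" "a \<noteq> 0"
    and w: "w \<in> places L" and A: "0 \<le> A" and g: "0 \<le> g"
    and arch: "\<And>v. v \<in> arch_places L \<Longrightarrow> v a \<le> exp (A - (if v = w then g else 0)) * (max_abs v z)\<^sup>2"
    and padic: "\<And>p v. Factorial_Ring.prime p \<Longrightarrow> v \<in> padic_places L p \<Longrightarrow>
      v a \<le> exp (- (if v = w then g else 0)) * (max_abs v z)\<^sup>2"
  shows "g \<le> real (field_degree L) * (2 * weil_height L z + A)"
proof -
  obtain q :: rat where q: "q \<noteq> 0"
    "\<And>u. absolute_value UNIV u \<Longrightarrow> \<exists>c. c \<noteq> 0 \<and> u c < 1 \<Longrightarrow>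
       ln (u q) \<le> (\<Sum>v\<in>places_above L u. real (local_degree L v) * ln (v a))"
    using norm_inequality[OF L a] by blast
  obtain S0 where S0: "finite S0" "\<And>p. p \<in> S0 \<Longrightarrow> Factorial_Ring.prime p"
    "\<And>S. finite S \<Longrightarrow> S0 \<subseteq> S \<Longrightarrow> (\<And>p. p \<in> S \<Longrightarrow> Factorial_Ring.prime p) \<Longrightarrow>
      ln (real_of_rat \<bar>q\<bar>) + (\<Sum>p\<in>S. ln (padic_abs p q)) = 0"
    using rat_product_formula[OF q(1)] by blast
  obtain S1 where S1: "finite S1" "\<And>S. finite S \<Longrightarrow> (\<forall>p\<in>S. Factorial_Ring.prime p) \<Longrightarrow> {p\<in>S1. Factorial_Ring.prime p} \<subseteq> S \<Longrightarrow>
    real (field_degree L) * weil_height L z =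
      (\<Sum>v\<in>arch_places L. real (local_degree L v) * ln (max_abs v z))
      + (\<Sum>p\<in>S. \<Sum>v\<in>padic_places L p. real (local_degree L v) * ln (max_abs v z))"
    using weil_height_eq[OF L z] by blast
  define Sw where "Sw = {p. Factorial_Ring.prime p \<and> w \<in> padic_places L p}"
  have "finite Sw"
  proof (cases "Sw = {}")
    case False
    then obtain p where p: "Factorial_Ring.prime p" "w \<in> padic_places L p" by (auto simp: Sw_def)
    have "p' = p" if "p' \<in> Sw" for p'
    proof (rule ccontr)
      assume "p' \<noteq> p"
      then have "padic_abs p' \<noteq> padic_abs p" using padic_abs_inj[of p' p] p(1) that by (auto simp: Sw_def)
      from places_above_disjoint[OF this, of L] show False using p that by (auto simp: Sw_def padic_places_def)
    qed
    then have "Sw \<subseteq> {p}" by auto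
    then show ?thesis by (rule finite_subset) simp
  qed simp
  \<comment> \<open>\<open>S\<close> collects the primes that matter for the product formula, for
    the height of \<open>z\<close> and for the place \<open>w\<close>.\<close>
  define S where "S = S0 \<union> {p\<in>S1. Factorial_Ring.prime p} \<union> Sw"
  have S: "finite S" "\<And>p. p \<in> S \<Longrightarrow> Factorial_Ring.prime p" "S0 \<subseteq> S" "{p\<in>S1. Factorial_Ring.prime p} \<subseteq> S" "Sw \<subseteq> S"
    using S0(1,2) S1(1) \<open>finite Sw\<close> by (auto simp: S_def Sw_def)
  let ?n = "\<lambda>v. real (local_degree L v)"
  let ?h = "\<lambda>v. ln (max_abs v z)"
  let ?i = "\<lambda>v. (if v = w then g else 0)"
  have finA: "finite (arch_places L)"
    unfolding arch_places_def by (rule finite_places_above[OF L absolute_value_rat rat_abs_nontrivial])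
  have finP: "finite (padic_places L p)" if "p \<in> S" for p
    unfolding padic_places_def
    by (rule finite_places_above[OF L absolute_value_padic[OF S(2)[OF that]] padic_abs_nontrivial[OF S(2)[OF that]]])
  have posA: "0 < v a" if "v \<in> arch_places L" for v
  proof -
    interpret V: valued_field L v using valued_field_place[OF L] that by (simp add: arch_places_def)
    show ?thesis using a by simp
  qed
  have posP: "0 < v a" if "v \<in> padic_places L p" for v p
  proof -
    interpret V: valued_field L v using valued_field_place[OF L] that by (simp add: padic_places_def)
    show ?thesis using a by simp
  qed
  have ln_bound: "ln (v a) \<le> c + 2 * ?h v" if "0 < v a" "v a \<le> exp c * (max_abs v z)\<^sup>2" for v c
  proof -
    have h: "0 < max_abs v z" using max_abs_ge_1[of v z] by linarith
    have "ln (v a) \<le> ln (exp c * (max_abs v z)\<^sup>2)" using that by (intro ln_mono) auto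
    also have "\<dots> = c + 2 * ?h v" using h by (simp add: ln_mult ln_realpow)
    finally show ?thesis .
  qed
  have 1: "(\<Sum>v\<in>arch_places L. ?n v * ln (v a)) \<le> (\<Sum>v\<in>arch_places L. ?n v * A + 2 * (?n v * ?h v) - ?n v * ?i v)"
  proof (rule sum_mono)
    fix v assume v: "v \<in> arch_places L"
    have "?n v * ln (v a) \<le> ?n v * (A - ?i v + 2 * ?h v)"
      by (intro mult_left_mono ln_bound posA[OF v] arch[OF v]) simp
    then show "?n v * ln (v a) \<le> ?n v * A + 2 * (?n v * ?h v) - ?n v * ?i v" by (simp add: algebra_simps)
  qed
  have 2: "(\<Sum>p\<in>S. \<Sum>v\<in>padic_places L p. ?n v * ln (v a)) \<le> (\<Sum>p\<in>S. \<Sum>v\<in>padic_places L p. 2 * (?n v * ?h v) - ?n v * ?i v)"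
  proof (intro sum_mono)
    fix p v assume p: "p \<in> S" and v: "v \<in> padic_places L p"
    have "?n v * ln (v a) \<le> ?n v * (- ?i v + 2 * ?h v)"
      by (intro mult_left_mono ln_bound posP[OF v] padic[OF S(2)[OF p] v]) simp
    then show "?n v * ln (v a) \<le> 2 * (?n v * ?h v) - ?n v * ?i v" by (simp add: algebra_simps)
  qed
  have "0 = ln (real_of_rat \<bar>q\<bar>) + (\<Sum>p\<in>S. ln (padic_abs p q))" using S0(3)[of S] S by auto
  also have "\<dots> \<le> (\<Sum>v\<in>arch_places L. ?n v * ln (v a)) + (\<Sum>p\<in>S. \<Sum>v\<in>padic_places L p. ?n v * ln (v a))"
    unfolding arch_places_def padic_places_def
    by (intro add_mono sum_mono q(2) absolute_value_rat rat_abs_nontrivial absolute_value_padic padic_abs_nontrivial S(2))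
  also have "\<dots> \<le> (\<Sum>v\<in>arch_places L. ?n v * A) + 2 * ((\<Sum>v\<in>arch_places L. ?n v * ?h v)
      + (\<Sum>p\<in>S. \<Sum>v\<in>padic_places L p. ?n v * ?h v))
      - ((\<Sum>v\<in>arch_places L. ?n v * ?i v) + (\<Sum>p\<in>S. \<Sum>v\<in>padic_places L p. ?n v * ?i v))"
    using 1 2 by (simp add: sum.distrib sum_subtractf sum_distrib_left)
  also have "(\<Sum>v\<in>arch_places L. ?n v * ?h v) + (\<Sum>p\<in>S. \<Sum>v\<in>padic_places L p. ?n v * ?h v)
      = real (field_degree L) * weil_height L z" using S1(2)[of S] S by auto
  also have "(\<Sum>v\<in>arch_places L. ?n v * A) = real (field_degree L) * A"
    using sum_local_degree[OF L absolute_value_rat rat_abs_nontrivial]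
    by (simp add: arch_places_def flip: sum_distrib_right of_nat_sum)
  finally have main: "(\<Sum>v\<in>arch_places L. ?n v * ?i v) + (\<Sum>p\<in>S. \<Sum>v\<in>padic_places L p. ?n v * ?i v)
      \<le> real (field_degree L) * (2 * weil_height L z + A)" by (simp add: algebra_simps)
  have nn: "0 \<le> ?n v * ?i v" for v using g by simp
  have "g \<le> (\<Sum>v\<in>arch_places L. ?n v * ?i v) + (\<Sum>p\<in>S. \<Sum>v\<in>padic_places L p. ?n v * ?i v)"
  proof (cases "w \<in> arch_places L")
    case True
    have "0 < local_degree L w" using local_degree_pos[OF L absolute_value_rat rat_abs_nontrivial] True
      by (simp add: arch_places_def)
    then have "g \<le> ?n w * ?i w" using g by (simp add: mult_le_cancel_right1)
    also have "\<dots> \<le> (\<Sum>v\<in>arch_places L. ?n v * ?i v)" using nn True finA by (intro member_le_sum) auto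
    finally show ?thesis using nn by (intro add_increasing2 sum_nonneg) auto
  next
    case False
    then obtain p where p: "Factorial_Ring.prime p" "w \<in> padic_places L p" using w by (auto simp: places_eq)
    then have pS: "p \<in> S" using S(5) by (auto simp: Sw_def)
    have "0 < local_degree L w" using local_degree_pos[OF L absolute_value_padic padic_abs_nontrivial] p
      by (simp add: padic_places_def)
    then have "g \<le> ?n w * ?i w" using g by (simp add: mult_le_cancel_right1)
    also have "\<dots> \<le> (\<Sum>v\<in>padic_places L p. ?n v * ?i v)" using nn p finP[OF pS] by (intro member_le_sum) auto
    also have "\<dots> \<le> (\<Sum>p\<in>S. \<Sum>v\<in>padic_places L p. ?n v * ?i v)"
      using nn pS S(1) by (intro member_le_sum[of p S "\<lambda>p. \<Sum>v\<in>padic_places L p. ?n v * ?i v"] sum_nonneg) auto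
    finally show ?thesis using nn by (intro add_increasing sum_nonneg) auto
  qed
  with main show ?thesis by linarith
qed

section \<open>Quadratic polynomials\<close>

definition mon1 :: "'n \<Rightarrow> ('n \<Rightarrow>\<^sub>0 nat)" where "mon1 a = Poly_Mapping.single a 1"

text \<open>Cancellation can make the keys of a sum smaller than the union of the keys, so
  additivity is proved over a common larger index set.\<close>

lemma mpoly_eval_superset:
  assumes "finite A" "Poly_Mapping.keys f \<subseteq> A"
  shows "mpoly_eval f x = (\<Sum>m\<in>A. of_int (Poly_Mapping.lookup f m) * (\<Prod>i\<in>UNIV. (x $ i) ^ Poly_Mapping.lookup m i))"
  unfolding mpoly_eval_def using assms by (intro sum.mono_neutral_left) (auto simp: in_keys_iff)

lemma mpoly_eval_0 [simp]: "mpoly_eval 0 x = 0"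
  by (simp add: mpoly_eval_def)

lemma mpoly_eval_add: "mpoly_eval (f + g) x = mpoly_eval f x + mpoly_eval g x"
  using keys_add[of f g]
  by (simp add: mpoly_eval_superset[of "Poly_Mapping.keys f \<union> Poly_Mapping.keys g"] lookup_add algebra_simps sum.distrib)

lemma mpoly_eval_single:
  "mpoly_eval (Poly_Mapping.single m c) x = of_int c * (\<Prod>i\<in>UNIV. (x $ i) ^ Poly_Mapping.lookup m i)"
  by (subst mpoly_eval_superset[of "{m}"]) auto

lemma mpoly_pderiv_superset:
  assumes "finite A" "Poly_Mapping.keys f \<subseteq> A"
  shows "mpoly_pderiv i f = (\<Sum>m\<in>A. Poly_Mapping.single (m - Poly_Mapping.single i 1)
          (Poly_Mapping.lookup f m * int (Poly_Mapping.lookup m i)))"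
  unfolding mpoly_pderiv_def using assms by (intro sum.mono_neutral_left) (auto simp: in_keys_iff)

lemma mpoly_pderiv_0 [simp]: "mpoly_pderiv i 0 = 0"
  by (simp add: mpoly_pderiv_def)

lemma mpoly_pderiv_add: "mpoly_pderiv i (f + g) = mpoly_pderiv i f + mpoly_pderiv i g"
  using keys_add[of f g]
  by (simp add: mpoly_pderiv_superset[of "Poly_Mapping.keys f \<union> Poly_Mapping.keys g"] lookup_add distrib_right
      single_add sum.distrib)

lemma mpoly_pderiv_single:
  "mpoly_pderiv i (Poly_Mapping.single m c)
    = Poly_Mapping.single (m - mon1 i) (c * int (Poly_Mapping.lookup m i))"
  unfolding mon1_def by (subst mpoly_pderiv_superset[of "{m}"]) auto

lemma fold_mpoly_pderiv_0: "fold mpoly_pderiv is 0 = 0"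
  by (induction "is") auto

lemma fold_mpoly_pderiv_add: "fold mpoly_pderiv is (f + g) = fold mpoly_pderiv is f + fold mpoly_pderiv is g"
  by (induction "is" arbitrary: f g) (auto simp: mpoly_pderiv_add)

lemma lookup_mon1 [simp]: "Poly_Mapping.lookup (mon1 a) i = (if a = i then 1 else 0)"
  by (simp add: mon1_def lookup_single when_def)

abbreviation mon2 :: "'n \<Rightarrow> 'n \<Rightarrow> ('n \<Rightarrow>\<^sub>0 nat)" where "mon2 a b \<equiv> mon1 a + mon1 b"

lemma sum_lookup_mon1: "(\<Sum>i\<in>UNIV. Poly_Mapping.lookup (mon1 (a::'n::finite)) i) = 1"
  by simp

lemma monomial_degree_le_2:
  fixes m :: "'n::finite \<Rightarrow>\<^sub>0 nat"
  assumes "(\<Sum>i\<in>UNIV. Poly_Mapping.lookup m i) \<le> 2"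
  obtains "m = 0" | a where "m = mon1 a" | a b where "m = mon2 a b"
proof -
  have split: "\<exists>a m'. m = mon1 a + m' \<and> (\<Sum>i\<in>UNIV. Poly_Mapping.lookup m i) = 1 + (\<Sum>i\<in>UNIV. Poly_Mapping.lookup m' i)"
    if ne: "m \<noteq> 0" for m :: "'n \<Rightarrow>\<^sub>0 nat"
  proof -
    obtain a where a: "Poly_Mapping.lookup m a \<noteq> 0" using ne by (auto simp: poly_mapping_eq_iff fun_eq_iff)
    have eq: "m = mon1 a + (m - mon1 a)"
      using a by (intro poly_mapping_eqI) (auto simp: lookup_add lookup_minus)
    have "(\<Sum>i\<in>UNIV. Poly_Mapping.lookup m i) = (\<Sum>i\<in>UNIV. Poly_Mapping.lookup (mon1 a + (m - mon1 a)) i)"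
      using eq by simp
    also have "\<dots> = 1 + (\<Sum>i\<in>UNIV. Poly_Mapping.lookup (m - mon1 a) i)"
      by (simp only: lookup_add sum.distrib sum_lookup_mon1)
    finally show ?thesis using eq by blast
  qed
  show ?thesis
  proof (cases "m = 0")
    case False
    then obtain a m' where a: "m = mon1 a + m'" "(\<Sum>i\<in>UNIV. Poly_Mapping.lookup m' i) \<le> 1" using split[of m] assms by auto
    show ?thesis
    proof (cases "m' = 0")
      case False
      then obtain b m'' where b: "m' = mon1 b + m''" "(\<Sum>i\<in>UNIV. Poly_Mapping.lookup m'' i) = 0" using split[of m'] a by auto
      then have "m'' = 0" by (auto simp: poly_mapping_eq_iff fun_eq_iff)
      then show ?thesis using that(3) a b by simp
    qed (use that(2) a in simp)
  qed (use that in simp)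
qed

lemma keys_degree_le_2:
  "mpoly_degree f \<le> 2 \<Longrightarrow> m \<in> Poly_Mapping.keys f \<Longrightarrow> (\<Sum>i\<in>UNIV. Poly_Mapping.lookup m i) \<le> 2"
  by (auto simp: mpoly_degree_def)

text \<open>Statements additive in \<open>f\<close> reduce to monomials of degree 0, 1 and 2. The
  addition case carries no degree condition, which spares a discussion of cancellation of leading
  terms.\<close>

lemma quadratic_induct [consumes 1, case_names zero add mon0 mon1 mon2]:
  fixes f :: "'n::finite int_mpoly"
  assumes deg: "mpoly_degree f \<le> 2" and "P 0" and add: "\<And>f g. P f \<Longrightarrow> P g \<Longrightarrow> P (f + g)"
    and "\<And>c. P (Poly_Mapping.single 0 c)" "\<And>a c. P (Poly_Mapping.single (mon1 a) c)"
      "\<And>a b c. P (Poly_Mapping.single (mon2 a b) c)"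
  shows "P f"
proof -
  have "P (\<Sum>m\<in>A. Poly_Mapping.single m (Poly_Mapping.lookup f m))" if "A \<subseteq> Poly_Mapping.keys f" "finite A" for A
    using that(2,1)
  proof (induction A rule: finite_induct)
    case (insert m A)
    have "P (Poly_Mapping.single m (Poly_Mapping.lookup f m))"
      using keys_degree_le_2[OF deg, of m] insert.prems assms(4-6) by (auto elim!: monomial_degree_le_2)
    then show ?case using insert add by auto
  qed (simp add: assms(2))
  from this[OF order_refl finite_keys] have "P (\<Sum>m\<in>Poly_Mapping.keys f. Poly_Mapping.single m (Poly_Mapping.lookup f m))" .
  moreover have "(\<Sum>m\<in>Poly_Mapping.keys f. Poly_Mapping.single m (Poly_Mapping.lookup f m)) = f"
    by (intro poly_mapping_eqI) (simp add: lookup_sum lookup_single when_def in_keys_iff)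
  ultimately show ?thesis by simp
qed

lemma prod_power_mon1: "(\<Prod>i\<in>UNIV. (x $ i) ^ Poly_Mapping.lookup (mon1 a) i) = (x $ a :: 'a::field_char_0)"
  for a :: "'n::finite"
proof -
  have "(\<Prod>i\<in>UNIV. (x $ i) ^ Poly_Mapping.lookup (mon1 a) i) = (\<Prod>i\<in>UNIV. if a = i then x $ i else 1)"
    by (intro prod.cong) auto
  then show ?thesis by simp
qed

lemma mpoly_eval_mon [simp]:
  fixes x :: "'a::field_char_0 ^ 'n::finite"
  shows "mpoly_eval (Poly_Mapping.single 0 c) x = of_int c"
    "mpoly_eval (Poly_Mapping.single (mon1 a) c) x = of_int c * x $ a"
    "mpoly_eval (Poly_Mapping.single (mon2 a b) c) x = of_int c * (x $ a * x $ b)"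
  by (simp_all only: mpoly_eval_single prod_power_mon1 lookup_add power_add prod.distrib) auto

lemma mpoly_pderiv_mon [simp]:
  fixes a b j :: "'n::finite"
  shows "mpoly_pderiv j (Poly_Mapping.single 0 c) = 0"
    "mpoly_pderiv j (Poly_Mapping.single (mon1 a) c) = (if j = a then Poly_Mapping.single 0 c else 0)"
    "mpoly_pderiv j (Poly_Mapping.single (mon2 a b) c)
      = (if j = a then Poly_Mapping.single (mon1 b) c else 0) + (if j = b then Poly_Mapping.single (mon1 a) c else 0)"
proof -
  have "mon2 a b - mon1 a = mon1 b" "mon2 a b - mon1 b = mon1 a" by simp_all
  then show "mpoly_pderiv j (Poly_Mapping.single (mon2 a b) c)
      = (if j = a then Poly_Mapping.single (mon1 b) c else 0) + (if j = b then Poly_Mapping.single (mon1 a) c else 0)"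
    by (auto simp: mpoly_pderiv_single lookup_add distrib_left single_add)
qed (auto simp: mpoly_pderiv_single)

definition hess :: "'n::finite int_mpoly \<Rightarrow> 'a::field_char_0 ^ 'n \<Rightarrow> 'n \<Rightarrow> 'n \<Rightarrow> 'a" where
  "hess f x a b = mpoly_eval (fold mpoly_pderiv [a, b] f) x"

lemma hess_add: "hess (f + g) x a b = hess f x a b + hess g x a b"
  by (simp only: hess_def fold_mpoly_pderiv_add mpoly_eval_add)

lemma hess_mon2: "hess (Poly_Mapping.single (mon2 a b) c) x i j
    = (if i = a then if j = b then of_int c else 0 else 0) + (if i = b then if j = a then of_int c else 0 else 0)"
proof -
  have "mpoly_pderiv j (if P then f else 0) = (if P then mpoly_pderiv j f else 0)"
    "mpoly_eval (if P then f else 0) x = (if P then mpoly_eval f x else 0)" for P f by auto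
  then show ?thesis
    by (simp only: hess_def fold_simps mpoly_pderiv_mon mpoly_pderiv_add mpoly_eval_add mpoly_eval_mon)
qed

lemma hess_mon01: "hess (Poly_Mapping.single 0 c) x i j = 0" "hess (Poly_Mapping.single (mon1 a) c) x i j = 0"
  by (auto simp: hess_def)

lemma sum_hess_mon2:
  fixes w :: "'a::field_char_0 ^ 'n::finite"
  shows "(\<Sum>i\<in>UNIV. \<Sum>j\<in>UNIV. hess (Poly_Mapping.single (mon2 a b) c) x i j * (w $ i * w $ j)) = 2 * of_int c * (w $ a * w $ b)"
proof -
  have "(\<Sum>i\<in>UNIV. \<Sum>j\<in>UNIV. hess (Poly_Mapping.single (mon2 a b) c) x i j * (w $ i * w $ j))
      = (\<Sum>i\<in>UNIV. \<Sum>j\<in>UNIV. (if i = a then if j = b then of_int c * (w $ i * w $ j) else 0 else 0)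
          + (if i = b then if j = a then of_int c * (w $ i * w $ j) else 0 else 0))"
    unfolding hess_mon2 by (intro sum.cong refl) auto
  also have "\<dots> = of_int c * (w $ a * w $ b) + of_int c * (w $ b * w $ a)"
  proof -
    have "(\<Sum>j\<in>UNIV. if i = k then if j = l then of_int c * (w $ i * w $ j) else 0 else 0)
        = (if i = k then of_int c * (w $ i * w $ l) else 0)" for i k l by simp
    then show ?thesis by (simp add: sum.distrib)
  qed
  finally show ?thesis by (simp add: algebra_simps)
qed

text \<open>The expansion is exact, there being no terms of order 3. On a quadratic monomial the
  full Hessian sum counts the product twice, also when the two variables coincide, and the factor
  1/2 compensates.\<close>

lemma quadratic_taylor:
  fixes x w :: "'a::field_char_0 ^ 'n::finite"
  assumes "mpoly_degree f \<le> 2"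
  shows "mpoly_eval f (x + w) = mpoly_eval f x + (\<Sum>j\<in>UNIV. mpoly_eval (mpoly_pderiv j f) x * w $ j)
    + 1 / 2 * (\<Sum>i\<in>UNIV. \<Sum>j\<in>UNIV. hess f x i j * (w $ i * w $ j))"
  using assms
proof (induction f rule: quadratic_induct)
  case zero
  then show ?case by (simp add: hess_def)
next
  case (add f g)
  then show ?case
    by (simp add: mpoly_eval_add mpoly_pderiv_add hess_add distrib_right sum.distrib algebra_simps)
next
  case (mon0 c)
  then show ?case by (simp add: hess_mon01)
next
  case (mon1 a c)
  have "(\<Sum>j\<in>UNIV. mpoly_eval (mpoly_pderiv j (Poly_Mapping.single (mon1 a) c)) x * w $ j)
      = (\<Sum>j\<in>UNIV. if j = a then of_int c * w $ j else 0)" by (intro sum.cong) auto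
  then show ?case by (simp add: hess_mon01 algebra_simps)
next
  case (mon2 a b c)
  have "(\<Sum>j\<in>UNIV. mpoly_eval (mpoly_pderiv j (Poly_Mapping.single (mon2 a b) c)) x * w $ j)
      = (\<Sum>j\<in>UNIV. (if j = a then of_int c * x $ b * w $ j else 0) + (if j = b then of_int c * x $ a * w $ j else 0))"
    by (intro sum.cong) (auto simp: mpoly_eval_add algebra_simps)
  then show ?case unfolding sum_hess_mon2 by (simp add: sum.distrib algebra_simps)
qed

text \<open>Consequently only \<open>k = 2\<close> contributes to the supremum that defines
  \<open>gamma_inv\<close>.\<close>

lemma fold_pderiv_eq_0:
  assumes "mpoly_degree f \<le> 2" "3 \<le> length is" shows "fold mpoly_pderiv is f = 0"
proof -
  obtain a b c js where js: "is = a # b # c # js"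
    using assms(2) by (auto simp: numeral_3_eq_3 Suc_le_length_iff)
  have "mpoly_pderiv c (mpoly_pderiv b (mpoly_pderiv a f)) = 0"
    using assms(1) by (induction f rule: quadratic_induct) (auto simp: mpoly_pderiv_add)
  then show ?thesis by (simp add: js fold_mpoly_pderiv_0)
qed

lemma mon2_eq_iff: "mon2 a b = mon2 a' b' \<longleftrightarrow> (a = a' \<and> b = b') \<or> (a = b' \<and> b = a')"
proof
  assume eq: "mon2 a b = mon2 a' b'"
  have inj: "i = j" if "mon1 i = mon1 j" for i j :: 'a
    using arg_cong[OF that, of "\<lambda>m. Poly_Mapping.lookup m i"] by (simp split: if_splits)
  have "Poly_Mapping.lookup (mon2 a b) a = Poly_Mapping.lookup (mon2 a' b') a" using eq by simp
  then have "a = a' \<or> a = b'" by (auto simp: lookup_add split: if_splits)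
  then show "(a = a' \<and> b = b') \<or> (a = b' \<and> b = a')"
  proof
    assume "a = a'"
    then show ?thesis using eq inj by simp
  next
    assume "a = b'"
    then have "mon1 b' + mon1 b = mon1 b' + mon1 a'" using eq by (simp only: add.commute)
    then show ?thesis using \<open>a = b'\<close> inj by simp
  qed
qed (auto simp: add.commute)

lemma mon2_neq: "mon2 a b \<noteq> 0" "mon2 a b \<noteq> mon1 c" "mon1 c \<noteq> 0" for a b c :: "'n::finite"
proof -
  have s: "(\<Sum>i\<in>UNIV. Poly_Mapping.lookup (mon2 a b) i) = 2"
    by (simp only: lookup_add sum.distrib sum_lookup_mon1)
  show "mon2 a b \<noteq> 0"
  proof
    assume "mon2 a b = 0"
    then show False using s by simp
  qed
  show "mon2 a b \<noteq> mon1 c"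
  proof
    assume "mon2 a b = mon1 c"
    then have "(2::nat) = 1" using s sum_lookup_mon1[of c] by (simp only:)
    then show False by simp
  qed
  show "mon1 c \<noteq> 0"
  proof
    assume "mon1 c = 0"
    then show False using sum_lookup_mon1[of c] by simp
  qed
qed

text \<open>Differentiating a square twice produces the 2 on the diagonal. The Hessian is constant,
  so its size is governed by a single integer coefficient.\<close>

lemma hess_eq_coefficient:
  assumes "mpoly_degree f \<le> 2"
  shows "hess f x a b = of_int (Poly_Mapping.lookup f (mon2 a b)) * (if a = b then 2 else 1)"
  using assms
proof (induction f rule: quadratic_induct)
  case (mon2 a' b' c)
  show ?case
    by (auto simp: hess_mon2 lookup_single when_def mon2_eq_iff)
qed (auto simp: mon2_neq mon2_neq[symmetric] hess_def[of 0] hess_add lookup_add hess_mon01 lookup_single when_def algebra_simps)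

text \<open>Ordered pairs are counted; the bound exceeds the number of monomials but still fits
  under a power of \<open>n\<close> for \<open>n \<ge> 2\<close>.\<close>

lemma card_keys_quadratic:
  fixes f :: "'n::finite int_mpoly"
  assumes "mpoly_degree f \<le> 2"
  shows "card (Poly_Mapping.keys f) \<le> 1 + CARD('n) + CARD('n)\<^sup>2"
proof -
  have "Poly_Mapping.keys f \<subseteq> {0} \<union> range mon1 \<union> (\<lambda>(a, b). mon2 a b) ` UNIV"
  proof
    fix m assume "m \<in> Poly_Mapping.keys f"
    from keys_degree_le_2[OF assms this] show "m \<in> {0} \<union> range mon1 \<union> (\<lambda>(a, b). mon2 a b) ` UNIV"
      by (rule monomial_degree_le_2) auto
  qed
  then have "card (Poly_Mapping.keys f) \<le> card ({0} \<union> range mon1 \<union> (\<lambda>(a, b). mon2 a b) ` (UNIV :: ('n \<times> 'n) set))"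
    by (intro card_mono) auto
  also have "\<dots> \<le> card {0 :: 'n \<Rightarrow>\<^sub>0 nat} + card (range (mon1 :: 'n \<Rightarrow> _)) + card ((\<lambda>(a, b). mon2 a b) ` (UNIV :: ('n \<times> 'n) set))"
    by (intro order_trans[OF card_Un_le] add_mono order_refl card_Un_le)
  also have "\<dots> \<le> 1 + CARD('n) + CARD('n \<times> 'n)"
    by (intro add_mono card_image_le) auto
  finally show ?thesis by (simp add: power2_eq_square)
qed

text \<open>A nonzero coefficient makes the maximum positive, so that the logarithm can be inverted;
  a zero coefficient is treated directly, as the convention for \<open>ln 0\<close> carries no
  information.\<close>

lemma abs_lookup_le_exp_height:
  assumes "mpoly_height f \<le> h" shows "real_of_int \<bar>Poly_Mapping.lookup f m\<bar> \<le> exp h"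
proof -
  have "finite (range (\<lambda>m. \<bar>Poly_Mapping.lookup f m\<bar>))"
  proof (rule finite_subset)
    show "range (\<lambda>m. \<bar>Poly_Mapping.lookup f m\<bar>) \<subseteq> insert 0 ((\<lambda>m. \<bar>Poly_Mapping.lookup f m\<bar>) ` Poly_Mapping.keys f)"
      by (auto simp: in_keys_iff)
  qed simp
  then have le: "\<bar>Poly_Mapping.lookup f m\<bar> \<le> Max (range (\<lambda>m. \<bar>Poly_Mapping.lookup f m\<bar>))" by (intro Max_ge) auto
  show ?thesis
  proof (cases "Poly_Mapping.lookup f m = 0")
    case False
    then have "0 < real_of_int (Max (range (\<lambda>m. \<bar>Poly_Mapping.lookup f m\<bar>)))" using le by linarith
    then have "real_of_int (Max (range (\<lambda>m. \<bar>Poly_Mapping.lookup f m\<bar>))) \<le> exp h"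
      using assms unfolding mpoly_height_def by (metis exp_le_cancel_iff exp_ln)
    then show ?thesis using le by linarith
  qed simp
qed

lemma quadratic_univariate:
  fixes x :: "'a::field_char_0 ^ 'n::finite"
  assumes "mpoly_degree f \<le> 2" and U: "(UNIV :: 'n set) = {a}"
  shows "mpoly_eval f x = of_int (Poly_Mapping.lookup f (mon2 a a)) * (x $ a)\<^sup>2
      + of_int (Poly_Mapping.lookup f (mon1 a)) * x $ a + of_int (Poly_Mapping.lookup f 0)"
    and "mpoly_eval (mpoly_pderiv a f) x = 2 * of_int (Poly_Mapping.lookup f (mon2 a a)) * x $ a
      + of_int (Poly_Mapping.lookup f (mon1 a))"
proof -
  have eq: "b = a" for b using U by (metis UNIV_I singletonD)
  have ne: "0 \<noteq> mon1 a" "0 \<noteq> mon2 a a" "mon1 a \<noteq> mon2 a a" using mon2_neq by metis+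
  note ne' = ne ne[symmetric]
  have "mpoly_eval f x = of_int (Poly_Mapping.lookup f (mon2 a a)) * (x $ a)\<^sup>2
      + of_int (Poly_Mapping.lookup f (mon1 a)) * x $ a + of_int (Poly_Mapping.lookup f 0) \<and>
    mpoly_eval (mpoly_pderiv a f) x = 2 * of_int (Poly_Mapping.lookup f (mon2 a a)) * x $ a
      + of_int (Poly_Mapping.lookup f (mon1 a))"
    using assms(1)
  proof (induction f rule: quadratic_induct)
    case (add f g)
    then show ?case by (simp add: mpoly_eval_add mpoly_pderiv_add lookup_add algebra_simps)
  next
    case (mon1 b c)
    then show ?case using ne' by (simp add: eq[of b] lookup_single when_def)
  next
    case (mon2 b b' c)
    have "mpoly_eval (mpoly_pderiv a (Poly_Mapping.single (mon2 a a) c)) x = of_int c * x $ a + of_int c * x $ a"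
      by (simp only: mpoly_pderiv_mon mpoly_eval_add if_True mpoly_eval_mon simp_thms)
    then show ?case using ne' by (simp add: eq[of b] eq[of b'] lookup_single when_def power2_eq_square del: mpoly_pderiv_mon)
  qed (use ne' in \<open>simp_all add: lookup_single when_def\<close>)
  then show "mpoly_eval f x = of_int (Poly_Mapping.lookup f (mon2 a a)) * (x $ a)\<^sup>2
      + of_int (Poly_Mapping.lookup f (mon1 a)) * x $ a + of_int (Poly_Mapping.lookup f 0)"
    "mpoly_eval (mpoly_pderiv a f) x = 2 * of_int (Poly_Mapping.lookup f (mon2 a a)) * x $ a
      + of_int (Poly_Mapping.lookup f (mon1 a))" by auto
qed

context valued_field
begin

lemma mpoly_eval_mem: "(\<And>i. x $ i \<in> K) \<Longrightarrow> mpoly_eval f x \<in> K"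
  unfolding mpoly_eval_def by (intro K_sum K_mult K_prod K_power) auto

lemma v_monomial_le:
  assumes "\<And>i. x $ i \<in> K" "\<And>i. v (x $ i) \<le> Z" "1 \<le> Z" "(\<Sum>i\<in>UNIV. Poly_Mapping.lookup m i) \<le> 2"
  shows "v (\<Prod>i\<in>UNIV. (x $ i) ^ Poly_Mapping.lookup m i) \<le> Z\<^sup>2"
proof -
  have "v (\<Prod>i\<in>UNIV. (x $ i) ^ Poly_Mapping.lookup m i) = (\<Prod>i\<in>UNIV. v (x $ i) ^ Poly_Mapping.lookup m i)"
    using assms(1) by (subst v_prod) auto
  also have "\<dots> \<le> (\<Prod>i\<in>UNIV. Z ^ Poly_Mapping.lookup m i)"
    using assms by (intro prod_mono) (auto intro: power_mono)
  also have "\<dots> = Z ^ (\<Sum>i\<in>UNIV. Poly_Mapping.lookup m i)" by (simp add: power_sum)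
  also have "\<dots> \<le> Z\<^sup>2" using assms by (intro power_increasing) auto
  finally show ?thesis .
qed

lemma v_eval_le:
  assumes deg: "mpoly_degree f \<le> 2" and x: "\<And>i. x $ i \<in> K" "\<And>i. v (x $ i) \<le> Z" "1 \<le> Z"
  shows "v (mpoly_eval f x) \<le> (\<Sum>m\<in>Poly_Mapping.keys f. v (of_int (Poly_Mapping.lookup f m))) * Z\<^sup>2"
proof -
  have "v (mpoly_eval f x) \<le> (\<Sum>m\<in>Poly_Mapping.keys f. v (of_int (Poly_Mapping.lookup f m) *
        (\<Prod>i\<in>UNIV. (x $ i) ^ Poly_Mapping.lookup m i)))"
    unfolding mpoly_eval_def using x by (intro v_sum K_mult K_prod) auto
  also have "\<dots> \<le> (\<Sum>m\<in>Poly_Mapping.keys f. v (of_int (Poly_Mapping.lookup f m)) * Z\<^sup>2)"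
  proof (rule sum_mono)
    fix m assume m: "m \<in> Poly_Mapping.keys f"
    have "v (of_int (Poly_Mapping.lookup f m) * (\<Prod>i\<in>UNIV. (x $ i) ^ Poly_Mapping.lookup m i))
       = v (of_int (Poly_Mapping.lookup f m)) * v (\<Prod>i\<in>UNIV. (x $ i) ^ Poly_Mapping.lookup m i)"
      using x by (intro v_mult K_prod) auto
    also have "\<dots> \<le> v (of_int (Poly_Mapping.lookup f m)) * Z\<^sup>2"
      using v_monomial_le[OF x keys_degree_le_2[OF deg m]] by (intro mult_left_mono) auto
    finally show "v (of_int (Poly_Mapping.lookup f m) * (\<Prod>i\<in>UNIV. (x $ i) ^ Poly_Mapping.lookup m i)) \<le> \<dots>" .
  qed
  finally show ?thesis by (simp add: sum_distrib_right)
qed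

lemma v_eval_le_nonarch:
  assumes deg: "mpoly_degree f \<le> 2" and x: "\<And>i. x $ i \<in> K" "\<And>i. v (x $ i) \<le> Z" "1 \<le> Z"
    and int: "\<And>k. v (of_int k) \<le> 1"
  shows "v (mpoly_eval f x) \<le> Z\<^sup>2"
  unfolding mpoly_eval_def
proof (rule ultrametric_sum)
  show "v (of_nat n) \<le> 1" for n using int[of "int n"] by simp
  fix m assume m: "m \<in> Poly_Mapping.keys f"
  have "v (of_int (Poly_Mapping.lookup f m) * (\<Prod>i\<in>UNIV. (x $ i) ^ Poly_Mapping.lookup m i))
     = v (of_int (Poly_Mapping.lookup f m)) * v (\<Prod>i\<in>UNIV. (x $ i) ^ Poly_Mapping.lookup m i)"
    using x by (intro v_mult K_prod) auto
  also have "\<dots> \<le> 1 * Z\<^sup>2"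
    using v_monomial_le[OF x keys_degree_le_2[OF deg m]] int x by (intro mult_mono v_nonneg K_prod K_power) auto
  finally show "v (of_int (Poly_Mapping.lookup f m) * (\<Prod>i\<in>UNIV. (x $ i) ^ Poly_Mapping.lookup m i)) \<le> Z\<^sup>2" by simp
qed (use x in \<open>auto intro!: K_mult K_prod\<close>)

lemma v_monomial_diff_le:
  fixes x y :: "'a ^ 'n::finite"
  assumes deg: "(\<Sum>i\<in>UNIV. Poly_Mapping.lookup m i) \<le> 2"
    and B: "0 \<le> B" "\<And>i. v (x $ i - y $ i) \<le> B" "\<And>i j. v (x $ i * x $ j - y $ i * y $ j) \<le> B"
  shows "v ((\<Prod>i\<in>UNIV. (x $ i) ^ Poly_Mapping.lookup m i) - (\<Prod>i\<in>UNIV. (y $ i) ^ Poly_Mapping.lookup m i)) \<le> B"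
  using deg
proof (rule monomial_degree_le_2)
  fix a assume "m = mon1 a"
  then show ?thesis using B(2) by (simp only: prod_power_mon1)
next
  fix a b assume "m = mon2 a b"
  then show ?thesis using B(3) by (simp only: prod_power_mon1 lookup_add power_add prod.distrib)
qed (use B in simp)

lemma mpoly_eval_diff_eq:
  "mpoly_eval f x - mpoly_eval f y = (\<Sum>m\<in>Poly_Mapping.keys f. of_int (Poly_Mapping.lookup f m) *
     ((\<Prod>i\<in>UNIV. (x $ i) ^ Poly_Mapping.lookup m i) - (\<Prod>i\<in>UNIV. (y $ i) ^ Poly_Mapping.lookup m i)))"
  by (simp add: mpoly_eval_def right_diff_distrib sum_subtractf)

text \<open>Constant terms cancel, and \<open>B\<close> dominates the differences of all linear and
  quadratic monomials at once. Under the ultrametric inequality the sum over the coefficients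
  disappears.\<close>

lemma v_eval_diff_le:
  fixes x y :: "'a ^ 'n::finite"
  assumes deg: "mpoly_degree f \<le> 2" and xy: "\<And>i. x $ i \<in> K" "\<And>i. y $ i \<in> K"
    and B: "0 \<le> B" "\<And>i. v (x $ i - y $ i) \<le> B" "\<And>i j. v (x $ i * x $ j - y $ i * y $ j) \<le> B"
  shows "v (mpoly_eval f x - mpoly_eval f y) \<le> (\<Sum>m\<in>Poly_Mapping.keys f. v (of_int (Poly_Mapping.lookup f m))) * B"
    and "(\<And>k. v (of_int k) \<le> 1) \<Longrightarrow> v (mpoly_eval f x - mpoly_eval f y) \<le> B"
proof -
  let ?c = "\<lambda>m. of_int (Poly_Mapping.lookup f m) :: 'a"
  let ?d = "\<lambda>m. (\<Prod>i\<in>UNIV. (x $ i) ^ Poly_Mapping.lookup m i) - (\<Prod>i\<in>UNIV. (y $ i) ^ Poly_Mapping.lookup m i)"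
  have d: "?d m \<in> K" for m using xy by (intro K_diff K_prod K_power) auto
  have bnd: "v (?c m * ?d m) \<le> v (?c m) * B" if m: "m \<in> Poly_Mapping.keys f" for m
  proof -
    have "v (?d m) \<le> B" by (rule v_monomial_diff_le[OF keys_degree_le_2[OF deg m] B])
    then have "v (?c m) * v (?d m) \<le> v (?c m) * B" by (intro mult_left_mono) auto
    then show ?thesis using d by simp
  qed
  have "v (mpoly_eval f x - mpoly_eval f y) \<le> (\<Sum>m\<in>Poly_Mapping.keys f. v (?c m * ?d m))"
    unfolding mpoly_eval_diff_eq using d by (intro v_sum) auto
  also have "\<dots> \<le> (\<Sum>m\<in>Poly_Mapping.keys f. v (?c m) * B)" by (intro sum_mono bnd)
  finally show "v (mpoly_eval f x - mpoly_eval f y) \<le> (\<Sum>m\<in>Poly_Mapping.keys f. v (?c m)) * B"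
    by (simp add: sum_distrib_right)
  assume int: "\<And>k. v (of_int k) \<le> 1"
  show "v (mpoly_eval f x - mpoly_eval f y) \<le> B"
    unfolding mpoly_eval_diff_eq
  proof (rule ultrametric_sum)
    show "v (of_nat n) \<le> 1" for n using int[of "int n"] by simp
    fix m assume m: "m \<in> Poly_Mapping.keys f"
    have "v (?c m) * B \<le> 1 * B" using int B by (intro mult_right_mono) auto
    then show "v (?c m * ?d m) \<le> B" using bnd[OF m] by simp
  qed (use B d in auto)
qed

end

section \<open>The invariant \<open>\<gamma>\<close> of a quadratic system\<close>

lemma sum_lists_length_2:
  fixes f :: "'n::finite list \<Rightarrow> 'b::comm_monoid_add"
  shows "(\<Sum>is\<in>{is. length is = 2}. f is) = (\<Sum>a\<in>UNIV. \<Sum>b\<in>UNIV. f [a, b])"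
proof -
  have "(\<Sum>is\<in>{is. length is = 2}. f is) = (\<Sum>ab\<in>UNIV. f [fst ab, snd ab])"
    by (rule sum.reindex_bij_witness[of _ "\<lambda>ab. [fst ab, snd ab]" "\<lambda>is. (is ! 0, is ! 1)"])
       (auto simp: numeral_2_eq_2 length_Suc_conv)
  also have "\<dots> = (\<Sum>a\<in>UNIV. \<Sum>b\<in>UNIV. f [a, b])"
    by (simp add: sum.cartesian_product case_prod_unfold)
  finally show ?thesis .
qed

lemma finite_lists_length: "finite {is :: 'n::finite list. length is = k}"
  using finite_lists_length_eq[of "UNIV :: 'n set" k] by simp

context valued_field
begin

section \<open>Norms of vectors over the completion\<close>

lemma cpl_emb_eq: "cpl_emb K v x = cls (\<lambda>_. x)"
  by (simp add: cpl_emb_def cls_def)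

lemma cpl_abs_emb: "x \<in> K \<Longrightarrow> cpl_abs v (cpl_emb K v x) = v x"
  unfolding cpl_emb_eq by (intro cpl_abs_cls) auto

lemma cpl_abs_lim:
  assumes "s \<in> carrier Cseq" shows "(\<lambda>n. v (s n)) \<longlonglongrightarrow> cpl_abs v (cls s)"
proof -
  obtain r where r: "(\<lambda>n. v (s n)) \<longlonglongrightarrow> r" using v_Cseq_convergent[OF assms] by (auto simp: convergent_def)
  then show ?thesis using cpl_abs_cls[OF assms r] by simp
qed

lemma cpl_abs_nonneg:
  assumes "c \<in> carrier Cpl" shows "0 \<le> cpl_abs v c"
proof -
  obtain s where s: "c = cls s" "s \<in> carrier Cseq" using assms by (auto simp: carrier_Cpl)
  show ?thesis unfolding s(1)
    by (rule LIMSEQ_le_const[OF cpl_abs_lim[OF s(2)]]) (use s(2) in \<open>auto simp: Cseq_mem\<close>)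
qed

lemma cpl_abs_zero: "cpl_abs v \<zero>\<^bsub>Cpl\<^esub> = 0"
  unfolding cls_zero by (rule cpl_abs_cls) auto

lemma cpl_abs_le_vec_norm:
  assumes "\<And>i. x $ i \<in> carrier Cpl" shows "cpl_abs v (x $ i) \<le> vec_norm K v x"
proof (cases "nonarchimedean K v")
  case False
  have "(cpl_abs v (x $ i))\<^sup>2 \<le> (\<Sum>i\<in>UNIV. (cpl_abs v (x $ i))\<^sup>2)" by (rule member_le_sum) auto
  then have "cpl_abs v (x $ i) \<le> sqrt (\<Sum>i\<in>UNIV. (cpl_abs v (x $ i))\<^sup>2)" by (rule real_le_rsqrt)
  then show ?thesis using False by (simp add: vec_norm_def)
qed (auto simp: vec_norm_def)

lemma vec_norm_le_sum:
  assumes "\<And>i. x $ i \<in> carrier Cpl" shows "vec_norm K v x \<le> (\<Sum>i\<in>UNIV. cpl_abs v (x $ i))"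
proof (cases "nonarchimedean K v")
  case True
  have "Max (range (\<lambda>i. cpl_abs v (x $ i))) \<le> (\<Sum>i\<in>UNIV. cpl_abs v (x $ i))"
    using cpl_abs_nonneg[OF assms] by (intro Max.boundedI) (auto intro!: member_le_sum)
  then show ?thesis using True by (simp add: vec_norm_def)
next
  case False
  then show ?thesis
    using L2_set_le_sum[of UNIV "\<lambda>i. cpl_abs v (x $ i)"] cpl_abs_nonneg[OF assms] by (simp add: vec_norm_def L2_set_def)
qed

lemma vec_norm_nonneg:
  assumes "\<And>i. x $ i \<in> carrier Cpl" shows "0 \<le> vec_norm K v x"
  using order_trans[OF cpl_abs_nonneg[OF assms] cpl_abs_le_vec_norm[OF assms]] .

lemma vec_emb_mem: "(\<And>i. x $ i \<in> K) \<Longrightarrow> vec_emb K v x $ i \<in> carrier Cpl"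
  by (simp add: vec_emb_def cpl_emb_eq)

definition enorm :: "'a ^ 'n::finite \<Rightarrow> real" where "enorm x = vec_norm K v (vec_emb K v x)"

lemma enorm_eq:
  assumes "\<And>i. x $ i \<in> K"
  shows "enorm x = (if nonarchimedean K v then Max (range (\<lambda>i. v (x $ i))) else sqrt (\<Sum>i\<in>UNIV. (v (x $ i))\<^sup>2))"
  using assms by (simp add: enorm_def vec_norm_def vec_emb_def cpl_abs_emb)

lemma v_le_enorm: "(\<And>i. x $ i \<in> K) \<Longrightarrow> v (x $ i) \<le> enorm x"
  using cpl_abs_le_vec_norm[of "vec_emb K v x" i] vec_emb_mem[of x]
  by (simp add: enorm_def vec_emb_def cpl_abs_emb)

lemma enorm_nonneg: "(\<And>i. x $ i \<in> K) \<Longrightarrow> 0 \<le> enorm x"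
  unfolding enorm_def by (intro vec_norm_nonneg vec_emb_mem)

lemma enorm_eq_0_imp:
  assumes "\<And>i. x $ i \<in> K" "enorm x = 0" shows "x = 0"
proof (rule Finite_Cartesian_Product.vec_eq_iff[THEN iffD2, rule_format])
  fix i
  have "v (x $ i) \<le> 0" using v_le_enorm[OF assms(1)] assms(2) by simp
  then show "x $ i = 0 $ i" using v_pos[OF assms(1), of i] by auto
qed

lemma enorm_0: "enorm (0 :: 'a ^ 'n::finite) = 0"
  by (subst enorm_eq) auto

lemma enorm_axis: "enorm (axis a 1 :: 'a ^ 'n::finite) = 1"
proof -
  have mem: "(axis a 1 :: 'a ^ 'n) $ i \<in> K" for i by (simp add: axis_def)
  have "(\<Sum>i\<in>UNIV. (v ((axis a 1 :: 'a ^ 'n) $ i))\<^sup>2) = (\<Sum>i\<in>UNIV. if i = a then 1 else 0)"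
    by (intro sum.cong) (auto simp: axis_def)
  then have 1: "(\<Sum>i\<in>UNIV. (v ((axis a 1 :: 'a ^ 'n) $ i))\<^sup>2) = 1" by simp
  have 2: "Max (range (\<lambda>i. v ((axis a 1 :: 'a ^ 'n) $ i))) = 1"
    by (intro Max_eqI) (auto simp: axis_def image_iff split: if_splits intro!: exI[of _ a])
  show ?thesis using 1 2 by (simp only: enorm_eq[OF mem]) simp
qed

text \<open>Coefficients of the bilinear map obtained by applying the inverse Jacobian to half of
  the second derivative. They lie in \<open>K\<close>, although the operator norm is taken over the
  completion.\<close>

definition quad_coeff :: "'n::finite int_mpoly ^ 'n \<Rightarrow> 'a ^ 'n \<Rightarrow> 'n \<Rightarrow> 'n \<Rightarrow> 'n \<Rightarrow> 'a" where
  "quad_coeff F x i a b = (\<Sum>l\<in>UNIV. matrix_inv (poly_jacobian F x) $ i $ l * (1 / 2 * hess (F $ l) x a b))"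

definition quad_form :: "'n::finite int_mpoly ^ 'n \<Rightarrow> 'a ^ 'n \<Rightarrow> 'a ^ 'n \<Rightarrow> 'a ^ 'n \<Rightarrow> 'a ^ 'n" where
  "quad_form F x y z = (\<chi> i. \<Sum>a\<in>UNIV. \<Sum>b\<in>UNIV. quad_coeff F x i a b * (y $ a * z $ b))"

context
  fixes F :: "'n::finite int_mpoly ^ 'n" and \<zeta> :: "'a ^ 'n"
  assumes \<zeta>: "\<And>i. \<zeta> $ i \<in> K"
    and inv_mem: "\<And>i j. matrix_inv (poly_jacobian F \<zeta>) $ i $ j \<in> K"
    and degree: "\<And>i. mpoly_degree (F $ i) \<le> 2"
begin

lemma hess_mem: "hess (F $ l) \<zeta> a b \<in> K"
  unfolding hess_def by (rule mpoly_eval_mem) (rule \<zeta>)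

lemma quad_coeff_mem: "quad_coeff F \<zeta> i a b \<in> K"
  unfolding quad_coeff_def using inv_mem hess_mem K_of_rat[of "1/2"]
  by (intro K_sum K_mult) (auto simp: of_rat_divide)

text \<open>Vectors over the completion are replaced by representing sequences, on which the form
  acts termwise with constant coefficients.\<close>

lemma gamma_form_2:
  assumes s: "\<And>m j. m < 2 \<Longrightarrow> s m j \<in> carrier Cseq" and V: "\<And>m j. m < 2 \<Longrightarrow> V m $ j = cls (s m j)"
  shows "gamma_form K v F \<zeta> 2 V $ i = cls (\<lambda>n. \<Sum>a\<in>UNIV. \<Sum>b\<in>UNIV. quad_coeff F \<zeta> i a b * (s 0 a n * s 1 b n))"
    and "(\<lambda>n. \<Sum>a\<in>UNIV. \<Sum>b\<in>UNIV. quad_coeff F \<zeta> i a b * (s 0 a n * s 1 b n)) \<in> carrier Cseq"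
proof -
  interpret C: cring Cpl by (rule cring_Cpl)
  have s': "(\<lambda>n. s m j n) \<in> carrier Cseq" if "m < 2" for m j using s[OF that] by simp
  show mem: "(\<lambda>n. \<Sum>a\<in>UNIV. \<Sum>b\<in>UNIV. quad_coeff F \<zeta> i a b * (s 0 a n * s 1 b n)) \<in> carrier Cseq" for i
  proof (intro Cseq_sum)
    fix a b
    show "(\<lambda>n. quad_coeff F \<zeta> i a b * (s 0 a n * s 1 b n)) \<in> carrier Cseq"
      using Cseq_mult[OF Cseq_const[OF quad_coeff_mem[of i a b]] Cseq_mult[OF s'[of 0 a] s'[of 1 b]]] by simp
  qed
  have prod: "(\<Otimes>\<^bsub>Cpl\<^esub>m\<in>{..<2}. V m $ (is ! m)) = cls (\<lambda>n. \<Prod>m<2. s m (is ! m) n)" for "is"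
  proof -
    have "(\<Otimes>\<^bsub>Cpl\<^esub>m\<in>{..<2}. V m $ (is ! m)) = (\<Otimes>\<^bsub>Cpl\<^esub>m\<in>{..<2}. cls (s m (is ! m)))"
      by (rule C.finprod_cong') (auto simp: V s)
    also have "\<dots> = cls (\<lambda>n. \<Prod>m<2. s m (is ! m) n)" by (intro cls_finprod) (auto simp: s)
    finally show ?thesis .
  qed
  have pmem: "(\<lambda>n. \<Prod>m<2. s m (is ! m) n) \<in> carrier Cseq" for "is" by (intro Cseq_prod) (simp add: s)
  define c where "c l is = mpoly_eval (fold mpoly_pderiv is (F $ l)) \<zeta>" for l "is"
  have c: "c l is \<in> K" for l "is" unfolding c_def by (rule mpoly_eval_mem) (rule \<zeta>)
  define D where "D l n = (\<Sum>is\<in>{is. length is = 2}. c l is * (\<Prod>m<2. s m (is ! m) n))" for l n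
  have cs: "(\<lambda>n. c l is * (\<Prod>m<2. s m (is ! m) n)) \<in> carrier Cseq" for l "is"
    using Cseq_mult[OF Cseq_const[OF c] pmem] by simp
  have D: "(\<lambda>n. D l n) \<in> carrier Cseq" for l unfolding D_def by (intro Cseq_sum cs)
  have deriv: "deriv_form K v F \<zeta> 2 V $ l = cls (\<lambda>n. D l n)" for l
  proof -
    have "deriv_form K v F \<zeta> 2 V $ l
        = (\<Oplus>\<^bsub>Cpl\<^esub>is\<in>{is. length is = 2}. cls (\<lambda>n. c l is * (\<Prod>m<2. s m (is ! m) n)))"
      using c pmem by (simp add: deriv_form_def prod cpl_emb_eq cls_mult flip: c_def)
    also have "\<dots> = cls (\<lambda>n. D l n)" unfolding D_def by (intro cls_finsum finite_lists_length cs)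
    finally show ?thesis .
  qed
  let ?A = "matrix_inv (poly_jacobian F \<zeta>)"
  have AD: "(\<lambda>n. ?A $ i $ l * D l n) \<in> carrier Cseq" for i l
    using Cseq_mult[OF Cseq_const[OF inv_mem] D] by simp
  have mv: "cpl_mat_vec K v (cpl_mat_emb K v ?A) (deriv_form K v F \<zeta> 2 V) $ i = cls (\<lambda>n. \<Sum>l\<in>UNIV. ?A $ i $ l * D l n)"
  proof -
    have "cpl_mat_vec K v (cpl_mat_emb K v ?A) (deriv_form K v F \<zeta> 2 V) $ i
        = (\<Oplus>\<^bsub>Cpl\<^esub>l\<in>UNIV. cls (\<lambda>n. ?A $ i $ l * D l n))"
      using inv_mem D by (simp add: cpl_mat_vec_def cpl_mat_emb_def deriv cpl_emb_eq cls_mult)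
    also have "\<dots> = cls (\<lambda>n. \<Sum>l\<in>UNIV. ?A $ i $ l * D l n)" by (intro cls_finsum AD) auto
    finally show ?thesis .
  qed
  have half: "1 / fact 2 \<in> K" using K_of_rat[of "1/2"] by (simp add: of_rat_divide)
  have "gamma_form K v F \<zeta> 2 V $ i = cls (\<lambda>n. 1 / fact 2 * (\<Sum>l\<in>UNIV. ?A $ i $ l * D l n))"
    using half AD by (simp add: gamma_form_def mv cpl_emb_eq cls_mult Cseq_sum del: fact_2)
  also have "(\<lambda>n. 1 / fact 2 * (\<Sum>l\<in>UNIV. ?A $ i $ l * D l n))
      = (\<lambda>n. \<Sum>a\<in>UNIV. \<Sum>b\<in>UNIV. quad_coeff F \<zeta> i a b * (s 0 a n * s 1 b n))"
  proof
    fix n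
    have "D l n = (\<Sum>a\<in>UNIV. \<Sum>b\<in>UNIV. hess (F $ l) \<zeta> a b * (s 0 a n * s 1 b n))" for l
      unfolding D_def sum_lists_length_2 by (simp add: c_def hess_def numeral_2_eq_2)
    then have "1 / fact 2 * (\<Sum>l\<in>UNIV. ?A $ i $ l * D l n)
        = (\<Sum>l\<in>UNIV. \<Sum>a\<in>UNIV. \<Sum>b\<in>UNIV. ?A $ i $ l * (1 / 2 * hess (F $ l) \<zeta> a b) * (s 0 a n * s 1 b n))"
      by (simp add: sum_distrib_left mult_ac)
    also have "\<dots> = (\<Sum>a\<in>UNIV. \<Sum>l\<in>UNIV. \<Sum>b\<in>UNIV. ?A $ i $ l * (1 / 2 * hess (F $ l) \<zeta> a b) * (s 0 a n * s 1 b n))"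
      by (rule sum.swap)
    also have "\<dots> = (\<Sum>a\<in>UNIV. \<Sum>b\<in>UNIV. \<Sum>l\<in>UNIV. ?A $ i $ l * (1 / 2 * hess (F $ l) \<zeta> a b) * (s 0 a n * s 1 b n))"
      by (intro sum.cong refl sum.swap)
    finally show "1 / fact 2 * (\<Sum>l\<in>UNIV. ?A $ i $ l * D l n)
        = (\<Sum>a\<in>UNIV. \<Sum>b\<in>UNIV. quad_coeff F \<zeta> i a b * (s 0 a n * s 1 b n))"
      by (simp only: quad_coeff_def sum_distrib_right)
  qed
  finally show "gamma_form K v F \<zeta> 2 V $ i = cls (\<lambda>n. \<Sum>a\<in>UNIV. \<Sum>b\<in>UNIV. quad_coeff F \<zeta> i a b * (s 0 a n * s 1 b n))" .
qed

text \<open>A crude bound that makes the suprema in the operator norm and in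
  \<open>gamma_inv\<close> suprema of bounded sets, without which a real supremum says nothing. In
  one variable it consists of a single term and then bounds \<open>gamma_inv\<close> well
  enough.\<close>

definition quad_bound :: real where
  "quad_bound = (\<Sum>i\<in>UNIV. \<Sum>a\<in>UNIV. \<Sum>b\<in>UNIV. v (quad_coeff F \<zeta> i a b))"

lemma gamma_form_2_mem_le:
  assumes V: "V \<in> {..<2} \<rightarrow>\<^sub>E cpl_space K v"
  shows "gamma_form K v F \<zeta> 2 V $ i \<in> carrier Cpl"
    and "vec_norm K v (gamma_form K v F \<zeta> 2 V) \<le> quad_bound * (\<Prod>m<2. vec_norm K v (V m))"
proof -
  have "\<forall>m\<in>{..<2::nat}. \<exists>t. \<forall>j. t j \<in> carrier Cseq \<and> V m $ j = cls (t j)"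
  proof
    fix m :: nat assume "m \<in> {..<2}"
    then have "V m $ j \<in> cls ` carrier Cseq" for j using V by (auto simp: cpl_space_def carrier_Cpl)
    then have "\<forall>j. \<exists>t. t \<in> carrier Cseq \<and> V m $ j = cls t" by auto
    then show "\<exists>t. \<forall>j. t j \<in> carrier Cseq \<and> V m $ j = cls (t j)" by (rule choice)
  qed
  from bchoice[OF this] obtain s where "\<forall>m\<in>{..<2}. \<forall>j. s m j \<in> carrier Cseq \<and> V m $ j = cls (s m j)" by auto
  then have s: "\<And>m j. m < 2 \<Longrightarrow> s m j \<in> carrier Cseq" "\<And>m j. m < 2 \<Longrightarrow> V m $ j = cls (s m j)" by auto
  have form: "gamma_form K v F \<zeta> 2 V $ i = cls (\<lambda>n. \<Sum>a\<in>UNIV. \<Sum>b\<in>UNIV. quad_coeff F \<zeta> i a b * (s 0 a n * s 1 b n))"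
    "(\<lambda>n. \<Sum>a\<in>UNIV. \<Sum>b\<in>UNIV. quad_coeff F \<zeta> i a b * (s 0 a n * s 1 b n)) \<in> carrier Cseq" for i
    by (rule gamma_form_2; fact s)+
  show mem: "gamma_form K v F \<zeta> 2 V $ i \<in> carrier Cpl" for i
    unfolding form(1) by (rule cls_mem[OF form(2)])
  have VC: "V m $ j \<in> carrier Cpl" if "m < 2" for m j using s that by simp
  have abs: "cpl_abs v (gamma_form K v F \<zeta> 2 V $ i)
      \<le> (\<Sum>a\<in>UNIV. \<Sum>b\<in>UNIV. v (quad_coeff F \<zeta> i a b) * (cpl_abs v (V 0 $ a) * cpl_abs v (V 1 $ b)))" for i
  proof (rule LIMSEQ_le)
    show "(\<lambda>n. v (\<Sum>a\<in>UNIV. \<Sum>b\<in>UNIV. quad_coeff F \<zeta> i a b * (s 0 a n * s 1 b n))) \<longlonglongrightarrow> cpl_abs v (gamma_form K v F \<zeta> 2 V $ i)"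
      unfolding form(1) by (rule cpl_abs_lim[OF form(2)])
    have l0: "(\<lambda>n. v (s m j n)) \<longlonglongrightarrow> cpl_abs v (V m $ j)" if "m < 2" for m j
      using cpl_abs_lim[OF s(1)[OF that]] s(2)[OF that] by simp
    show "(\<lambda>n. \<Sum>a\<in>UNIV. \<Sum>b\<in>UNIV. v (quad_coeff F \<zeta> i a b) * (v (s 0 a n) * v (s 1 b n)))
      \<longlonglongrightarrow> (\<Sum>a\<in>UNIV. \<Sum>b\<in>UNIV. v (quad_coeff F \<zeta> i a b) * (cpl_abs v (V 0 $ a) * cpl_abs v (V 1 $ b)))"
      by (intro tendsto_sum tendsto_mult tendsto_const l0) auto
    have "v (\<Sum>a\<in>UNIV. \<Sum>b\<in>UNIV. quad_coeff F \<zeta> i a b * (s 0 a n * s 1 b n))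
        \<le> (\<Sum>a\<in>UNIV. \<Sum>b\<in>UNIV. v (quad_coeff F \<zeta> i a b) * (v (s 0 a n) * v (s 1 b n)))" for n
    proof -
      have mem: "s 0 a n \<in> K" "s 1 b n \<in> K" for a b using Cseq_mem s(1) by auto
      have "v (\<Sum>a\<in>UNIV. \<Sum>b\<in>UNIV. quad_coeff F \<zeta> i a b * (s 0 a n * s 1 b n))
        \<le> (\<Sum>a\<in>UNIV. \<Sum>b\<in>UNIV. v (quad_coeff F \<zeta> i a b * (s 0 a n * s 1 b n)))"
        using mem quad_coeff_mem by (intro order_trans[OF v_sum] sum_mono v_sum K_sum K_mult) auto
      also have "\<dots> = (\<Sum>a\<in>UNIV. \<Sum>b\<in>UNIV. v (quad_coeff F \<zeta> i a b) * (v (s 0 a n) * v (s 1 b n)))"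
        using mem quad_coeff_mem by simp
      finally show ?thesis .
    qed
    then show "\<exists>N. \<forall>n\<ge>N. v (\<Sum>a\<in>UNIV. \<Sum>b\<in>UNIV. quad_coeff F \<zeta> i a b * (s 0 a n * s 1 b n))
        \<le> (\<Sum>a\<in>UNIV. \<Sum>b\<in>UNIV. v (quad_coeff F \<zeta> i a b) * (v (s 0 a n) * v (s 1 b n)))" by simp
  qed
  let ?N = "vec_norm K v (V 0) * vec_norm K v (V 1)"
  have "vec_norm K v (gamma_form K v F \<zeta> 2 V) \<le> (\<Sum>i\<in>UNIV. cpl_abs v (gamma_form K v F \<zeta> 2 V $ i))"
    by (rule vec_norm_le_sum[OF mem])
  also have "\<dots> \<le> (\<Sum>i\<in>UNIV. \<Sum>a\<in>UNIV. \<Sum>b\<in>UNIV. v (quad_coeff F \<zeta> i a b) * ?N)"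
  proof (intro sum_mono order_trans[OF abs] mult_left_mono mult_mono)
    show "cpl_abs v (V 0 $ a) \<le> vec_norm K v (V 0)" "cpl_abs v (V 1 $ a) \<le> vec_norm K v (V 1)" for a
      using VC by (auto intro!: cpl_abs_le_vec_norm)
    show "0 \<le> vec_norm K v (V 0)" "0 \<le> cpl_abs v (V 1 $ a)" for a
      using VC by (auto intro!: vec_norm_nonneg cpl_abs_nonneg)
    show "0 \<le> v (quad_coeff F \<zeta> i a b)" for i a b using quad_coeff_mem by simp
  qed
  also have "\<dots> = quad_bound * ?N" by (simp add: quad_bound_def sum_distrib_right)
  finally show "vec_norm K v (gamma_form K v F \<zeta> 2 V) \<le> quad_bound * (\<Prod>m<2. vec_norm K v (V m))"
    by (simp add: numeral_2_eq_2)
qed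

lemma quad_bound_nonneg: "0 \<le> quad_bound"
  unfolding quad_bound_def using quad_coeff_mem by (intro sum_nonneg) auto

lemma cpl_space_nonempty: "{..<k} \<rightarrow>\<^sub>E (cpl_space K v :: ('a cpl ^ 'n) set) \<noteq> {}"
proof -
  have "(\<chi> i. cls (\<lambda>_. 0)) \<in> (cpl_space K v :: ('a cpl ^ 'n) set)" by (simp add: cpl_space_def)
  then show ?thesis by (auto simp: PiE_eq_empty_iff)
qed

lemma multi_onorm_ge_3:
  assumes k: "3 \<le> k" shows "multi_onorm K v k (gamma_form K v F \<zeta> k) = 0"
proof -
  interpret C: cring Cpl by (rule cring_Cpl)
  have "vec_norm K v (gamma_form K v F \<zeta> k V) = 0" if V: "V \<in> {..<k} \<rightarrow>\<^sub>E cpl_space K v" for V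
  proof -
    have VC: "V m $ j \<in> carrier Cpl" if "m < k" for m j using V that by (auto simp: cpl_space_def)
    have zero: "cpl_emb K v 0 = \<zero>\<^bsub>Cpl\<^esub>" by (simp add: cpl_emb_eq cls_zero)
    have deriv: "deriv_form K v F \<zeta> k V $ l = \<zero>\<^bsub>Cpl\<^esub>" for l
    proof -
      have "deriv_form K v F \<zeta> k V $ l = (\<Oplus>\<^bsub>Cpl\<^esub>is\<in>{is :: 'n list. length is = k}. \<zero>\<^bsub>Cpl\<^esub>)"
        unfolding deriv_form_def vec_lambda_beta
      proof (rule C.finsum_cong'[OF refl])
        fix "is" :: "'n list" assume "is \<in> {is. length is = k}"
        then have "mpoly_eval (fold mpoly_pderiv is (F $ l)) \<zeta> = 0"
          using k by (simp add: fold_pderiv_eq_0[OF degree])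
        moreover have "(\<Otimes>\<^bsub>Cpl\<^esub>m\<in>{..<k}. V m $ (is ! m)) \<in> carrier Cpl"
          by (intro C.finprod_closed) (auto simp: VC)
        ultimately show "cpl_emb K v (mpoly_eval (fold mpoly_pderiv is (F $ l)) \<zeta>)
          \<otimes>\<^bsub>Cpl\<^esub> (\<Otimes>\<^bsub>Cpl\<^esub>m\<in>{..<k}. V m $ (is ! m)) = \<zero>\<^bsub>Cpl\<^esub>" by (simp add: zero)
      qed auto
      then show ?thesis by simp
    qed
    have "gamma_form K v F \<zeta> k V $ i = \<zero>\<^bsub>Cpl\<^esub>" for i
    proof -
      have "1 / fact k \<in> K" using K_divide[OF K_one K_of_nat[of "fact k"]] by simp
      moreover have "cpl_emb K v (matrix_inv (poly_jacobian F \<zeta>) $ i $ j) \<in> carrier Cpl" for j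
        using inv_mem by (simp add: cpl_emb_eq)
      ultimately show ?thesis
        by (simp add: gamma_form_def cpl_mat_vec_def cpl_mat_emb_def deriv) (simp add: cpl_emb_eq)
    qed
    then show ?thesis by (simp add: vec_norm_def cpl_abs_zero)
  qed
  then have "multi_onorm K v k (gamma_form K v F \<zeta> k) = (SUP V \<in> {..<k} \<rightarrow>\<^sub>E (cpl_space K v :: ('a cpl ^ 'n) set). 0)"
    unfolding multi_onorm_def by (intro SUP_cong refl) simp
  also have "\<dots> = 0" by (rule cSUP_const[OF cpl_space_nonempty])
  finally show ?thesis .
qed

text \<open>For \<open>k \<ge> 3\<close> the operator norms are 0 and stay 0 under
  \<open>powr\<close>, while for \<open>k = 2\<close> the exponent is 1. The supremum is therefore
  the operator norm of the quadratic part, and vectors over \<open>K\<close> are among the arguments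
  over which that norm is taken.\<close>

lemma gamma_inv_quadratic:
  shows gamma_nonneg: "0 \<le> gamma_inv K v F \<zeta>"
    and gamma_le_quad_bound: "gamma_inv K v F \<zeta> \<le> quad_bound"
    and quad_form_le: "\<lbrakk>\<And>i. y $ i \<in> K; \<And>i. z $ i \<in> K\<rbrakk> \<Longrightarrow>
      enorm (quad_form F \<zeta> y z) \<le> gamma_inv K v F \<zeta> * enorm y * enorm z"
proof -
  let ?q = "\<lambda>V. vec_norm K v (gamma_form K v F \<zeta> 2 V) / (\<Prod>m<2. vec_norm K v (V m))"
  let ?S = "{..<2::nat} \<rightarrow>\<^sub>E (cpl_space K v :: ('a cpl ^ 'n) set)"
  define M where "M = multi_onorm K v 2 (gamma_form K v F \<zeta> 2)"
  have nn: "0 \<le> (\<Prod>m<2. vec_norm K v (V m))" "0 \<le> vec_norm K v (gamma_form K v F \<zeta> 2 V)" if V: "V \<in> ?S" for V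
  proof -
    show "0 \<le> vec_norm K v (gamma_form K v F \<zeta> 2 V)" by (intro vec_norm_nonneg gamma_form_2_mem_le[OF V])
    have "V m $ j \<in> carrier Cpl" if "m < 2" for m j using V that by (auto simp: cpl_space_def)
    then show "0 \<le> (\<Prod>m<2. vec_norm K v (V m))" by (intro prod_nonneg vec_norm_nonneg) auto
  qed
  have q: "?q V \<le> quad_bound" "0 \<le> ?q V" if V: "V \<in> ?S" for V
  proof -
    show "?q V \<le> quad_bound"
    proof (cases "(\<Prod>m<2. vec_norm K v (V m)) = 0")
      case False
      then show ?thesis using gamma_form_2_mem_le(2)[OF V] nn[OF V] by (simp add: pos_divide_le_eq less_le)
    next
      \<comment> \<open>Division by zero gives 0, so arguments with a zero vector do not raise the
        quotient above the nonnegative bound.\<close>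
      case True
      then show ?thesis using quad_bound_nonneg by (simp only: div_by_0)
    qed
    show "0 \<le> ?q V" using nn[OF V] by simp
  qed
  have bdd: "bdd_above (?q ` ?S)" using q by (intro bdd_aboveI[of _ quad_bound]) auto
  have le_M: "?q V \<le> M" if "V \<in> ?S" for V
    unfolding M_def multi_onorm_def using that bdd by (rule cSUP_upper)
  have M: "M \<le> quad_bound" unfolding M_def multi_onorm_def using cpl_space_nonempty q by (intro cSUP_least) auto
  have "\<exists>V0. V0 \<in> ?S" using cpl_space_nonempty[of 2] by (simp only: ex_in_conv not_False_eq_True)
  then obtain V0 where V0: "V0 \<in> ?S" ..
  have "0 \<le> M" using order_trans[OF q(2)[OF V0] le_M[OF V0]] .
  have val: "multi_onorm K v k (gamma_form K v F \<zeta> k) powr (1 / (real k - 1)) = (if k = 2 then M else 0)" if "2 \<le> k" for k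
    using that \<open>0 \<le> M\<close> by (cases "k = 2") (auto simp: multi_onorm_ge_3 M_def)
  have bdd2: "bdd_above ((\<lambda>k. multi_onorm K v k (gamma_form K v F \<zeta> k) powr (1 / (real k - 1))) ` {2..})"
    using val \<open>0 \<le> M\<close> by (intro bdd_aboveI[of _ M]) auto
  have M_le: "M \<le> gamma_inv K v F \<zeta>"
    unfolding gamma_inv_def using val[of 2] cSUP_upper[OF _ bdd2, of 2] by simp
  then show "0 \<le> gamma_inv K v F \<zeta>" using \<open>0 \<le> M\<close> by simp
  show "gamma_inv K v F \<zeta> \<le> quad_bound"
    unfolding gamma_inv_def using val M \<open>0 \<le> M\<close> quad_bound_nonneg by (intro cSUP_least) auto
  assume y: "\<And>i. y $ i \<in> K" and z: "\<And>i. z $ i \<in> K"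
  define V where "V = (\<lambda>m\<in>{..<2::nat}. if m = 0 then vec_emb K v y else vec_emb K v z)"
  have V: "V \<in> ?S" using vec_emb_mem[OF y] vec_emb_mem[OF z] by (auto simp: V_def cpl_space_def)
  have V01: "V 0 = vec_emb K v y" "V 1 = vec_emb K v z" by (simp_all add: V_def)
  have form: "gamma_form K v F \<zeta> 2 V = vec_emb K v (quad_form F \<zeta> y z)"
  proof (rule Finite_Cartesian_Product.vec_eq_iff[THEN iffD2, rule_format])
    fix i
    have "V m $ j = cls (\<lambda>_. if m = 0 then y $ j else z $ j)" if "m < 2" for m j
      using that by (simp add: V_def vec_emb_def cpl_emb_eq)
    then show "gamma_form K v F \<zeta> 2 V $ i = vec_emb K v (quad_form F \<zeta> y z) $ i"
      by (subst gamma_form_2(1)[where s = "\<lambda>m j _. if m = 0 then y $ j else z $ j"])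
         (auto simp: y z vec_emb_def cpl_emb_eq quad_form_def)
  qed
  have "(\<Prod>m<2. vec_norm K v (V m)) = enorm y * enorm z"
    using V01 by (simp add: numeral_2_eq_2 enorm_def)
  then have "enorm (quad_form F \<zeta> y z) / (enorm y * enorm z) \<le> gamma_inv K v F \<zeta>"
    using le_M[OF V] M_le form by (simp add: enorm_def)
  moreover have "0 \<le> enorm y" "0 \<le> enorm z" using y z by (auto intro: enorm_nonneg)
  ultimately show "enorm (quad_form F \<zeta> y z) \<le> gamma_inv K v F \<zeta> * enorm y * enorm z"
  proof (cases "y = 0 \<or> z = 0")
    case True
    then have "quad_form F \<zeta> y z = 0" by (auto simp: quad_form_def Finite_Cartesian_Product.vec_eq_iff)
    then show ?thesis using True by (auto simp: enorm_0)
  next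
    case False
    then have "enorm y \<noteq> 0" "enorm z \<noteq> 0" using enorm_eq_0_imp[of y] enorm_eq_0_imp[of z] y z by auto
    then show ?thesis
      using \<open>enorm _ / _ \<le> _\<close> \<open>0 \<le> enorm y\<close> \<open>0 \<le> enorm z\<close> by (simp add: pos_divide_le_eq less_le mult.assoc)
  qed
qed

end

lemma det_mem: "(\<And>i j. A $ i $ j \<in> K) \<Longrightarrow> Determinants.det (A :: 'a ^ 'n ^ 'n::finite) \<in> K"
  unfolding Determinants.det_def by (intro K_sum K_mult K_prod) auto

text \<open>Cramer's rule writes the entries of the inverse, taken over the ambient field, as
  quotients of determinants with entries in \<open>K\<close>.\<close>

lemma matrix_inv_mem:
  fixes J :: "'a ^ 'n ^ 'n::finite"
  assumes J: "invertible J" "\<And>i j. J $ i $ j \<in> K"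
  shows "matrix_inv J $ i $ j \<in> K"
proof -
  have inv: "J ** matrix_inv J = Finite_Cartesian_Product.mat 1"
    using J(1) unfolding invertible_def matrix_inv_def by (metis (mono_tags, lifting) someI_ex)
  have d: "Determinants.det J \<noteq> 0" using J(1) by (simp add: invertible_det_nz)
  have "J *v (matrix_inv J *v axis j 1) = axis j 1"
    by (simp add: matrix_vector_mul_assoc inv)
  then have "matrix_inv J *v axis j 1 = (\<chi> k. Determinants.det (\<chi> i l. if l = k then axis j 1 $ i else J $ i $ l) / Determinants.det J)"
    by (simp only: cramer[OF d])
  then have "(matrix_inv J *v axis j 1) $ i = Determinants.det (\<chi> k l. if l = i then axis j 1 $ k else J $ k $ l) / Determinants.det J"
    by simp
  moreover have "(matrix_inv J *v axis j 1) $ i = matrix_inv J $ i $ j"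
    by (simp add: matrix_vector_mult_def axis_def if_distrib cong: if_cong)
  moreover have "Determinants.det (\<chi> k l. if l = i then axis j 1 $ k else J $ k $ l) \<in> K"
    using J by (intro det_mem) (auto simp: axis_def)
  ultimately show ?thesis using det_mem[of J] J by simp
qed

lemma cpl_det_emb:
  fixes A :: "'a ^ 'n ^ 'n::finite"
  assumes A: "\<And>i j. A $ i $ j \<in> K"
  shows "cpl_det K v (cpl_mat_emb K v A) = cpl_emb K v (Determinants.det A)"
proof -
  have prod: "(\<Otimes>\<^bsub>Cpl\<^esub>i\<in>UNIV. cpl_mat_emb K v A $ i $ p i) = cls (\<lambda>_. \<Prod>i\<in>UNIV. A $ i $ p i)" for p
    using A by (simp add: cpl_mat_emb_def cpl_emb_eq cls_finprod)
  have mem: "(\<lambda>_. \<Prod>i\<in>UNIV. A $ i $ p i) \<in> carrier Cseq" for p using A by (intro Cseq_const K_prod)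
  have "cpl_det K v (cpl_mat_emb K v A)
      = (\<Oplus>\<^bsub>Cpl\<^esub>p\<in>{p. p permutes UNIV}. cls (\<lambda>_. of_int (sign p) * (\<Prod>i\<in>UNIV. A $ i $ p i)))"
    unfolding cpl_det_def prod
    by (intro arg_cong[of _ _ "\<lambda>f. finsum Cpl f _"] ext) (simp add: sign_def cls_uminus[OF mem])
  also have "\<dots> = cls (\<lambda>_. \<Sum>p\<in>{p. p permutes UNIV}. of_int (sign p) * (\<Prod>i\<in>UNIV. A $ i $ p i))"
    using A by (intro cls_finsum Cseq_const K_mult K_prod) auto
  finally show ?thesis by (simp add: cpl_emb_eq Determinants.det_def)
qed

text \<open>Subtracting \<open>1 / J\<^sub>i\<^sub>j\<close> from the entry \<open>(j, i)\<close> of the inverse of \<open>J\<close> makes it singular,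
  since the resulting matrix annihilates the \<open>j\<close>-th column of \<open>J\<close>.\<close>

lemma frob_setdist_le:
  fixes J :: "'a ^ 'n ^ 'n::finite"
  assumes J: "invertible J" "\<And>i j. J $ i $ j \<in> K" and ij: "J $ i $ j \<noteq> 0"
  shows "frob_setdist K v (cpl_mat_emb K v (matrix_inv J)) (singular_mats K v) \<le> 1 / v (J $ i $ j)"
    and "0 \<le> frob_setdist K v (cpl_mat_emb K v (matrix_inv J)) (singular_mats K v)"
proof -
  let ?A = "matrix_inv J"
  have inv: "?A ** J = Finite_Cartesian_Product.mat 1"
    using J(1) unfolding invertible_def matrix_inv_def by (metis (mono_tags, lifting) someI_ex)
  have A: "?A $ k $ l \<in> K" for k l by (rule matrix_inv_mem[OF J])
  define B where "B = (\<chi> k l. ?A $ k $ l - (if k = j \<and> l = i then 1 / J $ i $ j else 0))"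
  have B: "B $ k $ l \<in> K" for k l using A J by (simp add: B_def)
  define c where "c = J *v axis j 1"
  have cl: "c $ l = J $ l $ j" for l by (simp add: c_def matrix_vector_mult_def axis_def if_distrib cong: if_cong)
  have Ac: "?A *v c = axis j 1" by (simp add: c_def matrix_vector_mul_assoc inv)
  have "B *v c = 0"
  proof (rule Finite_Cartesian_Product.vec_eq_iff[THEN iffD2, rule_format])
    fix k
    have "(B *v c) $ k = (\<Sum>l\<in>UNIV. ?A $ k $ l * c $ l) - (\<Sum>l\<in>UNIV. if l = i then (if k = j then 1 / J $ i $ j * c $ l else 0) else 0)"
      unfolding sum_subtractf[symmetric] matrix_vector_mult_def
      by (simp add: B_def left_diff_distrib) (intro sum.cong, auto)
    also have "\<dots> = (?A *v c) $ k - (if k = j then 1 / J $ i $ j * c $ i else 0)"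
      by (simp add: matrix_vector_mult_def)
    also have "\<dots> = 0" using ij by (simp add: Ac cl axis_def)
    finally show "(B *v c) $ k = 0 $ k" by simp
  qed
  moreover have "c \<noteq> 0" using cl[of i] ij by (auto simp: Finite_Cartesian_Product.vec_eq_iff intro!: exI[of _ i])
  ultimately have "\<not> invertible B"
  proof (intro notI)
    assume "B *v c = 0" "c \<noteq> 0" "invertible B"
    then obtain B' where "B' ** B = Finite_Cartesian_Product.mat 1" by (auto simp: invertible_def)
    then have "c = B' *v (B *v c)" by (simp add: matrix_vector_mul_assoc)
    then show False using \<open>B *v c = 0\<close> \<open>c \<noteq> 0\<close> by (simp add: matrix_vector_mult_0_right)
  qed
  then have "Determinants.det B = 0" by (simp add: invertible_det_nz)
  then have sing: "cpl_mat_emb K v B \<in> singular_mats K v"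
    using B by (simp add: singular_mats_def cpl_det_emb) (simp add: cpl_mat_emb_def cpl_emb_eq cls_zero)
  have nonneg: "0 \<le> frob_dist K v (cpl_mat_emb K v ?A) M" if M: "M \<in> singular_mats K v" for M
  proof -
    interpret C: cring Cpl by (rule cring_Cpl)
    have "cpl_mat_emb K v ?A $ k $ l \<ominus>\<^bsub>Cpl\<^esub> M $ k $ l \<in> carrier Cpl" for k l
      using M A by (intro C.minus_closed) (auto simp: singular_mats_def cpl_mat_emb_def cpl_emb_eq)
    then have nn: "0 \<le> cpl_abs v (cpl_mat_emb K v ?A $ k $ l \<ominus>\<^bsub>Cpl\<^esub> M $ k $ l)" for k l by (rule cpl_abs_nonneg)
    have "0 \<le> Max (range (\<lambda>(k, l). cpl_abs v (cpl_mat_emb K v ?A $ k $ l \<ominus>\<^bsub>Cpl\<^esub> M $ k $ l)))"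
    \<comment> \<open>\<open>undefined\<close> merely serves as some index of a nonempty
      type.\<close>
    proof (rule order_trans[OF nn[of undefined undefined]])
      show "cpl_abs v (cpl_mat_emb K v ?A $ undefined $ undefined \<ominus>\<^bsub>Cpl\<^esub> M $ undefined $ undefined)
        \<le> Max (range (\<lambda>(k, l). cpl_abs v (cpl_mat_emb K v ?A $ k $ l \<ominus>\<^bsub>Cpl\<^esub> M $ k $ l)))"
        by (rule Max_ge) (auto intro!: image_eqI[of _ _ "(undefined, undefined)"])
    qed
    then show ?thesis by (simp add: frob_dist_def Let_def sum_nonneg)
  qed
  then have bdd: "bdd_below (frob_dist K v (cpl_mat_emb K v ?A) ` singular_mats K v)"
    by (intro bdd_belowI[of _ 0]) auto
  show "0 \<le> frob_setdist K v (cpl_mat_emb K v ?A) (singular_mats K v)"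
    unfolding frob_setdist_def using sing nonneg by (intro cINF_greatest) auto
  \<comment> \<open>The difference has a single nonzero entry, so the Hermitian and the maximum
    distance have the same value.\<close>
  have d: "cpl_abs v (cpl_mat_emb K v ?A $ k $ l \<ominus>\<^bsub>Cpl\<^esub> cpl_mat_emb K v B $ k $ l) = (if k = j \<and> l = i then 1 / v (J $ i $ j) else 0)" for k l
  proof -
    have "cpl_mat_emb K v ?A $ k $ l \<ominus>\<^bsub>Cpl\<^esub> cpl_mat_emb K v B $ k $ l = cpl_emb K v (?A $ k $ l - B $ k $ l)"
      using A B by (simp add: cpl_mat_emb_def cpl_emb_eq cls_minus)
    then have "cpl_abs v (cpl_mat_emb K v ?A $ k $ l \<ominus>\<^bsub>Cpl\<^esub> cpl_mat_emb K v B $ k $ l) = v (?A $ k $ l - B $ k $ l)"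
      using A B by (simp add: cpl_abs_emb)
    then show ?thesis using J by (simp add: B_def)
  qed
  have pos: "0 \<le> 1 / v (J $ i $ j)" using J by simp
  have "frob_dist K v (cpl_mat_emb K v ?A) (cpl_mat_emb K v B) \<le> 1 / v (J $ i $ j)"
  proof (cases "nonarchimedean K v")
    case True
    have "Max (range (\<lambda>(k, l). cpl_abs v (cpl_mat_emb K v ?A $ k $ l \<ominus>\<^bsub>Cpl\<^esub> cpl_mat_emb K v B $ k $ l))) \<le> 1 / v (J $ i $ j)"
      by (intro Max.boundedI) (auto simp: d v_nonneg[OF J(2)])
    then show ?thesis using True by (simp add: frob_dist_def Let_def)
  next
    case False
    have "(\<Sum>kl\<in>UNIV. ((\<lambda>(k, l). cpl_abs v (cpl_mat_emb K v ?A $ k $ l \<ominus>\<^bsub>Cpl\<^esub> cpl_mat_emb K v B $ k $ l)) kl)\<^sup>2)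
        = (\<Sum>kl\<in>UNIV. if kl = (j, i) then (1 / v (J $ i $ j))\<^sup>2 else 0)"
    proof (intro sum.cong refl)
      fix kl :: "'n \<times> 'n"
      show "((\<lambda>(k, l). cpl_abs v (cpl_mat_emb K v ?A $ k $ l \<ominus>\<^bsub>Cpl\<^esub> cpl_mat_emb K v B $ k $ l)) kl)\<^sup>2
          = (if kl = (j, i) then (1 / v (J $ i $ j))\<^sup>2 else 0)"
        by (cases kl) (simp only: d prod.case prod.inject, simp)
    qed
    also have "\<dots> = (1 / v (J $ i $ j))\<^sup>2" by simp
    finally show ?thesis using False pos by (simp add: frob_dist_def Let_def real_sqrt_abs)
  qed
  then show "frob_setdist K v (cpl_mat_emb K v ?A) (singular_mats K v) \<le> 1 / v (J $ i $ j)"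
    unfolding frob_setdist_def using cINF_lower[OF bdd sing] by linarith
qed

end

section \<open>The lower bounds for the height\<close>

lemma valued_field_of_places:
  assumes "number_field K" "v \<in> places K" shows "valued_field K v"
  using number_field_closed[OF assms(1)] assms(2) by unfold_locales (auto simp: places_def)

lemma place_cases:
  assumes "v \<in> places K"
  obtains (arch) "\<And>k. v (of_int k) = \<bar>real_of_int k\<bar>"
    | (padic) p where "Factorial_Ring.prime p" "\<And>q. v (of_rat q) = padic_abs p q" "\<And>k. v (of_int k) \<le> 1"
proof -
  consider "\<forall>q. v (of_rat q) = real_of_rat \<bar>q\<bar>" | p where "Factorial_Ring.prime p" "\<forall>q. v (of_rat q) = padic_abs p q"
    using assms by (auto simp: places_def)
  then show ?thesis
  proof cases
    case 1
    have "v (of_int k) = \<bar>real_of_int k\<bar>" for k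
    proof -
      have "v (of_rat (of_int k)) = real_of_rat \<bar>of_int k\<bar>" using 1 by blast
      then show ?thesis by (simp flip: of_int_abs)
    qed
    then show ?thesis by (rule arch)
  next
    case (2 p)
    have "v (of_int k) \<le> 1" for k
    proof -
      have "v (of_rat (of_int k)) = padic_abs p (of_int k)" using 2 by blast
      then show ?thesis by (simp add: padic_abs_of_int_le_1[OF 2(1)])
    qed
    then show ?thesis using 2 padic by blast
  qed
qed

text \<open>At a \<open>p\<close>-adic place the exact power of \<open>p\<close> in \<open>k\<close>
  divides \<open>k\<close> and is at most its usual absolute value; at an archimedean place a
  nonzero integer has absolute value at least 1. The bound serves for coefficients and for the
  discriminant.\<close>

lemma place_of_int_ge:
  assumes v: "v \<in> places K" and k: "k \<noteq> 0" shows "1 / \<bar>real_of_int k\<bar> \<le> v (of_int k)"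
  using v
proof (cases rule: place_cases)
  case arch
  have "1 \<le> \<bar>real_of_int k\<bar>" using k by linarith
  then have "1 / \<bar>real_of_int k\<bar> \<le> 1" by simp
  also note \<open>1 \<le> \<bar>real_of_int k\<bar>\<close>
  finally show ?thesis by (simp add: arch)
next
  case (padic p)
  let ?m = "multiplicity (int p) k"
  have "int p ^ ?m dvd k" by (rule multiplicity_dvd)
  then have "\<bar>int p ^ ?m\<bar> \<le> \<bar>k\<bar>" using k by (rule dvd_imp_le_int[rotated])
  then have "real_of_int (int p ^ ?m) \<le> real_of_int \<bar>k\<bar>" by linarith
  then have le: "real p ^ ?m \<le> \<bar>real_of_int k\<bar>" by simp
  have "v (of_int k) = padic_abs p (of_int k)" using padic(2)[of "of_int k"] by simp
  also have "\<dots> = inverse (real p ^ ?m)"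
    using padic_abs_fraction[OF padic(1) k, of 1] by (simp add: power_int_minus)
  finally have eq: "v (of_int k) = 1 / real p ^ ?m" by (simp add: inverse_eq_divide)
  have "0 < real p ^ ?m" using prime_gt_0_nat[OF padic(1)] by simp
  then show ?thesis unfolding eq using le k by (intro divide_left_mono) auto
qed

lemma place_of_int_le:
  assumes v: "v \<in> places K" shows "v (of_int k) \<le> max 1 \<bar>real_of_int k\<bar>"
  using v by (cases rule: place_cases) (auto simp: le_max_iff_disj)

text \<open>The element 1/2 has size 1/2 at archimedean places, 2 at places above 2, and 1
  elsewhere.\<close>

lemma place_half_ge:
  assumes K: "number_field K" and v: "v \<in> places K" shows "1 / 2 \<le> v (1 / 2)"
proof -
  interpret V: valued_field K v by (rule valued_field_of_places[OF K v])
  have "v 2 \<le> 2" using place_of_int_le[OF v, of 2] by simp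
  moreover have "v (1 / 2) = 1 / v 2" using V.v_divide[OF V.K_one V.K_of_nat[of 2]] by simp
  moreover have "0 < v 2" using V.v_pos[OF V.K_of_nat[of 2]] by simp
  ultimately show ?thesis by (simp only:) (rule divide_left_mono, auto)
qed

text \<open>The rational bound rests on \<open>sqrt 7 \<ge> 13 / 5\<close>.\<close>

lemma small_constant: "(3 - sqrt 7) / 2 \<le> (1 / 5 :: real)"
proof -
  have "(13 / 5 :: real) \<le> sqrt 7" by (rule real_le_rsqrt) (simp add: power2_eq_square)
  then show ?thesis by simp
qed

locale smooth_zero =
  fixes K :: "'a::field_char_0 set" and \<nu> :: "'a \<Rightarrow> real"
    and F :: "'n::finite int_mpoly ^ 'n" and \<zeta> :: "'a ^ 'n"
  assumes K: "number_field K" and place: "\<nu> \<in> places K"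
    and degree: "\<And>i. mpoly_degree (F $ i) \<le> 2"
    and zeta_K: "\<And>i. \<zeta> $ i \<in> K"
    and zero: "\<And>i. mpoly_eval (F $ i) \<zeta> = 0"
    and smooth: "invertible (poly_jacobian F \<zeta>)"
begin

sublocale valued_field K \<nu>
  by (rule valued_field_of_places[OF K place])

abbreviation J :: "'a ^ 'n ^ 'n" where "J \<equiv> poly_jacobian F \<zeta>"
abbreviation gam :: real where "gam \<equiv> gamma_inv K \<nu> F \<zeta>"

lemma J_mem: "J $ i $ j \<in> K"
  using zeta_K by (simp add: poly_jacobian_def mpoly_eval_mem)

lemma inv_mem: "matrix_inv J $ i $ j \<in> K"
  by (rule matrix_inv_mem[OF smooth J_mem])

lemma inv_J: "J ** matrix_inv J = Finite_Cartesian_Product.mat 1" "matrix_inv J ** J = Finite_Cartesian_Product.mat 1"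
  using smooth unfolding invertible_def matrix_inv_def by (metis (mono_tags, lifting) someI_ex)+

lemmas gam_nonneg = gamma_nonneg[where F = F and \<zeta> = \<zeta>, OF zeta_K inv_mem degree]
lemmas gam_le = gamma_le_quad_bound[where F = F and \<zeta> = \<zeta>, OF zeta_K inv_mem degree]
lemmas gam_quad_form = quad_form_le[where F = F and \<zeta> = \<zeta>, OF zeta_K inv_mem degree]
lemmas quad_mem = quad_coeff_mem[where F = F and \<zeta> = \<zeta>, OF zeta_K inv_mem degree]

text \<open>\<open>J\<close> undoes the inverse inside \<open>quad_coeff\<close>. Read as an
  estimate, a coefficient of \<open>F\<close> is bounded by entries of \<open>J\<close> times
  \<gamma>, which links \<gamma> to the distance from the singular matrices.\<close>

lemma J_quad_coeff: "(\<Sum>j\<in>UNIV. J $ l $ j * quad_coeff F \<zeta> j a b) = 1 / 2 * hess (F $ l) \<zeta> a b"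
proof -
  define y where "y = (\<chi> l. 1 / 2 * hess (F $ l) \<zeta> a b)"
  have "J *v (matrix_inv J *v y) = y" by (simp add: matrix_vector_mul_assoc inv_J)
  then have "(J *v (matrix_inv J *v y)) $ l = y $ l" by simp
  then show ?thesis by (simp add: matrix_vector_mult_def y_def quad_coeff_def)
qed

lemma nonvanishing:
  assumes z: "\<And>i. z $ i \<in> K" "z \<noteq> \<zeta>" and close: "enorm (z - \<zeta>) * gam < 1"
  shows "\<exists>i. mpoly_eval (F $ i) z \<noteq> 0"
proof (rule ccontr)
  assume "\<not> ?thesis"
  then have Fz: "mpoly_eval (F $ i) z = 0" for i by simp
  define x where "x = z - \<zeta>"
  have x: "x $ i \<in> K" for i using z zeta_K by (simp add: x_def)
  define y where "y = (\<chi> l. 1 / 2 * (\<Sum>a\<in>UNIV. \<Sum>b\<in>UNIV. hess (F $ l) \<zeta> a b * (x $ a * x $ b)))"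
  have "(J *v x) $ l = - y $ l" for l
  proof -
    have "mpoly_eval (F $ l) (\<zeta> + x) = 0" using Fz by (simp add: x_def)
    then show ?thesis unfolding quadratic_taylor[OF degree] zero
      by (simp add: matrix_vector_mult_def poly_jacobian_def y_def eq_neg_iff_add_eq_0)
  qed
  then have "J *v x = - y" by (simp add: Finite_Cartesian_Product.vec_eq_iff)
  then have "matrix_inv J *v (J *v x) = matrix_inv J *v (- y)" by simp
  then have xy: "x = matrix_inv J *v (- y)" by (simp add: matrix_vector_mul_assoc inv_J)
  have "x $ i = - quad_form F \<zeta> x x $ i" for i
  proof -
    have "x $ i = - (\<Sum>l\<in>UNIV. matrix_inv J $ i $ l * y $ l)"
      by (subst xy) (simp add: matrix_vector_mult_def sum_negf)
    also have "(\<Sum>l\<in>UNIV. matrix_inv J $ i $ l * y $ l)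
        = (\<Sum>l\<in>UNIV. \<Sum>a\<in>UNIV. \<Sum>b\<in>UNIV. matrix_inv J $ i $ l * (1 / 2 * hess (F $ l) \<zeta> a b) * (x $ a * x $ b))"
      by (simp add: y_def sum_distrib_left mult_ac)
    also have "\<dots> = (\<Sum>a\<in>UNIV. \<Sum>l\<in>UNIV. \<Sum>b\<in>UNIV. matrix_inv J $ i $ l * (1 / 2 * hess (F $ l) \<zeta> a b) * (x $ a * x $ b))"
      by (rule sum.swap)
    also have "\<dots> = (\<Sum>a\<in>UNIV. \<Sum>b\<in>UNIV. \<Sum>l\<in>UNIV. matrix_inv J $ i $ l * (1 / 2 * hess (F $ l) \<zeta> a b) * (x $ a * x $ b))"
      by (intro sum.cong refl sum.swap)
    also have "\<dots> = quad_form F \<zeta> x x $ i" by (simp add: quad_form_def quad_coeff_def sum_distrib_right)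
    finally show ?thesis .
  qed
  then have eq: "quad_form F \<zeta> x x $ i = - x $ i" for i by (metis minus_minus vector_uminus_component)
  have "enorm (quad_form F \<zeta> x x) = enorm x"
    using x by (subst (1 2) enorm_eq) (auto simp: eq)
  then have "enorm x \<le> gam * enorm x * enorm x" using gam_quad_form[OF x x] by simp
  moreover have "0 < enorm x" using enorm_nonneg[OF x] enorm_eq_0_imp[OF x] z by (auto simp: x_def less_le)
  ultimately have "1 \<le> gam * enorm x" by simp
  then show False using close by (simp add: x_def mult.commute)
qed

lemma log_gam_le_univariate:
  assumes n: "CARD('n) = 1" and h: "\<And>i. mpoly_height (F $ i) \<le> h" "0 \<le> h" and gam: "1 < gam"
  shows "ln gam \<le> h + 3"
proof -
  obtain a :: 'n where U: "UNIV = {a}" using n by (auto simp: card_1_singleton_iff)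
  define f where "f = F $ a"
  have deg: "mpoly_degree f \<le> 2" by (simp add: f_def degree)
  define c2 c1 c0 where "c2 = Poly_Mapping.lookup f (mon2 a a)" and "c1 = Poly_Mapping.lookup f (mon1 a)"
    and "c0 = Poly_Mapping.lookup f 0"
  note cs = c2_def c1_def c0_def
  have c: "real_of_int \<bar>c2\<bar> \<le> exp h" "real_of_int \<bar>c1\<bar> \<le> exp h" "real_of_int \<bar>c0\<bar> \<le> exp h"
    unfolding cs f_def by (rule abs_lookup_le_exp_height[OF h(1)])+
  define t where "t = J $ a $ a"
  have t: "t = 2 * of_int c2 * \<zeta> $ a + of_int c1"
    using quadratic_univariate(2)[OF deg U, of \<zeta>] by (simp add: t_def poly_jacobian_def f_def cs)
  have f0: "of_int c2 * (\<zeta> $ a)\<^sup>2 + of_int c1 * \<zeta> $ a + of_int c0 = 0"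
    using quadratic_univariate(1)[OF deg U, of \<zeta>] zero[of a] by (simp add: f_def cs)
  define \<Delta> where "\<Delta> = c1\<^sup>2 - 4 * c2 * c0"
  \<comment> \<open>The square of the derivative of a quadratic polynomial differs from the
    discriminant by \<open>4 * c2\<close> times the polynomial, which vanishes at
    \<open>\<zeta>\<close>.\<close>
  have "t\<^sup>2 = 4 * of_int c2 * (of_int c2 * (\<zeta> $ a)\<^sup>2 + of_int c1 * \<zeta> $ a + of_int c0) + (of_int c1)\<^sup>2 - 4 * of_int c2 * of_int c0"
    by (simp add: t power2_eq_square algebra_simps)
  then have t2: "t\<^sup>2 = of_int \<Delta>" by (simp add: f0 \<Delta>_def)
  have "(matrix_inv J ** J) $ a $ a = 1" by (simp add: inv_J Finite_Cartesian_Product.mat_def)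
  then have At: "matrix_inv J $ a $ a * t = 1" by (simp add: matrix_matrix_mult_def U t_def)
  then have "t \<noteq> 0" by auto
  then have "\<Delta> \<noteq> 0" using t2 by auto
  have tK: "t \<in> K" by (simp add: t_def J_mem)
  have "gam \<le> \<nu> (quad_coeff F \<zeta> a a a)" using gam_le by (simp add: quad_bound_def[OF zeta_K inv_mem degree] U)
  also have "quad_coeff F \<zeta> a a a = of_int c2 / t"
    using At \<open>t \<noteq> 0\<close> by (simp add: quad_coeff_def U hess_eq_coefficient[OF degree] cs f_def field_simps)
  also have "\<nu> (of_int c2 / t) = \<nu> (of_int c2) / \<nu> t" using tK by simp
  finally have "gam\<^sup>2 \<le> (\<nu> (of_int c2) / \<nu> t)\<^sup>2" using gam by (intro power_mono) auto
  also have "\<dots> = (\<nu> (of_int c2))\<^sup>2 / \<nu> (of_int \<Delta>)"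
    using v_power[OF tK, of 2] by (simp add: power_divide t2)
  \<comment> \<open>At archimedean places the discriminant is at least 1 and the height bounds
    \<open>c2\<close>. At \<open>p\<close>-adic places \<open>c2\<close> has size at most 1, and the
    discriminant is no smaller than the inverse of its usual absolute value, which is at most
    \<open>5 * exp h ^ 2\<close>.\<close>
  also have "\<dots> \<le> 5 * exp h ^ 2"
    using place
  proof (cases rule: place_cases)
    case arch
    have "1 \<le> \<bar>real_of_int \<Delta>\<bar>" using \<open>\<Delta> \<noteq> 0\<close> by linarith
    then have "(\<nu> (of_int c2))\<^sup>2 / \<nu> (of_int \<Delta>) \<le> (\<nu> (of_int c2))\<^sup>2 / 1"
      by (intro divide_left_mono) (auto simp: arch)
    also have "\<dots> \<le> exp h ^ 2" using power_mono[of "\<bar>real_of_int c2\<bar>" "exp h" 2] c(1) by (simp add: arch)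
    also have "\<dots> \<le> 5 * exp h ^ 2" by simp
    finally show ?thesis .
  next
    case (padic p)
    have "\<bar>real_of_int \<Delta>\<bar> \<le> \<bar>real_of_int c1\<bar> ^ 2 + 4 * (\<bar>real_of_int c2\<bar> * \<bar>real_of_int c0\<bar>)"
      unfolding \<Delta>_def using abs_triangle_ineq4[of "(real_of_int c1)\<^sup>2" "4 * real_of_int c2 * real_of_int c0"]
      by (simp add: abs_mult)
    also have "\<dots> \<le> exp h ^ 2 + 4 * (exp h * exp h)"
      using c by (intro add_mono mult_mono power_mono) auto
    finally have \<Delta>: "\<bar>real_of_int \<Delta>\<bar> \<le> 5 * exp h ^ 2" by (simp add: power2_eq_square)
    have pos: "0 < \<nu> (of_int \<Delta>)" using \<open>\<Delta> \<noteq> 0\<close> by simp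
    have "(\<nu> (of_int c2))\<^sup>2 / \<nu> (of_int \<Delta>) \<le> 1 / \<nu> (of_int \<Delta>)"
      using padic(3)[of c2] pos by (intro divide_right_mono) (auto simp: power_le_one)
    also have "\<dots> \<le> \<bar>real_of_int \<Delta>\<bar>"
      using place_of_int_ge[OF place \<open>\<Delta> \<noteq> 0\<close>] pos \<open>\<Delta> \<noteq> 0\<close> by (simp add: field_simps)
    finally show ?thesis using \<Delta> by simp
  qed
  finally have "ln (gam\<^sup>2) \<le> ln (5 * exp h ^ 2)" using gam by (intro ln_mono) auto
  then have "2 * ln gam \<le> ln 5 + 2 * h" using gam by (simp add: ln_mult ln_realpow)
  moreover have "ln 5 \<le> (4 :: real)" using ln_le_minus_one[of "5::real"] by simp
  ultimately show ?thesis by simp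
qed

text \<open>Origin of \<open>5 * ln n\<close>: there are at most \<open>8 * n^2\<close> monomials,
  and 8 is at most \<open>n^3\<close> for \<open>n \<ge> 2\<close>.\<close>

lemma sum_v_coefficients_le:
  assumes "mpoly_degree f \<le> 2" "mpoly_height f \<le> h" "2 \<le> CARD('n)"
    and v: "\<And>k. v (of_int k) = \<bar>real_of_int k\<bar>"
  shows "(\<Sum>m\<in>Poly_Mapping.keys (f :: 'n int_mpoly). v (of_int (Poly_Mapping.lookup f m))) \<le> exp (5 * ln CARD('n) + h)"
proof -
  let ?n = "CARD('n)"
  have "(\<Sum>m\<in>Poly_Mapping.keys f. v (of_int (Poly_Mapping.lookup f m))) \<le> (\<Sum>m\<in>Poly_Mapping.keys f. exp h)"
    using abs_lookup_le_exp_height[OF assms(2)] by (intro sum_mono) (simp add: v)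
  also have "\<dots> = real (card (Poly_Mapping.keys f)) * exp h" by simp
  also have "\<dots> \<le> real ?n ^ 5 * exp h"
  proof (rule mult_right_mono)
    have "card (Poly_Mapping.keys f) \<le> 1 + ?n + ?n\<^sup>2" by (rule card_keys_quadratic[OF assms(1)])
    also have "\<dots> \<le> ?n\<^sup>2 * 2 ^ 3"
    proof -
      have "?n \<le> ?n\<^sup>2" "1 \<le> ?n\<^sup>2" using assms(3) by (auto simp: power2_eq_square)
      then have "1 + ?n + ?n\<^sup>2 \<le> ?n\<^sup>2 * 8" by linarith
      then show ?thesis by simp
    qed
    also have "\<dots> \<le> ?n\<^sup>2 * ?n ^ 3" using assms(3) by (intro mult_left_mono power_mono) auto
    also have "\<dots> = ?n ^ 5" by (simp flip: power_add)
    finally show "real (card (Poly_Mapping.keys f)) \<le> real ?n ^ 5" by (metis of_nat_le_iff of_nat_power)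
  qed simp
  also have "real ?n ^ 5 = exp (5 * ln (real ?n))"
    using exp_of_nat_mult[of 5 "ln (real ?n)"] assms(3) by simp
  finally show ?thesis by (simp add: exp_add)
qed

lemma log_gam_le_multivariate:
  assumes n: "2 \<le> CARD('n)" and h: "\<And>i. mpoly_height (F $ i) \<le> h" "0 \<le> h" and gam: "1 < gam"
    and L: "number_field L" "L \<subseteq> K" and z: "\<And>i. z $ i \<in> L" "z \<noteq> \<zeta>"
    and close: "enorm (z - \<zeta>) * gam \<le> (3 - sqrt 7) / 2"
  shows "ln gam \<le> real (field_degree L) * (2 * weil_height L z + (5 * ln CARD('n) + h))"
proof -
  have zK: "z $ i \<in> K" for i using z L by auto
  have c: "enorm (z - \<zeta>) * gam \<le> 1 / 5" using close small_constant by linarith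
  then obtain i where i: "mpoly_eval (F $ i) z \<noteq> 0" using nonvanishing[OF zK z(2)] by auto
  define \<alpha> where "\<alpha> = mpoly_eval (F $ i) z"
  \<comment> \<open>Places are extensional functions on their field, so \<open>\<nu>\<close> is cut
    down to \<open>L\<close> in order to become a place of \<open>L\<close>.\<close>
  define w where "w = restrict \<nu> L"
  have w_eq: "w x = \<nu> x" if "x \<in> L" for x using that by (simp add: w_def)
  obtain e co where "number_field_basis L (field_degree L) e co" using number_field_basis_exists[OF L(1)] by blast
  then interpret B: number_field_basis L "field_degree L" e co .
  have "absolute_value L \<nu>" using absolute_value L(2) unfolding absolute_value_def by (meson subsetD)
  then have w: "w \<in> places L" using place by (auto simp: places_def w_def absolute_value_def)
  have \<alpha>L: "\<alpha> \<in> L"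
  proof -
    interpret W: valued_field L w by (rule valued_field_of_places[OF L(1) w])
    show ?thesis unfolding \<alpha>_def by (rule W.mpoly_eval_mem[OF z(1)])
  qed
  define Z where "Z = max_abs w z"
  have Z1: "1 \<le> Z" unfolding Z_def by (rule max_abs_ge_1)
  have zZ: "\<nu> (z $ j) \<le> Z" for j using le_max_abs[of w z j] w_eq[OF z(1)] by (simp add: Z_def)
  define \<omega> where "\<omega> = enorm (z - \<zeta>)"
  have memd: "(z - \<zeta>) $ j \<in> K" for j using zK zeta_K by simp
  have \<omega>0: "0 \<le> \<omega>" unfolding \<omega>_def by (rule enorm_nonneg[OF memd])
  have d\<omega>: "\<nu> (z $ j - \<zeta> $ j) \<le> \<omega>" for j using v_le_enorm[OF memd, of j] by (simp add: \<omega>_def)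
  have \<omega>g: "\<omega> \<le> 1 / 5 / gam" using c gam by (simp add: \<omega>_def pos_le_divide_eq)
  also have "\<dots> \<le> 1 / 5 / 1" using gam by (intro divide_left_mono) auto
  finally have \<omega>5: "\<omega> \<le> 1 / 5" by simp
  \<comment> \<open>A common bound for the changes of linear and quadratic monomials; a product
    changes by at most \<open>Z * \<omega> + \<omega> * (Z + \<omega>)\<close>.\<close>
  define M where "M = \<omega> * (2 * Z + \<omega>)"
  have M0: "0 \<le> M" using \<omega>0 Z1 by (simp add: M_def)
  have "\<omega> * 1 \<le> \<omega> * (2 * Z + \<omega>)" using \<omega>0 Z1 by (intro mult_left_mono) auto
  then have M1: "\<nu> (z $ j - \<zeta> $ j) \<le> M" for j using d\<omega>[of j] by (simp add: M_def)
  have M2: "\<nu> (z $ j * z $ k - \<zeta> $ j * \<zeta> $ k) \<le> M" for j k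
  proof -
    have \<zeta>Z: "\<nu> (\<zeta> $ k) \<le> Z + \<omega>"
      using v_diff[of "z $ k" "z $ k - \<zeta> $ k"] zK zeta_K zZ[of k] d\<omega>[of k] by simp
    have "z $ j * z $ k - \<zeta> $ j * \<zeta> $ k = z $ j * (z $ k - \<zeta> $ k) + (z $ j - \<zeta> $ j) * \<zeta> $ k"
      by (simp add: algebra_simps)
    then have "\<nu> (z $ j * z $ k - \<zeta> $ j * \<zeta> $ k) \<le> \<nu> (z $ j * (z $ k - \<zeta> $ k)) + \<nu> ((z $ j - \<zeta> $ j) * \<zeta> $ k)"
      using zK zeta_K by (simp only:) (intro v_add K_mult K_diff)
    also have "\<dots> = \<nu> (z $ j) * \<nu> (z $ k - \<zeta> $ k) + \<nu> (z $ j - \<zeta> $ j) * \<nu> (\<zeta> $ k)"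
      using zK zeta_K by simp
    also have "\<dots> \<le> Z * \<omega> + \<omega> * (Z + \<omega>)"
      using zZ d\<omega> \<zeta>Z \<omega>0 Z1 zK zeta_K by (intro add_mono mult_mono) auto
    finally show ?thesis by (simp add: M_def algebra_simps)
  qed
  \<comment> \<open>The closeness condition gives \<open>\<omega> \<le> 1 / (5 * gam)\<close>, whose
    5 absorbs \<open>2 * Z + \<omega> \<le> 5 * Z\<close>. The resulting bound, linear in
    \<open>Z\<close>, is weakened to \<open>Z\<^sup>2\<close> to match the bounds at the other
    places.\<close>
  have MZ: "M \<le> exp (- ln gam) * Z\<^sup>2"
  proof -
    have "2 * Z + \<omega> \<le> 5 * Z" using Z1 \<omega>5 by linarith
    then have "M \<le> \<omega> * (5 * Z)" unfolding M_def using \<omega>0 by (intro mult_left_mono)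
    also have "\<dots> \<le> 1 / 5 / gam * (5 * Z)" using \<omega>g Z1 by (intro mult_right_mono) auto
    also have "\<dots> = Z / gam" by simp
    also have "\<dots> \<le> Z\<^sup>2 / gam" using Z1 gam by (intro divide_right_mono) (auto simp: power2_eq_square)
    finally show ?thesis using gam by (simp add: exp_minus divide_inverse mult.commute)
  qed
  have \<alpha>diff: "\<alpha> = mpoly_eval (F $ i) z - mpoly_eval (F $ i) \<zeta>" by (simp add: \<alpha>_def zero)
  note diff1 = v_eval_diff_le(1)[OF degree[of i] zK zeta_K M0 M1 M2, folded \<alpha>diff]
  note diff2 = v_eval_diff_le(2)[OF degree[of i] zK zeta_K M0 M1 M2, folded \<alpha>diff]
  let ?A = "5 * ln CARD('n) + h"
  have A0: "0 \<le> ?A" using n h by simp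
  show ?thesis
  proof (rule liouville_inequality[OF L(1) z(1) \<alpha>L _ w A0])
    show "\<alpha> \<noteq> 0" using i by (simp add: \<alpha>_def)
    show "0 \<le> ln gam" using gam by simp
  next
    fix v assume v: "v \<in> arch_places L"
    have vint: "v (of_int k) = \<bar>real_of_int k\<bar>" for k
    proof -
      have "v (of_rat (of_int k)) = real_of_rat \<bar>of_int k\<bar>"
        using v by (simp only: arch_places_def places_above_def mem_Collect_eq)
      then show ?thesis by (simp flip: of_int_abs)
    qed
    note coeffs = sum_v_coefficients_le[OF degree[of i] h(1)[of i] n, of v, OF vint]
    show "v \<alpha> \<le> exp (?A - (if v = w then ln gam else 0)) * (max_abs v z)\<^sup>2"
    proof (cases "v = w")
      case True
      have \<nu>int: "\<nu> (of_int k) = v (of_int k)" for k using True w_eq[OF B.of_int_mem] by simp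
      have "v \<alpha> \<le> (\<Sum>m\<in>Poly_Mapping.keys (F $ i). v (of_int (Poly_Mapping.lookup (F $ i) m))) * M"
        using diff1 unfolding \<nu>int by (simp only: w_eq[OF \<alpha>L] True)
      also have "\<dots> \<le> exp ?A * (exp (- ln gam) * Z\<^sup>2)"
        using coeffs MZ M0 by (intro mult_mono) auto
      also have "\<dots> = exp (?A - ln gam) * Z\<^sup>2" 
      proof -
        have "exp (?A - ln gam) = exp ?A * exp (- ln gam)"
          by (simp only: exp_add[symmetric] add_uminus_conv_diff)
        then show ?thesis by (simp only: mult.assoc)
      qed
      finally show ?thesis using True by (simp only: Z_def refl if_True)
    next
      case False
      interpret V: valued_field L v using valued_field_place[OF L(1)] v by (simp add: arch_places_def)
      have "v \<alpha> \<le> (\<Sum>m\<in>Poly_Mapping.keys (F $ i). v (of_int (Poly_Mapping.lookup (F $ i) m))) * (max_abs v z)\<^sup>2"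
        unfolding \<alpha>_def by (rule V.v_eval_le[OF degree z(1) le_max_abs max_abs_ge_1])
      also have "\<dots> \<le> exp ?A * (max_abs v z)\<^sup>2" using coeffs by (intro mult_right_mono) auto
      finally show ?thesis using False by simp
    qed
  next
    fix p v assume p: "Factorial_Ring.prime p" and v: "v \<in> padic_places L p"
    have vint: "v (of_int k) \<le> 1" for k by (rule padic_place_of_int[OF p v])
    show "v \<alpha> \<le> exp (- (if v = w then ln gam else 0)) * (max_abs v z)\<^sup>2"
    proof (cases "v = w")
      case True
      have "\<nu> (of_int k) \<le> 1" for k using vint[of k] True w_eq[OF B.of_int_mem] by simp
      from diff2[OF this] have "v \<alpha> \<le> M" using \<alpha>L w_eq True by simp
      then show ?thesis using MZ True by (simp add: Z_def)
    next
      case False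
      interpret V: valued_field L v using valued_field_place[OF L(1)] v by (simp add: padic_places_def)
      have "v \<alpha> \<le> (max_abs v z)\<^sup>2"
        unfolding \<alpha>_def by (rule V.v_eval_le_nonarch[OF degree z(1) le_max_abs max_abs_ge_1 vint])
      then show ?thesis using False by simp
    qed
  qed
qed

text \<open>The multivariate bound has factors 2 and 1 at the height and at \<open>h\<close>. The
  slack up to 3 and 2 is nonnegative, and together with the constant 3 the right-hand side also
  covers one variable, where the bound is \<open>h + 3\<close>, and \<open>gam \<le> 1\<close>,
  where the logarithm is at most 0.\<close>

lemma log_gam_le:
  assumes h: "\<And>i. mpoly_height (F $ i) \<le> h" "0 \<le> h"
    and L: "number_field L" "L \<subseteq> K" and z: "\<And>i. z $ i \<in> L" "z \<noteq> \<zeta>"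
    and close: "enorm (z - \<zeta>) * gam \<le> (3 - sqrt 7) / 2"
  shows "ln gam \<le> real (field_degree L) * (3 * weil_height L z + 5 * ln CARD('n) + 2 * h) + 3"
proof -
  let ?D = "real (field_degree L)" and ?H = "weil_height L z" and ?n = "real CARD('n)"
  have D: "1 \<le> ?D" using field_degree_pos[OF L(1)] by linarith
  have H: "0 \<le> ?H" by (rule weil_height_nonneg)
  have n: "0 \<le> ln ?n" using zero_less_card_finite[where 'a = 'n] by (intro ln_ge_zero) linarith
  have DH: "0 \<le> ?D * ?H" and Dn: "0 \<le> ?D * ln ?n" and Dh: "h \<le> ?D * h"
    using D H n h mult_right_mono[OF D h(2)] by auto
  have expand: "?D * (3 * ?H + 5 * ln ?n + 2 * h) = 3 * (?D * ?H) + 5 * (?D * ln ?n) + 2 * (?D * h)"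
    by (simp add: algebra_simps)
  show ?thesis
  proof (cases "1 < gam")
    case False
    \<comment> \<open>For \<open>gam = 0\<close> this rests on the convention
      \<open>ln 0 = 0\<close>.\<close>
    then have "ln gam \<le> 0" using gam_nonneg by (cases "gam = 0") (auto simp: ln_le_zero_iff)
    then show ?thesis unfolding expand using DH Dn Dh h(2) by linarith
  next
    case True
    show ?thesis
    proof (cases "CARD('n) = 1")
      case n1: True
      have "ln gam \<le> h + 3" by (rule log_gam_le_univariate[OF n1 h True])
      then show ?thesis unfolding expand using DH Dn Dh h(2) by linarith
    next
      case False
      then have n2: "2 \<le> CARD('n)" using zero_less_card_finite[where 'a = 'n] by linarith
      have "ln gam \<le> ?D * (2 * ?H + (5 * ln ?n + h))"
        by (rule log_gam_le_multivariate[OF n2 h True L z close])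
      also have "\<dots> = 2 * (?D * ?H) + 5 * (?D * ln ?n) + ?D * h" by (simp add: algebra_simps)
      finally show ?thesis unfolding expand using DH Dh h(2) by linarith
    qed
  qed
qed

text \<open>A component of degree 2 has a nonzero quadratic coefficient. Up to a factor 1 or 1/2 it
  is a sum of \<open>n\<close> products of an entry in row \<open>l\<close> of \<open>J\<close> and
  a coefficient of the form, the latter of size at most \<open>gam\<close>. The factor
  \<open>2 * n\<close> comes from this half and the number of summands.\<close>

lemma frob_setdist_le_gam:
  assumes h: "\<And>i. mpoly_height (F $ i) \<le> h" and l: "mpoly_degree (F $ l) = 2"
  shows "0 < gam" and "frob_setdist K \<nu> (cpl_mat_emb K \<nu> (matrix_inv J)) (singular_mats K \<nu>) \<le> 2 * CARD('n) * gam * exp h"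
proof -
  have "2 \<in> insert 0 ((\<lambda>m. \<Sum>i\<in>UNIV. Poly_Mapping.lookup m i) ` Poly_Mapping.keys (F $ l))"
    unfolding l[symmetric] mpoly_degree_def by (rule Max_in) auto
  then obtain m where m: "m \<in> Poly_Mapping.keys (F $ l)" "(\<Sum>i\<in>UNIV. Poly_Mapping.lookup m i) = 2" by auto
  have "m \<noteq> 0" using m(2) by auto
  moreover have "m \<noteq> mon1 a" for a using m(2) sum_lookup_mon1[of a] by auto
  ultimately obtain a b where ab: "m = mon2 a b" using monomial_degree_le_2[of m] m(2) by auto
  define c where "c = Poly_Mapping.lookup (F $ l) (mon2 a b)"
  have c0: "c \<noteq> 0" using m(1) by (simp add: c_def ab in_keys_iff)
  define x where "x = 1 / 2 * hess (F $ l) \<zeta> a b"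
  have half: "1 / 2 \<in> K" using K_divide[OF K_one K_of_nat[of 2]] by simp
  have cge: "exp (- h) \<le> \<nu> (of_int c)"
  proof -
    have "\<bar>real_of_int c\<bar> \<le> exp h" using abs_lookup_le_exp_height[OF h, of l "mon2 a b"] by (simp add: c_def)
    then have "1 / exp h \<le> 1 / \<bar>real_of_int c\<bar>" using c0 by (intro divide_left_mono) auto
    then show ?thesis using place_of_int_ge[OF place c0] by (simp add: exp_minus inverse_eq_divide)
  qed
  have xge: "exp (- h) / 2 \<le> \<nu> x"
  proof (cases "a = b")
    case True
    then have "x = of_int c" by (simp add: x_def hess_eq_coefficient[OF degree] c_def)
    then show ?thesis using cge exp_gt_zero[of "- h"] by (simp only:)
  next
    case False
    then have "x = 1 / 2 * of_int c" by (simp add: x_def hess_eq_coefficient[OF degree] c_def)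
    then have "\<nu> x = \<nu> (1 / 2) * \<nu> (of_int c)" using half by (simp only:) (rule v_mult, auto)
    also have "1 / 2 * exp (- h) \<le> \<dots>" using place_half_ge[OF K place] cge by (intro mult_mono) auto
    finally show ?thesis by simp
  qed
  \<comment> \<open>Unit vectors isolate a single coefficient, and they have norm 1 at archimedean
    and nonarchimedean places alike.\<close>
  have g_le: "\<nu> (quad_coeff F \<zeta> j a b) \<le> gam" for j
  proof -
    have ax: "axis k (1::'a) $ i \<in> K" for k i :: 'n by (simp add: axis_def)
    have comp: "quad_form F \<zeta> (axis a 1) (axis b 1) $ j = quad_coeff F \<zeta> j a b" for j
    proof -
      have "quad_form F \<zeta> (axis a 1) (axis b 1) $ j
          = (\<Sum>a'\<in>UNIV. \<Sum>b'\<in>UNIV. if a' = a then if b' = b then quad_coeff F \<zeta> j a' b' else 0 else 0)"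
        unfolding quad_form_def vec_lambda_beta axis_def by (intro sum.cong refl) auto
      also have "\<dots> = (\<Sum>a'\<in>UNIV. if a' = a then quad_coeff F \<zeta> j a' b else 0)"
        by (intro sum.cong refl) simp
      finally show ?thesis by simp
    qed
    have "\<nu> (quad_form F \<zeta> (axis a 1) (axis b 1) $ j) \<le> enorm (quad_form F \<zeta> (axis a 1) (axis b 1))"
      by (rule v_le_enorm) (simp add: comp quad_mem)
    also have "\<dots> \<le> gam * enorm (axis a 1 :: 'a ^ 'n) * enorm (axis b 1 :: 'a ^ 'n)" by (rule gam_quad_form[OF ax ax])
    finally show ?thesis by (simp add: comp enorm_axis)
  qed
  obtain j0 where j0: "\<And>j. \<nu> (J $ l $ j) \<le> \<nu> (J $ l $ j0)"
  proof -
    have "Max (range (\<lambda>j. \<nu> (J $ l $ j))) \<in> range (\<lambda>j. \<nu> (J $ l $ j))" by (rule Max_in) auto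
    then obtain j0 where "Max (range (\<lambda>j. \<nu> (J $ l $ j))) = \<nu> (J $ l $ j0)" by (rule rangeE)
    then have "\<nu> (J $ l $ j) \<le> \<nu> (J $ l $ j0)" for j
      using Max_ge[of "range (\<lambda>j. \<nu> (J $ l $ j))" "\<nu> (J $ l $ j)"] by simp
    then show ?thesis by (rule that)
  qed
  have "\<nu> x = \<nu> (\<Sum>j\<in>UNIV. J $ l $ j * quad_coeff F \<zeta> j a b)" by (simp only: J_quad_coeff x_def)
  also have "\<dots> \<le> (\<Sum>j\<in>UNIV. \<nu> (J $ l $ j * quad_coeff F \<zeta> j a b))" by (intro v_sum K_mult J_mem quad_mem)
  also have "\<dots> \<le> (\<Sum>j\<in>(UNIV::'n set). \<nu> (J $ l $ j0) * gam)"
  proof (rule sum_mono)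
    fix j
    have "\<nu> (J $ l $ j) * \<nu> (quad_coeff F \<zeta> j a b) \<le> \<nu> (J $ l $ j0) * gam"
      using j0 g_le J_mem quad_mem by (intro mult_mono) auto
    then show "\<nu> (J $ l $ j * quad_coeff F \<zeta> j a b) \<le> \<nu> (J $ l $ j0) * gam" by (simp add: J_mem quad_mem)
  qed
  finally have le: "exp (- h) / 2 \<le> CARD('n) * (\<nu> (J $ l $ j0) * gam)" using xge by simp
  have "0 < CARD('n) * (\<nu> (J $ l $ j0) * gam)" using le exp_gt_zero[of "- h"] by linarith
  then have pos: "0 < \<nu> (J $ l $ j0) * gam" by (simp add: zero_less_mult_iff)
  then have J0: "0 < \<nu> (J $ l $ j0)" and "0 < gam"
    using gam_nonneg v_nonneg[OF J_mem, of l j0] by (auto simp: zero_less_mult_iff)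
  then show "0 < gam" by simp
  have "J $ l $ j0 \<noteq> 0" using J0 by auto
  then have "frob_setdist K \<nu> (cpl_mat_emb K \<nu> (matrix_inv J)) (singular_mats K \<nu>) \<le> 1 / \<nu> (J $ l $ j0)"
    by (rule frob_setdist_le(1)[OF smooth J_mem])
  also have "1 / \<nu> (J $ l $ j0) \<le> 2 * CARD('n) * gam * exp h"
    using le J0 by (simp add: exp_minus field_simps)
  finally show "frob_setdist K \<nu> (cpl_mat_emb K \<nu> (matrix_inv J)) (singular_mats K \<nu>) \<le> 2 * CARD('n) * gam * exp h" .
qed

text \<open>Logarithms add \<open>ln 2 + ln n + h\<close> to the bound for \<open>ln gam\<close>.
  With \<open>ln 2 \<le> 1\<close> and \<open>D \<ge> 1\<close>, its constants 5, 2 and 3 grow to 6,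
  3 and 4 at most, within 7, 3 and 5.\<close>

lemma log_frob_setdist_le:
  assumes h: "\<And>i. mpoly_height (F $ i) \<le> h" "0 \<le> h" and l: "mpoly_degree (F $ l) = 2"
    and L: "number_field L" "L \<subseteq> K" and z: "\<And>i. z $ i \<in> L" "z \<noteq> \<zeta>"
    and close: "enorm (z - \<zeta>) * gam \<le> (3 - sqrt 7) / 2"
  shows "ln (frob_setdist K \<nu> (cpl_mat_emb K \<nu> (matrix_inv J)) (singular_mats K \<nu>))
    \<le> real (field_degree L) * (3 * weil_height L z + 7 * ln CARD('n) + 3 * h) + 5"
proof -
  let ?D = "real (field_degree L)" and ?H = "weil_height L z" and ?n = "real CARD('n)"
  define d where "d = frob_setdist K \<nu> (cpl_mat_emb K \<nu> (matrix_inv J)) (singular_mats K \<nu>)"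
  have D: "1 \<le> ?D" using field_degree_pos[OF L(1)] by linarith
  have H: "0 \<le> ?H" by (rule weil_height_nonneg)
  have n1: "1 \<le> ?n" using zero_less_card_finite[where 'a = 'n] by linarith
  then have n: "0 \<le> ln ?n" by (rule ln_ge_zero)
  have DH: "0 \<le> ?D * ?H" and Dn: "ln ?n \<le> ?D * ln ?n" and Dh: "h \<le> ?D * h"
    using D H mult_right_mono[OF D h(2)] mult_right_mono[OF D n] by auto
  have expand: "?D * (3 * ?H + 7 * ln ?n + 3 * h) = 3 * (?D * ?H) + 7 * (?D * ln ?n) + 3 * (?D * h)"
    by (simp add: algebra_simps)
  have "ln d \<le> ?D * (3 * ?H + 7 * ln ?n + 3 * h) + 5"
  proof (cases "0 < d")
    \<comment> \<open>A distance 0 has logarithm 0 by convention, and the right-hand side is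
      nonnegative.\<close>
    case False
    then have "d \<le> 0" by simp
    moreover have "0 \<le> d"
    proof -
      have "\<exists>i j. J $ i $ j \<noteq> 0"
      proof (rule ccontr)
        assume "\<not> ?thesis"
        then have "(J ** matrix_inv J) $ l $ l = 0" by (simp add: matrix_matrix_mult_def)
        then show False unfolding inv_J by (simp add: Finite_Cartesian_Product.mat_def)
      qed
      then show ?thesis unfolding d_def using frob_setdist_le(2)[OF smooth J_mem] by blast
    qed
    ultimately have "ln d = 0" by simp
    then show ?thesis unfolding expand using DH Dn Dh n h(2) by linarith
  next
    case True
    note fg = frob_setdist_le_gam[OF h(1) l]
    have "ln d \<le> ln (2 * ?n * gam * exp h)" using True fg(2) by (intro ln_mono) (auto simp: d_def)
    also have "\<dots> = ln 2 + ln ?n + ln gam + h" using fg(1) n1 by (simp add: ln_mult)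
    finally have "ln d \<le> ln 2 + ln ?n + ln gam + h" .
    moreover have "ln 2 \<le> (1::real)" using ln_le_minus_one[of "2::real"] by simp
    moreover have "ln gam \<le> 3 * (?D * ?H) + 5 * (?D * ln ?n) + 2 * (?D * h) + 3"
      using log_gam_le[OF h L z close] by (simp add: algebra_simps)
    ultimately show ?thesis unfolding expand using Dn Dh n by linarith
  qed
  then show ?thesis by (simp add: d_def)
qed

end

text \<open>The dimension is counted by adjoining \<open>im\<close> and then 1 to the zero space. If
  1 were a rational multiple of \<open>im\<close>, then \<open>im\<close> would be rational with
  square -1.\<close>

lemma field_degree_gaussian:
  fixes im :: "'a::field_char_0"
  assumes "im\<^sup>2 = -1"
  shows "field_degree {of_rat a + of_rat b * im |a b. True} = 2"
proof -
  let ?R = "ring_of_type_algebra :: 'a ring"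
  interpret R: field ?R by (rule field_from_type_algebra)
  have simps: "x \<otimes>\<^bsub>?R\<^esub> y = x * y" "x \<oplus>\<^bsub>?R\<^esub> y = x + y" "\<one>\<^bsub>?R\<^esub> = 1" "\<zero>\<^bsub>?R\<^esub> = 0" "carrier ?R = UNIV" for x y :: 'a
    by (simp_all add: ring_of_type_algebra_def)
  have irr: "of_rat q \<noteq> im" for q
  proof
    assume "of_rat q = im"
    then have "of_rat (q\<^sup>2) = (of_rat (-1) :: 'a)" using assms by (simp add: of_rat_power)
    then have "q\<^sup>2 = -1" by (simp only: of_rat_eq_iff)
    moreover have "0 \<le> q\<^sup>2" by simp
    ultimately show False by linarith
  qed
  define E0 where "E0 = {\<zero>\<^bsub>?R\<^esub>}"
  define E1 where "E1 = R.line_extension \<rat> im E0"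
  define E2 where "E2 = R.line_extension \<rat> 1 E1"
  have E0: "x \<in> E0 \<longleftrightarrow> x = 0" for x by (simp add: E0_def simps)
  have E1: "x \<in> E1 \<longleftrightarrow> (\<exists>b. x = of_rat b * im)" for x
    by (auto simp: E1_def R.line_extension_mem_iff simps Rats_def E0)
  have E2: "x \<in> E2 \<longleftrightarrow> (\<exists>a b. x = of_rat a + of_rat b * im)" for x
  proof -
    have "x \<in> E2 \<longleftrightarrow> (\<exists>k\<in>\<rat>. \<exists>v\<in>E1. x = k * 1 + v)" by (simp only: E2_def R.line_extension_mem_iff simps)
    then show ?thesis unfolding Bex_def E1 Rats_def image_iff mult_1_right by blast
  qed
  have "im \<noteq> 0" using assms by auto
  have d0: "R.dimension 0 \<rat> E0" unfolding E0_def by (rule R.zero_dim)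
  have d1: "R.dimension (Suc 0) \<rat> E1" unfolding E1_def
    by (rule R.Suc_dim[OF _ _ d0]) (simp_all add: simps E0 \<open>im \<noteq> 0\<close>)
  have "1 \<notin> E1"
  proof
    assume "1 \<in> E1"
    then obtain b where b: "1 = of_rat b * im" unfolding E1 by blast
    then have "of_rat (inverse b) = im" by (metis inverse_unique of_rat_inverse)
    with irr show False by blast
  qed
  then have "R.dimension (Suc (Suc 0)) \<rat> E2" unfolding E2_def
    by (intro R.Suc_dim[OF _ _ d1]) (simp_all add: simps)
  then have "R.dim \<rat> E2 = Suc (Suc 0)" using R.dimI[OF subfield_Rats] by (simp add: over_def)
  moreover have "E2 = {of_rat a + of_rat b * im |a b. True}" using E2 by auto
  ultimately show ?thesis by (simp add: field_degree_def)
qed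

theorem theorem4:
  fixes K L :: "'a::field_char_0 set"
    and \<nu> :: "'a \<Rightarrow> real"
    and F :: "'n::finite int_mpoly ^ 'n"
    and \<zeta> z :: "'a ^ 'n"
    and im :: 'a
    and h :: real
  assumes K: "number_field K"
    and imag: "im \<in> K" "im\<^sup>2 = -1"
    and degF: "Max (range (\<lambda>i. mpoly_degree (F $ i))) = 2"
    and htF: "\<And>i. mpoly_height (F $ i) \<le> h"
    and zeta_K: "\<And>i. \<zeta> $ i \<in> K"
    and zero: "\<And>i. mpoly_eval (F $ i) \<zeta> = 0"
    and smooth: "invertible (poly_jacobian F \<zeta>)"
    and place: "\<nu> \<in> places K"
    and L: "number_field L" "L \<subseteq> K"
    and zeta_L: "\<And>i. cpl_emb K \<nu> (\<zeta> $ i) \<in> cpl_sub K \<nu> L"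
    and z_L: "\<And>i. z $ i \<in> L"
    and z_ne: "z \<noteq> \<zeta>"
    and close: "vec_norm K \<nu> (vec_emb K \<nu> (z - \<zeta>)) * gamma_inv K \<nu> F \<zeta> \<le> (3 - sqrt 7) / 2"
  shows "(let \<gamma> = gamma_inv K \<nu> F \<zeta>;
              d = frob_setdist K \<nu> (cpl_mat_emb K \<nu> (matrix_inv (poly_jacobian F \<zeta>))) (singular_mats K \<nu>);
              D = real (field_degree L);
              n = real CARD('n)
          in weil_height L z \<ge> 1 / (3 * D) * (ln \<gamma> - D * (5 * ln n + 2 * h) - 3) \<and>
             weil_height L z \<ge> 1 / (3 * D) * (ln d - D * (7 * ln n + 3 * h) - 5) \<and>
             (L = {of_rat a + of_rat b * im |a b. True} \<longrightarrow>
                weil_height L z \<ge> 1 / 6 * (ln \<gamma> - (10 * ln n + 4 * h + 3)) \<and>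
                weil_height L z \<ge> 1 / 6 * (ln d - (14 * ln n + 6 * h + 5))))"
proof -
  have deg: "mpoly_degree (F $ i) \<le> 2" for i unfolding degF[symmetric] by (rule Max_ge) auto
  interpret S: smooth_zero K \<nu> F \<zeta>
    by (rule smooth_zero.intro[OF K place deg zeta_K zero smooth])
  have "2 \<in> range (\<lambda>i. mpoly_degree (F $ i))" unfolding degF[symmetric] by (rule Max_in) auto
  then obtain l where l: "mpoly_degree (F $ l) = 2" by auto
  \<comment> \<open>A component of degree 2 has a nonzero integer coefficient, so
    \<open>exp h\<close> is at least 1.\<close>
  have "0 \<le> h"
  proof -
    have "Poly_Mapping.keys (F $ l) \<noteq> {}" using l by (auto simp: mpoly_degree_def)
    then obtain m where "m \<in> Poly_Mapping.keys (F $ l)" by blast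
    then have m: "Poly_Mapping.lookup (F $ l) m \<noteq> 0" by (simp add: in_keys_iff)
    have "1 \<le> real_of_int \<bar>Poly_Mapping.lookup (F $ l) m\<bar>" using m by linarith
    also have "\<dots> \<le> exp h" by (rule abs_lookup_le_exp_height[OF htF])
    finally show ?thesis by simp
  qed
  have close': "S.enorm (z - \<zeta>) * S.gam \<le> (3 - sqrt 7) / 2" using close by (simp add: S.enorm_def)
  define \<gamma> where "\<gamma> = gamma_inv K \<nu> F \<zeta>"
  define d where "d = frob_setdist K \<nu> (cpl_mat_emb K \<nu> (matrix_inv (poly_jacobian F \<zeta>))) (singular_mats K \<nu>)"
  define D where "D = real (field_degree L)"
  define n where "n = real CARD('n)"
  have D: "0 < D" using field_degree_pos[OF L(1)] by (simp add: D_def)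
  have 1: "ln \<gamma> \<le> D * (3 * weil_height L z + 5 * ln n + 2 * h) + 3"
    using S.log_gam_le[OF htF \<open>0 \<le> h\<close> L z_L z_ne close'] by (simp add: \<gamma>_def D_def n_def)
  have 2: "ln d \<le> D * (3 * weil_height L z + 7 * ln n + 3 * h) + 5"
    using S.log_frob_setdist_le[OF htF \<open>0 \<le> h\<close> l L z_L z_ne close'] by (simp add: d_def D_def n_def)
  have "1 / (3 * D) * (ln \<gamma> - D * (5 * ln n + 2 * h) - 3) \<le> weil_height L z"
    using 1 D by (simp add: pos_divide_le_eq algebra_simps)
  moreover have "1 / (3 * D) * (ln d - D * (7 * ln n + 3 * h) - 5) \<le> weil_height L z"
    using 2 D by (simp add: pos_divide_le_eq algebra_simps)
  moreover have "1 / 6 * (ln \<gamma> - (10 * ln n + 4 * h + 3)) \<le> weil_height L z \<and>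
      1 / 6 * (ln d - (14 * ln n + 6 * h + 5)) \<le> weil_height L z"
    if "L = {of_rat a + of_rat b * im |a b. True}"
  proof -
    have "D = 2" using field_degree_gaussian[OF imag(2)] by (simp add: D_def that)
    then show ?thesis using 1 2 by (simp add: algebra_simps)
  qed
  ultimately show ?thesis
    unfolding Let_def \<gamma>_def[symmetric] d_def[symmetric] D_def[symmetric] n_def[symmetric] by blast
qed

end
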